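(* Let $k$ be a field of characteristic zero, $\mathcal O$ a complete discrete valuation $k$-algebra with residue field $k$, and $K$ its fraction field. The continuous $k$-dual of the exact sequence $$0\to\Omega_K^{\otimes2}\to\hat\Omega_K^{\otimes2}\xrightarrow{\ \text{biresidue}\ }k\to0,$$ which is an exact sequence of the form $0\to k\to\hat\theta_K\to\theta_K\to0$, has the property that its middle term $\hat\theta_K$ is naturally identified with the Virasoro subalgebra $\operatorname{Vir}(K)$ of (the completion of) $\mathcal U(\hat K)[1/\hbar]$. That is, there is a $k$-linear isomorphism $\hat\theta_K\cong\operatorname{Vir}(K)$, canonical in the sense that it depends on no choice of $\eta$ or of uniformizer (in particular, it is equivariant for continuous $k$-algebra automorphisms of $\mathcal O$), which is compatible with the projections of both sides onto $\theta_K$. This makes $\hat\theta_K$ in a canonical manner a central extension of Lie algebras of $\theta_K$ by $k$.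
   Context: Basic notation. Let $\mathfrak m\subset\mathcal O$ be the maximal ideal, $d\colon\mathcal O\to\Omega$ the universal continuous $k$-derivation, $\Omega_K=K\otimes_{\mathcal O}\Omega$, $\theta_K$ the Lie algebra of continuous $k$-derivations $K\to K$. A uniformizer $t$ identifies $\mathcal O=k[[t]]$, $K=k((t))$; put $D_n=t^{n+1}\frac{d}{dt}$, so that elements of $\theta_K$ are the series $\sum_{n\ge r}c_nD_n$, $c_n\in k$. $\operatorname{Res}\colon\Omega_K\to k$ is the residue, $\langle f|g\rangle:=\operatorname{Res}(f\,dg)$ for $f,g\in K$. The exact sequence. $\Omega_K^{\otimes2}=\Omega_K\otimes_K\Omega_K=K\,dt^2$. Let $\mathcal O^{(2)}=k[[t_1,t_2]]$, $K^{(2)}=k[[t_1,t_2]][1/(t_1t_2)]$, $\mathcal I_\Delta=(t_1-t_2)$, $\Omega^{(2)}=\mathcal O^{(2)}dt_1dt_2$ and $\Omega^{(2)}_{K^{(2)}}=K^{(2)}dt_1dt_2$, where $dt_1dt_2=dt_2dt_1$, and let $\sigma$ exchange the indices $1,2$. The biresidue of $\sum_{n}(t_1-t_2)^nf_n(t_2)\,dt_1dt_2$ is $f_{-2}$. $\hat\Omega_K^{\otimes2}$ is the space of $\sigma$-invariant elements of $\mathcal I_\Delta^{-2}\Omega^{(2)}_{K^{(2)}}/\mathcal I_\Delta\Omega^{(2)}_{K^{(2)}}$ whose biresidue is a constant in $k$; its elements are represented by $c(t_1-t_2)^{-2}dt_1dt_2+f\,dt_1dt_2$ with $c\in k$ and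 $f\in K$ (viewed on the diagonal), and $\Omega_K^{\otimes2}$ is the subspace $c=0$. The $k$-pairing $\theta_K\times\Omega_K^{\otimes2}\to k$ given by contraction followed by the residue identifies $\theta_K$ with the continuous dual of $\Omega_K^{\otimes2}$. $\hat\theta_K$ is the continuous dual of $\hat\Omega_K^{\otimes2}$ (linear forms whose restriction to $\Omega_K^{\otimes2}$ is continuous); $1\in k\subset\hat\theta_K$ is the biresidue map. Heisenberg algebra. $\hat K=k\hbar\oplus K$ is the Lie algebra with $\hbar$ central and $[f,g]=\langle f|g\rangle\hbar$ for $f,g\in K$. $\mathcal U(\hat K)$ is its universal enveloping algebra with product $\circ$; localize to make $\hbar$ invertible. Complete $\mathcal U(\hat K)[1/\hbar]$ with respect to the left ideals generated by $\mathfrak m^N\subset K$, $N\ge1$; the product extends to this completion. The Virasoro subalgebra. Choose a $\sigma$-invariant $\eta=(t_1-t_2)^{-2}dt_1dt_2+\sum_{n\ge1}t_1^{n-1}dt_1\cdot\pi_2^*(df_n)$ with $f_n\in\mathfrak m$ ($\pi_2^*$ means substitution of $t_2$ for $t$), i.e. a $\sigma$-invariant element of $\mathcal I_\Delta^{-2}\Omega^{(2)}$ with biresidue $1$. Let $L_\eta\subset K$ be the $k$-span of $t^{-n}-f_n$, $n\ge1$; then $K=L_\eta\oplus\mathcal O$. Write $f\in K$ as $f=f_-+f_+$ with $f_-\in L_\eta$, $f_+\in\mathcal O$ and set $$f\circ_\eta g=f_-\circ g_-+f_-\circ g_++f_+\circ g_++g_-\circ f_+=f\circ g-\langle f_+|g_-\rangle\hbar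 .$$ Let $T_\eta$ be the $k$-linear map from $\theta_K$ to the completion of $\mathcal U(\hat K)[1/\hbar]$ with $T_\eta(D_n)=\frac1{2\hbar}\sum_{i+j=n}t^i\circ_\eta t^j$ and $T_\eta(\sum_nc_nD_n)=\sum_nc_nT_\eta(D_n)$. The subspace $\operatorname{Vir}(K):=k\cdot1+T_\eta(\theta_K)$ is a Lie subalgebra for the commutator bracket and does not depend on $\eta$; it is called the Virasoro subalgebra. The projection $\operatorname{Vir}(K)\to\theta_K$ sends $T_\eta(D)+\lambda\cdot1$ to $D$; equivalently, the image $D$ of $X\in\operatorname{Vir}(K)$ is determined by $[X,f]=D(f)$ for all $f\in K$. *)

theory Defs
  imports
    "HOL-Computational_Algebra.Computational_Algebra"
    "HOL-Library.Poly_Mapping"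
    "HOL-Library.Product_Plus"
begin

section \<open>Complete discrete valuation algebras\<close>

definition maximal_ideal :: "'K::field set \<Rightarrow> 'K set" where
  "maximal_ideal \<O> = {x \<in> \<O>. x = 0 \<or> inverse x \<notin> \<O>}"

primrec maximal_ideal_power :: "'K::field set \<Rightarrow> nat \<Rightarrow> 'K set" where
  "maximal_ideal_power \<O> 0 = \<O>"
| "maximal_ideal_power \<O> (Suc n) =
     {sum_list (map (\<lambda>(x, y). x * y) zs) | zs.
        set zs \<subseteq> maximal_ideal \<O> \<times> maximal_ideal_power \<O> n}"

definition uniformizer :: "'K::field set \<Rightarrow> 'K \<Rightarrow> bool" where
  "uniformizer \<O> t \<longleftrightarrow> t \<noteq> 0 \<and> maximal_ideal \<O> = (\<lambda>a. t * a) ` \<O>"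

definition discrete_valuation_ring :: "'K::field set \<Rightarrow> bool" where
  "discrete_valuation_ring \<O> \<longleftrightarrow>
     (\<exists>v :: 'K \<Rightarrow> int.
        (\<forall>x y. x \<noteq> 0 \<longrightarrow> y \<noteq> 0 \<longrightarrow> v (x * y) = v x + v y) \<and>
        (\<forall>x y. x \<noteq> 0 \<longrightarrow> y \<noteq> 0 \<longrightarrow> x + y \<noteq> 0 \<longrightarrow> min (v x) (v y) \<le> v (x + y)) \<and>
        (\<exists>x. x \<noteq> 0 \<and> v x = 1) \<and>
        \<O> = {x. x = 0 \<or> 0 \<le> v x})"

text \<open>The discrete valuation ring \<open>\<O>\<close> is given as a subring of a field \<open>'K\<close>, which is then
  automatically its fraction field; \<open>\<iota>\<close> is the \<open>k\<close>-algebra structure.\<close>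

locale cdv_algebra =
  fixes \<iota> :: "'k::field_char_0 \<Rightarrow> 'K::field" and \<O> :: "'K set"
  assumes iota_one: "\<iota> 1 = 1"
    and iota_add: "\<And>a b. \<iota> (a + b) = \<iota> a + \<iota> b"
    and iota_mult: "\<And>a b. \<iota> (a * b) = \<iota> a * \<iota> b"
    and iota_mem: "\<And>a. \<iota> a \<in> \<O>"
    and dvr: "discrete_valuation_ring \<O>"
    and residue_field: "\<And>x. x \<in> \<O> \<Longrightarrow> \<exists>!c. x - \<iota> c \<in> maximal_ideal \<O>"
    and complete: "\<And>x :: nat \<Rightarrow> 'K.
      (\<And>n. x n \<in> \<O>) \<Longrightarrow>
      (\<And>N. \<exists>M. \<forall>m\<ge>M. \<forall>n\<ge>M. x m - x n \<in> maximal_ideal_power \<O> N) \<Longrightarrow>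
      \<exists>l\<in>\<O>. \<forall>N. \<exists>M. \<forall>n\<ge>M. x n - l \<in> maximal_ideal_power \<O> N"
begin

text \<open>The Laurent series \<open>s\<close> with \<open>f = \<Sum>n. s\<^sub>n t\<^sup>n\<close>, i.e. the identification \<open>K = k((t))\<close>.\<close>

definition expansion :: "'K \<Rightarrow> 'K \<Rightarrow> 'k fls" where
  "expansion t f = (THE s. \<forall>N.
     f - (\<Sum>n\<in>{fls_subdegree s..<int N}. \<iota> (fls_nth s n) * t powi n)
       \<in> maximal_ideal_power \<O> N)"

definition continuous_map :: "('K \<Rightarrow> 'K) \<Rightarrow> bool" where
  "continuous_map h \<longleftrightarrow>
     (\<forall>x N. \<exists>M. \<forall>y. y - x \<in> maximal_ideal_power \<O> M \<longrightarrow> h y - h x \<in> maximal_ideal_power \<O> N)"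

definition theta :: "('K \<Rightarrow> 'K) set" where
  "theta = {D. (\<forall>x y. D (x + y) = D x + D y) \<and> (\<forall>c x. D (\<iota> c * x) = \<iota> c * D x) \<and>
               (\<forall>x y. D (x * y) = x * D y + y * D x) \<and> continuous_map D}"

text \<open>\<open>\<langle>f|g\<rangle> = Res (f dg)\<close>; the residue may be computed in any uniformizer.\<close>

definition res_pairing :: "'K \<Rightarrow> 'K \<Rightarrow> 'k" where
  "res_pairing f g = (THE c. \<forall>t. uniformizer \<O> t \<longrightarrow>
     c = fls_residue (expansion t f * fls_deriv (expansion t g)))"

text \<open>Continuous \<open>k\<close>-algebra automorphisms of \<open>\<O>\<close>, extended to the fraction field.\<close>

definition automorphism :: "('K \<Rightarrow> 'K) \<Rightarrow> bool" where
  "automorphism \<alpha> \<longleftrightarrow> bij \<alpha> \<and> (\<forall>x y. \<alpha> (x + y) = \<alpha> x + \<alpha> y) \<and>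
     (\<forall>x y. \<alpha> (x * y) = \<alpha> x * \<alpha> y) \<and> (\<forall>c. \<alpha> (\<iota> c) = \<iota> c) \<and> \<alpha> ` \<O> = \<O> \<and> continuous_map \<alpha>"

end


section \<open>The extension of the quadratic differentials\<close>

text \<open>All fractions below live in the fraction field of \<open>k[[t\<^sub>1,t\<^sub>2]]\<close>, where the outer series
  variable is \<open>t\<^sub>1\<close> and the coefficient ring is \<open>k[[t\<^sub>2]]\<close>. A form \<open>F dt\<^sub>1dt\<^sub>2\<close> is represented by its
  coefficient \<open>F\<close>.\<close>

type_synonym 'k frac2 = "'k fps fps fract"

definition emb2 :: "'k::field fps fps \<Rightarrow> 'k frac2" where
  "emb2 F = Fraction_Field.Fract F 1"

definition t1 :: "'k::field frac2" where "t1 = emb2 fps_X"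
definition t2 :: "'k::field frac2" where "t2 = emb2 (fps_const fps_X)"

text \<open>\<open>f(t\<^sub>1)\<close> and \<open>f(t\<^sub>2)\<close> for a power series \<open>f\<close>, and \<open>f(t\<^sub>2)\<close> for a Laurent series \<open>f\<close>.\<close>

definition subst_t1 :: "'k::field fps \<Rightarrow> 'k fps fps" where
  "subst_t1 f = Abs_fps (\<lambda>i. fps_const (f $ i))"

definition subst_t2 :: "'k::field fps \<Rightarrow> 'k fps fps" where
  "subst_t2 f = fps_const f"

definition laurent_t2 :: "'k::field fls \<Rightarrow> 'k frac2" where
  "laurent_t2 f = emb2 (subst_t2 (fls_base_factor_to_fps f)) * t2 powi fls_subdegree f"

definition scalar2 :: "'k::field \<Rightarrow> 'k frac2" where
  "scalar2 c = emb2 (fps_const (fps_const c))"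

text \<open>The extension to the fraction field of an injective ring endomorphism.\<close>

definition extend_fract :: "('a::idom \<Rightarrow> 'a) \<Rightarrow> 'a fract \<Rightarrow> 'a fract" where
  "extend_fract h x = (THE y. \<exists>a b. b \<noteq> 0 \<and> x = Fraction_Field.Fract a b \<and>
                                     y = Fraction_Field.Fract (h a) (h b))"

definition swap2 :: "'k::field frac2 \<Rightarrow> 'k frac2" where
  "swap2 = extend_fract (\<lambda>F. Abs_fps (\<lambda>i. Abs_fps (\<lambda>j. F $ j $ i)))"

definition K2 :: "'k::field frac2 set" where
  "K2 = {emb2 F / (t1 * t2) ^ n | F n. True}"

definition diag_power :: "int \<Rightarrow> 'k::field frac2 set" where
  "diag_power n = {(t1 - t2) powi n * x | x. x \<in> K2}"

text \<open>The leading coefficient \<open>f\<^sub>-\<^sub>2\<close> of \<open>\<Sum>n\<ge>-2. (t\<^sub>1 - t\<^sub>2)\<^sup>n f\<^sub>n(t\<^sub>2)\<close>.\<close>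

definition biresidue :: "'k::field frac2 \<Rightarrow> 'k fls" where
  "biresidue F = (THE f. F - laurent_t2 f / (t1 - t2)\<^sup>2 \<in> diag_power (-1))"

definition qclass :: "'k::field frac2 \<Rightarrow> 'k frac2 set" where
  "qclass F = {G. G - F \<in> diag_power 1}"

definition hat_omega_reps :: "'k::field frac2 set" where
  "hat_omega_reps = {F \<in> diag_power (-2).
     swap2 F - F \<in> diag_power 1 \<and> (\<exists>c. biresidue F = fls_const c)}"

definition hat_omega :: "'k::field frac2 set set" where
  "hat_omega = qclass ` hat_omega_reps"

text \<open>The element \<open>f dt\<^sup>2\<close> of \<open>\<Omega>\<^sub>K\<^sup>\<otimes>\<^sup>2 = K dt\<^sup>2\<close>, with \<open>f\<close> viewed on the diagonal.\<close>

definition quad_diff :: "'k::field fls \<Rightarrow> 'k frac2 set" where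
  "quad_diff f = qclass (laurent_t2 f)"

definition hat_biresidue :: "'k::field frac2 set \<Rightarrow> 'k" where
  "hat_biresidue \<omega> =
     (if \<omega> \<in> hat_omega then THE c. \<exists>F\<in>\<omega>. biresidue F = fls_const c else 0)"

text \<open>The continuous dual. Linear forms are extended by \<open>0\<close> outside the space, so that equality of
  functions is equality of linear forms; \<open>k\<close> is discrete and \<open>K dt\<^sup>2\<close> has the \<open>t\<close>-adic topology.\<close>

definition hat_theta :: "('k::field frac2 set \<Rightarrow> 'k) set" where
  "hat_theta = {\<zeta>.
     (\<forall>\<omega>. \<omega> \<notin> hat_omega \<longrightarrow> \<zeta> \<omega> = 0) \<and>
     (\<forall>F\<in>hat_omega_reps. \<forall>G\<in>hat_omega_reps. \<zeta> (qclass (F + G)) = \<zeta> (qclass F) + \<zeta> (qclass G)) \<and>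
     (\<forall>F\<in>hat_omega_reps. \<forall>c. \<zeta> (qclass (scalar2 c * F)) = c * \<zeta> (qclass F)) \<and>
     (\<exists>N::int. \<forall>f. (\<forall>n<N. fls_nth f n = 0) \<longrightarrow> \<zeta> (quad_diff f) = 0)}"

text \<open>Change of coordinates: if \<open>t = \<phi>(s)\<close>, then
  \<open>F(t\<^sub>1,t\<^sub>2) dt\<^sub>1dt\<^sub>2 = F(\<phi>(s\<^sub>1),\<phi>(s\<^sub>2)) \<phi>'(s\<^sub>1) \<phi>'(s\<^sub>2) ds\<^sub>1ds\<^sub>2\<close>.\<close>

definition subst2 :: "'k::field fps \<Rightarrow> 'k fps fps \<Rightarrow> 'k fps fps" where
  "subst2 \<phi> F = fps_compose (Abs_fps (\<lambda>i. fps_compose (F $ i) \<phi>)) (subst_t1 \<phi>)"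

definition change_coord :: "'k::field fps \<Rightarrow> 'k frac2 \<Rightarrow> 'k frac2" where
  "change_coord \<phi> F = extend_fract (subst2 \<phi>) F *
     emb2 (subst_t1 (fps_deriv \<phi>)) * emb2 (subst_t2 (fps_deriv \<phi>))"

definition pullback :: "'k::field fps \<Rightarrow> ('k frac2 set \<Rightarrow> 'k) \<Rightarrow> 'k frac2 set \<Rightarrow> 'k" where
  "pullback \<phi> \<zeta> \<omega> = (if \<omega> \<in> hat_omega then \<zeta> (\<Union>F\<in>\<omega>. qclass (change_coord \<phi> F)) else 0)"

context cdv_algebra
begin

text \<open>\<open>\<phi>\<close> with \<open>t = \<phi>(s)\<close>.\<close>

definition transition :: "'K \<Rightarrow> 'K \<Rightarrow> 'k fps" where
  "transition s t = fls_regpart (expansion s t)"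

text \<open>The restriction of a form \<open>\<zeta>\<close> to \<open>\<Omega>\<^sub>K\<^sup>\<otimes>\<^sup>2 = K dt\<^sup>2\<close>, as an element of \<open>\<theta>\<^sub>K\<close>: contracting \<open>f dt\<^sup>2\<close> with
  \<open>D\<close> gives \<open>D(t) f dt\<close>.\<close>

definition hat_theta_proj :: "'K \<Rightarrow> ('k frac2 set \<Rightarrow> 'k) \<Rightarrow> 'K \<Rightarrow> 'K" where
  "hat_theta_proj t \<zeta> = (THE D. D \<in> theta \<and>
     (\<forall>f. \<zeta> (quad_diff f) = fls_residue (expansion t (D t) * f)))"

end


section \<open>Free algebras\<close>

datatype 'g mword = MWord (letters: "'g list")

instantiation mword :: (type) monoid_add
begin
definition "0 = MWord []"
definition "u + v = MWord (letters u @ letters v)"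
instance
  by standard (auto simp: zero_mword_def plus_mword_def)
end

text \<open>The free associative algebra on \<open>'g\<close> is the monoid algebra of the free monoid.\<close>

type_synonym ('k, 'g) free_algebra = "'g mword \<Rightarrow>\<^sub>0 'k"

definition gen :: "'g \<Rightarrow> ('k::field, 'g) free_algebra" where
  "gen g = Poly_Mapping.single (MWord [g]) 1"

definition scal :: "'k::field \<Rightarrow> ('k, 'g) free_algebra" where
  "scal c = Poly_Mapping.single 0 c"

definition free_map :: "('g \<Rightarrow> 'h) \<Rightarrow> ('k::field, 'g) free_algebra \<Rightarrow> ('k, 'h) free_algebra" where
  "free_map h p = (\<Sum>w\<in>Poly_Mapping.keys p.
     Poly_Mapping.single (map_mword h w) (Poly_Mapping.lookup p w))"

inductive_set two_sided_ideal :: "'a::ring_1 set \<Rightarrow> 'a set" for S where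
  "0 \<in> two_sided_ideal S"
| "x \<in> two_sided_ideal S \<Longrightarrow> y \<in> two_sided_ideal S \<Longrightarrow> x + y \<in> two_sided_ideal S"
| "s \<in> S \<Longrightarrow> a * s * b \<in> two_sided_ideal S"

inductive_set left_ideal :: "'a::ring_1 set \<Rightarrow> 'a set" for S where
  "0 \<in> left_ideal S"
| "x \<in> left_ideal S \<Longrightarrow> y \<in> left_ideal S \<Longrightarrow> x + y \<in> left_ideal S"
| "s \<in> S \<Longrightarrow> a * s \<in> left_ideal S"


section \<open>The completed enveloping algebra of the Heisenberg algebra\<close>

text \<open>A pair \<open>(c, f) :: 'k \<times> 'K\<close> stands for the element \<open>c\<hbar> + f\<close> of the Heisenberg algebra.
  Since \<open>\<hbar>\<close> is central, localizing the enveloping algebra at \<open>\<hbar>\<close> amounts to adjoining a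
  two-sided inverse \<open>HInv\<close> of \<open>\<hbar>\<close>.\<close>

datatype 'g letter = Emb 'g | HInv

type_synonym ('k, 'K) heis_free = "('k, ('k \<times> 'K) letter) free_algebra"
type_synonym ('k, 'K) completed = "nat \<Rightarrow> ('k, 'K) heis_free set"

context cdv_algebra
begin

definition heis_scale :: "'k \<Rightarrow> 'k \<times> 'K \<Rightarrow> 'k \<times> 'K" where
  "heis_scale c x = (c * fst x, \<iota> c * snd x)"

definition heis_bracket :: "'k \<times> 'K \<Rightarrow> 'k \<times> 'K \<Rightarrow> 'k \<times> 'K" where
  "heis_bracket x y = (res_pairing (snd x) (snd y), 0)"

definition hbar :: "'k \<times> 'K" where
  "hbar = (1, 0)"

definition envelope_relations :: "('k, 'K) heis_free set" where
  "envelope_relations =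
     {gen (Emb (x + y)) - gen (Emb x) - gen (Emb y) | x y. True} \<union>
     {gen (Emb (heis_scale c x)) - scal c * gen (Emb x) | c x. True} \<union>
     {gen (Emb x) * gen (Emb y) - gen (Emb y) * gen (Emb x) - gen (Emb (heis_bracket x y)) | x y. True}"

definition localization_relations :: "('k, 'K) heis_free set" where
  "localization_relations = {gen (Emb hbar) * gen HInv - 1, gen HInv * gen (Emb hbar) - 1}"

text \<open>\<open>\<U>(K^)[1/\<hbar>]\<close> is the free algebra modulo this ideal.\<close>

definition U_ideal :: "('k, 'K) heis_free set" where
  "U_ideal = two_sided_ideal (envelope_relations \<union> localization_relations)"

definition elt :: "'K \<Rightarrow> ('k, 'K) heis_free" where
  "elt f = gen (Emb (0, f))"

text \<open>The preimage in the free algebra of the left ideal of \<open>\<U>(K^)[1/\<hbar>]\<close> generated by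
  the \<open>N\<close>-th power of the maximal ideal.\<close>

definition J :: "nat \<Rightarrow> ('k, 'K) heis_free set" where
  "J N = left_ideal (U_ideal \<union> elt ` maximal_ideal_power \<O> N)"

text \<open>The completion \<open>lim \<U>/J\<^sub>N\<close>; its elements are compatible families of cosets.\<close>

definition completion :: "('k, 'K) completed set" where
  "completion = {X. \<forall>N. (\<exists>u. X N = {z. z - u \<in> J N}) \<and> X (Suc N) \<subseteq> X N}"

definition incl :: "('k, 'K) heis_free \<Rightarrow> ('k, 'K) completed" where
  "incl u = (\<lambda>N. {z. z - u \<in> J N})"

definition cadd :: "('k, 'K) completed \<Rightarrow> ('k, 'K) completed \<Rightarrow> ('k, 'K) completed" where
  "cadd X Y = (\<lambda>N. {x + y | x y. x \<in> X N \<and> y \<in> Y N})"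

definition cdiff :: "('k, 'K) completed \<Rightarrow> ('k, 'K) completed \<Rightarrow> ('k, 'K) completed" where
  "cdiff X Y = (\<lambda>N. {x - y | x y. x \<in> X N \<and> y \<in> Y N})"

definition cscale :: "'k \<Rightarrow> ('k, 'K) completed \<Rightarrow> ('k, 'K) completed" where
  "cscale c X = (\<lambda>N. {z. \<exists>x\<in>X N. z - scal c * x \<in> J N})"

text \<open>The extended product: right multiplication by a fixed \<open>y\<close> maps \<open>J M\<close> into \<open>J N\<close> for large
  \<open>M\<close>, so \<open>X \<cdot> Y\<close> is represented modulo \<open>J N\<close> by \<open>x * y\<close>, where \<open>y\<close> represents \<open>Y\<close> modulo \<open>J N\<close>
  and \<open>x\<close> represents \<open>X\<close> modulo \<open>J M\<close>.\<close>

definition cprod :: "('k, 'K) completed \<Rightarrow> ('k, 'K) completed \<Rightarrow> ('k, 'K) completed" where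
  "cprod X Y = (\<lambda>N. {z. \<exists>y\<in>Y N. \<exists>M. \<forall>x\<in>X M. z - x * y \<in> J N})"

definition commutator :: "('k, 'K) completed \<Rightarrow> ('k, 'K) completed \<Rightarrow> ('k, 'K) completed" where
  "commutator X Y = cdiff (cprod X Y) (cprod Y X)"

text \<open>Unconditional summation of a family: modulo each \<open>J N\<close>, all sufficiently large finite partial
  sums (computed with arbitrary representatives) agree with the sum.\<close>

definition csum :: "('i \<Rightarrow> ('k, 'K) completed) \<Rightarrow> ('k, 'K) completed" where
  "csum A = (\<lambda>N. {z. \<exists>F\<^sub>0. finite F\<^sub>0 \<and>
     (\<forall>F w. finite F \<and> F\<^sub>0 \<subseteq> F \<and> (\<forall>i\<in>F. w i \<in> A i N) \<longrightarrow> z - (\<Sum>i\<in>F. w i) \<in> J N)})"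

text \<open>The action of an automorphism of \<open>\<O>\<close> by functoriality.\<close>

definition aut_act :: "('K \<Rightarrow> 'K) \<Rightarrow> ('k, 'K) completed \<Rightarrow> ('k, 'K) completed" where
  "aut_act \<alpha> X = (\<lambda>N. free_map (map_letter (\<lambda>(c, f). (c, \<alpha> f))) ` X N)"


section \<open>The Virasoro subalgebra\<close>

text \<open>The element \<open>\<eta>\<close> is given by the sequence \<open>fs 1, fs 2, \<dots>\<close>; the value \<open>fs 0\<close> is irrelevant.\<close>

definition eta :: "'K \<Rightarrow> (nat \<Rightarrow> 'K) \<Rightarrow> 'k frac2" where
  "eta t fs = 1 / (t1 - t2)\<^sup>2 +
     emb2 (Abs_fps (\<lambda>i. fps_deriv (fls_regpart (expansion t (fs (Suc i))))))"

definition admissible :: "'K \<Rightarrow> (nat \<Rightarrow> 'K) \<Rightarrow> bool" where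
  "admissible t fs \<longleftrightarrow>
     (\<forall>n\<ge>1. fs n \<in> maximal_ideal \<O>) \<and> swap2 (eta t fs) = eta t fs"

definition L_eta :: "'K \<Rightarrow> (nat \<Rightarrow> 'K) \<Rightarrow> 'K set" where
  "L_eta t fs = {\<Sum>n\<in>S. \<iota> (c n) * (t powi (- int n) - fs n) | c S. finite S \<and> S \<subseteq> {1..}}"

definition minus_part :: "'K \<Rightarrow> (nat \<Rightarrow> 'K) \<Rightarrow> 'K \<Rightarrow> 'K" where
  "minus_part t fs f = (THE u. u \<in> L_eta t fs \<and> f - u \<in> \<O>)"

definition plus_part :: "'K \<Rightarrow> (nat \<Rightarrow> 'K) \<Rightarrow> 'K \<Rightarrow> 'K" where
  "plus_part t fs f = f - minus_part t fs f"

definition normal_prod :: "'K \<Rightarrow> (nat \<Rightarrow> 'K) \<Rightarrow> 'K \<Rightarrow> 'K \<Rightarrow> ('k, 'K) heis_free" where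
  "normal_prod t fs f g =
     elt (minus_part t fs f) * elt (minus_part t fs g) +
     elt (minus_part t fs f) * elt (plus_part t fs g) +
     elt (plus_part t fs f) * elt (plus_part t fs g) +
     elt (minus_part t fs g) * elt (plus_part t fs f)"

text \<open>\<open>T_basis t fs n\<close> is the image of \<open>D\<^sub>n = t\<^sup>n\<^sup>+\<^sup>1 d/dt\<close>; a general \<open>D\<close> is \<open>\<Sum>n. c\<^sub>n D\<^sub>n\<close> where \<open>c\<^sub>n\<close> is
  the coefficient of \<open>t\<^sup>n\<^sup>+\<^sup>1\<close> in \<open>D t\<close>.\<close>

definition T_basis :: "'K \<Rightarrow> (nat \<Rightarrow> 'K) \<Rightarrow> int \<Rightarrow> ('k, 'K) completed" where
  "T_basis t fs n = csum (\<lambda>i::int.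
     incl (scal (1 / 2) * gen HInv * normal_prod t fs (t powi i) (t powi (n - i))))"

definition T_eta :: "'K \<Rightarrow> (nat \<Rightarrow> 'K) \<Rightarrow> ('K \<Rightarrow> 'K) \<Rightarrow> ('k, 'K) completed" where
  "T_eta t fs D =
     csum (\<lambda>n::int. cscale (fls_nth (expansion t (D t)) (n + 1)) (T_basis t fs n))"

definition Vir :: "'K \<Rightarrow> (nat \<Rightarrow> 'K) \<Rightarrow> ('k, 'K) completed set" where
  "Vir t fs = {cadd (incl (scal c)) (T_eta t fs D) | c D. D \<in> theta}"

text \<open>The derivation \<open>D\<close> with \<open>[X, f] = D(f)\<close> for all \<open>f\<close>.\<close>

definition Vir_proj :: "('k, 'K) completed \<Rightarrow> 'K \<Rightarrow> 'K" where
  "Vir_proj X = (THE D. D \<in> theta \<and> (\<forall>f. commutator X (incl (elt f)) = incl (elt (D f))))"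

end


section \<open>Lie brackets on spaces of functions\<close>

definition lie_bracket_on :: "('x \<Rightarrow> 'k::field) set \<Rightarrow>
    (('x \<Rightarrow> 'k) \<Rightarrow> ('x \<Rightarrow> 'k) \<Rightarrow> ('x \<Rightarrow> 'k)) \<Rightarrow> bool" where
  "lie_bracket_on V B \<longleftrightarrow>
     (\<forall>x\<in>V. \<forall>y\<in>V. B x y \<in> V) \<and>
     (\<forall>x\<in>V. \<forall>y\<in>V. \<forall>z\<in>V. \<forall>a b. B (\<lambda>i. a * x i + b * y i) z = (\<lambda>i. a * B x z i + b * B y z i)) \<and>
     (\<forall>x\<in>V. \<forall>y\<in>V. \<forall>z\<in>V. \<forall>a b. B z (\<lambda>i. a * x i + b * y i) = (\<lambda>i. a * B z x i + b * B z y i)) \<and>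
     (\<forall>x\<in>V. B x x = (\<lambda>_. 0)) \<and>
     (\<forall>x\<in>V. \<forall>y\<in>V. \<forall>z\<in>V. (\<lambda>i. B x (B y z) i + B y (B z x) i + B z (B x y) i) = (\<lambda>_. 0))"

end

theory Submission
  imports Defs
begin

text \<open>In a coordinate \<open>t\<close>, a continuous form on the quadratic differentials is a pair of a scalar
  \<open>z\<close>, its value on \<open>dt\<^sub>1dt\<^sub>2/(t\<^sub>1-t\<^sub>2)\<^sup>2\<close>, and a vector field \<open>D\<close>. It is sent to \<open>-z/2 + T(D)\<close>, where
  \<open>T\<close> is the normally ordered series for the standard splitting \<open>K = t\<^sup>-\<^sup>1k[t\<^sup>-\<^sup>1] \<oplus> \<O>\<close>. Series for the
  same \<open>D\<close> in other coordinates or for other normal orderings have the same commutators with \<open>K\<close>; they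
  differ by a scalar, which is a vacuum expectation value in a Fock module. For the ordering given by
  \<open>\<eta>\<close> one finds that \<open>T\<^sub>\<eta>(D) - T(D)\<close> is one half of the pairing of \<open>D\<close> with
  \<open>\<eta> - dt\<^sub>1dt\<^sub>2/(t\<^sub>1-t\<^sub>2)\<^sup>2\<close>. Under a change of coordinates \<open>T(D)\<close> changes by one half of the pairing of
  \<open>D\<close> with the change of the double pole (a Schwarzian derivative on the diagonal), and \<open>z\<close> by the
  whole pairing, so that \<open>-z/2 + T(D)\<close> is invariant. The bracket on forms is given by the cocycle
  \<open>Res(f'''g)/12\<close>.\<close>

subsection \<open>Valuation and expansion\<close>

text \<open>That two series for one vector field differ by a scalar is not deduced from their equal
  commutators, which would require the centralizer of K in the completion. It comes from a symbol:
  modulo \<open>J N\<close> each series is a finite quadratic expression, and the symmetric part of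
  its coefficient tensor depends only on the vector field (\<open>box_symbol_approx\<close>). The
  difference of two series is then antisymmetric modulo \<open>J N\<close>, hence a scalar. The
  algebra is a quotient of a free algebra, and its definition alone does not exclude that
  \<open>J N\<close> contains nonzero scalars. The Fock module excludes it. It is a right module
  because \<open>J N\<close> is a left ideal: in a product \<open>a * elt f\<close> the factor
  \<open>a\<close> acts first, so vanishing is decided by \<open>elt f\<close>. The same module
  supplies the functional \<open>vacuum\<close> that computes all scalars. The factor -1/2 is forced
  by the wish to send a form vanishing on \<eta> to the normally ordered series of \<eta>; its 2 is
  the 2 of 1/(2\<hbar>). Thus the biresidue, with z = 1, goes to the scalar -1/2, and a scalar c
  comes from the form with z = -2c.\<close>

context cdv_algebra
begin

definition is_valuation :: "('K \<Rightarrow> int) \<Rightarrow> bool" where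
  "is_valuation v \<longleftrightarrow>
     (\<forall>x y. x \<noteq> 0 \<longrightarrow> y \<noteq> 0 \<longrightarrow> v (x * y) = v x + v y) \<and>
     (\<forall>x y. x \<noteq> 0 \<longrightarrow> y \<noteq> 0 \<longrightarrow> x + y \<noteq> 0 \<longrightarrow> min (v x) (v y) \<le> v (x + y)) \<and>
     (\<exists>x. x \<noteq> 0 \<and> v x = 1) \<and>
     \<O> = {x. x = 0 \<or> 0 \<le> v x}"

text \<open>A discrete valuation ring is only known to have some valuation; one is fixed here. Its
  value at 0 is arbitrary, which is why 0 is treated separately in what follows.\<close>

definition val :: "'K \<Rightarrow> int" where
  "val = (SOME v. is_valuation v)"

lemma is_valuation_val: "is_valuation val"
  using dvr unfolding val_def discrete_valuation_ring_def is_valuation_def[symmetric]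
  by (rule someI_ex)

lemma val_mult: "x \<noteq> 0 \<Longrightarrow> y \<noteq> 0 \<Longrightarrow> val (x * y) = val x + val y"
  using is_valuation_val by (auto simp: is_valuation_def)

lemma val_add: "x \<noteq> 0 \<Longrightarrow> y \<noteq> 0 \<Longrightarrow> x + y \<noteq> 0 \<Longrightarrow> min (val x) (val y) \<le> val (x + y)"
  using is_valuation_val by (auto simp: is_valuation_def)

lemma val_surj: "\<exists>x. x \<noteq> 0 \<and> val x = 1"
  using is_valuation_val by (auto simp: is_valuation_def)

lemma ring_eq: "x \<in> \<O> \<longleftrightarrow> x = 0 \<or> 0 \<le> val x"
  using is_valuation_val by (auto simp: is_valuation_def)

lemma val_one [simp]: "val 1 = 0"
  using val_mult[of 1 1] by simp

lemma val_minus [simp]: "val (- x) = val x"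
proof (cases "x = 0")
  case False
  have "val (-1) = 0" using val_mult[of "-1" "-1"] by simp
  with False show ?thesis using val_mult[of "-1" x] by simp
qed simp

lemma val_inverse: "x \<noteq> 0 \<Longrightarrow> val (inverse x) = - val x"
  using val_mult[of x "inverse x"] by simp

lemma val_power: "x \<noteq> 0 \<Longrightarrow> val (x ^ n) = int n * val x"
  by (induction n) (auto simp: val_mult algebra_simps)

lemma val_powi: "x \<noteq> 0 \<Longrightarrow> val (x powi n) = n * val x"
  by (auto simp: power_int_def val_power val_inverse)

text \<open>The power of the maximal ideal with an arbitrary integer exponent. Negative exponents
  accommodate poles, and nearly all estimates below are memberships in these sets.\<close>

definition frac_ideal :: "int \<Rightarrow> 'K set" where
  "frac_ideal N = {x. x = 0 \<or> N \<le> val x}"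

lemma frac_ideal_0 [simp]: "0 \<in> frac_ideal N"
  by (simp add: frac_ideal_def)

lemma frac_ideal_add: "x \<in> frac_ideal N \<Longrightarrow> y \<in> frac_ideal N \<Longrightarrow> x + y \<in> frac_ideal N"
  using val_add[of x y] by (cases "x = 0 \<or> y = 0 \<or> x + y = 0") (auto simp: frac_ideal_def min_def split: if_splits)

lemma frac_ideal_minus [simp]: "- x \<in> frac_ideal N \<longleftrightarrow> x \<in> frac_ideal N"
  by (auto simp: frac_ideal_def)

lemma frac_ideal_diff: "x \<in> frac_ideal N \<Longrightarrow> y \<in> frac_ideal N \<Longrightarrow> x - y \<in> frac_ideal N"
  using frac_ideal_add[of x N "- y"] by simp

lemma frac_ideal_mult: "x \<in> frac_ideal M \<Longrightarrow> y \<in> frac_ideal N \<Longrightarrow> x * y \<in> frac_ideal (M + N)"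
  by (cases "x = 0 \<or> y = 0") (auto simp: frac_ideal_def val_mult)

lemma frac_ideal_mono: "M \<le> N \<Longrightarrow> x \<in> frac_ideal N \<Longrightarrow> x \<in> frac_ideal M"
  by (auto simp: frac_ideal_def)

lemma frac_ideal_sum: "(\<And>i. i \<in> A \<Longrightarrow> f i \<in> frac_ideal N) \<Longrightarrow> sum f A \<in> frac_ideal N"
  by (induction A rule: infinite_finite_induct) (auto intro: frac_ideal_add)

lemma ring_mem: "x \<in> \<O> \<longleftrightarrow> x \<in> frac_ideal 0"
  by (simp add: frac_ideal_def ring_eq)

lemma maximal_ideal_frac_ideal: "maximal_ideal \<O> = frac_ideal 1"
  by (auto simp: maximal_ideal_def ring_mem frac_ideal_def val_inverse)

text \<open>Elements of an ideal power are sums of products, but one product is enough to produce a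
  given x of valuation at least N + 1: with p of valuation 1, take p times
  \<open>inverse p * x\<close>.\<close>

lemma maximal_ideal_power_frac_ideal: "maximal_ideal_power \<O> N = frac_ideal (int N)"
proof (induction N)
  case 0
  show ?case by (auto simp: ring_mem)
next
  case (Suc N)
  show ?case
  proof (intro set_eqI iffI)
    fix x assume "x \<in> maximal_ideal_power \<O> (Suc N)"
    then obtain zs where x: "x = sum_list (map (\<lambda>(x, y). x * y) zs)"
      and "set zs \<subseteq> frac_ideal 1 \<times> frac_ideal (int N)"
      by (auto simp: Suc maximal_ideal_frac_ideal)
    from this(2) show "x \<in> frac_ideal (int (Suc N))"
      unfolding x
    proof (induction zs)
      case (Cons z zs)
      then show ?case
        using frac_ideal_mult[of "fst z" 1 "snd z" "int N"]
        by (auto simp: case_prod_beta intro!: frac_ideal_add)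
    qed simp
  next
    fix x assume x: "x \<in> frac_ideal (int (Suc N))"
    obtain p where p: "p \<noteq> 0" "val p = 1" using val_surj by blast
    have "inverse p * x \<in> frac_ideal (- 1 + int (Suc N))"
      using x p by (intro frac_ideal_mult) (auto simp: frac_ideal_def val_inverse)
    moreover have "p \<in> frac_ideal 1" using p by (simp add: frac_ideal_def)
    moreover have "x = sum_list (map (\<lambda>(x, y). x * y) [(p, inverse p * x)])" using p by simp
    ultimately show "x \<in> maximal_ideal_power \<O> (Suc N)"
      by (simp add: Suc maximal_ideal_frac_ideal del: of_nat_Suc)
         (intro exI[of _ "[(p, inverse p * x)]"], simp)
  qed
qed

lemma uniformizer_val: "uniformizer \<O> t \<longleftrightarrow> t \<noteq> 0 \<and> val t = 1"
proof
  assume u: "uniformizer \<O> t"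
  then have t: "t \<noteq> 0" and eq: "frac_ideal 1 = (\<lambda>a. t * a) ` frac_ideal 0"
    by (auto simp: uniformizer_def maximal_ideal_frac_ideal ring_mem image_iff)
  have "1 \<in> frac_ideal 0" by (simp add: frac_ideal_def)
  then have "t * 1 \<in> frac_ideal 1" unfolding eq by blast
  then have 1: "1 \<le> val t" using t by (simp add: frac_ideal_def)
  obtain p where p: "p \<noteq> 0" "val p = 1" using val_surj by blast
  then have "p \<in> frac_ideal 1" by (simp add: frac_ideal_def)
  then obtain a where "p = t * a" "a \<in> frac_ideal 0" unfolding eq by blast
  then have "val t \<le> 1" using p t by (auto simp: frac_ideal_def val_mult)
  with 1 t show "t \<noteq> 0 \<and> val t = 1" by simp
next
  assume t: "t \<noteq> 0 \<and> val t = 1"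
  have "x \<in> (\<lambda>a. t * a) ` frac_ideal 0" if "x \<in> frac_ideal 1" for x
  proof
    show "x = t * (x / t)" using t by simp
    show "x / t \<in> frac_ideal 0"
      using frac_ideal_mult[OF that, of "inverse t" "-1"] t
      by (simp add: divide_inverse frac_ideal_def val_inverse)
  qed
  moreover have "t * a \<in> frac_ideal 1" if "a \<in> frac_ideal 0" for a
    using frac_ideal_mult[OF _ that, of t 1] t by (simp add: frac_ideal_def)
  ultimately have "frac_ideal 1 = (\<lambda>a. t * a) ` \<O>"
    by (auto simp: ring_mem image_iff Bex_def)
  then show "uniformizer \<O> t"
    using t by (simp add: uniformizer_def maximal_ideal_frac_ideal)
qed

lemma iota_0 [simp]: "\<iota> 0 = 0"
  using iota_add[of 0 0] by (metis add.right_neutral add_left_cancel)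

lemma iota_minus: "\<iota> (- a) = - \<iota> a"
  using iota_add[of a "- a"] by (simp add: eq_neg_iff_add_eq_0 add.commute)

lemma iota_diff: "\<iota> (a - b) = \<iota> a - \<iota> b"
  using iota_add[of a "- b"] by (simp add: iota_minus)

lemma iota_eq_0 [simp]: "\<iota> a = 0 \<longleftrightarrow> a = 0"
proof
  assume "\<iota> a = 0"
  show "a = 0"
  proof (rule ccontr)
    assume "a \<noteq> 0"
    then have "\<iota> a * \<iota> (inverse a) = 1" by (simp add: iota_one flip: iota_mult)
    with \<open>\<iota> a = 0\<close> show False by simp
  qed
qed simp

lemma iota_frac_ideal [simp]: "\<iota> a \<in> frac_ideal 0"
  using iota_mem ring_mem by simp

lemma val_iota: "a \<noteq> 0 \<Longrightarrow> val (\<iota> a) = 0"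
proof -
  assume a: "a \<noteq> 0"
  have "\<iota> a * \<iota> (inverse a) = 1" using a by (simp add: iota_one flip: iota_mult)
  then have "val (\<iota> a) + val (\<iota> (inverse a)) = 0"
    using a val_mult[of "\<iota> a" "\<iota> (inverse a)"] by simp
  moreover have "0 \<le> val (\<iota> a)" "0 \<le> val (\<iota> (inverse a))"
    using a iota_mem[of a] iota_mem[of "inverse a"] by (auto simp: ring_eq)
  ultimately show ?thesis by simp
qed

lemma frac_ideal_iota_mult: "x \<in> frac_ideal N \<Longrightarrow> \<iota> c * x \<in> frac_ideal N"
  using frac_ideal_mult[of "\<iota> c" 0 x N] by simp

lemma frac_ideal_powi: "uniformizer \<O> t \<Longrightarrow> N \<le> n \<Longrightarrow> t powi n \<in> frac_ideal N"
  by (simp add: frac_ideal_def uniformizer_val val_powi)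

lemma frac_ideal_powi_mult_iff:
  assumes "uniformizer \<O> t"
  shows "t powi n * x \<in> frac_ideal N \<longleftrightarrow> x \<in> frac_ideal (N - n)"
  using assms by (cases "x = 0") (auto simp: frac_ideal_def uniformizer_val val_powi val_mult)

lemma leading_zero:
  assumes t: "uniformizer \<O> t" and "\<iota> d * t powi m + y \<in> frac_ideal N" "y \<in> frac_ideal (m + 1)" "m < N"
  shows "d = 0"
proof (rule ccontr)
  assume "d \<noteq> 0"
  have "\<iota> d * t powi m + y \<in> frac_ideal (m + 1)"
    using assms by (intro frac_ideal_mono[of "m + 1" N]) auto
  from frac_ideal_diff[OF this assms(3)] have "\<iota> d * t powi m \<in> frac_ideal (m + 1)" by simp
  then show False using t \<open>d \<noteq> 0\<close>
    by (auto simp: frac_ideal_def uniformizer_val val_mult val_iota val_powi)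
qed

text \<open>The nonzero term of least exponent cannot be cancelled by the later terms, and its
  valuation is too small for the ideal.\<close>

lemma laurent_sum_zero:
  assumes t: "uniformizer \<O> t" and mem: "(\<Sum>n\<in>{a..<M}. \<iota> (d n) * t powi n) \<in> frac_ideal N"
    and n: "a \<le> n" "n < M" "n < N"
  shows "d n = 0"
proof (rule ccontr)
  assume "d n \<noteq> 0"
  define S where "S = {k. a \<le> k \<and> k \<le> n \<and> d k \<noteq> 0}"
  have "finite S" by (rule finite_subset[of _ "{a..n}"]) (auto simp: S_def)
  moreover have "n \<in> S" using n \<open>d n \<noteq> 0\<close> by (simp add: S_def)
  ultimately have m: "Min S \<in> S" "\<And>k. k \<in> S \<Longrightarrow> Min S \<le> k"
    by (auto intro!: Min_in)
  define m where "m = Min S"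
  have m1: "a \<le> m" "m \<le> n" "d m \<noteq> 0" using m(1) by (auto simp: S_def m_def)
  have m2: "d k = 0" if "a \<le> k" "k < m" for k
    using m(2)[of k] that m1 by (auto simp: S_def m_def)
  have "(\<Sum>k\<in>{a..<M}. \<iota> (d k) * t powi k) = (\<Sum>k\<in>{m..<M}. \<iota> (d k) * t powi k)"
    by (rule sum.mono_neutral_right) (use m1 m2 in auto)
  also have "{m..<M} = insert m {m+1..<M}" using m1 n by auto
  finally have "\<iota> (d m) * t powi m + (\<Sum>k\<in>{m+1..<M}. \<iota> (d k) * t powi k) \<in> frac_ideal N"
    using mem by simp
  moreover have "(\<Sum>k\<in>{m+1..<M}. \<iota> (d k) * t powi k) \<in> frac_ideal (m + 1)"
    by (intro frac_ideal_sum frac_ideal_iota_mult frac_ideal_powi t) auto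
  ultimately have "d m = 0" by (rule leading_zero[OF t]) (use m1 n in auto)
  with m1 show False by simp
qed

section \<open>Laurent expansion in a uniformizer\<close>

definition partial_sum :: "'K \<Rightarrow> 'k fls \<Rightarrow> int \<Rightarrow> 'K" where
  "partial_sum t s N = (\<Sum>n\<in>{fls_subdegree s..<N}. \<iota> (fls_nth s n) * t powi n)"

text \<open>Any lower bound of the exponents can replace the subdegree, so that several series get a
  common range of summation. The zero series, whose subdegree is 0 by convention, is covered as
  well.\<close>

lemma partial_sum_eq:
  assumes "\<And>n. n < a \<Longrightarrow> fls_nth s n = 0"
  shows "partial_sum t s N = (\<Sum>n\<in>{a..<N}. \<iota> (fls_nth s n) * t powi n)"
proof -
  have "partial_sum t s N = (\<Sum>n\<in>{min a (fls_subdegree s)..<N}. \<iota> (fls_nth s n) * t powi n)"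
    unfolding partial_sum_def by (rule sum.mono_neutral_left) auto
  also have "\<dots> = (\<Sum>n\<in>{a..<N}. \<iota> (fls_nth s n) * t powi n)"
    by (rule sum.mono_neutral_right) (use assms in \<open>auto simp: min_def\<close>)
  finally show ?thesis .
qed

lemma expansion_unique:
  assumes t: "uniformizer \<O> t"
    and s: "\<And>N. f - partial_sum t s (int N) \<in> frac_ideal (int N)"
    and s': "\<And>N. f - partial_sum t s' (int N) \<in> frac_ideal (int N)"
  shows "s = s'"
proof (rule fls_eqI)
  fix n
  define a where "a = min n (min (fls_subdegree s) (fls_subdegree s'))"
  define N where "N = nat (n + 1)"
  have "partial_sum t s (int N) - partial_sum t s' (int N) \<in> frac_ideal (int N)"
    using frac_ideal_diff[OF s'[of N] s[of N]] by simp
  also have "partial_sum t s (int N) - partial_sum t s' (int N) =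
      (\<Sum>n\<in>{a..<int N}. \<iota> (fls_nth s n - fls_nth s' n) * t powi n)"
    by (subst (1 2) partial_sum_eq[of a]) (auto simp: a_def iota_diff algebra_simps sum_subtractf)
  finally have "fls_nth s n - fls_nth s' n = 0"
    by (rule laurent_sum_zero[OF t]) (auto simp: N_def a_def)
  then show "fls_nth s n = fls_nth s' n" by simp
qed

text \<open>The coefficients are extracted like digits: subtract the residue, divide by t,
  repeat.\<close>

lemma ex_power_series:
  assumes t: "uniformizer \<O> t" and x: "x \<in> frac_ideal 0"
  shows "\<exists>c. \<forall>N. x - (\<Sum>k<N. \<iota> (c k) * t ^ k) \<in> frac_ideal (int N)"
proof -
  have "\<forall>x\<in>frac_ideal 0. \<exists>c. x - \<iota> c \<in> frac_ideal 1"
    using residue_field unfolding ring_mem maximal_ideal_frac_ideal by blast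
  then obtain res where res: "\<And>x. x \<in> frac_ideal 0 \<Longrightarrow> x - \<iota> (res x) \<in> frac_ideal 1"
    by metis
  define r where "r = rec_nat x (\<lambda>_ y. (y - \<iota> (res y)) / t)"
  have r0: "r 0 = x" and rS: "\<And>n. r (Suc n) = (r n - \<iota> (res (r n))) / t" by (simp_all add: r_def)
  have t0: "t \<noteq> 0" "val t = 1" using t by (auto simp: uniformizer_val)
  have r: "r n \<in> frac_ideal 0" for n
  proof (induction n)
    case (Suc n)
    from frac_ideal_mult[OF res[OF Suc], of "inverse t" "-1"] t0 show ?case
      by (simp add: rS divide_inverse frac_ideal_def val_inverse)
  qed (use x r0 in simp)
  have eq: "x - (\<Sum>k<N. \<iota> (res (r k)) * t ^ k) = t ^ N * r N" for N
  proof (induction N)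
    case (Suc N)
    have "x - (\<Sum>k<Suc N. \<iota> (res (r k)) * t ^ k) = t ^ N * r N - \<iota> (res (r N)) * t ^ N"
      using Suc by (simp add: algebra_simps)
    also have "\<dots> = t ^ Suc N * r (Suc N)" using t0 by (simp add: rS field_simps)
    finally show ?case .
  qed (simp add: r0)
  have "x - (\<Sum>k<N. \<iota> (res (r k)) * t ^ k) \<in> frac_ideal (int N)" for N
    unfolding eq using frac_ideal_powi_mult_iff[OF t, of "int N" "r N" "int N"] r by simp
  then show ?thesis by (intro exI[of _ "\<lambda>k. res (r k)"]) blast
qed

lemma ex_limit:
  assumes t: "uniformizer \<O> t"
  shows "\<exists>x. \<forall>N. x - (\<Sum>k<N. \<iota> (c k) * t ^ k) \<in> frac_ideal (int N)"
proof -
  define y where "y N = (\<Sum>k<N. \<iota> (c k) * t ^ k)" for N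
  have mem: "t ^ k \<in> frac_ideal N" if "N \<le> int k" for k N
    using frac_ideal_powi[OF t that] by simp
  have yd: "y m - y n \<in> frac_ideal (int N)" if "N \<le> n" "n \<le> m" for m n N
  proof -
    have "y m - y n = (\<Sum>k\<in>{n..<m}. \<iota> (c k) * t ^ k)"
      unfolding y_def using that sum_diff_nat_ivl[of 0 n m "\<lambda>k. \<iota> (c k) * t ^ k"]
      by (simp add: atLeast0LessThan)
    then show ?thesis
      using that by (auto intro!: frac_ideal_sum frac_ideal_iota_mult mem)
  qed
  have yd': "y m - y n \<in> frac_ideal (int N)" if "N \<le> n" "N \<le> m" for m n N
    using yd[of N n m] yd[of N m n] that frac_ideal_minus[of "y m - y n"] by (cases "n \<le> m") auto
  have "\<exists>l\<in>\<O>. \<forall>N. \<exists>M. \<forall>n\<ge>M. y n - l \<in> maximal_ideal_power \<O> N"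
  proof (rule complete)
    show "y n \<in> \<O>" for n using yd[of 0 0 n] by (simp add: ring_mem y_def)
    show "\<exists>M. \<forall>m\<ge>M. \<forall>n\<ge>M. y m - y n \<in> maximal_ideal_power \<O> N" for N
      using yd'[of N] by (auto simp: maximal_ideal_power_frac_ideal)
  qed
  then obtain l where l: "\<And>N. \<exists>M. \<forall>n\<ge>M. y n - l \<in> frac_ideal (int N)"
    by (auto simp: maximal_ideal_power_frac_ideal)
  \<comment> \<open>The limit is compared with the truncation at N through a later partial sum that
    is close to both.\<close>
  have "l - y N \<in> frac_ideal (int N)" for N
  proof -
    obtain M where "\<forall>n\<ge>M. y n - l \<in> frac_ideal (int N)" using l by blast
    then have "y (max M N) - l \<in> frac_ideal (int N)" by simp
    from frac_ideal_diff[OF yd'[of N N "max M N"] this] show ?thesis by simp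
  qed
  then show ?thesis unfolding y_def by blast
qed

lemma partial_sum_shift:
  assumes t: "uniformizer \<O> t"
  shows "partial_sum t (fls_shift (int m) (fps_to_fls (Abs_fps c))) (int N) =
    t powi (- int m) * (\<Sum>k<N + m. \<iota> (c k) * t ^ k)"
proof -
  have t0: "t \<noteq> 0" using t by (simp add: uniformizer_def)
  have "partial_sum t (fls_shift (int m) (fps_to_fls (Abs_fps c))) (int N) =
    (\<Sum>n\<in>{- int m..<int N}. \<iota> (c (nat (n + int m))) * t powi n)"
    by (subst partial_sum_eq[of "- int m"]) auto
  also have "\<dots> = (\<Sum>k<N + m. \<iota> (c k) * t powi (int k - int m))"
    by (rule sum.reindex_bij_witness[of _ "\<lambda>k. int k - int m" "\<lambda>n. nat (n + int m)"]) auto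
  finally show ?thesis
    using t0 by (simp add: sum_distrib_left power_int_diff power_int_minus field_simps)
qed

lemma ex_expansion:
  assumes t: "uniformizer \<O> t"
  shows "\<exists>s. \<forall>N. f - partial_sum t s (int N) \<in> frac_ideal (int N)"
proof -
  have t0: "t \<noteq> 0" using t by (simp add: uniformizer_def)
  define m where "m = nat (- val f)"
  have "t powi int m * f \<in> frac_ideal 0"
    unfolding frac_ideal_powi_mult_iff[OF t] by (auto simp: frac_ideal_def m_def)
  from ex_power_series[OF t this] obtain c where
    c: "\<And>N. t powi int m * f - (\<Sum>k<N. \<iota> (c k) * t ^ k) \<in> frac_ideal (int N)" by blast
  have "f - partial_sum t (fls_shift (int m) (fps_to_fls (Abs_fps c))) (int N) =
      t powi (- int m) * (t powi int m * f - (\<Sum>k<N + m. \<iota> (c k) * t ^ k))" for N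
    unfolding partial_sum_shift[OF t] using t0 by (simp add: power_int_minus field_simps)
  moreover have "t powi (- int m) * (t powi int m * f - (\<Sum>k<N + m. \<iota> (c k) * t ^ k)) \<in> frac_ideal (int N)" for N
    unfolding frac_ideal_powi_mult_iff[OF t] using c[of "N + m"] by simp
  ultimately show ?thesis by metis
qed

lemma expansion_iff:
  assumes t: "uniformizer \<O> t"
  shows "expansion t f = s \<longleftrightarrow> (\<forall>N. f - partial_sum t s (int N) \<in> frac_ideal (int N))"
proof -
  obtain s0 where s0: "\<forall>N. f - partial_sum t s0 (int N) \<in> frac_ideal (int N)"
    using ex_expansion[OF t] by blast
  have "expansion t f = s0"
    unfolding expansion_def maximal_ideal_power_frac_ideal partial_sum_def[symmetric]
    by (rule the_equality) (use s0 expansion_unique[OF t] in blast)+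
  then show ?thesis using s0 expansion_unique[OF t] by blast
qed

lemma expansion_approx:
  assumes t: "uniformizer \<O> t"
  shows "f - partial_sum t (expansion t f) (int N) \<in> frac_ideal (int N)"
  using expansion_iff[OF t] by blast

lemma expansion_mem:
  assumes t: "uniformizer \<O> t"
  shows "f \<in> frac_ideal N \<longleftrightarrow> (\<forall>n<N. fls_nth (expansion t f) n = 0)"
proof
  let ?s = "expansion t f"
  assume f: "f \<in> frac_ideal N"
  show "\<forall>n<N. fls_nth ?s n = 0"
  proof (intro allI impI)
    fix n assume n: "n < N"
    define a where "a = min n (fls_subdegree ?s)"
    define M where "M = nat (max N (n + 1))"
    have "f - partial_sum t ?s (int M) \<in> frac_ideal N"
      using expansion_approx[OF t, of f M] by (rule frac_ideal_mono[rotated]) (auto simp: M_def)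
    from frac_ideal_diff[OF f this] have "partial_sum t ?s (int M) \<in> frac_ideal N" by simp
    also have "partial_sum t ?s (int M) = (\<Sum>n\<in>{a..<int M}. \<iota> (fls_nth ?s n) * t powi n)"
      by (rule partial_sum_eq) (simp add: a_def)
    finally show "fls_nth ?s n = 0"
      by (rule laurent_sum_zero[OF t]) (use n in \<open>auto simp: a_def M_def\<close>)
  qed
next
  let ?s = "expansion t f"
  assume z: "\<forall>n<N. fls_nth ?s n = 0"
  define M where "M = nat N"
  have "f - partial_sum t ?s (int M) \<in> frac_ideal N"
    using expansion_approx[OF t, of f M] by (rule frac_ideal_mono[rotated]) (simp add: M_def)
  moreover have "partial_sum t ?s (int M) \<in> frac_ideal N"
    by (subst partial_sum_eq[of N])
      (use z in \<open>auto intro!: frac_ideal_sum frac_ideal_iota_mult frac_ideal_powi[OF t]\<close>)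
  ultimately show "f \<in> frac_ideal N" using frac_ideal_add by fastforce
qed

lemma partial_sum_add: "partial_sum t (s + s') N = partial_sum t s N + partial_sum t s' N"
proof -
  define a where "a = min (fls_subdegree s) (fls_subdegree s')"
  show ?thesis
    by (subst (1 2 3) partial_sum_eq[of a]) (auto simp: a_def iota_add algebra_simps sum.distrib)
qed

lemma partial_sum_const_mult: "partial_sum t (fls_const c * s) N = \<iota> c * partial_sum t s N"
  by (subst (1 2) partial_sum_eq[of "fls_subdegree s"])
    (auto simp: iota_mult algebra_simps sum_distrib_left)

lemma expansion_add [simp]:
  assumes t: "uniformizer \<O> t"
  shows "expansion t (f + g) = expansion t f + expansion t g"
  unfolding expansion_iff[OF t] partial_sum_add
proof
  fix N
  show "f + g - (partial_sum t (expansion t f) (int N) + partial_sum t (expansion t g) (int N)) \<in> frac_ideal (int N)"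
    using frac_ideal_add[OF expansion_approx[OF t, of f N] expansion_approx[OF t, of g N]]
    by (simp add: algebra_simps)
qed

lemma expansion_const_mult [simp]:
  assumes t: "uniformizer \<O> t"
  shows "expansion t (\<iota> c * f) = fls_const c * expansion t f"
  unfolding expansion_iff[OF t] partial_sum_const_mult
  using frac_ideal_iota_mult[OF expansion_approx[OF t, of f]]
  by (simp add: algebra_simps)

lemma expansion_0 [simp]: "uniformizer \<O> t \<Longrightarrow> expansion t 0 = 0"
  using expansion_add[of t 0 0] by simp

lemma expansion_minus [simp]: "uniformizer \<O> t \<Longrightarrow> expansion t (- f) = - expansion t f"
  using expansion_add[of t f "- f"] by (simp add: eq_neg_iff_add_eq_0 add.commute)

lemma expansion_diff [simp]: "uniformizer \<O> t \<Longrightarrow> expansion t (f - g) = expansion t f - expansion t g"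
  using expansion_add[of t f "- g"] by simp

lemma expansion_sum: "uniformizer \<O> t \<Longrightarrow> expansion t (sum f A) = (\<Sum>i\<in>A. expansion t (f i))"
  by (induction A rule: infinite_finite_induct) auto

lemma expansion_eq_0_iff [simp]:
  assumes t: "uniformizer \<O> t"
  shows "expansion t f = 0 \<longleftrightarrow> f = 0"
proof
  assume "expansion t f = 0"
  then have "f \<in> frac_ideal (val f + 1)" using expansion_mem[OF t] by simp
  then show "f = 0" by (simp add: frac_ideal_def)
qed (use t in simp)

lemma expansion_eq_iff: "uniformizer \<O> t \<Longrightarrow> expansion t f = expansion t g \<longleftrightarrow> f = g"
  using expansion_eq_0_iff[of t "f - g"] by simp

lemma expansion_surj:
  assumes t: "uniformizer \<O> t"
  shows "\<exists>f. expansion t f = s"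
proof -
  have t0: "t \<noteq> 0" using t by (simp add: uniformizer_def)
  define m where "m = nat (- fls_subdegree s)"
  define c where "c k = fls_nth s (int k - int m)" for k
  have s: "s = fls_shift (int m) (fps_to_fls (Abs_fps c))"
    by (rule fls_eqI) (auto simp: c_def m_def)
  obtain x where x: "\<And>N. x - (\<Sum>k<N. \<iota> (c k) * t ^ k) \<in> frac_ideal (int N)"
    using ex_limit[OF t, of c] by blast
  define f where "f = t powi (- int m) * x"
  have "f - partial_sum t s (int N) = t powi (- int m) * (x - (\<Sum>k<N + m. \<iota> (c k) * t ^ k))" for N
    unfolding f_def partial_sum_shift[OF t, folded s] s by (simp add: partial_sum_shift[OF t] algebra_simps)
  then have "expansion t f = s"
    unfolding expansion_iff[OF t] using frac_ideal_powi_mult_iff[OF t] x[of "_ + m"] by simp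
  then show ?thesis by blast
qed

lemma expansion_uniformizer_powi_mult:
  assumes t: "uniformizer \<O> t"
  shows "expansion t (t powi n * f) = fls_shift (- n) (expansion t f)"
proof -
  let ?s = "expansion t f"
  have t0: "t \<noteq> 0" using t by (simp add: uniformizer_def)
  have "t powi n * f - partial_sum t (fls_shift (- n) ?s) (int N) \<in> frac_ideal (int N)" for N
  proof -
    define a where "a = fls_subdegree ?s"
    \<comment> \<open>\<open>expansion_approx\<close> speaks of cut-offs that are natural numbers,
      while the shifted cut-off may be negative. The terms between a negative cut-off and 0 already
      lie in the ideal in question.\<close>
    define M where "M = max (int N - n) 0"
    have *: "f - partial_sum t ?s M \<in> frac_ideal M"
      using expansion_approx[OF t, of f "nat M"] by (simp add: M_def)
    have "partial_sum t ?s (int N - n) - partial_sum t ?s M \<in> frac_ideal (int N - n)"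
    proof (cases "int N - n \<ge> 0")
      case False
      then have M: "M = 0" by (simp add: M_def)
      define b where "b = min a (int N - n)"
      have "{b..<0} = {b..<int N - n} \<union> {int N - n..<0}" using False by (auto simp: b_def)
      then have "partial_sum t ?s 0 = partial_sum t ?s (int N - n) + (\<Sum>k\<in>{int N - n..<0}. \<iota> (fls_nth ?s k) * t powi k)"
        by (subst (1 2) partial_sum_eq[of b]) (auto simp: b_def a_def sum.union_disjoint)
      then show ?thesis
        using M by (auto intro!: frac_ideal_sum frac_ideal_iota_mult frac_ideal_powi[OF t])
    qed (simp add: M_def max_def)
    from frac_ideal_diff[OF frac_ideal_mono[OF _ *] this] have "f - partial_sum t ?s (int N - n) \<in> frac_ideal (int N - n)"
      by (simp add: M_def)
    moreover have "partial_sum t (fls_shift (- n) ?s) (int N) = t powi n * partial_sum t ?s (int N - n)"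
    proof -
      have "partial_sum t (fls_shift (- n) ?s) (int N) = (\<Sum>k\<in>{a + n..<int N}. \<iota> (fls_nth ?s (k - n)) * t powi k)"
        by (subst partial_sum_eq[of "a + n"]) (auto simp: a_def)
      also have "\<dots> = (\<Sum>k\<in>{a..<int N - n}. \<iota> (fls_nth ?s k) * t powi (k + n))"
        by (rule sum.reindex_bij_witness[of _ "\<lambda>k. k + n" "\<lambda>k. k - n"]) auto
      finally show ?thesis
        using t0 by (simp add: partial_sum_def a_def sum_distrib_left power_int_add mult_ac)
    qed
    ultimately show ?thesis
      using frac_ideal_powi_mult_iff[OF t, of n "f - partial_sum t ?s (int N - n)" "int N"]
      by (simp add: algebra_simps)
  qed
  then show ?thesis unfolding expansion_iff[OF t] by blast
qed

lemma expansion_1 [simp]: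
  assumes t: "uniformizer \<O> t"
  shows "expansion t 1 = 1"
  unfolding expansion_iff[OF t]
proof
  fix N
  show "1 - partial_sum t 1 (int N) \<in> frac_ideal (int N)"
  proof (cases N)
    case 0
    then show ?thesis by (simp add: partial_sum_def frac_ideal_def)
  next
    case (Suc M)
    have "partial_sum t 1 (int N) = (\<Sum>n\<in>{0..<int N}. if n = 0 then 1 else 0)"
      by (subst partial_sum_eq[of 0]) (auto intro!: sum.cong simp: iota_one simp del: sum.delta sum.delta')
    also have "\<dots> = 1" using Suc by (subst sum.delta) auto
    finally show ?thesis by simp
  qed
qed

lemma expansion_iota [simp]: "uniformizer \<O> t \<Longrightarrow> expansion t (\<iota> c) = fls_const c"
  using expansion_const_mult[of t c 1] by simp

lemma expansion_powi [simp]: "uniformizer \<O> t \<Longrightarrow> expansion t (t powi n) = fls_X_intpow n"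
  using expansion_uniformizer_powi_mult[of t n 1] by simp

lemma expansion_uniformizer [simp]: "uniformizer \<O> t \<Longrightarrow> expansion t t = fls_X"
  using expansion_powi[of t 1] by (simp add: fls_X_conv_shift_1)

lemma fls_mult_vanish:
  fixes f g :: "'k fls"
  assumes "\<And>n. n < a \<Longrightarrow> fls_nth f n = 0" "\<And>n. n < b \<Longrightarrow> fls_nth g n = 0" "n < a + b"
  shows "fls_nth (f * g) n = 0"
proof (cases "f = 0 \<or> g = 0")
  case False
  then have "a \<le> fls_subdegree f" "b \<le> fls_subdegree g"
    using assms by (auto intro!: fls_subdegree_geI)
  then show ?thesis using assms by (intro fls_times_nth_eq0) simp
qed auto

lemma expansion_partial_sum_mult:
  assumes t: "uniformizer \<O> t"
  shows "expansion t (partial_sum t s N * y) = expansion t (partial_sum t s N) * expansion t y"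
proof -
  have "expansion t (\<iota> c * t powi n * y) = expansion t (\<iota> c * t powi n) * expansion t y" for c n
    using t by (simp add: mult.assoc expansion_uniformizer_powi_mult fls_shifted_times_simps)
  then show ?thesis
    unfolding partial_sum_def by (simp add: sum_distrib_right expansion_sum[OF t])
qed

text \<open>Multiplication by a finite sum of powers of t is a combination of shifts. The remainder
  of x is chosen so small that its product with y does not reach the coefficient n.\<close>

lemma expansion_mult [simp]:
  assumes t: "uniformizer \<O> t"
  shows "expansion t (x * y) = expansion t x * expansion t y"
proof (rule fls_eqI)
  fix n
  define b where "b = val y"
  define M where "M = nat (n + 1 - b)"
  define r where "r = x - partial_sum t (expansion t x) (int M)"
  have r: "r \<in> frac_ideal (int M)" unfolding r_def by (rule expansion_approx[OF t])
  have y: "y \<in> frac_ideal b" by (simp add: b_def frac_ideal_def)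
  have x: "x = partial_sum t (expansion t x) (int M) + r" by (simp add: r_def)
  have "fls_nth (expansion t (r * y)) n = 0"
    using frac_ideal_mult[OF r y] unfolding expansion_mem[OF t] by (simp add: M_def)
  moreover have "fls_nth (expansion t r * expansion t y) n = 0"
    by (rule fls_mult_vanish[of "int M" _ b]) (use r y in \<open>auto simp: expansion_mem[OF t] M_def\<close>)
  ultimately show "fls_nth (expansion t (x * y)) n = fls_nth (expansion t x * expansion t y) n"
    using t by (subst (1 2) x) (simp add: ring_distribs expansion_partial_sum_mult del: partial_sum_def)
qed

lemma expansion_power [simp]: "uniformizer \<O> t \<Longrightarrow> expansion t (x ^ n) = expansion t x ^ n"
  by (induction n) auto

lemma expansion_inverse [simp]:
  assumes t: "uniformizer \<O> t"
  shows "expansion t (inverse x) = inverse (expansion t x)"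
proof (cases "x = 0")
  case False
  then have "expansion t x * expansion t (inverse x) = 1" using t by (simp flip: expansion_mult)
  then show ?thesis by (metis inverse_unique)
qed (use t in simp)

lemma expansion_power_int [simp]: "uniformizer \<O> t \<Longrightarrow> expansion t (x powi n) = expansion t x powi n"
  by (simp add: power_int_def)

lemma subdegree_expansion:
  assumes t: "uniformizer \<O> t" and "x \<noteq> 0"
  shows "fls_subdegree (expansion t x) = val x"
proof (rule antisym)
  have "x \<notin> frac_ideal (val x + 1)" using assms by (simp add: frac_ideal_def)
  then obtain n where "n < val x + 1" "fls_nth (expansion t x) n \<noteq> 0"
    unfolding expansion_mem[OF t] by auto
  then show "fls_subdegree (expansion t x) \<le> val x" using fls_subdegree_leI' by fastforce
  have "x \<in> frac_ideal (val x)" by (simp add: frac_ideal_def)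
  then show "val x \<le> fls_subdegree (expansion t x)"
    unfolding expansion_mem[OF t] using assms by (intro fls_subdegree_geI) auto
qed

end

section \<open>Substitution into Laurent series: chain rule and residue\<close>

lemma fls_compose_deriv:
  fixes f :: "'a::field_char_0 fls"
  assumes "\<phi> \<noteq> 0" "fps_nth \<phi> 0 = 0"
  shows "fls_deriv (fls_compose_fps f \<phi>) = fls_compose_fps (fls_deriv f) \<phi> * fps_to_fls (fps_deriv \<phi>)"
proof -
  have P: "fls_deriv (fls_compose_fps (fps_to_fls g) \<phi>) =
      fls_compose_fps (fls_deriv (fps_to_fls g)) \<phi> * fps_to_fls (fps_deriv \<phi>)" for g
    using assms by (simp add: fls_deriv_fps_to_fls fps_compose_deriv fls_times_fps_to_fls)
  \<comment> \<open>A power of the variable clears the pole. The chain rule for power series and the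
    product rule then yield the claim after cancelling that power.\<close>
  define n where "n = nat (- fls_subdegree f)"
  define g where "g = fls_regpart (fls_X ^ n * f)"
  have "fls_X ^ n * f = fps_to_fls g"
    unfolding g_def by (rule fls_eqI) (auto simp: fls_X_power_times_conv_shift n_def)
  then have f2: "fls_X ^ n * f = fps_to_fls g" .
  let ?c = "\<lambda>f. fls_compose_fps f \<phi>"
  have m: "?c (x * y) = ?c x * ?c y" for x y using assms by (intro fls_compose_fps_mult)
  have c0: "?c (fls_X ^ n) \<noteq> 0"
    using assms by (simp add: fls_compose_fps_eq_0_iff)
  have X: "fls_X ^ n = fps_to_fls (fps_X ^ n :: 'a fps)"
    by (simp add: fps_to_fls_power)
  have "?c (fls_X ^ n) * fls_deriv (?c f) = fls_deriv (?c (fls_X ^ n * f)) - fls_deriv (?c (fls_X ^ n)) * ?c f"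
    by (simp add: m)
  also have "\<dots> = (?c (fls_deriv (fls_X ^ n * f)) - ?c (fls_deriv (fls_X ^ n)) * ?c f) * fps_to_fls (fps_deriv \<phi>)"
    unfolding f2 unfolding P X by (simp add: algebra_simps)
  also have "\<dots> = ?c (fls_X ^ n) * (?c (fls_deriv f) * fps_to_fls (fps_deriv \<phi>))"
    using assms by (simp add: m fls_compose_fps_add algebra_simps)
  finally show ?thesis using c0 by simp
qed

text \<open>A Laurent series is c/X plus a derivative. A derivative remains one after the
  substitution and has residue 0; 1/X becomes the logarithmic derivative of \<phi>, whose residue is
  the subdegree of \<phi>.\<close>

lemma fls_residue_compose:
  fixes f :: "'a::field_char_0 fls"
  assumes "subdegree \<phi> = 1"
  shows "fls_residue (fls_compose_fps f \<phi> * fps_to_fls (fps_deriv \<phi>)) = fls_residue f"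
proof -
  have \<phi>: "\<phi> \<noteq> 0" using assms by (intro notI) simp
  have \<phi>0: "fps_nth \<phi> 0 = 0" using assms by (intro nth_less_subdegree_zero) simp
  note \<phi> = \<phi> \<phi>0
  define c where "c = fls_residue f"
  define g where "g = f - fls_const c * fls_X_inv"
  have "fls_residue g = 0" by (simp add: g_def c_def)
  then obtain h where h: "g = fls_deriv h"
    using fls_residue_nonzero_ex_antiderivative[of g] by auto
  have f: "f = fls_const c * inverse fls_X + fls_deriv h" using h unfolding g_def by (simp add: fls_inverse_X diff_eq_eq add.commute)
  have "fls_compose_fps f \<phi> = fls_const c * inverse (fps_to_fls \<phi>) + fls_compose_fps (fls_deriv h) \<phi>"
    using \<phi> by (subst f) (simp add: fls_compose_fps_add fls_compose_fps_mult fls_compose_fps_inverse)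
  then have "fls_compose_fps f \<phi> * fps_to_fls (fps_deriv \<phi>) =
      fls_const c * (fls_deriv (fps_to_fls \<phi>) * inverse (fps_to_fls \<phi>)) + fls_deriv (fls_compose_fps h \<phi>)"
    using \<phi> by (simp add: fls_compose_deriv fls_deriv_fps_to_fls algebra_simps)
  then show ?thesis
    using fls_residue_deriv_times_inverse_eq_subdegree[of "fps_to_fls \<phi>"] \<phi> assms
    by (simp add: c_def fls_subdegree_fls_to_fps)
qed

context cdv_algebra
begin

subsection \<open>Change of uniformizer\<close>

lemma fps_to_fls_transition:
  assumes "uniformizer \<O> t" "uniformizer \<O> s"
  shows "fps_to_fls (transition t s) = expansion t s"
proof -
  have "s \<in> frac_ideal 1" using assms by (simp add: uniformizer_val frac_ideal_def)
  then have "fls_nth (expansion t s) n = 0" if "n < 1" for n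
    using that by (simp add: expansion_mem[OF assms(1)])
  then show ?thesis unfolding transition_def by (intro fls_eqI) auto
qed

lemma subdegree_transition:
  assumes "uniformizer \<O> t" "uniformizer \<O> s"
  shows "subdegree (transition t s) = 1"
proof -
  have "int (subdegree (transition t s)) = fls_subdegree (expansion t s)"
    by (simp add: fls_subdegree_fls_to_fps flip: fps_to_fls_transition[OF assms])
  also have "\<dots> = 1" using subdegree_expansion[OF assms(1), of s] assms(2) by (simp add: uniformizer_val)
  finally show ?thesis by simp
qed

lemma transition_nonzero:
  assumes "uniformizer \<O> t" "uniformizer \<O> s"
  shows "transition t s \<noteq> 0" "fps_nth (transition t s) 0 = 0"
proof -
  show "transition t s \<noteq> 0" using subdegree_transition[OF assms] by (intro notI) simp
  show "fps_nth (transition t s) 0 = 0"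
    using subdegree_transition[OF assms] by (intro nth_less_subdegree_zero) simp
qed

text \<open>On finite sums of powers of s both sides agree because substitution is multiplicative.
  The remainder keeps its valuation under substitution, since the transition series has subdegree 1,
  and so misses the coefficient n on both sides.\<close>

lemma expansion_compose:
  assumes t: "uniformizer \<O> t" and s: "uniformizer \<O> s"
  shows "fls_compose_fps (expansion s f) (transition t s) = expansion t f"
proof (rule fls_eqI)
  fix n
  let ?c = "\<lambda>f. fls_compose_fps f (transition t s)"
  note nz = transition_nonzero[OF t s]
  have tm: "?c (expansion s (\<iota> c * s powi m)) = expansion t (\<iota> c * s powi m)" for c m
    using t s nz
    by (simp add: fls_compose_fps_mult fls_compose_fps_powi fps_to_fls_transition flip: fls_X_power_int)
  have sum: "?c (sum h A) = (\<Sum>i\<in>A. ?c (h i))" for h :: "int \<Rightarrow> 'k fls" and A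
    by (induction A rule: infinite_finite_induct) (auto simp: fls_compose_fps_add nz)
  define M where "M = nat (n + 1)"
  define p where "p = partial_sum s (expansion s f) (int M)"
  define r where "r = f - p"
  have r: "r \<in> frac_ideal (int M)" unfolding r_def p_def by (rule expansion_approx[OF s])
  have p: "?c (expansion s p) = expansion t p"
    unfolding p_def partial_sum_def by (simp only: expansion_sum[OF s] expansion_sum[OF t] sum tm)
  have "fls_nth (?c (expansion s r)) n = 0"
  proof (cases "r = 0")
    case False
    have "fls_subdegree (?c (expansion s r)) = val r"
      using subdegree_fls_compose_fps[of "transition t s" "expansion s r"] nz subdegree_transition[OF t s]
        subdegree_expansion[OF s False] by simp
    moreover have "int M \<le> val r" using r False by (simp add: frac_ideal_def)
    ultimately show ?thesis by (intro fls_eq0_below_subdegree) (simp add: M_def split: if_splits)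
  qed (use s in simp)
  moreover have "fls_nth (expansion t r) n = 0" using r by (simp add: expansion_mem[OF t] M_def)
  moreover have "f = p + r" by (simp add: r_def)
  ultimately show "fls_nth (?c (expansion s f)) n = fls_nth (expansion t f) n"
    using t s p nz by (simp add: fls_compose_fps_add)
qed

definition resid :: "'K \<Rightarrow> 'K \<Rightarrow> 'k" where
  "resid t f = fls_residue (expansion t f)"

definition ddt :: "'K \<Rightarrow> 'K \<Rightarrow> 'K" where
  "ddt t f = (THE y. expansion t y = fls_deriv (expansion t f))"

lemma expansion_ddt [simp]:
  assumes t: "uniformizer \<O> t"
  shows "expansion t (ddt t f) = fls_deriv (expansion t f)"
proof -
  obtain y where y: "expansion t y = fls_deriv (expansion t f)" using expansion_surj[OF t] by blast
  show ?thesis unfolding ddt_def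
    by (rule theI[of _ y]) (simp_all add: y flip: expansion_eq_iff[OF t])
qed

lemma ddt_change:
  assumes t: "uniformizer \<O> t" and s: "uniformizer \<O> s"
  shows "ddt t f = ddt s f * ddt t s"
proof -
  note nz = transition_nonzero[OF t s]
  have "expansion t (ddt t f) = fls_deriv (fls_compose_fps (expansion s f) (transition t s))"
    using t expansion_compose[OF t s] by simp
  also have "\<dots> = fls_compose_fps (expansion s (ddt s f)) (transition t s) * fps_to_fls (fps_deriv (transition t s))"
    using nz s by (simp add: fls_compose_deriv)
  also have "\<dots> = expansion t (ddt s f * ddt t s)"
    using t expansion_compose[OF t s]
    by (simp add: fps_to_fls_transition[OF t s] flip: fls_deriv_fps_to_fls)
  finally show ?thesis by (simp add: expansion_eq_iff[OF t])
qed

lemma resid_change: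
  assumes t: "uniformizer \<O> t" and s: "uniformizer \<O> s"
  shows "resid t (f * ddt t s) = resid s f"
  using fls_residue_compose[OF subdegree_transition[OF t s], of "expansion s f"] t
  by (simp add: resid_def expansion_compose[OF t s] fps_to_fls_transition[OF t s] flip: fls_deriv_fps_to_fls)

text \<open>The definite description quantifies over all uniformizers, so evaluating it in one of
  them is the invariance of Res(f dg): the factor from the chain rule for dg is the one from the
  change of variable in the residue.\<close>

lemma res_pairing_eq:
  assumes t: "uniformizer \<O> t"
  shows "res_pairing f g = resid t (f * ddt t g)"
proof -
  have eq: "resid s (f * ddt s g) = resid t (f * ddt t g)" if s: "uniformizer \<O> s" for s
    using resid_change[OF t s, of "f * ddt s g"] ddt_change[OF t s, of g] by (simp add: mult_ac)
  have "fls_residue (expansion s f * fls_deriv (expansion s g)) = resid s (f * ddt s g)"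
    if s: "uniformizer \<O> s" for s
    using s by (simp add: resid_def)
  then have *: "uniformizer \<O> s \<Longrightarrow>
      fls_residue (expansion s f * fls_deriv (expansion s g)) = resid t (f * ddt t g)" for s
    using eq by metis
  show ?thesis
    unfolding res_pairing_def by (rule the_equality) (metis * t)+
qed

lemma ex_uniformizer: "\<exists>t. uniformizer \<O> t"
  using val_surj by (auto simp: uniformizer_val)

lemma res_pairing_add_left: "res_pairing (f + f') g = res_pairing f g + res_pairing f' g"
  and res_pairing_add_right: "res_pairing f (g + g') = res_pairing f g + res_pairing f g'"
  and res_pairing_const_left: "res_pairing (\<iota> c * f) g = c * res_pairing f g"
  and res_pairing_const_right: "res_pairing f (\<iota> c * g) = c * res_pairing f g"
proof -
  obtain t where t: "uniformizer \<O> t" using ex_uniformizer by blast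
  show "res_pairing (f + f') g = res_pairing f g + res_pairing f' g"
    "res_pairing f (g + g') = res_pairing f g + res_pairing f g'"
    "res_pairing (\<iota> c * f) g = c * res_pairing f g"
    "res_pairing f (\<iota> c * g) = c * res_pairing f g"
    using t by (simp_all add: res_pairing_eq[OF t] resid_def ring_distribs mult_ac fls_deriv_mult_const_left)
qed

lemma res_pairing_antisym: "res_pairing g f = - res_pairing f g"
proof -
  obtain t where t: "uniformizer \<O> t" using ex_uniformizer by blast
  show ?thesis
    using fls_residue_times_deriv[of "expansion t f" "expansion t g"] t
    by (simp add: res_pairing_eq[OF t] resid_def mult_ac)
qed

lemma res_pairing_0_left [simp]: "res_pairing 0 g = 0"
  and res_pairing_0_right [simp]: "res_pairing g 0 = 0"
  using res_pairing_add_left[of 0 0 g] res_pairing_add_right[of g 0 0] by simp_all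

lemma res_pairing_minus_left: "res_pairing (- f) g = - res_pairing f g"
  and res_pairing_minus_right: "res_pairing g (- f) = - res_pairing g f"
  using res_pairing_add_left[of f "- f" g] res_pairing_add_right[of g f "- f"]
  by (simp_all add: eq_neg_iff_add_eq_0 add.commute)

lemma res_pairing_diff_left: "res_pairing (f - f') g = res_pairing f g - res_pairing f' g"
  and res_pairing_diff_right: "res_pairing g (f - f') = res_pairing g f - res_pairing g f'"
  using res_pairing_add_left[of f "- f'" g] res_pairing_add_right[of g f "- f'"]
  by (simp_all add: res_pairing_minus_left res_pairing_minus_right)

lemma ddt_frac_ideal:
  assumes t: "uniformizer \<O> t" and f: "f \<in> frac_ideal N"
  shows "ddt t f \<in> frac_ideal (N - 1)"
  using f t by (simp add: expansion_mem[OF t])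

lemma resid_frac_ideal:
  assumes t: "uniformizer \<O> t" and f: "f \<in> frac_ideal N" and "0 \<le> N"
  shows "resid t f = 0"
  using f t assms by (simp add: expansion_mem[OF t] resid_def)

lemma res_pairing_vanish:
  assumes "f \<in> frac_ideal M" "g \<in> frac_ideal N" "0 < M + N"
  shows "res_pairing f g = 0"
proof -
  obtain t where t: "uniformizer \<O> t" using ex_uniformizer by blast
  show ?thesis
    using frac_ideal_mult[OF assms(1) ddt_frac_ideal[OF t assms(2)]] assms(3)
    by (simp add: res_pairing_eq[OF t] resid_frac_ideal[OF t, of _ "M + (N - 1)"])
qed

subsection \<open>Vector fields\<close>

text \<open>The vector field g(t) d/dt. Its component along D_n is the coefficient n + 1 of g, which
  is the origin of the index i + j + 1 in the quadratic series.\<close>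

definition vec :: "'K \<Rightarrow> 'k fls \<Rightarrow> 'K \<Rightarrow> 'K" where
  "vec t g f = (THE y. expansion t y = g * fls_deriv (expansion t f))"

lemma expansion_vec [simp]:
  assumes t: "uniformizer \<O> t"
  shows "expansion t (vec t g f) = g * fls_deriv (expansion t f)"
proof -
  obtain y where y: "expansion t y = g * fls_deriv (expansion t f)" using expansion_surj[OF t] by blast
  show ?thesis unfolding vec_def
    by (rule theI[of _ y]) (simp_all add: y flip: expansion_eq_iff[OF t])
qed

lemma continuous_map_iff:
  "continuous_map h \<longleftrightarrow> (\<forall>x N. \<exists>M. \<forall>y. y - x \<in> frac_ideal (int M) \<longrightarrow> h y - h x \<in> frac_ideal (int N))"
  by (simp add: continuous_map_def maximal_ideal_power_frac_ideal)

lemma thetaD: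
  assumes "D \<in> theta"
  shows "D (x + y) = D x + D y" "D (\<iota> c * x) = \<iota> c * D x" "D (x * y) = x * D y + y * D x" "continuous_map D"
  using assms by (auto simp: theta_def)

lemma theta_0: "D \<in> theta \<Longrightarrow> D 0 = 0"
  using thetaD(1)[of D 0 0] by (metis add.right_neutral add_left_cancel)

lemma vec_theta:
  assumes t: "uniformizer \<O> t"
  shows "vec t g \<in> theta"
proof -
  have *: "vec t g (x + y) = vec t g x + vec t g y"
    "vec t g (\<iota> c * x) = \<iota> c * vec t g x"
    "vec t g (x * y) = x * vec t g y + y * vec t g x" for x y c
    using t by (simp_all add: algebra_simps fls_deriv_mult_const_left flip: expansion_eq_iff[OF t])
  have diff: "vec t g y - vec t g x = vec t g (y - x)" for x y
    using *(1)[of "y - x" x] by simp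
  obtain a where a: "\<And>n. n < a \<Longrightarrow> fls_nth g n = 0" using fls_nth_vanishes_belowE by metis
  have mem: "vec t g z \<in> frac_ideal (int N)" if z: "z \<in> frac_ideal (int (nat (int N - a + 1)))" for z N
  proof -
    have "fls_nth (g * fls_deriv (expansion t z)) n = 0" if "n < int N" for n
    proof (rule fls_mult_vanish[of a])
      show "n < a + (int N - a)" using that by simp
      show "fls_nth (fls_deriv (expansion t z)) k = 0" if "k < int N - a" for k
        using z that by (auto simp: expansion_mem[OF t])
    qed (rule a)
    then show ?thesis using t by (simp add: expansion_mem[OF t])
  qed
  have "continuous_map (vec t g)"
    unfolding continuous_map_iff diff using mem by blast
  with * show ?thesis unfolding theta_def by blast
qed

text \<open>By the Leibniz rule the difference E of the two derivations vanishes on all powers of t,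
  hence on truncations. Continuity makes E arbitrarily small on the remainders, so E f lies in every
  power of the maximal ideal.\<close>

lemma theta_eqI:
  assumes t: "uniformizer \<O> t" and D: "D \<in> theta" "D' \<in> theta" and eq: "D t = D' t"
  shows "D = D'"
proof
  fix f
  define E where "E x = D x - D' x" for x
  have t0: "t \<noteq> 0" using t by (simp add: uniformizer_def)
  have E: "E (x + y) = E x + E y" "E (\<iota> c * x) = \<iota> c * E x" "E (x * y) = x * E y + y * E x" for x y c
    unfolding E_def thetaD(1)[OF D(1)] thetaD(1)[OF D(2)] thetaD(2)[OF D(1)] thetaD(2)[OF D(2)]
      thetaD(3)[OF D(1), of x y] thetaD(3)[OF D(2), of x y] by (simp_all only: algebra_simps)
  have Et: "E t = 0" by (simp add: E_def eq)
  have E1: "E 1 = 0" using E(3)[of 1 1] by (metis add_cancel_left_left mult_1)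
  have En: "E (t ^ n) = 0" for n by (induction n) (auto simp: E(3) E1 Et)
  have Ei: "E (inverse (t ^ n)) = 0" for n
    using E(3)[of "t ^ n" "inverse (t ^ n)"] t0 by (simp add: E1 En)
  have Ep: "E (t powi n) = 0" for n using En Ei by (simp add: power_int_def power_inverse)
  have E0: "E 0 = 0" using E(1)[of 0 0] by (metis add.right_neutral add_left_cancel)
  have Es: "E (sum h A) = (\<Sum>i\<in>A. E (h i))" for h :: "int \<Rightarrow> 'K" and A
    using E0 by (induction A rule: infinite_finite_induct) (auto simp: E(1))
  have EP: "E (partial_sum t s N) = 0" for s N by (simp add: partial_sum_def Es E(2) Ep)
  have c: "\<exists>M. \<forall>y. y \<in> frac_ideal (int M) \<longrightarrow> E y \<in> frac_ideal (int N)" for N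
  proof -
    have z: "D 0 = 0" "D' 0 = 0" using theta_0[OF D(1)] theta_0[OF D(2)] .
    from thetaD(4)[OF D(1)] obtain M1 where M1: "\<forall>y. y \<in> frac_ideal (int M1) \<longrightarrow> D y \<in> frac_ideal (int N)"
      unfolding continuous_map_iff by (metis z(1) diff_zero)
    from thetaD(4)[OF D(2)] obtain M2 where M2: "\<forall>y. y \<in> frac_ideal (int M2) \<longrightarrow> D' y \<in> frac_ideal (int N)"
      unfolding continuous_map_iff by (metis z(2) diff_zero)
    show ?thesis
    proof (intro exI allI impI)
      fix y assume y: "y \<in> frac_ideal (int (max M1 M2))"
      have "y \<in> frac_ideal (int M1)" "y \<in> frac_ideal (int M2)"
        using y by (auto intro: frac_ideal_mono[OF _ y])
      then show "E y \<in> frac_ideal (int N)" unfolding E_def using M1 M2 by (intro frac_ideal_diff) auto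
    qed
  qed
  have "E f = 0"
  proof (rule ccontr)
    assume nz: "E f \<noteq> 0"
    define N where "N = nat (val (E f) + 1)"
    obtain M where M: "\<And>y. y \<in> frac_ideal (int M) \<Longrightarrow> E y \<in> frac_ideal (int N)" using c by blast
    have "E (f - partial_sum t (expansion t f) (int M)) \<in> frac_ideal (int N)"
      by (rule M) (rule expansion_approx[OF t])
    moreover have "E (f - partial_sum t (expansion t f) (int M)) = E f"
      using E(1)[of "f - partial_sum t (expansion t f) (int M)" "partial_sum t (expansion t f) (int M)"]
      by (simp add: EP)
    ultimately show False using nz by (auto simp: frac_ideal_def N_def split: if_splits)
  qed
  then show "D f = D' f" by (simp add: E_def)
qed

lemma theta_vec:
  assumes t: "uniformizer \<O> t" and D: "D \<in> theta"
  shows "D = vec t (expansion t (D t))"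
  by (rule theta_eqI[OF t D vec_theta[OF t]]) (use t in \<open>simp flip: expansion_eq_iff[OF t]\<close>)

lemma vec_uniformizer [simp]: "uniformizer \<O> t \<Longrightarrow> expansion t (vec t g t) = g"
  by simp

end

subsection \<open>Restriction to the diagonal\<close>

lemma emb2_add: "emb2 (F + G) = emb2 F + emb2 G"
  and emb2_mult: "emb2 (F * G) = emb2 F * emb2 G"
  and emb2_diff: "emb2 (F - G) = emb2 F - emb2 G"
  and emb2_minus: "emb2 (- F) = - emb2 F"
  and emb2_0 [simp]: "emb2 0 = 0"
  and emb2_1 [simp]: "emb2 1 = 1"
  by (simp_all add: emb2_def fract_collapse)

lemma emb2_power: "emb2 (F ^ n) = emb2 F ^ n"
  by (induction n) (simp_all add: emb2_mult)

lemma emb2_eq_iff [simp]: "emb2 F = emb2 G \<longleftrightarrow> F = G"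
  by (simp add: emb2_def eq_fract)

lemma emb2_eq_0_iff [simp]: "emb2 F = 0 \<longleftrightarrow> F = 0"
  using emb2_eq_iff[of F 0] by simp

definition tau :: "'k::field fps fps" where "tau = fps_X - fps_const fps_X"

lemma emb2_tau: "emb2 tau = t1 - t2"
  by (simp add: tau_def t1_def t2_def emb2_diff)

lemma t1_nz [simp]: "(t1 :: 'k::field frac2) \<noteq> 0" and t2_nz [simp]: "(t2 :: 'k::field frac2) \<noteq> 0"
  by (simp_all add: t1_def t2_def)

lemma tau_nz [simp]: "(tau :: 'k::field fps fps) \<noteq> 0"
proof
  assume "(tau :: 'k fps fps) = 0"
  then have "fps_nth (tau :: 'k fps fps) 1 = 0" by simp
  then show False by (simp add: tau_def)
qed

lemma t1_t2_nz [simp]: "(t1 - t2 :: 'k::field frac2) \<noteq> 0"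
  using tau_nz emb2_eq_0_iff[of "tau :: 'k fps fps"] by (simp add: emb2_tau del: tau_nz)

lemma t1_neq_t2 [simp]: "(t1 :: 'k::field frac2) \<noteq> t2"
  using t1_t2_nz by fastforce

text \<open>The restriction F(t, t): the coefficient n collects the monomials of total degree
  n.\<close>

definition diag :: "'k::field fps fps \<Rightarrow> 'k fps" where
  "diag F = Abs_fps (\<lambda>n. \<Sum>i\<le>n. F $ i $ (n - i))"

lemma diag_decomp: "\<exists>Q. F = fps_const (diag F) + tau * Q"
proof
  \<comment> \<open>Divide the first variable out monomial by monomial: x^i - y^i is x - y times the
    sum of x^a y^(i-1-a). The coefficient at (a, c) collects the entries of F with i = a + 1 + b and
    second index c - b.\<close>
  define Q where "Q = Abs_fps (\<lambda>a. Abs_fps (\<lambda>c. \<Sum>b\<le>c. F $ (a + 1 + b) $ (c - b)))"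
  show "F = fps_const (diag F) + tau * Q"
  proof (intro fps_ext)
    fix a c
    have X: "(fps_const fps_X * Q) $ a $ c = (if c = 0 then 0 else Q $ a $ (c - 1))"
      by (simp only: fps_mult_left_const_nth fps_X_mult_nth)
    have "(tau * Q) $ a $ c = (if a = 0 then 0 else Q $ (a - 1) $ c) - (if c = 0 then 0 else Q $ a $ (c - 1))"
      using X by (simp add: tau_def left_diff_distrib)
    moreover have "Q $ a $ (c - 1) = (\<Sum>b\<in>{1..c}. F $ (a + b) $ (c - b))" if "c > 0"
      unfolding Q_def fps_nth_Abs_fps
      by (rule sum.reindex_bij_witness[of _ "\<lambda>b. b - 1" Suc]) (use that in auto)
    moreover have "(\<Sum>b\<le>c. F $ (a + b) $ (c - b)) = F $ a $ c + (\<Sum>b\<in>{1..c}. F $ (a + b) $ (c - b))"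
      by (simp add: atMost_atLeast0 sum.atLeast_Suc_atMost)
    moreover have "(\<Sum>b\<in>{1..c}. F $ (a + b) $ (c - b)) = 0" if "c = 0" using that by simp
    ultimately show "F $ a $ c = (fps_const (diag F) + tau * Q) $ a $ c"
      by (cases a) (auto simp: Q_def diag_def)
  qed
qed

text \<open>Comparing coefficients of the first variable shows that each coefficient of H is the
  second variable times the next one. Hence the lowest is divisible by all powers of that variable
  and vanishes, and with it g.\<close>

lemma const_tau_multiple:
  assumes "fps_const g = tau * H"
  shows "g = 0"
proof -
  have H: "H $ i = fps_X * H $ (i + 1)" for i
    using arg_cong[OF assms, of "\<lambda>F. F $ (i + 1)"]
    by (simp add: tau_def left_diff_distrib)
  have "H $ 0 = fps_X ^ n * H $ n" for n
  proof (induction n)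
    case (Suc n)
    then show ?case by (simp only: H[of n] power_Suc2 mult.assoc Suc_eq_plus1[symmetric])
  qed simp
  then have "H $ 0 $ n = 0" for n by (metis fps_X_power_mult_nth lessI)
  then have "H $ 0 = 0" by (simp add: fps_eq_iff)
  then show ?thesis
    using arg_cong[OF assms, of "\<lambda>F. F $ 0"] by (simp add: tau_def left_diff_distrib)
qed

lemma diag_unique: "F = fps_const g + tau * Q \<Longrightarrow> diag F = g"
proof -
  assume F: "F = fps_const g + tau * Q"
  obtain Q' where "F = fps_const (diag F) + tau * Q'" using diag_decomp by blast
  with F have "fps_const (diag F - g) = tau * (Q - Q')"
    by (simp add: algebra_simps flip: fps_const_sub)
  from const_tau_multiple[OF this] show ?thesis by simp
qed

lemma diag_const [simp]: "diag (fps_const g) = g"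
  by (rule diag_unique[of _ _ 0]) simp

lemma diag_tau_mult [simp]: "diag (tau * Q) = 0"
  by (rule diag_unique[of _ _ Q]) simp

lemma diag_diff: "diag (F - G) = diag F - diag G"
  by (simp add: diag_def fps_eq_iff sum_subtractf)

lemma diag_mult: "diag (F * G) = diag F * diag G"
proof -
  obtain Q where Q: "F = fps_const (diag F) + tau * Q" using diag_decomp by blast
  obtain R where R: "G = fps_const (diag G) + tau * R" using diag_decomp by blast
  have "(fps_const (diag F) + tau * Q) * (fps_const (diag G) + tau * R) =
      fps_const (diag F * diag G) + tau * (Q * fps_const (diag G) + fps_const (diag F) * R + tau * Q * R)"
    by (simp add: algebra_simps flip: fps_const_mult)
  then show ?thesis using Q R by (metis diag_unique)
qed

lemma diag_fps_X [simp]: "diag fps_X = fps_X"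
  by (rule diag_unique[of _ _ 1]) (simp add: tau_def)

lemma diag_1 [simp]: "diag 1 = 1"
  using diag_const[of 1] by simp

lemma diag_power_fps: "diag (F ^ n) = diag F ^ n"
  by (induction n) (simp_all add: diag_mult)

lemma diag_eq_0E: "diag F = 0 \<Longrightarrow> (\<And>Q. F = tau * Q \<Longrightarrow> P) \<Longrightarrow> P"
  using diag_decomp[of F] by auto

lemma diag_subst_t1 [simp]: "diag (subst_t1 f) = f"
proof -
  have "(\<Sum>i\<le>n. fps_const (f $ i) $ (n - i)) = (\<Sum>i\<le>n. if i = n then f $ n else 0)" for n
    by (intro sum.cong) auto
  then show ?thesis by (simp add: diag_def subst_t1_def fps_eq_iff)
qed

lemma diag_swap: "diag (Abs_fps (\<lambda>i. Abs_fps (\<lambda>j. F $ j $ i))) = diag F"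
proof (rule fps_ext)
  fix n
  show "diag (Abs_fps (\<lambda>i. Abs_fps (\<lambda>j. F $ j $ i))) $ n = diag F $ n"
    unfolding diag_def fps_nth_Abs_fps
    by (rule sum.reindex_bij_witness[of _ "\<lambda>i. n - i" "\<lambda>i. n - i"]) auto
qed

subsection \<open>Functions with poles along the axes\<close>

lemma K2_I: "emb2 F / (t1 * t2) ^ n \<in> K2"
  by (auto simp: K2_def)

lemma K2_emb2 [simp]: "emb2 F \<in> K2"
  using K2_I[of F 0] by simp

lemma K2_add:
  assumes "x \<in> K2" "y \<in> K2" shows "x + y \<in> K2"
proof -
  obtain F m G n where x: "x = emb2 F / (t1 * t2) ^ m" and y: "y = emb2 G / (t1 * t2) ^ n"
    using assms by (auto simp: K2_def)
  have tt: "(t1 * t2 :: 'a frac2) = emb2 (fps_X * fps_const fps_X)" by (simp add: t1_def t2_def emb2_mult)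
  have "x + y = emb2 (F * (fps_X * fps_const fps_X) ^ n + G * (fps_X * fps_const fps_X) ^ m) / (t1 * t2) ^ (m + n)"
    unfolding emb2_add emb2_mult[of F] emb2_mult[of G] emb2_power tt[symmetric] x y
    by (simp add: field_simps power_add)
  then show ?thesis using K2_I by metis
qed

lemma K2_mult:
  assumes "x \<in> K2" "y \<in> K2" shows "x * y \<in> K2"
proof -
  obtain F m G n where "x = emb2 F / (t1 * t2) ^ m" "y = emb2 G / (t1 * t2) ^ n"
    using assms by (auto simp: K2_def)
  then have "x * y = emb2 (F * G) / (t1 * t2) ^ (m + n)"
    by (simp add: emb2_mult power_add)
  then show ?thesis using K2_I by metis
qed

lemma K2_minus: "x \<in> K2 \<Longrightarrow> - x \<in> K2"
  using K2_mult[OF K2_emb2[of "- 1"], of x] by (simp add: emb2_minus)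

lemma K2_diff: "x \<in> K2 \<Longrightarrow> y \<in> K2 \<Longrightarrow> x - y \<in> K2"
  using K2_add[OF _ K2_minus, of x y] by simp

lemma K2_power: "x \<in> K2 \<Longrightarrow> x ^ n \<in> K2"
  by (induction n) (use K2_emb2[of 1] in \<open>auto intro: K2_mult\<close>)

lemma K2_t [simp]: "t1 \<in> K2" "t2 \<in> K2" "t1 - t2 \<in> K2"
  by (simp_all add: t1_def t2_def flip: emb2_diff)

lemma K2_inverse_t [simp]: "inverse t1 \<in> K2" "inverse t2 \<in> K2"
proof -
  have "inverse t1 = emb2 (fps_const fps_X) / (t1 * t2) ^ 1" by (simp add: field_simps flip: t2_def)
  then show "inverse t1 \<in> K2" using K2_I by metis
  have "inverse t2 = emb2 fps_X / (t1 * t2) ^ 1" by (simp add: field_simps flip: t1_def)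
  then show "inverse t2 \<in> K2" using K2_I by metis
qed

lemma K2_powi: "x \<in> K2 \<Longrightarrow> inverse x \<in> K2 \<Longrightarrow> x powi n \<in> K2"
  by (auto simp: power_int_def K2_power)

lemma diag_power_iff: "x \<in> diag_power n \<longleftrightarrow> x / (t1 - t2) powi n \<in> K2"
  by (force simp: diag_power_def)

lemma diag_power_0 [simp]: "0 \<in> diag_power n"
  using K2_emb2[of 0] by (simp add: diag_power_iff)

lemma diag_power_add: "x \<in> diag_power n \<Longrightarrow> y \<in> diag_power n \<Longrightarrow> x + y \<in> diag_power n"
  by (simp add: diag_power_iff K2_add add_divide_distrib)

lemma diag_power_minus: "x \<in> diag_power n \<Longrightarrow> - x \<in> diag_power n"
  using K2_minus by (fastforce simp: diag_power_iff)

lemma diag_power_diff: "x \<in> diag_power n \<Longrightarrow> y \<in> diag_power n \<Longrightarrow> x - y \<in> diag_power n"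
  using diag_power_add[OF _ diag_power_minus, of x n y] by simp

lemma diag_power_mult: "x \<in> diag_power m \<Longrightarrow> y \<in> diag_power n \<Longrightarrow> x * y \<in> diag_power (m + n)"
  using K2_mult[of "x / (t1 - t2) powi m" "y / (t1 - t2) powi n"]
  by (simp add: diag_power_iff power_int_add)

lemma diag_power_K2: "diag_power 0 = K2"
  by (auto simp: diag_power_iff)

lemma K2_mult_diag_power: "x \<in> K2 \<Longrightarrow> y \<in> diag_power n \<Longrightarrow> x * y \<in> diag_power n"
  using diag_power_mult[of x 0 y n] by (simp add: diag_power_K2)

lemma diag_power_Suc_sub: "x \<in> diag_power (n + 1) \<Longrightarrow> x \<in> diag_power n"
proof -
  assume "x \<in> diag_power (n + 1)"
  then have "(t1 - t2) * (x / (t1 - t2) powi (n + 1)) \<in> K2"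
    unfolding diag_power_iff by (rule K2_mult[rotated]) simp
  then show ?thesis unfolding diag_power_iff by (simp add: power_int_add)
qed

lemma diag_power_mono: "m \<le> n \<Longrightarrow> x \<in> diag_power n \<Longrightarrow> x \<in> diag_power m"
proof (induction n rule: int_ge_induct)
  case (step n)
  then show ?case using diag_power_Suc_sub by blast
qed

lemma diag_power_tau: "(t1 - t2) powi n \<in> diag_power n"
  using K2_emb2[of 1] by (simp add: diag_power_iff)

lemma emb2_diag_power_1: "emb2 (tau * Q) \<in> diag_power 1"
  by (simp add: diag_power_iff emb2_mult emb2_tau)

subsection \<open>Laurent series in the second variable\<close>

text \<open>Frees \<open>laurent_t2\<close> from the normal form in its definition: any exponent
  that clears the pole gives the same element, so sums and products can be computed over a common
  denominator.\<close>

lemma laurent_t2_eq: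
  assumes f: "fls_X ^ n * f = fps_to_fls g"
  shows "laurent_t2 f = emb2 (fps_const g) / t2 ^ n"
proof (cases "f = 0")
  case True
  then show ?thesis using f by (simp add: laurent_t2_def subst_t2_def)
next
  case False
  have "fls_subdegree (fls_X ^ n * f) = int n + fls_subdegree f"
    using False by (subst fls_subdegree_mult) auto
  then have ge: "int n + fls_subdegree f \<ge> 0"
    using f by (simp add: fls_subdegree_fls_to_fps)
  define k where "k = nat (int n + fls_subdegree f)"
  have "fps_to_fls g = fls_X ^ k * fps_to_fls (fls_base_factor_to_fps f)"
    unfolding f[symmetric] using ge
    by (intro fls_eqI) (auto simp: fls_X_power_times_conv_shift k_def fls_base_factor_to_fps_nth algebra_simps)
  also have "\<dots> = fps_to_fls (fps_X ^ k * fls_base_factor_to_fps f)"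
    by (simp add: fls_times_fps_to_fls fps_to_fls_power)
  finally have g: "g = fps_X ^ k * fls_base_factor_to_fps f" by simp
  have "emb2 (fps_const g) = t2 ^ k * emb2 (fps_const (fls_base_factor_to_fps f))"
    unfolding g t2_def by (simp add: emb2_mult emb2_power flip: fps_const_mult fps_const_power)
  also have "t2 ^ k = t2 powi (int n + fls_subdegree f)" using ge by (simp add: k_def flip: power_int_of_nat)
  finally show ?thesis by (simp add: laurent_t2_def subst_t2_def power_int_add)
qed

lemma ex_fls_X_power_mult: "\<exists>n g. fls_X ^ n * f = fps_to_fls g"
proof -
  have "fls_X ^ nat (- fls_subdegree f) * f = fps_to_fls (fls_regpart (fls_X ^ nat (- fls_subdegree f) * f))"
    by (rule fls_eqI) (auto simp: fls_X_power_times_conv_shift)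
  then show ?thesis by blast
qed

lemma ex_fls_X_power_mult2:
  fixes f f' :: "'k::field fls"
  obtains n g g' where "fls_X ^ n * f = fps_to_fls g" "fls_X ^ n * f' = fps_to_fls g'"
proof -
  obtain m h where h: "fls_X ^ m * f = fps_to_fls h" using ex_fls_X_power_mult by blast
  obtain n h' where h': "fls_X ^ n * f' = fps_to_fls h'" using ex_fls_X_power_mult by blast
  have "fls_X ^ (m + n) * f = fls_X ^ n * (fls_X ^ m * f)" "fls_X ^ (m + n) * f' = fls_X ^ m * (fls_X ^ n * f')"
    by (simp_all only: power_add mult_ac)
  then have "fls_X ^ (m + n) * f = fps_to_fls (fps_X ^ n * h)" "fls_X ^ (m + n) * f' = fps_to_fls (fps_X ^ m * h')"
    unfolding h h' by (simp_all add: fls_times_fps_to_fls fps_to_fls_power)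
  then show ?thesis by (rule that)
qed

lemma laurent_t2_fps [simp]: "laurent_t2 (fps_to_fls g) = emb2 (fps_const g)"
  using laurent_t2_eq[of 0 "fps_to_fls g" g] by simp

lemma laurent_t2_0 [simp]: "laurent_t2 0 = 0"
  using laurent_t2_fps[of 0] by simp

lemma laurent_t2_1 [simp]: "laurent_t2 1 = 1"
  using laurent_t2_fps[of 1] by simp

lemma laurent_t2_const: "laurent_t2 (fls_const c) = scalar2 c"
  using laurent_t2_fps[of "fps_const c"] by (simp add: scalar2_def)

lemma laurent_t2_add: "laurent_t2 (f + f') = laurent_t2 f + laurent_t2 f'"
proof -
  obtain n g g' where *: "fls_X ^ n * f = fps_to_fls g" "fls_X ^ n * f' = fps_to_fls g'"
    by (rule ex_fls_X_power_mult2)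
  then have "fls_X ^ n * (f + f') = fps_to_fls (g + g')" by (simp add: ring_distribs)
  from laurent_t2_eq[OF this] show ?thesis
    by (simp add: laurent_t2_eq[OF *(1)] laurent_t2_eq[OF *(2)] add_divide_distrib emb2_add flip: fps_const_add)
qed

lemma laurent_t2_mult: "laurent_t2 (f * f') = laurent_t2 f * laurent_t2 f'"
proof -
  obtain m g where g: "fls_X ^ m * f = fps_to_fls g" using ex_fls_X_power_mult by blast
  obtain n g' where g': "fls_X ^ n * f' = fps_to_fls g'" using ex_fls_X_power_mult by blast
  have "fls_X ^ (m + n) * (f * f') = (fls_X ^ m * f) * (fls_X ^ n * f')"
    by (simp only: power_add mult_ac)
  then have "fls_X ^ (m + n) * (f * f') = fps_to_fls (g * g')"
    unfolding g g' by (simp add: fls_times_fps_to_fls)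
  from laurent_t2_eq[OF this] show ?thesis
    by (simp add: laurent_t2_eq[OF g] laurent_t2_eq[OF g'] emb2_mult power_add flip: fps_const_mult)
qed

lemma laurent_t2_minus: "laurent_t2 (- f) = - laurent_t2 f"
  using laurent_t2_add[of f "- f"] by (simp add: eq_neg_iff_add_eq_0 add.commute)

lemma laurent_t2_diff: "laurent_t2 (f - f') = laurent_t2 f - laurent_t2 f'"
  using laurent_t2_add[of f "- f'"] by (simp add: laurent_t2_minus)

lemma laurent_t2_power: "laurent_t2 (f ^ n) = laurent_t2 f ^ n"
  by (induction n) (simp_all add: laurent_t2_mult)

lemma laurent_t2_K2 [simp]: "laurent_t2 f \<in> K2"
proof -
  obtain n g where "fls_X ^ n * f = fps_to_fls g" using ex_fls_X_power_mult by blast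
  from laurent_t2_eq[OF this] show ?thesis
    by (simp add: divide_inverse power_inverse[symmetric] K2_mult K2_power)
qed

text \<open>Clearing denominators and restricting to the diagonal leaves g times a power of t on one
  side and 0 on the other.\<close>

lemma laurent_t2_diag_power_1:
  assumes "laurent_t2 f \<in> diag_power 1"
  shows "f = 0"
proof -
  obtain n g where g: "fls_X ^ n * f = fps_to_fls g" using ex_fls_X_power_mult by blast
  obtain H m where H: "laurent_t2 f / (t1 - t2) powi 1 = emb2 H / (t1 * t2) ^ m"
    using assms by (auto simp: diag_power_iff K2_def)
  have "laurent_t2 f = (t1 - t2) * (emb2 H / (t1 * t2) ^ m)"
    unfolding H[symmetric] by simp
  then have "emb2 (fps_const g) * (t1 * t2) ^ m = (t1 - t2) * emb2 H * t2 ^ n"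
    unfolding laurent_t2_eq[OF g] by (simp add: frac_eq_eq)
  then have "emb2 (fps_const g * (fps_X * fps_const fps_X) ^ m) = emb2 (tau * H * fps_const fps_X ^ n)"
    by (simp add: emb2_mult emb2_power emb2_tau t1_def t2_def del: fps_const_power)
  then have "fps_const g * (fps_X * fps_const fps_X) ^ m = tau * (H * fps_const fps_X ^ n)"
    by (simp add: mult_ac)
  then have "diag (fps_const g * (fps_X * fps_const fps_X) ^ m) = 0"
    by (metis diag_tau_mult)
  then have "g = 0" by (simp add: diag_mult diag_power_fps)
  then show "f = 0" using g by simp
qed

text \<open>On the diagonal the denominator \<open>(t1 * t2) ^ n\<close> becomes t^(2n), which gives
  the candidate f; the numerator of the difference vanishes on the diagonal and is therefore
  divisible by \<open>tau\<close>.\<close>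

lemma K2_congruent_laurent:
  assumes "x \<in> K2"
  shows "\<exists>f. x - laurent_t2 f \<in> diag_power 1"
proof -
  obtain F n where x: "x = emb2 F / (t1 * t2) ^ n" using assms by (auto simp: K2_def)
  define f where "f = fps_to_fls (diag F) / fls_X ^ (2 * n)"
  have "fls_X ^ (2 * n) * f = fps_to_fls (diag F)"
    unfolding f_def by (simp only: times_divide_eq_right nonzero_mult_div_cancel_left[OF fls_X_pow_nonzero])
  then have l: "laurent_t2 f = emb2 (fps_const (diag F)) / t2 ^ (2 * n)"
    by (rule laurent_t2_eq)
  have "diag (F * fps_const fps_X ^ n - fps_const (diag F) * fps_X ^ n) = 0"
    by (simp add: diag_diff diag_mult diag_power_fps)
  then obtain Q where Q: "F * fps_const fps_X ^ n - fps_const (diag F) * fps_X ^ n = tau * Q"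
    by (rule diag_eq_0E)
  have "x - laurent_t2 f = (emb2 F * t2 ^ n - emb2 (fps_const (diag F)) * t1 ^ n) / (t1 ^ n * t2 ^ n * t2 ^ n)"
    unfolding x l mult_2 power_add by (simp add: field_simps power_mult_distrib)
  also have "emb2 F * t2 ^ n - emb2 (fps_const (diag F)) * t1 ^ n = emb2 (tau * Q)"
    unfolding Q[symmetric] by (simp add: emb2_diff emb2_mult emb2_power t1_def t2_def del: fps_const_power)
  also have "emb2 (tau * Q) / (t1 ^ n * t2 ^ n * t2 ^ n) = (inverse t1 ^ n * inverse t2 ^ n * inverse t2 ^ n) * emb2 (tau * Q)"
    by (simp add: field_simps)
  also have "\<dots> \<in> diag_power 1"
    by (intro K2_mult_diag_power K2_mult K2_power emb2_diag_power_1) simp_all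
  finally show ?thesis by blast
qed

text \<open>Restriction to the diagonal as an isomorphism of \<open>K2\<close> modulo the ideal of
  the diagonal with k((t)). Existence is \<open>K2_congruent_laurent\<close>, uniqueness is
  \<open>laurent_t2_diag_power_1\<close>.\<close>

definition diag_fls :: "'k::field frac2 \<Rightarrow> 'k fls" where
  "diag_fls x = (THE f. x - laurent_t2 f \<in> diag_power 1)"

lemma diag_fls_eqI: "x - laurent_t2 f \<in> diag_power 1 \<Longrightarrow> diag_fls x = f"
  unfolding diag_fls_def
proof (rule the_equality)
  fix f' assume "x - laurent_t2 f \<in> diag_power 1" "x - laurent_t2 f' \<in> diag_power 1"
  from diag_power_diff[OF this] have "laurent_t2 (f' - f) \<in> diag_power 1" by (simp add: laurent_t2_diff)
  from laurent_t2_diag_power_1[OF this] show "f' = f" by simp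
qed

lemma diag_fls_mem: "x \<in> K2 \<Longrightarrow> x - laurent_t2 (diag_fls x) \<in> diag_power 1"
  using K2_congruent_laurent[of x] diag_fls_eqI by blast

lemma diag_fls_laurent [simp]: "diag_fls (laurent_t2 f) = f"
  by (rule diag_fls_eqI) simp

lemma diag_fls_eq_0_iff: "x \<in> K2 \<Longrightarrow> diag_fls x = 0 \<longleftrightarrow> x \<in> diag_power 1"
  using diag_fls_mem[of x] diag_fls_eqI[of x 0] by auto

lemma diag_fls_add: "x \<in> K2 \<Longrightarrow> y \<in> K2 \<Longrightarrow> diag_fls (x + y) = diag_fls x + diag_fls y"
  using diag_power_add[OF diag_fls_mem[of x] diag_fls_mem[of y]]
  by (intro diag_fls_eqI) (simp add: laurent_t2_add algebra_simps)

lemma diag_fls_diff: "x \<in> K2 \<Longrightarrow> y \<in> K2 \<Longrightarrow> diag_fls (x - y) = diag_fls x - diag_fls y"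
  using diag_power_diff[OF diag_fls_mem[of x] diag_fls_mem[of y]]
  by (intro diag_fls_eqI) (simp add: laurent_t2_diff algebra_simps)

lemma diag_fls_mult: "x \<in> K2 \<Longrightarrow> y \<in> K2 \<Longrightarrow> diag_fls (x * y) = diag_fls x * diag_fls y"
proof -
  assume x: "x \<in> K2" and y: "y \<in> K2"
  have "x * (y - laurent_t2 (diag_fls y)) + laurent_t2 (diag_fls y) * (x - laurent_t2 (diag_fls x)) \<in> diag_power 1"
    by (intro diag_power_add K2_mult_diag_power diag_fls_mem x y) simp
  then show ?thesis
    by (intro diag_fls_eqI) (simp add: laurent_t2_mult algebra_simps)
qed

lemma diag_fls_emb2: "diag_fls (emb2 F) = fps_to_fls (diag F)"
proof (rule diag_fls_eqI)
  obtain Q where "F = fps_const (diag F) + tau * Q" using diag_decomp by blast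
  then have "emb2 F - laurent_t2 (fps_to_fls (diag F)) = emb2 (tau * Q)"
    by (metis add_diff_cancel_left' emb2_diff laurent_t2_fps)
  then show "emb2 F - laurent_t2 (fps_to_fls (diag F)) \<in> diag_power 1"
    by (simp add: emb2_diag_power_1)
qed

lemma diag_fls_scalar2 [simp]: "diag_fls (scalar2 c) = fls_const c"
  using diag_fls_emb2[of "fps_const (fps_const c)"] by (simp add: scalar2_def)

lemma scalar2_K2 [simp]: "scalar2 c \<in> K2" by (simp add: scalar2_def)

lemma scalar2_simps:
  "scalar2 (a + b) = scalar2 a + scalar2 b" "scalar2 (a * b) = scalar2 a * scalar2 b"
  "scalar2 (a - b) = scalar2 a - scalar2 b" "scalar2 0 = 0" "scalar2 1 = 1"
  by (simp_all add: scalar2_def flip: emb2_add emb2_mult emb2_diff)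

subsection \<open>Extension of ring homomorphisms to the fraction field\<close>

definition inj_hom :: "('a::idom \<Rightarrow> 'a) \<Rightarrow> bool" where
  "inj_hom h \<longleftrightarrow> (\<forall>x y. h (x + y) = h x + h y) \<and> (\<forall>x y. h (x * y) = h x * h y) \<and> h 1 = 1 \<and>
     (\<forall>x. h x = 0 \<longrightarrow> x = 0)"

text \<open>Two fractions are equal when cross products agree, a condition preserved by h;
  injectivity keeps the denominators nonzero. This makes the definite description
  single-valued.\<close>

lemma extend_fract_Fract:
  assumes h: "inj_hom h" and b: "b \<noteq> 0"
  shows "extend_fract h (Fraction_Field.Fract a b) = Fraction_Field.Fract (h a) (h b)"
proof -
  have h0: "h x \<noteq> 0" if "x \<noteq> 0" for x using h that by (auto simp: inj_hom_def)
  show ?thesis unfolding extend_fract_def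
  proof (rule the_equality)
    show "\<exists>a' b'. b' \<noteq> 0 \<and> Fraction_Field.Fract a b = Fraction_Field.Fract a' b' \<and>
        Fraction_Field.Fract (h a) (h b) = Fraction_Field.Fract (h a') (h b')"
      using b by blast
    fix y assume "\<exists>a' b'. b' \<noteq> 0 \<and> Fraction_Field.Fract a b = Fraction_Field.Fract a' b' \<and>
        y = Fraction_Field.Fract (h a') (h b')"
    then obtain a' b' where b': "b' \<noteq> 0" and eq: "Fraction_Field.Fract a b = Fraction_Field.Fract a' b'"
      and y: "y = Fraction_Field.Fract (h a') (h b')" by blast
    from eq b b' have "a * b' = a' * b" by (simp add: eq_fract)
    then have "h a * h b' = h a' * h b" using h by (metis inj_hom_def)
    then show "y = Fraction_Field.Fract (h a) (h b)" using b b' h0 by (simp add: y eq_fract)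
  qed
qed

lemma extend_fract_hom:
  assumes h: "inj_hom h"
  shows "extend_fract h (x + y) = extend_fract h x + extend_fract h y"
    and "extend_fract h (x * y) = extend_fract h x * extend_fract h y"
    and "extend_fract h 1 = 1" and "extend_fract h 0 = 0"
    and "extend_fract h (inverse x) = inverse (extend_fract h x)"
proof -
  have h0: "h x = 0 \<longleftrightarrow> x = 0" for x
    using h unfolding inj_hom_def by (metis add_cancel_right_right)
  note hh = h[unfolded inj_hom_def]
  note [simp] = extend_fract_Fract[OF h]
  show "extend_fract h (x + y) = extend_fract h x + extend_fract h y"
    by (cases x; cases y) (simp add: h0 hh)
  show "extend_fract h (x * y) = extend_fract h x * extend_fract h y"
    by (cases x; cases y) (simp add: h0 hh)
  show "extend_fract h 1 = 1" unfolding One_fract_def using hh by simp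
  have "extend_fract h (Fraction_Field.Fract 0 1) = Fraction_Field.Fract (h 0) (h 1)" by simp
  then show e0: "extend_fract h 0 = 0" using h0[of 0] by (simp add: fract_collapse)
  show "extend_fract h (inverse x) = inverse (extend_fract h x)"
    by (cases x rule: Fract_cases_nonzero) (simp_all add: e0)
qed

lemma extend_fract_emb2: "inj_hom h \<Longrightarrow> extend_fract h (emb2 F) = emb2 (h F)"
  by (simp add: emb2_def extend_fract_Fract) (simp add: inj_hom_def)

lemma extend_fract_more:
  assumes h: "inj_hom h"
  shows "extend_fract h (- x) = - extend_fract h x"
    and "extend_fract h (x - y) = extend_fract h x - extend_fract h y"
    and "extend_fract h (x / y) = extend_fract h x / extend_fract h y"
    and "extend_fract h (x ^ n) = extend_fract h x ^ n"
    and "extend_fract h (x powi m) = extend_fract h x powi m"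
proof -
  note hom = extend_fract_hom[OF h]
  show m: "extend_fract h (- x) = - extend_fract h x" for x
    using hom(1)[of x "- x"] hom(4) by (simp add: eq_neg_iff_add_eq_0 add.commute)
  show "extend_fract h (x - y) = extend_fract h x - extend_fract h y"
    using hom(1)[of x "- y"] m by simp
  show "extend_fract h (x / y) = extend_fract h x / extend_fract h y"
    by (simp add: divide_inverse hom)
  show p: "extend_fract h (x ^ n) = extend_fract h x ^ n" for x n
    by (induction n) (simp_all add: hom)
  show "extend_fract h (x powi m) = extend_fract h x powi m"
    by (simp add: power_int_def p hom)
qed

subsection \<open>Exchanging the variables\<close>

lemma inj_hom_swap: "inj_hom (\<lambda>F :: 'k::field fps fps. Abs_fps (\<lambda>i. Abs_fps (\<lambda>j. F $ j $ i)))"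
proof -
  let ?s = "\<lambda>F :: 'k fps fps. Abs_fps (\<lambda>i. Abs_fps (\<lambda>j. F $ j $ i))"
  have nth2: "(F * G) $ i $ j = (\<Sum>a\<le>i. \<Sum>b\<le>j. F $ a $ b * G $ (i - a) $ (j - b))" for F G :: "'k fps fps" and i j
    by (simp add: fps_mult_nth atMost_atLeast0 fps_sum_nth)
  have "?s (F * G) = ?s F * ?s G" for F G
    by (intro fps_ext, simp only: fps_nth_Abs_fps nth2) (rule sum.swap)
  moreover have "?s (F + G) = ?s F + ?s G" for F G by (simp add: fps_eq_iff)
  moreover have "?s 1 = 1" by (simp add: fps_eq_iff)
  moreover have "F = 0" if "?s F = 0" for F using that by (simp add: fps_eq_iff)
  ultimately show ?thesis unfolding inj_hom_def by blast
qed

lemmas swap2_hom = extend_fract_hom[OF inj_hom_swap, folded swap2_def]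
  extend_fract_more[OF inj_hom_swap, folded swap2_def]

lemma swap2_emb2: "swap2 (emb2 F) = emb2 (Abs_fps (\<lambda>i. Abs_fps (\<lambda>j. F $ j $ i)))"
  unfolding swap2_def by (rule extend_fract_emb2[OF inj_hom_swap])

lemma swap2_t [simp]: "swap2 t1 = t2" "swap2 t2 = t1"
  unfolding t1_def t2_def swap2_emb2 by (auto simp: fps_eq_iff)

lemma swap2_K2: "x \<in> K2 \<Longrightarrow> swap2 x \<in> K2"
proof -
  assume "x \<in> K2"
  then obtain F n where "x = emb2 F / (t1 * t2) ^ n" by (auto simp: K2_def)
  then have "swap2 x = emb2 (Abs_fps (\<lambda>i. Abs_fps (\<lambda>j. F $ j $ i))) / (t1 * t2) ^ n"
    by (simp add: swap2_hom swap2_emb2 mult_ac)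
  then show ?thesis using K2_I by metis
qed

text \<open>Multiplying by a power of \<open>t1 * t2\<close>, which is symmetric, reduces the claim
  to power series, where it is the symmetry of the sum over monomials of fixed total degree.\<close>

lemma diag_fls_swap2:
  fixes x :: "'k::field frac2"
  assumes "x \<in> K2" shows "diag_fls (swap2 x) = diag_fls x"
proof -
  obtain F n where x: "x = emb2 F / (t1 * t2) ^ n" using assms by (auto simp: K2_def)
  have "diag_fls (swap2 x) * diag_fls ((t1 * t2) ^ n) = diag_fls (swap2 x * (t1 * t2) ^ n)"
    by (simp add: diag_fls_mult swap2_K2 assms K2_power K2_mult)
  also have "swap2 x * (t1 * t2) ^ n = emb2 (Abs_fps (\<lambda>i. Abs_fps (\<lambda>j. F $ j $ i)))"
    by (simp add: x swap2_hom swap2_emb2 mult_ac)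
  also have "diag_fls \<dots> = diag_fls (emb2 F)" by (simp add: diag_fls_emb2 diag_swap)
  also have "emb2 F = x * (t1 * t2) ^ n" by (simp add: x)
  also have "diag_fls \<dots> = diag_fls x * diag_fls ((t1 * t2) ^ n)"
    by (simp add: diag_fls_mult assms K2_power K2_mult)
  finally have "diag_fls (swap2 x) * diag_fls ((t1 * t2) ^ n) = diag_fls x * diag_fls ((t1 * t2) ^ n)" .
  moreover have "diag_fls ((t1 * t2 :: 'k frac2) ^ n) \<noteq> 0"
  proof -
    have "(t1 * t2 :: 'k frac2) ^ n = emb2 ((fps_X * fps_const fps_X) ^ n)" by (simp add: t1_def t2_def emb2_mult emb2_power)
    show ?thesis unfolding \<open>(t1 * t2) ^ n = _\<close> diag_fls_emb2 diag_power_fps diag_mult by simp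
  qed
  ultimately show ?thesis by simp
qed

text \<open>Exchanging the variables is trivial modulo the ideal of the diagonal. Invariance is
  therefore automatic for the regular part of a form and restricts only its polar terms.\<close>

lemma swap2_diff_diag_power:
  assumes "x \<in> K2" shows "swap2 x - x \<in> diag_power 1"
  using diag_fls_eq_0_iff[of "swap2 x - x"] assms by (simp add: diag_fls_diff diag_fls_swap2 swap2_K2 K2_diff)

lemma swap2_scalar2 [simp]: "swap2 (scalar2 c) = scalar2 c"
  unfolding scalar2_def swap2_emb2 by (auto simp: fps_eq_iff)

subsection \<open>The space of quadratic differentials with constant biresidue\<close>

text \<open>Normal form of the representatives. Every class contains exactly one such element
  (\<open>hat_omegaE\<close>, \<open>qclass_hrep_inj\<close>), so the pair (c, f) is a coordinate
  system on the space.\<close>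

definition hrep :: "'k::field \<Rightarrow> 'k fls \<Rightarrow> 'k frac2" where
  "hrep c f = scalar2 c / (t1 - t2)\<^sup>2 + laurent_t2 f"

lemma diag_power_m1_iff: "x / (t1 - t2)\<^sup>2 \<in> diag_power (- 1) \<longleftrightarrow> x \<in> diag_power 1"
  by (simp add: diag_power_iff power2_eq_square power_int_minus divide_inverse mult.assoc)

lemma biresidue_eq:
  assumes "x \<in> K2" shows "biresidue (x / (t1 - t2)\<^sup>2) = diag_fls x"
  unfolding biresidue_def diag_fls_def diff_divide_distrib[symmetric] diag_power_m1_iff ..

lemma diag_power_m2E:
  assumes "F \<in> diag_power (- 2)"
  obtains x where "x \<in> K2" "F = x / (t1 - t2)\<^sup>2"
  using assms by (auto simp: diag_power_def power_int_minus divide_inverse mult.commute)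

lemma diag_power_m2I: "x \<in> K2 \<Longrightarrow> x / (t1 - t2)\<^sup>2 \<in> diag_power (- 2)"
  by (auto simp: diag_power_iff power_int_minus)

lemma hrep_close:
  fixes F :: "'k::field frac2"
  assumes "F - hrep c f \<in> diag_power 1"
  shows "F \<in> hat_omega_reps" "biresidue F = fls_const c"
proof -
  define y where "y = F - hrep c f"
  have y: "y \<in> diag_power 1" using assms by (simp add: y_def)
  have yK: "y \<in> K2" using diag_power_mono[of 0 1 y] y by (simp add: diag_power_K2)
  define x where "x = scalar2 c + (t1 - t2)\<^sup>2 * (laurent_t2 f + y)"
  have F: "F = x / (t1 - t2)\<^sup>2"
    by (simp add: x_def y_def hrep_def field_simps)
  have x: "x \<in> K2" unfolding x_def by (intro K2_add K2_mult K2_power yK) simp_all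
  have "diag_fls (t1 - t2 :: 'k frac2) = 0"
    using diag_power_tau[of 1] by (simp add: diag_fls_eq_0_iff)
  then have "diag_fls x = fls_const c"
    unfolding x_def power2_eq_square by (simp add: diag_fls_add diag_fls_mult K2_add K2_mult yK)
  then show b: "biresidue F = fls_const c" by (simp add: F biresidue_eq x)
  have "swap2 F - F = (swap2 (laurent_t2 f) - laurent_t2 f) + (swap2 y - y)"
  proof -
    have "F = scalar2 c / (t1 - t2)\<^sup>2 + laurent_t2 f + y" by (simp add: y_def hrep_def)
    then show ?thesis by (simp add: swap2_hom power2_commute)
  qed
  also have "\<dots> \<in> diag_power 1"
    by (intro diag_power_add swap2_diff_diag_power) (simp_all add: yK)
  finally show "F \<in> hat_omega_reps"
    unfolding hat_omega_reps_def using b diag_power_m2I[OF x] by (auto simp: F)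
qed

lemma laurent_tail:
  fixes d :: "'a::field"
  shows "d \<noteq> 0 \<Longrightarrow> (c + d * (l + d * z)) / d\<^sup>2 = c / d\<^sup>2 + l / d + z"
  by (simp add: field_simps power2_eq_square)

text \<open>Expand F along the diagonal as c/d^2 + l/d + z with d = t1 - t2. The exchange changes
  the sign of d, so invariance forces the sum of l and its exchange to vanish on the diagonal, i.e.
  twice the restriction of l is 0. In characteristic 0 the simple pole disappears.\<close>

lemma hat_omega_repsE:
  fixes F :: "'k::field_char_0 frac2"
  assumes "F \<in> hat_omega_reps"
  obtains c f where "F - hrep c f \<in> diag_power 1"
proof -
  obtain x where x: "x \<in> K2" and F: "F = x / (t1 - t2)\<^sup>2"
    using assms by (auto simp: hat_omega_reps_def elim: diag_power_m2E)
  obtain c where "diag_fls x = fls_const c"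
    using assms by (auto simp: hat_omega_reps_def F biresidue_eq x)
  then have "x - scalar2 c \<in> diag_power 1"
    using diag_fls_mem[OF x] by (simp add: laurent_t2_const)
  then obtain y where y: "y \<in> K2" and "x - scalar2 c = (t1 - t2) * y"
    by (auto simp: diag_power_def)
  then have xy: "x = scalar2 c + (t1 - t2) * y" by (simp add: algebra_simps)
  obtain z where z: "z \<in> K2" and "y - laurent_t2 (diag_fls y) = (t1 - t2) * z"
    using diag_fls_mem[OF y] by (auto simp: diag_power_def)
  then have yz: "y = laurent_t2 (diag_fls y) + (t1 - t2) * z" by (simp add: algebra_simps)
  define l where "l = laurent_t2 (diag_fls y)"
  have lK: "l \<in> K2" by (simp add: l_def)
  have Fl: "F = scalar2 c / (t1 - t2)\<^sup>2 + l / (t1 - t2) + z"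
    unfolding F xy yz[folded l_def] by (rule laurent_tail[OF t1_t2_nz])
  have "swap2 F - F = (swap2 z - z) - (swap2 l + l) / (t1 - t2)"
  proof -
    have "swap2 F = scalar2 c / (t1 - t2)\<^sup>2 - swap2 l / (t1 - t2) + swap2 z"
      unfolding Fl by (simp add: swap2_hom power2_commute minus_divide_right[symmetric])
        (metis minus_diff_eq minus_divide_right)
    then show ?thesis by (simp add: Fl add_divide_distrib)
  qed
  then have "(swap2 l + l) / (t1 - t2) = (swap2 z - z) - (swap2 F - F)" by simp
  also have "\<dots> \<in> diag_power 1"
    using assms by (intro diag_power_diff[OF swap2_diff_diag_power[OF z]]) (simp add: hat_omega_reps_def)
  finally have "(t1 - t2) * ((swap2 l + l) / (t1 - t2)) \<in> diag_power 1"
    by (rule K2_mult_diag_power[rotated]) simp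
  then have "diag_fls (swap2 l + l) = 0" by (simp add: diag_fls_eq_0_iff K2_add swap2_K2 lK)
  then have "2 * diag_fls l = 0" by (simp add: diag_fls_add swap2_K2 lK diag_fls_swap2)
  then have "diag_fls l = 0" by (simp add: fls_eq_iff)
  then have "l = 0" by (simp add: l_def)
  then have "F - hrep c (diag_fls z) = z - laurent_t2 (diag_fls z)" by (simp add: Fl hrep_def)
  then show ?thesis using diag_fls_mem[OF z] that by metis
qed

lemma hrep_diff: "hrep c f - hrep c' f' = hrep (c - c') (f - f')"
  by (simp add: hrep_def scalar2_simps laurent_t2_diff diff_divide_distrib)

lemma hrep_add: "hrep c f + hrep c' f' = hrep (c + c') (f + f')"
  by (simp add: hrep_def scalar2_simps laurent_t2_add add_divide_distrib)

lemma hrep_scale: "scalar2 a * hrep c f = hrep (a * c) (fls_const a * f)"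
  by (simp add: hrep_def scalar2_simps laurent_t2_mult laurent_t2_const algebra_simps)

lemma hrep_0 [simp]: "hrep 0 0 = 0"
  by (simp add: hrep_def scalar2_simps)

lemma hrep_diag_power_1:
  fixes f :: "'k::field fls"
  assumes a: "hrep c f \<in> diag_power 1"
  shows "c = 0 \<and> f = 0"
proof -
  have "biresidue (0 :: 'k frac2) = fls_const c"
    using hrep_close(2)[of 0 c f] diag_power_minus[OF a] by simp
  moreover have "biresidue (0 :: 'k frac2) = fls_const 0"
    using hrep_close(2)[of 0 0 0] by simp
  ultimately have "c = 0" by simp
  then show ?thesis using a laurent_t2_diag_power_1[of f] by (simp add: hrep_def scalar2_simps)
qed

lemma qclass_eq_iff: "qclass F = qclass G \<longleftrightarrow> F - G \<in> diag_power 1"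
proof
  assume "qclass F = qclass G"
  moreover have "F \<in> qclass F" by (simp add: qclass_def)
  ultimately show "F - G \<in> diag_power 1" by (simp add: qclass_def)
next
  assume a: "F - G \<in> diag_power 1"
  show "qclass F = qclass G"
    unfolding qclass_def using diag_power_add[OF _ a] diag_power_diff[OF _ a] by fastforce
qed

lemma qclass_hrep_inj: "qclass (hrep c f) = qclass (hrep c' f') \<longleftrightarrow> c = c' \<and> f = f'"
  using hrep_diag_power_1[of "c - c'" "f - f'"] by (auto simp: qclass_eq_iff hrep_diff)

lemma hrep_reps [simp]: "hrep c f \<in> hat_omega_reps"
  by (rule hrep_close(1)[of _ c f]) simp

lemma qclass_hrep_mem [simp]: "qclass (hrep c f) \<in> hat_omega"
  by (simp add: hat_omega_def)

lemma hat_omegaE: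
  fixes \<omega> :: "'k::field_char_0 frac2 set"
  assumes "\<omega> \<in> hat_omega"
  obtains c f where "\<omega> = qclass (hrep c f)"
  using assms by (auto simp: hat_omega_def qclass_eq_iff elim!: hat_omega_repsE intro: that)

lemma quad_diff_eq: "quad_diff f = qclass (hrep 0 f)"
  by (simp add: quad_diff_def hrep_def scalar2_simps)

lemma hat_biresidue_hrep [simp]: "hat_biresidue (qclass (hrep c f)) = c"
proof -
  have "biresidue F = fls_const c" if "F \<in> qclass (hrep c f)" for F
    using that hrep_close(2) by (auto simp: qclass_def)
  moreover have "hrep c f \<in> qclass (hrep c f)" by (simp add: qclass_def)
  ultimately have "(THE c'. \<exists>F\<in>qclass (hrep c f). biresidue F = fls_const c') = c"
    by (intro the_equality) (blast, metis fls_const_nth)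
  then show ?thesis by (simp add: hat_biresidue_def)
qed

lemma quad_diff_exact:
  shows "inj (quad_diff :: 'k::field_char_0 fls \<Rightarrow> _)"
    and "range (quad_diff :: 'k::field_char_0 fls \<Rightarrow> _) = {\<omega> \<in> hat_omega. hat_biresidue \<omega> = 0}"
    and "hat_biresidue ` (hat_omega :: 'k::field_char_0 frac2 set set) = UNIV"
proof -
  show "inj (quad_diff :: 'k fls \<Rightarrow> _)" by (auto simp: inj_on_def quad_diff_eq qclass_hrep_inj)
  show "range (quad_diff :: 'k fls \<Rightarrow> _) = {\<omega> \<in> hat_omega. hat_biresidue \<omega> = 0}"
    by (auto simp: quad_diff_eq elim!: hat_omegaE)
  show "hat_biresidue ` (hat_omega :: 'k frac2 set set) = UNIV"
    using hat_biresidue_hrep[of _ "0 :: 'k fls"] qclass_hrep_mem[of _ "0 :: 'k fls"] by (metis UNIV_eq_I rev_image_eqI)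
qed

subsection \<open>The continuous dual\<close>

text \<open>The form with value z on the double pole and Res(g f) on f dt^2. It is defined through
  the normal form of a class, with the value 0 outside the space that \<open>hat_theta\<close>
  prescribes.\<close>

definition hat_form :: "'k::field \<Rightarrow> 'k fls \<Rightarrow> 'k frac2 set \<Rightarrow> 'k" where
  "hat_form z g \<omega> = (if \<omega> \<in> hat_omega then
     (THE y. \<exists>c f. \<omega> = qclass (hrep c f) \<and> y = c * z + fls_residue (g * f)) else 0)"

lemma hat_form_hrep [simp]: "hat_form z g (qclass (hrep c f)) = c * z + fls_residue (g * f)"
  unfolding hat_form_def by (simp add: qclass_hrep_inj)

lemma hat_form_outside: "\<omega> \<notin> hat_omega \<Longrightarrow> hat_form z g \<omega> = 0"
  by (simp add: hat_form_def)

lemma fls_eqI_residue: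
  fixes g g' :: "'k::field fls"
  assumes "\<And>f. fls_residue (g * f) = fls_residue (g' * f)"
  shows "g = g'"
proof (rule fls_eqI)
  fix n
  have "fls_residue (h * fls_X_intpow (- 1 - n)) = fls_nth h n" for h :: "'k fls"
    by (simp add: fls_shifted_times_simps)
  then show "fls_nth g n = fls_nth g' n" using assms by metis
qed

lemma hat_form_inj: 
  fixes g :: "'k::field_char_0 fls"
  assumes "hat_form z g = hat_form z' g'" shows "z = z' \<and> g = g'"
proof -
  have *: "c * z + fls_residue (g * f) = c * z' + fls_residue (g' * f)" for c f
    using fun_cong[OF assms, of "qclass (hrep c f)"] by simp
  show ?thesis using *[of 1 0] *[of 0] by (auto intro: fls_eqI_residue)
qed

lemma qclass_cong: "F - hrep c f \<in> diag_power 1 \<Longrightarrow> qclass F = qclass (hrep c f)"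
  by (simp add: qclass_eq_iff)

lemma hat_form_hat_theta:
  fixes z :: "'k::field_char_0"
  shows "hat_form z g \<in> hat_theta"
  unfolding hat_theta_def
proof (intro CollectI conjI ballI allI impI)
  fix F G :: "'k frac2" assume "F \<in> hat_omega_reps" "G \<in> hat_omega_reps"
  then obtain c f c' f' where F: "F - hrep c f \<in> diag_power 1" and G: "G - hrep c' f' \<in> diag_power 1"
    by (metis hat_omega_repsE)
  have "F + G - hrep (c + c') (f + f') \<in> diag_power 1"
    using diag_power_add[OF F G] by (simp add: algebra_simps flip: hrep_add)
  from qclass_cong[OF this] qclass_cong[OF F] qclass_cong[OF G]
  show "hat_form z g (qclass (F + G)) = hat_form z g (qclass F) + hat_form z g (qclass G)"
    by (simp add: algebra_simps)
next
  fix F :: "'k frac2" and a assume "F \<in> hat_omega_reps"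
  then obtain c f where F: "F - hrep c f \<in> diag_power 1" by (metis hat_omega_repsE)
  have "scalar2 a * (F - hrep c f) \<in> diag_power 1" by (rule K2_mult_diag_power[OF _ F]) simp
  then have "scalar2 a * F - hrep (a * c) (fls_const a * f) \<in> diag_power 1"
    by (simp only: right_diff_distrib hrep_scale)
  from qclass_cong[OF this] qclass_cong[OF F]
  have "hat_form z g (qclass (scalar2 a * F)) = a * c * z + fls_nth (fls_const a * (g * f)) (-1)"
    and "hat_form z g (qclass F) = c * z + fls_nth (g * f) (-1)"
    by (simp_all add: mult_ac)
  then show "hat_form z g (qclass (scalar2 a * F)) = a * hat_form z g (qclass F)"
    by (simp add: ring_distribs mult.assoc)
next
  obtain a where a: "\<And>n. n < a \<Longrightarrow> fls_nth g n = 0" using fls_nth_vanishes_belowE by metis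
  have "fls_nth (g * f) (-1) = 0" if "\<forall>n<(- a). fls_nth f n = 0" for f
  proof (cases "f = 0 \<or> g = 0")
    case False
    then have "a \<le> fls_subdegree g" "- a \<le> fls_subdegree f" using a that by (auto intro!: fls_subdegree_geI)
    then show ?thesis by (intro fls_times_nth_eq0) simp
  qed auto
  then show "\<exists>N::int. \<forall>f. (\<forall>n<N. fls_nth f n = 0) \<longrightarrow> hat_form z g (quad_diff f) = 0"
    by (intro exI[of _ "- a"]) (simp add: quad_diff_eq)
qed (simp add: hat_form_outside)

text \<open>The continuous dual of k((t)) is k((t)) under the residue pairing. Continuity plays two
  roles: it makes the candidate g a Laurent series, and it kills the part of f from the exponent N
  on.\<close>

lemma continuous_functional:
  fixes l :: "'k::field fls \<Rightarrow> 'k"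
  assumes add: "\<And>f f'. l (f + f') = l f + l f'" and scale: "\<And>c f. l (fls_const c * f) = c * l f"
    and cont: "\<And>f. (\<forall>n<N. fls_nth f n = 0) \<Longrightarrow> l f = 0"
  shows "\<exists>g. \<forall>f. l f = fls_residue (g * f)"
proof (intro exI allI)
  fix f :: "'k fls"
  \<comment> \<open>Pairing g with the monomial of exponent -1-m must give the coefficient m of
    g.\<close>
  define g where "g = Abs_fls (\<lambda>m. l (fls_X_intpow (- 1 - m)))"
  have g: "fls_nth g m = l (fls_X_intpow (- 1 - m))" for m
    unfolding g_def
  proof (rule nth_Abs_fls_lower_bound[of "- N"], intro allI impI)
    fix m assume "m < - N"
    then show "l (fls_X_intpow (- 1 - m)) = 0" by (intro cont) auto
  qed
  have gN: "fls_nth g m = 0" if "m < - N" for m unfolding g using that by (intro cont) auto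
  define a where "a = min N (fls_subdegree f)"
  define p where "p = (\<Sum>n\<in>{a..<N}. fls_const (fls_nth f n) * fls_X_intpow n)"
  have sum: "l (sum h A) = (\<Sum>i\<in>A. l (h i))" for h and A :: "int set"
    using scale[of 0 0] by (induction A rule: infinite_finite_induct) (auto simp: add)
  have r: "fls_nth (f - p) n = 0" if "n < N" for n
  proof -
    have "fls_nth p n = (\<Sum>k\<in>{a..<N}. if k = n then fls_nth f n else 0)"
      unfolding p_def fls_nth_sum by (intro sum.cong) auto
    then show ?thesis using that by (auto simp: a_def)
  qed
  have "l f = l p + l (f - p)" using add[of p "f - p"] by simp
  also have "l (f - p) = 0" using r by (intro cont) simp
  also have "l p = (\<Sum>n\<in>{a..<N}. fls_nth f n * fls_nth g (- 1 - n))"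
    unfolding p_def sum scale g by simp
  also have "\<dots> = fls_residue (g * p)"
    unfolding p_def sum_distrib_left fls_residue_def fls_nth_sum
    by (intro sum.cong) (auto simp: mult.left_commute[of g] fls_shifted_times_simps)
  also have "\<dots> = fls_residue (g * p) + fls_residue (g * (f - p))"
  proof -
    have "fls_nth (g * (f - p)) (-1) = 0"
    proof (cases "f - p = 0 \<or> g = 0")
      case False
      then have "- N \<le> fls_subdegree g" "N \<le> fls_subdegree (f - p)" using r gN by (auto intro!: fls_subdegree_geI)
      then show ?thesis by (intro fls_times_nth_eq0) simp
    qed auto
    then show ?thesis by simp
  qed
  also have "\<dots> = fls_residue (g * f)" by (simp add: algebra_simps)
  finally show "l f = fls_residue (g * f)" by simp
qed

lemma hat_theta_hat_form:
  fixes \<zeta> :: "'k::field_char_0 frac2 set \<Rightarrow> 'k"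
  assumes "\<zeta> \<in> hat_theta"
  obtains z g where "\<zeta> = hat_form z g"
proof -
  have out: "\<And>\<omega>. \<omega> \<notin> hat_omega \<Longrightarrow> \<zeta> \<omega> = 0"
    and add: "\<And>F G. F \<in> hat_omega_reps \<Longrightarrow> G \<in> hat_omega_reps \<Longrightarrow> \<zeta> (qclass (F + G)) = \<zeta> (qclass F) + \<zeta> (qclass G)"
    and scale: "\<And>F c. F \<in> hat_omega_reps \<Longrightarrow> \<zeta> (qclass (scalar2 c * F)) = c * \<zeta> (qclass F)"
    using assms by (auto simp: hat_theta_def)
  obtain N :: int where N: "\<And>f. (\<forall>n<N. fls_nth f n = 0) \<Longrightarrow> \<zeta> (quad_diff f) = 0"
    using assms by (auto simp: hat_theta_def)
  define l where "l f = \<zeta> (qclass (hrep 0 f))" for f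
  have "\<exists>g. \<forall>f. l f = fls_residue (g * f)"
  proof (rule continuous_functional)
    show "l (f + f') = l f + l f'" for f f' using add[of "hrep 0 f" "hrep 0 f'"] by (simp add: l_def hrep_add)
    show "l (fls_const c * f) = c * l f" for c f using scale[of "hrep 0 f" c] by (simp add: l_def hrep_scale)
    show "l f = 0" if "\<forall>n<N. fls_nth f n = 0" for f using N[OF that] by (simp add: l_def quad_diff_eq)
  qed
  then obtain g where g: "\<And>f. l f = fls_residue (g * f)" by blast
  have "\<zeta> \<omega> = hat_form (\<zeta> (qclass (hrep 1 0))) g \<omega>" for \<omega>
  proof (cases "\<omega> \<in> hat_omega")
    case True
    then obtain c f where \<omega>: "\<omega> = qclass (hrep c f)" by (rule hat_omegaE)
    have "\<zeta> \<omega> = \<zeta> (qclass (scalar2 c * hrep 1 0 + hrep 0 f))" by (simp add: \<omega> hrep_scale hrep_add)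
    also have "\<dots> = c * \<zeta> (qclass (hrep 1 0)) + l f"
      by (subst add) (simp_all add: scale l_def hrep_scale[of c 1 0], simp add: scale flip: hrep_scale[of c 1 0, simplified])
    finally show ?thesis by (simp add: \<omega> g)
  qed (simp add: out hat_form_outside)
  then show ?thesis using that by blast
qed

lemma hat_theta_ex: "\<zeta> \<in> hat_theta \<Longrightarrow> \<exists>z g. \<zeta> = hat_form z g"
  for \<zeta> :: "'k::field_char_0 frac2 set \<Rightarrow> 'k"
  by (elim hat_theta_hat_form) blast

lemma hat_form_linear: "(\<lambda>\<omega>. a * hat_form z g \<omega> + b * hat_form z' g' \<omega>) = hat_form (a * z + b * z') (fls_const a * g + fls_const b * g')"
  for z :: "'k::field_char_0"
proof
  fix \<omega> :: "'k frac2 set"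
  show "a * hat_form z g \<omega> + b * hat_form z' g' \<omega> = hat_form (a * z + b * z') (fls_const a * g + fls_const b * g') \<omega>"
  proof (cases "\<omega> \<in> hat_omega")
    case True
    then obtain c f where \<omega>: "\<omega> = qclass (hrep c f)" by (rule hat_omegaE)
    have r: "fls_nth ((fls_const a * g + fls_const b * g') * f) (-1) = a * fls_nth (g * f) (-1) + b * fls_nth (g' * f) (-1)"
      by (simp add: ring_distribs mult.assoc)
    show ?thesis unfolding \<omega> hat_form_hrep fls_residue_def r by (simp add: algebra_simps)
  qed (simp add: hat_form_outside)
qed

lemma hat_biresidue_hat_form: "(\<lambda>\<omega>. c * hat_biresidue \<omega>) = hat_form (c :: 'k::field_char_0) 0"
proof
  fix \<omega> :: "'k frac2 set"
  show "c * hat_biresidue \<omega> = hat_form c 0 \<omega>"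
  proof (cases "\<omega> \<in> hat_omega")
    case True
    then obtain d f where \<omega>: "\<omega> = qclass (hrep d f)" by (rule hat_omegaE)
    show ?thesis by (simp add: \<omega>)
  qed (simp add: hat_form_outside hat_biresidue_def)
qed

context cdv_algebra
begin

lemma hat_theta_proj_hat_form:
  assumes t: "uniformizer \<O> t"
  shows "hat_theta_proj t (hat_form z g) = vec t g"
  unfolding hat_theta_proj_def
proof (rule the_equality)
  show "vec t g \<in> theta \<and> (\<forall>f. hat_form z g (quad_diff f) = fls_residue (expansion t (vec t g t) * f))"
    using t vec_theta[OF t] by (simp add: quad_diff_eq)
next
  fix D assume D: "D \<in> theta \<and> (\<forall>f. hat_form z g (quad_diff f) = fls_residue (expansion t (D t) * f))"
  then have "g = expansion t (D t)" by (intro fls_eqI_residue) (simp add: quad_diff_eq)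
  then show "D = vec t g" using theta_vec[OF t] D by simp
qed

lemma vec_inj:
  assumes t: "uniformizer \<O> t" and "vec t g = vec t g'"
  shows "g = g'"
  using vec_uniformizer[OF t] assms(2) by metis

lemma vec_linear:
  assumes t: "uniformizer \<O> t"
  shows "vec t (fls_const a * g + fls_const b * g') x = \<iota> a * vec t g x + \<iota> b * vec t g' x"
  using t by (simp add: algebra_simps flip: expansion_eq_iff[OF t])

lemma hat_theta_exact:
  assumes t: "uniformizer \<O> t"
  shows "\<zeta> \<in> hat_theta \<Longrightarrow> \<zeta>' \<in> hat_theta \<Longrightarrow> (\<lambda>\<omega>. a * \<zeta> \<omega> + b * \<zeta>' \<omega>) \<in> hat_theta"
    and "\<zeta> \<in> hat_theta \<Longrightarrow> \<zeta>' \<in> hat_theta \<Longrightarrow>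
      hat_theta_proj t (\<lambda>\<omega>. a * \<zeta> \<omega> + b * \<zeta>' \<omega>) = (\<lambda>x. \<iota> a * hat_theta_proj t \<zeta> x + \<iota> b * hat_theta_proj t \<zeta>' x)"
    and "inj (\<lambda>c \<omega>. c * hat_biresidue \<omega> :: 'k)"
    and "range (\<lambda>c \<omega>. c * hat_biresidue \<omega>) = {\<zeta> \<in> hat_theta. hat_theta_proj t \<zeta> = (\<lambda>_. 0)}"
    and "hat_theta_proj t ` hat_theta = theta"
proof -
  have v0: "vec t 0 = (\<lambda>_. 0)"
    by (rule ext) (use t in \<open>simp flip: expansion_eq_iff[OF t]\<close>)
  show "(\<lambda>\<omega>. a * \<zeta> \<omega> + b * \<zeta>' \<omega>) \<in> hat_theta" if z1: "\<zeta> \<in> hat_theta" and z2: "\<zeta>' \<in> hat_theta" 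
  proof -
    obtain z g where "\<zeta> = hat_form z g" using hat_theta_ex[OF z1] by blast
    moreover obtain z' g' where "\<zeta>' = hat_form z' g'" using hat_theta_ex[OF z2] by blast
    ultimately show ?thesis by (simp add: hat_form_linear hat_form_hat_theta)
  qed
  show "hat_theta_proj t (\<lambda>\<omega>. a * \<zeta> \<omega> + b * \<zeta>' \<omega>) = (\<lambda>x. \<iota> a * hat_theta_proj t \<zeta> x + \<iota> b * hat_theta_proj t \<zeta>' x)"
    if z1: "\<zeta> \<in> hat_theta" and z2: "\<zeta>' \<in> hat_theta" 
  proof -
    obtain z g where "\<zeta> = hat_form z g" using hat_theta_ex[OF z1] by blast
    moreover obtain z' g' where "\<zeta>' = hat_form z' g'" using hat_theta_ex[OF z2] by blast
    ultimately show ?thesis by (simp add: hat_form_linear hat_theta_proj_hat_form[OF t] ext[OF vec_linear[OF t]])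
  qed
  show "inj (\<lambda>c \<omega>. c * hat_biresidue \<omega> :: 'k)"
    unfolding hat_biresidue_hat_form by (rule injI) (drule hat_form_inj, simp)
  show "range (\<lambda>c \<omega>. c * hat_biresidue \<omega>) = {\<zeta> \<in> hat_theta. hat_theta_proj t \<zeta> = (\<lambda>_. 0)}"
    unfolding hat_biresidue_hat_form
  proof (intro subset_antisym subsetI)
    fix \<zeta> :: "'k frac2 set \<Rightarrow> 'k" assume "\<zeta> \<in> range (\<lambda>c. hat_form c 0)"
    then show "\<zeta> \<in> {\<zeta> \<in> hat_theta. hat_theta_proj t \<zeta> = (\<lambda>_. 0)}"
      by (auto simp: hat_form_hat_theta hat_theta_proj_hat_form[OF t] v0)
  next
    fix \<zeta> :: "'k frac2 set \<Rightarrow> 'k" assume a: "\<zeta> \<in> {\<zeta> \<in> hat_theta. hat_theta_proj t \<zeta> = (\<lambda>_. 0)}"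
    then obtain z g where \<zeta>: "\<zeta> = hat_form z g" using hat_theta_ex[of \<zeta>] by blast
    then have "vec t g = vec t 0" using a by (simp add: hat_theta_proj_hat_form[OF t] v0)
    then have "g = 0" by (rule vec_inj[OF t])
    then show "\<zeta> \<in> range (\<lambda>c. hat_form c 0)" by (simp add: \<zeta>)
  qed
  show "hat_theta_proj t ` hat_theta = theta"
  proof (intro subset_antisym subsetI)
    fix D assume "D \<in> hat_theta_proj t ` hat_theta"
    then obtain \<zeta> where "\<zeta> \<in> hat_theta" "D = hat_theta_proj t \<zeta>" by blast
    moreover from this obtain z g where "\<zeta> = hat_form z g" using hat_theta_ex[of \<zeta>] by blast
    ultimately show "D \<in> theta" by (simp add: hat_theta_proj_hat_form[OF t] vec_theta[OF t])
  next
    fix D assume "D \<in> theta"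
    then have "D = hat_theta_proj t (hat_form 0 (expansion t (D t)))"
      using theta_vec[OF t] by (simp add: hat_theta_proj_hat_form[OF t])
    then show "D \<in> hat_theta_proj t ` hat_theta" using hat_form_hat_theta by blast
  qed
qed

end

subsection \<open>Change of coordinates\<close>

text \<open>Serves for three operations on the second variable: substitution of \<phi>, the passage
  from power series to Laurent series, and the partial derivative. Only the first two are ring
  homomorphisms.\<close>

definition fps_map :: "('a::idom \<Rightarrow> 'b::idom) \<Rightarrow> 'a fps \<Rightarrow> 'b fps" where
  "fps_map h F = Abs_fps (\<lambda>i. h (F $ i))"

lemma fps_map_nth [simp]: "fps_map h F $ i = h (F $ i)"
  by (simp add: fps_map_def)

lemma fps_map_hom:
  assumes add: "\<And>x y. h (x + y) = h x + h y" and mult: "\<And>x y. h (x * y) = h x * h y"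
  shows "fps_map h (F + G) = fps_map h F + fps_map h G"
    and "fps_map h (F * G) = fps_map h F * fps_map h G"
proof -
  have h0: "h 0 = 0" using add[of 0 0] by (metis add.right_neutral add_left_cancel)
  have sum: "h (sum f A) = (\<Sum>i\<in>A. h (f i))" for f and A :: "nat set"
    by (induction A rule: infinite_finite_induct) (simp_all add: h0 add)
  show "fps_map h (F + G) = fps_map h F + fps_map h G" by (simp add: fps_eq_iff add)
  show "fps_map h (F * G) = fps_map h F * fps_map h G"
    by (simp add: fps_eq_iff fps_mult_nth sum mult)
qed

lemma subst2_eq: "subst2 \<phi> F = fps_compose (fps_map (\<lambda>f. fps_compose f \<phi>) F) (subst_t1 \<phi>)"
  by (simp add: subst2_def fps_map_def)

lemma subst_t1_nth [simp]: "subst_t1 f $ i = fps_const (f $ i)"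
  by (simp add: subst_t1_def)

context
  fixes \<phi> :: "'k::field_char_0 fps"
  assumes phi: "subdegree \<phi> = 1"
begin

lemma phi_nz: "\<phi> \<noteq> 0" using phi by (intro notI) simp

lemma phi_0: "\<phi> $ 0 = 0" using phi by (intro nth_less_subdegree_zero) simp

lemma phi_1: "\<phi> $ 1 \<noteq> 0" using phi phi_nz nth_subdegree_nonzero[of \<phi>] by simp

lemma subst_t1_phi_0: "subst_t1 \<phi> $ 0 = 0" by (simp add: phi_0)

lemma subst_t1_phi_nz: "subst_t1 \<phi> \<noteq> 0"
proof
  assume "subst_t1 \<phi> = 0"
  then have "subst_t1 \<phi> $ 1 = 0" by simp
  then show False using phi_1 by simp
qed

lemma inj_hom_subst2: "inj_hom (subst2 \<phi>)"
  unfolding inj_hom_def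
proof (intro conjI allI impI)
  have add: "fps_compose (x + y) \<phi> = fps_compose x \<phi> + fps_compose y \<phi>" for x y by (rule fps_compose_add_distrib)
  have mult: "fps_compose (x * y) \<phi> = fps_compose x \<phi> * fps_compose y \<phi>" for x y
    by (rule fps_compose_mult_distrib[OF phi_0])
  note hom = fps_map_hom[of "\<lambda>f. fps_compose f \<phi>", OF add mult]
  show "subst2 \<phi> (F + G) = subst2 \<phi> F + subst2 \<phi> G" for F G
    by (simp add: subst2_eq hom fps_compose_add_distrib)
  show "subst2 \<phi> (F * G) = subst2 \<phi> F * subst2 \<phi> G" for F G
    by (simp add: subst2_eq hom fps_compose_mult_distrib[OF subst_t1_phi_0])
  have "fps_map (\<lambda>f. fps_compose f \<phi>) 1 = 1" by (simp add: fps_eq_iff)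
  then show "subst2 \<phi> 1 = 1" by (simp add: subst2_eq)
  fix F assume "subst2 \<phi> F = 0"
  then have "fps_map (\<lambda>f. fps_compose f \<phi>) F = 0"
    using fps_compose_eq_0_iff[OF subst_t1_phi_0] subst_t1_phi_nz by (simp add: subst2_eq)
  then have "fps_compose (F $ i) \<phi> = 0" for i by (metis fps_map_nth fps_zero_nth)
  then have "F $ i = 0" for i using fps_compose_eq_0_iff[OF phi_0, of "F $ i"] phi_nz by simp
  then show "F = 0" by (intro fps_ext) simp
qed

abbreviation "ext \<equiv> extend_fract (subst2 \<phi>)"

lemmas ext_hom = extend_fract_hom[OF inj_hom_subst2] extend_fract_more[OF inj_hom_subst2]

lemma ext_emb2: "ext (emb2 F) = emb2 (subst2 \<phi> F)"
  by (rule extend_fract_emb2[OF inj_hom_subst2])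

lemma subst2_const: "subst2 \<phi> (fps_const g) = fps_const (fps_compose g \<phi>)"
proof -
  have "fps_map (\<lambda>f. fps_compose f \<phi>) (fps_const g) = fps_const (fps_compose g \<phi>)"
    by (simp add: fps_eq_iff)
  then show ?thesis by (simp add: subst2_eq)
qed

lemma subst2_X: "subst2 \<phi> fps_X = subst_t1 \<phi>"
proof -
  have "fps_map (\<lambda>f. fps_compose f \<phi>) fps_X = fps_X"
    by (rule fps_ext) simp
  then show ?thesis by (simp only: subst2_eq fps_X_fps_compose_startby0[OF subst_t1_phi_0])
qed

definition phi_t1 :: "'k frac2" where "phi_t1 = emb2 (subst_t1 \<phi>)"
definition phi_t2 :: "'k frac2" where "phi_t2 = emb2 (fps_const \<phi>)"

lemma ext_t: "ext t1 = phi_t1" "ext t2 = phi_t2"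
  by (simp_all add: t1_def t2_def ext_emb2 subst2_X subst2_const phi_0 phi_t1_def phi_t2_def)

lemma subst_t1_mult: "subst_t1 (a * b) = subst_t1 a * subst_t1 (b :: 'k fps)"
proof (rule fps_ext)
  fix n
  have sum: "fps_const (sum g A) = (\<Sum>i\<in>A. fps_const (g i))" for g :: "nat \<Rightarrow> 'k" and A
    by (induction A rule: infinite_finite_induct) (simp_all flip: fps_const_add)
  show "subst_t1 (a * b) $ n = (subst_t1 a * subst_t1 b) $ n"
    by (simp add: fps_mult_nth sum)
qed

lemma phi_unit: "\<exists>u v. \<phi> = fps_X * u \<and> u * v = 1"
proof (intro exI conjI)
  show "\<phi> = fps_X * fps_shift 1 \<phi>" by (rule fps_ext) (simp add: phi_0)
  have "fps_shift 1 \<phi> $ 0 \<noteq> 0" using phi_1 by simp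
  then show "fps_shift 1 \<phi> * inverse (fps_shift 1 \<phi>) = 1" by (simp add: inverse_mult_eq_1')
qed

text \<open>As \<phi> is the variable times a unit, the new coordinate axes are the old ones, and
  inverting the new coordinates does not lead out of \<open>K2\<close>.\<close>

lemma inverse_phi_t1_t2: "inverse (phi_t1 * phi_t2) \<in> K2"
proof -
  obtain u v where u: "\<phi> = fps_X * u" "u * v = 1" using phi_unit by blast
  have X: "subst_t1 fps_X = fps_X" by (rule fps_ext) simp
  have 1: "subst_t1 u * subst_t1 v = 1"
    unfolding subst_t1_mult[symmetric] u by (simp add: fps_eq_iff)
  have e1: "phi_t1 = emb2 fps_X * emb2 (subst_t1 u)"
    unfolding phi_t1_def by (subst u(1)) (simp only: subst_t1_mult X emb2_mult)
  have e2: "phi_t2 = t2 * emb2 (fps_const u)"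
    unfolding phi_t2_def by (subst u(1)) (simp add: t2_def flip: emb2_mult)
  have "phi_t1 * (emb2 (subst_t1 v) * inverse t1) = emb2 fps_X * emb2 (subst_t1 u * subst_t1 v) * inverse t1"
    unfolding e1 emb2_mult by simp
  also have "\<dots> = 1" unfolding 1 by (simp flip: t1_def)
  finally have i1: "inverse phi_t1 = emb2 (subst_t1 v) * inverse t1" by (rule inverse_unique)
  have "phi_t2 * (emb2 (fps_const v) * inverse t2) = t2 * emb2 (fps_const (u * v)) * inverse t2"
    unfolding e2 by (simp add: emb2_mult flip: fps_const_mult)
  also have "\<dots> = 1" unfolding u by simp
  finally have i2: "inverse phi_t2 = emb2 (fps_const v) * inverse t2" by (rule inverse_unique)
  show ?thesis unfolding inverse_mult_distrib i1 i2 by (intro K2_mult) simp_all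
qed

definition difference_quotient :: "'k fps fps" where
  "difference_quotient = (SOME Q. subst_t1 \<phi> - fps_const \<phi> = tau * Q)"

lemma difference_quotient: "subst_t1 \<phi> - fps_const \<phi> = tau * difference_quotient"
proof -
  have "diag (subst_t1 \<phi> - fps_const \<phi>) = 0" by (simp add: diag_diff)
  then have "\<exists>Q. subst_t1 \<phi> - fps_const \<phi> = tau * Q" by (rule diag_eq_0E) blast
  then show ?thesis unfolding difference_quotient_def by (rule someI_ex)
qed

text \<open>The value of the difference quotient at the origin is the linear coefficient of \<phi>,
  which is nonzero. Hence a change of coordinate multiplies the equation of the diagonal by a
  unit.\<close>

lemma difference_quotient_unit: "\<exists>V. difference_quotient * V = 1"
proof -
  have "(tau * difference_quotient) $ 1 $ 0 = difference_quotient $ 0 $ 0"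
    by (simp add: tau_def left_diff_distrib)
  then have "difference_quotient $ 0 $ 0 = \<phi> $ 1"
    by (simp flip: difference_quotient)
  then have "difference_quotient $ 0 * inverse (difference_quotient $ 0) = 1"
    using phi_1 by (simp add: inverse_mult_eq_1')
  then show ?thesis using fps_right_inverse by blast
qed

lemma phi_t1_t2_diff: "phi_t1 - phi_t2 = (t1 - t2) * emb2 difference_quotient"
  unfolding phi_t1_def phi_t2_def emb2_diff[symmetric] difference_quotient by (simp add: emb2_mult emb2_tau)

lemma inverse_difference_quotient: "inverse (emb2 difference_quotient) \<in> K2"
proof -
  obtain V where "difference_quotient * V = 1" using difference_quotient_unit by blast
  then have "emb2 difference_quotient * emb2 V = 1" by (simp flip: emb2_mult)
  then show ?thesis by (metis inverse_unique K2_emb2)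
qed

lemma ext_K2: "x \<in> K2 \<Longrightarrow> ext x \<in> K2"
proof -
  assume "x \<in> K2"
  then obtain F n where "x = emb2 F / (t1 * t2) ^ n" by (auto simp: K2_def)
  then have "ext x = emb2 (subst2 \<phi> F) / (phi_t1 * phi_t2) ^ n"
    by (simp add: ext_hom ext_emb2 ext_t)
  also have "\<dots> = emb2 (subst2 \<phi> F) * inverse (phi_t1 * phi_t2) ^ n"
    by (simp only: divide_inverse power_inverse)
  finally have "ext x = emb2 (subst2 \<phi> F) * inverse (phi_t1 * phi_t2) ^ n" .
  then show ?thesis using inverse_phi_t1_t2 by (simp add: K2_mult K2_power)
qed

lemma ext_diag_power: "x \<in> diag_power n \<Longrightarrow> ext x \<in> diag_power n"
proof -
  assume "x \<in> diag_power n"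
  then obtain y where y: "y \<in> K2" "x = (t1 - t2) powi n * y" by (auto simp: diag_power_def)
  have "ext x = (emb2 difference_quotient powi n * ext y) * (t1 - t2) powi n"
    by (simp add: y ext_hom ext_t phi_t1_t2_diff power_int_mult_distrib)
  also have "\<dots> \<in> diag_power n"
    by (intro K2_mult_diag_power diag_power_tau K2_mult K2_powi ext_K2 y inverse_difference_quotient) simp
  finally show ?thesis .
qed

lemma ext_laurent_t2: "ext (laurent_t2 f) = laurent_t2 (fls_compose_fps f \<phi>)"
proof -
  obtain n g where g: "fls_X ^ n * f = fps_to_fls g" using ex_fls_X_power_mult by blast
  have "ext (laurent_t2 f) = emb2 (fps_const (fps_compose g \<phi>)) / phi_t2 ^ n"
    unfolding laurent_t2_eq[OF g] by (simp add: ext_hom ext_emb2 subst2_const ext_t)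
  moreover have "fps_to_fls \<phi> ^ n * fls_compose_fps f \<phi> = fps_to_fls (fps_compose g \<phi>)"
    using arg_cong[OF g, of "\<lambda>f. fls_compose_fps f \<phi>"] phi_nz phi_0
    by (simp add: fls_compose_fps_mult fls_compose_fps_power)
  then have "phi_t2 ^ n * laurent_t2 (fls_compose_fps f \<phi>) = emb2 (fps_const (fps_compose g \<phi>))"
    by (metis laurent_t2_fps laurent_t2_mult laurent_t2_power phi_t2_def)
  moreover have "phi_t2 ^ n \<noteq> 0" using phi_nz by (simp add: phi_t2_def)
  ultimately show ?thesis by (metis nonzero_mult_div_cancel_left)
qed

lemma change_coord_diag_power: "x \<in> diag_power n \<Longrightarrow> change_coord \<phi> x \<in> diag_power n"
  unfolding change_coord_def using ext_diag_power[of x n]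
  by (metis K2_emb2 K2_mult_diag_power mult.commute)

lemma change_coord_add: "change_coord \<phi> (x + y) = change_coord \<phi> x + change_coord \<phi> y"
  by (simp add: change_coord_def ext_hom algebra_simps)

lemma change_coord_diff: "change_coord \<phi> (x - y) = change_coord \<phi> x - change_coord \<phi> y"
  by (simp add: change_coord_def ext_hom algebra_simps)

text \<open>On the diagonal both derivative factors become the derivative of \<phi>; this is the
  transformation rule of quadratic differentials.\<close>

lemma change_coord_laurent:
  "change_coord \<phi> (laurent_t2 f) - laurent_t2 (fls_compose_fps f \<phi> * fps_to_fls (fps_deriv \<phi>) ^ 2) \<in> diag_power 1"
proof -
  have "change_coord \<phi> (laurent_t2 f) \<in> K2"
    unfolding change_coord_def ext_laurent_t2 by (intro K2_mult) simp_all
  moreover have "diag_fls (change_coord \<phi> (laurent_t2 f)) = fls_compose_fps f \<phi> * fps_to_fls (fps_deriv \<phi>) ^ 2"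
    unfolding change_coord_def ext_laurent_t2
    by (simp add: diag_fls_mult K2_mult diag_fls_emb2 power2_eq_square subst_t2_def)
  ultimately show ?thesis using diag_fls_mem by metis
qed

text \<open>The difference of the pulled back and the standard double pole,
  \<open>\<phi>'(t\<^sub>1)\<phi>'(t\<^sub>2)/(\<phi>(t\<^sub>1)-\<phi>(t\<^sub>2))\<^sup>2 - 1/(t\<^sub>1-t\<^sub>2)\<^sup>2\<close>, is the \<open>t\<^sub>2\<close>-derivative of
  \<open>\<phi>'(t\<^sub>1)/(\<phi>(t\<^sub>1)-\<phi>(t\<^sub>2)) - 1/(t\<^sub>1-t\<^sub>2)\<close>.  The latter is computed by expanding both fractions in
  powers of \<open>t\<^sub>1\<close> over \<open>k((t\<^sub>2))\<close>, where the coefficient of \<open>t\<^sub>1\<^sup>m\<^sup>-\<^sup>1\<close> in the first one is minus the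
  polar part, in terms of \<open>\<phi>\<close>, of \<open>t\<^sub>2\<^sup>-\<^sup>m\<close>.\<close>

definition polar :: "nat \<Rightarrow> 'k fls" where
  "polar m = (\<Sum>j<m. fls_const ((fps_deriv \<phi> * \<phi> ^ j) $ (m - 1)) * fps_to_fls \<phi> powi (- int j - 1))"

lemma residue_powi_deriv: "fls_residue (fps_to_fls \<phi> powi n * fps_to_fls (fps_deriv \<phi>)) = (if n = -1 then 1 else 0)"
proof -
  have "fls_residue (fls_compose_fps (fls_X powi n) \<phi> * fps_to_fls (fps_deriv \<phi>)) = fls_residue (fls_X powi n)"
    by (rule fls_residue_compose[OF phi])
  moreover have "fls_compose_fps (fls_X powi n) \<phi> = fps_to_fls \<phi> powi n"
    using phi_nz phi_0 by (simp add: fls_compose_fps_powi del: fls_X_power_int)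
  moreover have "fls_residue (fls_X powi n :: 'k fls) = (if n = -1 then 1 else 0)" by auto
  ultimately show ?thesis by (simp only:)
qed

text \<open>If y had a pole of order p, then y times \<phi>^(p-1) times the derivative of \<phi>
  would have exactly a simple pole, and so a nonzero residue.\<close>

lemma regular_if_residues:
  assumes "\<And>i::nat. fls_residue (y * fps_to_fls \<phi> ^ i * fps_to_fls (fps_deriv \<phi>)) = 0"
  shows "n < 0 \<Longrightarrow> fls_nth y n = 0"
proof (rule ccontr)
  assume n: "n < 0" and nz: "fls_nth y n \<noteq> 0"
  then have y: "y \<noteq> 0" and sd: "fls_subdegree y \<le> n" by (auto intro: fls_subdegree_leI)
  define i where "i = nat (- fls_subdegree y - 1)"
  let ?p = "fps_to_fls \<phi> ^ i * fps_to_fls (fps_deriv \<phi>)"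
  have d: "fps_deriv \<phi> \<noteq> 0" "subdegree (fps_deriv \<phi>) = 0"
  proof -
    have 0: "fps_deriv \<phi> $ 0 \<noteq> 0" using phi_1 by simp
    then show "fps_deriv \<phi> \<noteq> 0" by (metis fps_zero_nth)
    show "subdegree (fps_deriv \<phi>) = 0" using 0 by (rule subdegree_eq_0)
  qed
  have p: "?p \<noteq> 0" using d phi_nz by simp
  have "?p = fps_to_fls (\<phi> ^ i * fps_deriv \<phi>)" by (simp add: fls_times_fps_to_fls fps_to_fls_power)
  then have "fls_subdegree ?p = int i"
    using d phi_nz phi by (simp only: fls_subdegree_fls_to_fps) simp
  then have "fls_subdegree (y * ?p) = -1"
    using y p n sd by (subst fls_subdegree_mult) (simp_all add: i_def)
  moreover have "y * ?p \<noteq> 0" using y p by simp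
  ultimately have "fls_nth (y * ?p) (-1) \<noteq> 0" by (metis nth_fls_subdegree_nonzero)
  then show False using assms[of i] by (simp add: mult.assoc)
qed

lemma residue_X_power:
  "fls_residue (fls_X_intpow (- int m) * fps_to_fls (F :: 'k fps)) = (if m = 0 then 0 else F $ (m - 1))"
  by (auto simp: fls_shifted_times_simps nat_diff_distrib)

lemma polar_coeff_vanish: "j \<ge> m \<Longrightarrow> m > 0 \<Longrightarrow> (fps_deriv \<phi> * \<phi> ^ j) $ (m - 1) = 0"
proof -
  assume j: "j \<ge> m" "m > 0"
  have "(\<phi> ^ j) $ k = 0" if "k < m" for k
    using that j phi phi_nz by (intro nth_less_subdegree_zero) (simp add: subdegree_power)
  then show ?thesis unfolding fps_mult_nth using j by (intro sum.neutral) auto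
qed

text \<open>With s = \<phi>(t), the coefficient of s^(-j-1) in t^(-m) is Res(t^(-m) s^j ds), which
  is the coefficient used in \<open>polar\<close>. So \<open>polar m\<close> and t^(-m) have equal
  residues against all s^i ds.\<close>

lemma polar_regular:
  assumes "m > 0" "n < 0"
  shows "fls_nth (polar m - fls_X_intpow (- int m)) n = 0"
  using _ assms(2)
proof (rule regular_if_residues)
  fix i :: nat
  let ?f = "fps_to_fls \<phi>" and ?d = "fps_to_fls (fps_deriv \<phi>)"
  let ?a = "\<lambda>j. (fps_deriv \<phi> * \<phi> ^ j) $ (m - 1)"
  have f0: "?f \<noteq> 0" using phi_nz by simp
  have r: "fls_residue (sum g A) = (\<Sum>i\<in>A. fls_residue (g i))" for g :: "nat \<Rightarrow> 'k fls" and A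
    by (simp add: fls_nth_sum)
  have "polar m * ?f ^ i * ?d = (\<Sum>j<m. fls_const (?a j) * (?f powi (int i - int j - 1) * ?d))"
    unfolding polar_def sum_distrib_right
  proof (rule sum.cong[OF refl])
    fix j
    have "int i - int j - 1 = (- int j - 1) + int i" by simp
    then have "?f powi (int i - int j - 1) = ?f powi (- int j - 1) * ?f ^ i"
      by (simp only: power_int_add[OF disjI1[OF f0]] power_int_of_nat)
    then show "fls_const (?a j) * ?f powi (- int j - 1) * ?f ^ i * ?d = fls_const (?a j) * (?f powi (int i - int j - 1) * ?d)"
      by (simp only: mult.assoc)
  qed
  then have "fls_residue (polar m * ?f ^ i * ?d) = (\<Sum>j<m. ?a j * (if j = i then 1 else 0))"
    unfolding r fls_residue_fls_const_times residue_powi_deriv by (auto simp: r fls_residue_fls_const_times residue_powi_deriv intro!: sum.cong simp del: fls_residue_def)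
  also have "\<dots> = ?a i"
    using polar_coeff_vanish[of m i] assms(1) by (auto simp: if_distrib cong: if_cong)
  finally have 1: "fls_residue (polar m * ?f ^ i * ?d) = ?a i" .
  have "fls_X_intpow (- int m) * ?f ^ i * ?d = fls_X_intpow (- int m) * fps_to_fls (fps_deriv \<phi> * \<phi> ^ i)"
    by (simp only: fls_times_fps_to_fls fps_to_fls_power mult_ac)
  then have 2: "fls_residue (fls_X_intpow (- int m) * ?f ^ i * ?d) = ?a i"
    using residue_X_power[of m "fps_deriv \<phi> * \<phi> ^ i"] assms(1) by (simp only:) simp
  show "fls_residue ((polar m - fls_X_intpow (- int m)) * ?f ^ i * ?d) = 0"
    using 1 2 by (simp add: left_diff_distrib)
qed

text \<open>By \<open>polar_diff_eq\<close> this is 1/(t1 - t2) minus \<phi>'(t1)/(\<phi>(t1) -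
  \<phi>(t2)). Expanded in the first variable each fraction has poles in the second; the polar parts
  cancel coefficient by coefficient, so the difference is a power series.\<close>

definition polar_diff :: "'k fps fps" where
  "polar_diff = Abs_fps (\<lambda>i. fls_regpart (polar (Suc i) - fls_X_intpow (- int (Suc i))))"

lemma polar_diff_nth: "fps_to_fls (polar_diff $ i) = polar (Suc i) - fls_X_intpow (- int (Suc i))"
  unfolding polar_diff_def using polar_regular[of "Suc i"] by (intro fls_eqI) auto

text \<open>The geometric series: \<phi>'(t1)/(\<phi>(t2) - \<phi>(t1)) is the sum of \<phi>'(t1)
  \<phi>(t1)^j \<phi>(t2)^(-j-1). Multiplying by \<phi>(t1) raises j and multiplying by \<phi>(t2)
  lowers the negative exponent, so everything but the term with j = 0 cancels.\<close>

lemma polar_generating: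
  "(fps_map fps_to_fls (subst_t1 \<phi>) - fps_const (fps_to_fls \<phi>)) * Abs_fps (\<lambda>i. polar (Suc i)) =
     - fps_map fps_to_fls (subst_t1 (fps_deriv \<phi>))"
proof (rule fps_ext)
  fix n
  let ?f = "fps_to_fls \<phi>"
  define a where "a m j = (fps_deriv \<phi> * \<phi> ^ j) $ m" for m j
  have f0: "?f \<noteq> 0" using phi_nz by simp
  \<comment> \<open>The added terms have coefficient 0; a range independent of m permits the
    exchange of the two sums.\<close>
  have pol: "polar (Suc m) = (\<Sum>j<Suc n. fls_const (a m j) * ?f powi (- int j - 1))" if "m \<le> n" for m
    unfolding polar_def a_def
    by (rule sum.mono_neutral_cong_left) (use that polar_coeff_vanish[of "Suc m"] in auto)
  have cs: "fls_const (sum g A) = (\<Sum>i\<in>A. fls_const (g i))" for g :: "nat \<Rightarrow> 'k" and A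
    by (induction A rule: infinite_finite_induct) (simp_all flip: fls_plus_const)
  have conv: "(\<Sum>i\<le>n. \<phi> $ i * a (n - i) j) = a n (Suc j)" for j
  proof -
    have "a n (Suc j) = (\<phi> * (fps_deriv \<phi> * \<phi> ^ j)) $ n" by (simp add: a_def mult_ac)
    then show ?thesis by (simp add: fps_mult_nth[of \<phi>] a_def atMost_atLeast0)
  qed
  have "(fps_map fps_to_fls (subst_t1 \<phi>) * Abs_fps (\<lambda>i. polar (Suc i))) $ n =
      (\<Sum>i\<le>n. fls_const (\<phi> $ i) * polar (Suc (n - i)))"
    by (simp add: fps_mult_nth atMost_atLeast0)
  also have "\<dots> = (\<Sum>i\<le>n. \<Sum>j<Suc n. fls_const (\<phi> $ i * a (n - i) j) * ?f powi (- int j - 1))"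
  proof (intro sum.cong refl)
    fix i
    show "fls_const (\<phi> $ i) * polar (Suc (n - i)) = (\<Sum>j<Suc n. fls_const (\<phi> $ i * a (n - i) j) * ?f powi (- int j - 1))"
      by (subst pol) (simp_all only: sum_distrib_left fls_const_mult_const[symmetric] mult.assoc diff_le_self)
  qed
  also have "\<dots> = (\<Sum>j<Suc n. fls_const (\<Sum>i\<le>n. \<phi> $ i * a (n - i) j) * ?f powi (- int j - 1))"
    unfolding cs sum_distrib_right by (rule sum.swap)
  also have "\<dots> = (\<Sum>j<Suc n. fls_const (a n (Suc j)) * ?f powi (- int j - 1))"
    by (simp only: conv)
  also have "\<dots> =
      (\<Sum>j\<in>{1..<Suc n}. fls_const (a n j) * ?f powi (- int j))"
  proof -
    have "a n (Suc n) = 0" using polar_coeff_vanish[of "Suc n" "Suc n"] by (simp add: a_def)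
    then have "(\<Sum>j<Suc n. fls_const (a n (Suc j)) * ?f powi (- int j - 1)) =
        (\<Sum>j<n. fls_const (a n (Suc j)) * ?f powi (- int j - 1))" by simp
    also have "\<dots> = (\<Sum>j\<in>{1..<Suc n}. fls_const (a n j) * ?f powi (- int j))"
      by (rule sum.reindex_bij_witness[of _ "\<lambda>j. j - 1" Suc]) (auto simp: minus_diff_commute)
    finally show ?thesis .
  qed
  finally have 1: "(fps_map fps_to_fls (subst_t1 \<phi>) * Abs_fps (\<lambda>i. polar (Suc i))) $ n =
    (\<Sum>j\<in>{1..<Suc n}. fls_const (a n j) * ?f powi (- int j))" .
  have fp: "?f * ?f powi (- int j - 1) = ?f powi (- int j)" for j
    using f0 by (subst power_int_add_1'[symmetric]) auto
  have "?f * polar (Suc n) = (\<Sum>j<Suc n. fls_const (a n j) * (?f * ?f powi (- int j - 1)))"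
    unfolding pol[OF order_refl] sum_distrib_left by (simp only: mult.left_commute)
  also have "\<dots> = (\<Sum>j<Suc n. fls_const (a n j) * ?f powi (- int j))"
    by (simp only: fp)
  also have "\<dots> =
      fls_const (a n 0) + (\<Sum>j\<in>{1..<Suc n}. fls_const (a n j) * ?f powi (- int j))"
    by (simp add: lessThan_atLeast0 sum.atLeast_Suc_lessThan)
  finally have 2: "?f * polar (Suc n) = fls_const (a n 0) + (\<Sum>j\<in>{1..<Suc n}. fls_const (a n j) * ?f powi (- int j))" .
  show "((fps_map fps_to_fls (subst_t1 \<phi>) - fps_const ?f) * Abs_fps (\<lambda>i. polar (Suc i))) $ n =
     (- fps_map fps_to_fls (subst_t1 (fps_deriv \<phi>))) $ n"
    unfolding left_diff_distrib fps_sub_nth 1 by (simp add: 2 a_def del: fps_deriv_nth)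
qed

lemma polar_X_generating:
  "(fps_X - fps_const fls_X) * Abs_fps (\<lambda>i. fls_X_intpow (- int (Suc i)) :: 'k fls) = - 1"
proof (rule fps_ext)
  fix n
  have X: "fls_X * (fls_X_intpow (- int (Suc i)) :: 'k fls) = fls_X_intpow (- int i)" for i
    by (simp add: fls_X_times_conv_shift)
  show "((fps_X - fps_const fls_X) * Abs_fps (\<lambda>i. fls_X_intpow (- int (Suc i)) :: 'k fls)) $ n = (- 1) $ n"
    by (cases n) (simp_all add: left_diff_distrib fls_X_times_conv_shift add.commute)
qed

text \<open>The identity is verified over k((t2)), where the two generating functions exist
  separately, and brought back because power series embed in Laurent series.\<close>

lemma polar_diff_eq:
  "tau * (subst_t1 \<phi> - fps_const \<phi>) * polar_diff = (subst_t1 \<phi> - fps_const \<phi>) - subst_t1 (fps_deriv \<phi>) * tau"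
proof -
  let ?e = "fps_map fps_to_fls :: 'k fps fps \<Rightarrow> 'k fls fps"
  have hom: "?e (F + G) = ?e F + ?e G" "?e (F * G) = ?e F * ?e G" for F G
    by (rule fps_map_hom; simp add: fls_times_fps_to_fls)+
  have diff: "?e (F - G) = ?e F - ?e G" for F G using hom(1)[of "F - G" G] by (simp add: algebra_simps)
  have const: "?e (fps_const g) = fps_const (fps_to_fls g)" for g by (simp add: fps_eq_iff)
  have X: "?e fps_X = fps_X" by (rule fps_ext) simp
  have tau: "?e tau = fps_X - fps_const fls_X" by (simp add: tau_def diff X const)
  define A where "A = Abs_fps (\<lambda>i. polar (Suc i))"
  define B where "B = Abs_fps (\<lambda>i. fls_X_intpow (- int (Suc i)) :: 'k fls)"
  have H: "?e polar_diff = A - B"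
    by (rule fps_ext) (simp only: fps_map_nth polar_diff_nth A_def B_def fps_nth_Abs_fps fps_sub_nth)
  define P where "P = ?e (subst_t1 \<phi> - fps_const \<phi>)"
  define T where "T = ?e tau"
  have 1: "P * A = - ?e (subst_t1 (fps_deriv \<phi>))"
    using polar_generating by (simp add: P_def A_def diff const)
  have 2: "T * B = - 1" using polar_X_generating by (simp add: T_def B_def tau)
  have "?e (tau * (subst_t1 \<phi> - fps_const \<phi>) * polar_diff) = T * (P * A) - P * (T * B)"
    unfolding hom H P_def[symmetric] T_def[symmetric] by (simp add: algebra_simps)
  also have "\<dots> = ?e ((subst_t1 \<phi> - fps_const \<phi>) - subst_t1 (fps_deriv \<phi>) * tau)"
    unfolding 1 2 diff[of _ "_ * _"] hom(2) P_def[symmetric] T_def[symmetric] by simp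
  finally have e: "?e (tau * (subst_t1 \<phi> - fps_const \<phi>) * polar_diff) =
    ?e ((subst_t1 \<phi> - fps_const \<phi>) - subst_t1 (fps_deriv \<phi>) * tau)" .
  show ?thesis
  proof (rule fps_ext)
    fix n
    show "(tau * (subst_t1 \<phi> - fps_const \<phi>) * polar_diff) $ n = ((subst_t1 \<phi> - fps_const \<phi>) - subst_t1 (fps_deriv \<phi>) * tau) $ n"
      using arg_cong[OF e, of "\<lambda>F. F $ n"] by (simp only: fps_map_nth fps_to_fls_eq_iff)
  qed
qed

text \<open>The regular part of the pulled back double pole. Its restriction to the diagonal is
  classically one sixth of the Schwarzian derivative of \<phi>.\<close>

definition schwarzian :: "'k fps fps" where
  "schwarzian = - fps_map fps_deriv polar_diff"

lemma schwarzian_eq: "change_coord \<phi> (1 / (t1 - t2)\<^sup>2) = 1 / (t1 - t2)\<^sup>2 + emb2 schwarzian"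
proof -
  let ?d = "fps_map fps_deriv :: 'k fps fps \<Rightarrow> 'k fps fps"
  define P where "P = subst_t1 \<phi> - fps_const \<phi>"
  define f1 where "f1 = subst_t1 (fps_deriv \<phi>)"
  define f2 where "f2 = fps_const (fps_deriv \<phi>)"
  let ?H = "polar_diff"
  have dadd: "?d (F + G) = ?d F + ?d G" for F G by (simp add: fps_eq_iff)
  have ddiff: "?d (F - G) = ?d F - ?d G" for F G by (simp add: fps_eq_iff)
  have dmult: "?d (F * G) = ?d F * G + F * ?d G" for F G
  proof (rule fps_ext)
    fix n
    have "?d (F * G) $ n = (\<Sum>i=0..n. fps_deriv (F $ i * G $ (n - i)))"
      by (simp add: fps_mult_nth fps_deriv_sum)
    also have "\<dots> = (\<Sum>i=0..n. fps_deriv (F $ i) * G $ (n - i)) + (\<Sum>i=0..n. F $ i * fps_deriv (G $ (n - i)))"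
      by (simp add: sum.distrib add.commute)
    finally show "?d (F * G) $ n = (?d F * G + F * ?d G) $ n" by (simp add: fps_mult_nth)
  qed
  have dP: "?d P = - f2" by (rule fps_ext) (simp add: P_def f2_def)
  have dt: "?d tau = - 1" by (rule fps_ext) (simp add: tau_def)
  have df: "?d f1 = 0" by (rule fps_ext) (simp add: f1_def)
  have eq: "tau * P * ?H = P - f1 * tau" using polar_diff_eq by (simp add: P_def f1_def)
  \<comment> \<open>Differentiate \<open>polar_diff_eq\<close> in the second variable. The result
    still contains the undifferentiated series; multiplying by \<open>tau * P\<close> makes it
    appear only in the product that \<open>eq\<close> evaluates.\<close>
  have "?d (tau * P * ?H) = ?d (P - f1 * tau)" by (simp only: eq)
  then have d: "- P * ?H - tau * f2 * ?H + tau * P * ?d ?H = - f2 + f1"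
    by (simp add: dmult ddiff dP dt df algebra_simps)
  have "tau * P * (- P * ?H - tau * f2 * ?H + tau * P * ?d ?H) =
      (tau * P * ?H) * (- P - tau * f2) + (tau * P) ^ 2 * ?d ?H"
    by (simp add: algebra_simps power2_eq_square)
  then have "tau * P * (- f2 + f1) = (P - f1 * tau) * (- P - tau * f2) + (tau * P) ^ 2 * ?d ?H"
    unfolding d eq .
  then have "(tau * P) ^ 2 * schwarzian = (P - f1 * tau) * (- P - tau * f2) - tau * P * (- f2 + f1)"
    by (simp add: schwarzian_def)
  also have "\<dots> = tau ^ 2 * f1 * f2 - P ^ 2"
    by (simp add: algebra_simps power2_eq_square)
  finally have "(tau * P) ^ 2 * schwarzian = tau ^ 2 * f1 * f2 - P ^ 2" .
  then have e: "emb2 ((tau * P) ^ 2 * schwarzian) = emb2 (tau ^ 2 * f1 * f2 - P ^ 2)" by simp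
  define p where "p = phi_t1 - phi_t2"
  have p: "p = emb2 P" by (simp add: p_def P_def phi_t1_def phi_t2_def emb2_diff)
  have pnz: "p \<noteq> 0"
    using difference_quotient_unit unfolding p_def phi_t1_t2_diff by auto
  define d where "d = (t1 - t2 :: 'k frac2)"
  have dnz: "d \<noteq> 0" by (simp add: d_def)
  have e': "(d * p)\<^sup>2 * emb2 schwarzian = d\<^sup>2 * emb2 f1 * emb2 f2 - p\<^sup>2"
    using e by (simp add: emb2_mult emb2_power emb2_diff emb2_tau p d_def)
  have "change_coord \<phi> (1 / (t1 - t2)\<^sup>2) = emb2 f1 * emb2 f2 / p\<^sup>2"
    by (simp add: change_coord_def ext_hom ext_t p_def f1_def f2_def subst_t2_def)
  also have "\<dots> = 1 / d\<^sup>2 + emb2 schwarzian"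
    using e' dnz pnz by (simp add: field_simps power_mult_distrib)
  finally show ?thesis by (simp add: d_def)
qed

lemma change_coord_scalar2: "change_coord \<phi> (scalar2 c * x) = scalar2 c * change_coord \<phi> x"
proof -
  have "ext (scalar2 c) = scalar2 c" by (simp add: scalar2_def ext_emb2 subst2_const)
  then show ?thesis by (simp add: change_coord_def ext_hom)
qed

lemma change_coord_hrep:
  "change_coord \<phi> (hrep c f) - hrep c (fls_const c * fps_to_fls (diag schwarzian) +
     fls_compose_fps f \<phi> * fps_to_fls (fps_deriv \<phi>) ^ 2) \<in> diag_power 1"
proof -
  have h: "hrep c f = scalar2 c * (1 / (t1 - t2)\<^sup>2) + laurent_t2 f" by (simp add: hrep_def)
  have "change_coord \<phi> (hrep c f) - hrep c (fls_const c * fps_to_fls (diag schwarzian) +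
     fls_compose_fps f \<phi> * fps_to_fls (fps_deriv \<phi>) ^ 2) =
    scalar2 c * (emb2 schwarzian - laurent_t2 (diag_fls (emb2 schwarzian))) +
    (change_coord \<phi> (laurent_t2 f) - laurent_t2 (fls_compose_fps f \<phi> * fps_to_fls (fps_deriv \<phi>) ^ 2))"
    unfolding h change_coord_add change_coord_scalar2 schwarzian_eq
    by (simp add: hrep_def diag_fls_emb2 laurent_t2_add laurent_t2_mult laurent_t2_const algebra_simps)
  also have "\<dots> \<in> diag_power 1"
    by (intro diag_power_add K2_mult_diag_power diag_fls_mem change_coord_laurent) simp_all
  finally show ?thesis .
qed

lemma pullback_hat_form:
  "pullback \<phi> (hat_form z g) = (\<lambda>\<omega>. if \<omega> \<in> hat_omega then THE y. \<exists>c f. \<omega> = qclass (hrep c f) \<and>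
     y = c * z + fls_residue (g * (fls_const c * fps_to_fls (diag schwarzian) +
     fls_compose_fps f \<phi> * fps_to_fls (fps_deriv \<phi>) ^ 2)) else 0)"
proof
  fix \<omega> :: "'k frac2 set"
  show "pullback \<phi> (hat_form z g) \<omega> = (if \<omega> \<in> hat_omega then THE y. \<exists>c f. \<omega> = qclass (hrep c f) \<and>
     y = c * z + fls_residue (g * (fls_const c * fps_to_fls (diag schwarzian) +
     fls_compose_fps f \<phi> * fps_to_fls (fps_deriv \<phi>) ^ 2)) else 0)"
  proof (cases "\<omega> \<in> hat_omega")
    case True
    then obtain c f where \<omega>: "\<omega> = qclass (hrep c f)" by (rule hat_omegaE)
    define h where "h = hrep c (fls_const c * fps_to_fls (diag schwarzian) +
     fls_compose_fps f \<phi> * fps_to_fls (fps_deriv \<phi>) ^ 2)"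
    \<comment> \<open>All representatives of a class are carried into one class, so the union in the
      definition of \<open>pullback\<close> is that class.\<close>
    have "qclass (change_coord \<phi> F) = qclass h" if "F \<in> \<omega>" for F
    proof -
      have "F - hrep c f \<in> diag_power 1" using that by (simp add: \<omega> qclass_def)
      from diag_power_add[OF change_coord_diag_power[OF this] change_coord_hrep[of c f]]
      show ?thesis by (simp add: qclass_eq_iff change_coord_diff h_def)
    qed
    moreover have "hrep c f \<in> \<omega>" by (simp add: \<omega> qclass_def)
    ultimately have "(\<Union>F\<in>\<omega>. qclass (change_coord \<phi> F)) = qclass h" by blast
    then have "pullback \<phi> (hat_form z g) \<omega> = hat_form z g (qclass h)" using True by (simp add: pullback_def)
    then show ?thesis using True by (simp add: h_def \<omega> qclass_hrep_inj)
  qed (simp add: pullback_def)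
qed

text \<open>The new value on the double pole is the old form evaluated on the pulled back double
  pole, hence the extra residue against the restricted \<open>schwarzian\<close>. The hypothesis
  determines the new vector field component.\<close>

lemma pullback_eq_hat_form:
  assumes "\<And>f. fls_residue (g * (fls_compose_fps f \<phi> * fps_to_fls (fps_deriv \<phi>) ^ 2)) = fls_residue (g' * f)"
  shows "pullback \<phi> (hat_form z g) = hat_form (z + fls_residue (g * fps_to_fls (diag schwarzian))) g'"
proof
  fix \<omega> :: "'k frac2 set"
  show "pullback \<phi> (hat_form z g) \<omega> = hat_form (z + fls_residue (g * fps_to_fls (diag schwarzian))) g' \<omega>"
  proof (cases "\<omega> \<in> hat_omega")
    case True
    then obtain c f where \<omega>: "\<omega> = qclass (hrep c f)" by (rule hat_omegaE)
    have "pullback \<phi> (hat_form z g) \<omega> = c * z + fls_residue (g * (fls_const c * fps_to_fls (diag schwarzian) +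
     fls_compose_fps f \<phi> * fps_to_fls (fps_deriv \<phi>) ^ 2))"
      unfolding pullback_hat_form by (simp add: \<omega> qclass_hrep_inj)
    also have "g * (fls_const c * fps_to_fls (diag schwarzian) +
        fls_compose_fps f \<phi> * fps_to_fls (fps_deriv \<phi>) ^ 2) =
      fls_const c * (g * fps_to_fls (diag schwarzian)) + g * (fls_compose_fps f \<phi> * fps_to_fls (fps_deriv \<phi>) ^ 2)"
      by (simp only: distrib_left mult.left_commute)
    also have "fls_residue \<dots> = c * fls_residue (g * fps_to_fls (diag schwarzian)) + fls_residue (g' * f)"
      unfolding fls_residue_add assms by simp
    finally show ?thesis by (simp add: \<omega> algebra_simps)
  qed (simp add: pullback_def hat_form_outside)
qed

end

subsection \<open>Ideals in the free algebra\<close>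

lemma scal_simps:
  "scal (a + b) = scal a + scal b" "scal (a * b) = scal a * scal b" "scal 0 = 0" "scal 1 = 1"
  "scal (- a) = - scal a" "scal (a - b) = scal a - scal b"
  by (simp_all add: scal_def single_add single_uminus single_diff mult_single)

lemma scal_sum: "scal (sum f A) = (\<Sum>i\<in>A. scal (f i))"
  by (induction A rule: infinite_finite_induct) (simp_all add: scal_simps)

lemma poly_mapping_sum:
  fixes p :: "'w \<Rightarrow>\<^sub>0 'c::comm_monoid_add"
  shows "p = (\<Sum>w\<in>Poly_Mapping.keys p. Poly_Mapping.single w (Poly_Mapping.lookup p w))"
proof (rule poly_mapping_eqI)
  fix k
  have "Poly_Mapping.lookup (sum f A) k = (\<Sum>w\<in>A. Poly_Mapping.lookup (f w) k)" for f :: "'w \<Rightarrow> 'w \<Rightarrow>\<^sub>0 'c" and A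
    by (induction A rule: infinite_finite_induct) (simp_all add: lookup_add)
  then show "Poly_Mapping.lookup p k =
      Poly_Mapping.lookup (\<Sum>w\<in>Poly_Mapping.keys p. Poly_Mapping.single w (Poly_Mapping.lookup p w)) k"
    by (simp add: lookup_single when_def sum.delta in_keys_iff)
qed

lemma scal_commute:
  fixes x :: "('k::field, 'g) free_algebra"
  shows "scal c * x = x * scal c"
proof -
  have "scal c * Poly_Mapping.single w d = Poly_Mapping.single w d * scal c" for w :: "'g mword" and d
    by (simp add: scal_def mult_single mult.commute)
  then have "scal c * (\<Sum>w\<in>A. Poly_Mapping.single w (h w)) = (\<Sum>w\<in>A. Poly_Mapping.single w (h w)) * scal c" for A :: "'g mword set" and h
    by (simp only: sum_distrib_left sum_distrib_right)
  then show ?thesis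
    using poly_mapping_sum[of x] by metis
qed

lemma scal_left_commute: "y * (scal c * x) = scal c * (y * x)"
  by (metis mult.assoc scal_commute)

lemma two_sided_ideal_left: "x \<in> two_sided_ideal S \<Longrightarrow> c * x \<in> two_sided_ideal S"
proof (induction rule: two_sided_ideal.induct)
  case (3 s a b)
  then show ?case using two_sided_ideal.intros(3)[of s S "c * a" b] by (simp add: mult.assoc)
qed (auto simp: distrib_left intro: two_sided_ideal.intros)

lemma two_sided_ideal_right: "x \<in> two_sided_ideal S \<Longrightarrow> x * c \<in> two_sided_ideal S"
proof (induction rule: two_sided_ideal.induct)
  case (3 s a b)
  then show ?case using two_sided_ideal.intros(3)[of s S a "b * c"] by (simp add: mult.assoc)
qed (auto simp: distrib_right intro: two_sided_ideal.intros)

lemma left_ideal_left: "x \<in> left_ideal S \<Longrightarrow> c * x \<in> left_ideal S"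
proof (induction rule: left_ideal.induct)
  case (3 s a)
  then show ?case using left_ideal.intros(3)[of s S "c * a"] by (simp add: mult.assoc)
qed (auto simp: distrib_left intro: left_ideal.intros)

context cdv_algebra
begin

lemma U_add: "x \<in> U_ideal \<Longrightarrow> y \<in> U_ideal \<Longrightarrow> x + y \<in> U_ideal"
  unfolding U_ideal_def by (rule two_sided_ideal.intros)

lemma U_0 [simp]: "0 \<in> U_ideal"
  unfolding U_ideal_def by (rule two_sided_ideal.intros)

lemma U_left: "x \<in> U_ideal \<Longrightarrow> c * x \<in> U_ideal"
  unfolding U_ideal_def by (rule two_sided_ideal_left)

lemma U_right: "x \<in> U_ideal \<Longrightarrow> x * c \<in> U_ideal"
  unfolding U_ideal_def by (rule two_sided_ideal_right)

lemma U_minus: "x \<in> U_ideal \<Longrightarrow> - x \<in> U_ideal"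
  using U_left[of x "- 1"] by simp

lemma U_diff: "x \<in> U_ideal \<Longrightarrow> y \<in> U_ideal \<Longrightarrow> x - y \<in> U_ideal"
  using U_add[OF _ U_minus, of x y] by simp

lemma U_gen: "s \<in> envelope_relations \<union> localization_relations \<Longrightarrow> s \<in> U_ideal"
  unfolding U_ideal_def using two_sided_ideal.intros(3)[of s _ 1 1] by simp

lemma J_add: "x \<in> J N \<Longrightarrow> y \<in> J N \<Longrightarrow> x + y \<in> J N"
  unfolding J_def by (rule left_ideal.intros)

lemma J_0 [simp]: "0 \<in> J N"
  unfolding J_def by (rule left_ideal.intros)

lemma J_left: "x \<in> J N \<Longrightarrow> c * x \<in> J N"
  unfolding J_def by (rule left_ideal_left)

lemma J_minus: "x \<in> J N \<Longrightarrow> - x \<in> J N"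
  using J_left[of x N "- 1"] by simp

lemma J_diff: "x \<in> J N \<Longrightarrow> y \<in> J N \<Longrightarrow> x - y \<in> J N"
  using J_add[OF _ J_minus, of x N y] by simp

lemma J_sum: "(\<And>i. i \<in> A \<Longrightarrow> f i \<in> J N) \<Longrightarrow> sum f A \<in> J N"
  by (induction A rule: infinite_finite_induct) (auto intro: J_add)

lemma U_J: "x \<in> U_ideal \<Longrightarrow> x \<in> J N"
  unfolding J_def using left_ideal.intros(3)[of x _ 1] by simp

lemma elt_J: "f \<in> frac_ideal (int N) \<Longrightarrow> elt f \<in> J N"
  unfolding J_def maximal_ideal_power_frac_ideal using left_ideal.intros(3)[of "elt f" _ 1] by simp

lemma J_induct [consumes 1, case_names U elt add]:
  assumes "x \<in> J N" and U: "\<And>x. x \<in> U_ideal \<Longrightarrow> P x"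
    and e: "\<And>a f. f \<in> frac_ideal (int N) \<Longrightarrow> P (a * elt f)"
    and add: "\<And>x y. P x \<Longrightarrow> P y \<Longrightarrow> P (x + y)"
  shows "P x"
  using assms(1) unfolding J_def
proof (induction rule: left_ideal.induct)
  case 1
  show ?case by (rule U) simp
next
  case (2 x y)
  then show ?case by (intro add)
next
  case (3 s a)
  then show ?case using U[OF U_left, of s a] e by (auto simp: maximal_ideal_power_frac_ideal)
qed

lemma J_antimono:
  assumes "M \<le> N" "x \<in> J N" shows "x \<in> J M"
  using assms(2)
proof (induction rule: J_induct)
  case (elt a f)
  then show ?case using assms(1) by (intro J_left elt_J) (auto intro: frac_ideal_mono[of _ "int N"])
qed (auto intro: U_J J_add)

section \<open>Calculation modulo the relations of the localized enveloping algebra\<close>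

definition ucong :: "('k, 'K) heis_free \<Rightarrow> ('k, 'K) heis_free \<Rightarrow> bool"  (infix "\<approx>" 50) where
  "x \<approx> y \<longleftrightarrow> x - y \<in> U_ideal"

lemma ucong_refl [simp]: "x \<approx> x"
  by (simp add: ucong_def)

lemma ucong_sym: "x \<approx> y \<Longrightarrow> y \<approx> x"
  using U_minus[of "x - y"] by (simp add: ucong_def)

lemma ucong_trans [trans]: "x \<approx> y \<Longrightarrow> y \<approx> z \<Longrightarrow> x \<approx> z"
  using U_add[of "x - y" "y - z"] by (simp add: ucong_def)

lemma ucong_eq_trans [trans]: "x \<approx> y \<Longrightarrow> y = z \<Longrightarrow> x \<approx> z"
  and eq_ucong_trans [trans]: "x = y \<Longrightarrow> y \<approx> z \<Longrightarrow> x \<approx> z"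
  by simp_all

lemma ucong_add: "x \<approx> y \<Longrightarrow> x' \<approx> y' \<Longrightarrow> x + x' \<approx> y + y'"
  unfolding ucong_def using U_add[of "x - y" "x' - y'"] by (simp add: algebra_simps)

lemma ucong_diff: "x \<approx> y \<Longrightarrow> x' \<approx> y' \<Longrightarrow> x - x' \<approx> y - y'"
  unfolding ucong_def using U_diff[of "x - y" "x' - y'"] by (simp add: algebra_simps)

lemma ucong_mult: "x \<approx> y \<Longrightarrow> x' \<approx> y' \<Longrightarrow> x * x' \<approx> y * y'"
  unfolding ucong_def using U_add[OF U_right[of "x - y" x'] U_left[of "x' - y'" y]]
  by (simp add: algebra_simps)

lemma ucong_left: "x \<approx> y \<Longrightarrow> c * x \<approx> c * y"
  by (rule ucong_mult) simp_all

lemma ucong_right: "x \<approx> y \<Longrightarrow> x * c \<approx> y * c"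
  by (rule ucong_mult) simp_all

lemma ucong_sum: "(\<And>i. i \<in> A \<Longrightarrow> f i \<approx> g i) \<Longrightarrow> sum f A \<approx> sum g A"
  by (induction A rule: infinite_finite_induct) (auto intro: ucong_add)

lemma ucong_J: "x \<approx> y \<Longrightarrow> x - y \<in> J N"
  unfolding ucong_def by (rule U_J)

abbreviation "hb \<equiv> gen (Emb hbar) :: ('k, 'K) heis_free"
abbreviation "hi \<equiv> gen HInv :: ('k, 'K) heis_free"

lemma Emb_add: "gen (Emb (x + y)) \<approx> gen (Emb x) + gen (Emb y)"
proof -
  have "gen (Emb (x + y)) - gen (Emb x) - gen (Emb y) \<in> U_ideal"
    by (rule U_gen) (unfold envelope_relations_def, blast)
  then show ?thesis by (simp add: ucong_def algebra_simps)
qed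

lemma Emb_scale: "gen (Emb (heis_scale c x)) \<approx> scal c * gen (Emb x)"
  unfolding ucong_def by (rule U_gen) (unfold envelope_relations_def, blast)

lemma Emb_commutator: "gen (Emb x) * gen (Emb y) - gen (Emb y) * gen (Emb x) \<approx> gen (Emb (heis_bracket x y))"
  unfolding ucong_def by (rule U_gen) (unfold envelope_relations_def, blast)

lemma hb_hi: "hb * hi \<approx> 1" and hi_hb: "hi * hb \<approx> 1"
  unfolding ucong_def by (rule U_gen; simp add: localization_relations_def)+

lemma elt_add: "elt (f + g) \<approx> elt f + elt g"
  using Emb_add[of "(0, f)" "(0, g)"] by (simp add: elt_def)

lemma elt_scale: "elt (\<iota> c * f) \<approx> scal c * elt f"
  using Emb_scale[of c "(0, f)"] by (simp add: elt_def heis_scale_def)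

lemma elt_0: "elt 0 \<approx> 0"
  using elt_scale[of 0 0] by (simp add: scal_simps)

lemma elt_sum: "elt (sum f A) \<approx> (\<Sum>i\<in>A. elt (f i))"
proof (induction A rule: infinite_finite_induct)
  case (insert x F)
  have "elt (f x + sum f F) \<approx> elt (f x) + elt (sum f F)" by (rule elt_add)
  also have "\<dots> \<approx> elt (f x) + (\<Sum>i\<in>F. elt (f i))" by (rule ucong_add[OF ucong_refl insert.IH])
  finally show ?case using insert.hyps by simp
qed (simp_all add: elt_0)

lemma elt_minus: "elt (- f) \<approx> - elt f"
  using elt_scale[of "- 1" f] by (simp add: scal_simps iota_minus iota_one)

lemma elt_diff: "elt (f - g) \<approx> elt f - elt g"
  using ucong_trans[OF elt_add[of f "- g"] ucong_add[OF ucong_refl elt_minus]] by simp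

lemma Emb_scalar: "gen (Emb (c, 0)) \<approx> scal c * hb"
  using Emb_scale[of c hbar] by (simp add: heis_scale_def hbar_def)

lemma Emb_0: "gen (Emb (0, 0)) \<approx> 0"
  using elt_0 by (simp add: elt_def)

lemma Emb_split: "gen (Emb (c, f)) \<approx> scal c * hb + elt f"
proof -
  have "gen (Emb ((c, 0) + (0, f))) \<approx> gen (Emb (c, 0)) + gen (Emb (0, f))" by (rule Emb_add)
  also have "\<dots> \<approx> scal c * hb + elt f" unfolding elt_def by (intro ucong_add Emb_scalar) simp
  finally show ?thesis by simp
qed

lemma elt_commutator: "elt f * elt g \<approx> elt g * elt f + scal (res_pairing f g) * hb"
proof -
  have "elt f * elt g - elt g * elt f \<approx> gen (Emb (res_pairing f g, 0))"
    using Emb_commutator[of "(0, f)" "(0, g)"] by (simp add: elt_def heis_bracket_def)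
  also have "\<dots> \<approx> scal (res_pairing f g) * hb" by (rule Emb_scalar)
  finally show ?thesis using ucong_add[OF ucong_refl, of _ _ "elt g * elt f"] by (metis add.commute diff_add_cancel)
qed

lemma hb_commute: "gen (Emb x) * hb \<approx> hb * gen (Emb x)"
proof -
  have "gen (Emb x) * hb - hb * gen (Emb x) \<approx> gen (Emb (0, 0))"
    using Emb_commutator[of x hbar] by (simp add: heis_bracket_def hbar_def)
  also have "\<dots> \<approx> 0" by (rule Emb_0)
  finally show ?thesis by (simp add: ucong_def)
qed

text \<open>The inverse of a central element is central: insert \<open>hi * hb\<close> on the left,
  move \<open>hb\<close> through, and cancel it on the right.\<close>

lemma hi_commute: "gen (Emb x) * hi \<approx> hi * gen (Emb x)"
proof -
  let ?x = "gen (Emb x) :: ('k, 'K) heis_free"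
  have "?x * hi = 1 * (?x * hi)" by simp
  also have "\<dots> \<approx> hi * hb * (?x * hi)" by (rule ucong_right[OF ucong_sym[OF hi_hb]])
  also have "\<dots> = hi * ((hb * ?x) * hi)" by (simp add: mult.assoc)
  also have "\<dots> \<approx> hi * ((?x * hb) * hi)" by (intro ucong_left ucong_right ucong_sym[OF hb_commute])
  also have "\<dots> = (hi * ?x) * (hb * hi)" by (simp add: mult.assoc)
  also have "\<dots> \<approx> (hi * ?x) * 1" by (intro ucong_left hb_hi)
  finally show ?thesis by simp
qed

lemma elt_hi: "elt f * hi \<approx> hi * elt f"
  unfolding elt_def by (rule hi_commute)

text \<open>For f of large valuation the pairing with the given letter vanishes, so
  \<open>elt f\<close> passes to the right end of the product, where it belongs to the left
  ideal.\<close>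

lemma letter_J:
  "\<exists>M. \<forall>f\<in>frac_ideal (int M). elt f * gen l \<in> J N"
proof (cases l)
  case (Emb x)
  obtain c h where x: "x = (c, h)" by (cases x)
  define M where "M = nat (max (int N) (1 - val h))"
  have "elt f * gen l \<in> J N" if f: "f \<in> frac_ideal (int M)" for f
  proof -
    have h: "h \<in> frac_ideal (val h)" by (simp add: frac_ideal_def)
    have "res_pairing f h = 0" by (rule res_pairing_vanish[OF f h]) (auto simp: M_def)
    then have "elt f * elt h \<approx> elt h * elt f" using elt_commutator[of f h] by (simp add: scal_simps)
    moreover have "elt f * (scal c * hb) \<approx> scal c * hb * elt f"
      using ucong_left[OF hb_commute[of "(0, f)"], of "scal c"] by (simp add: elt_def scal_left_commute mult.assoc)
    ultimately have "elt f * (scal c * hb + elt h) \<approx> (scal c * hb + elt h) * elt f"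
      by (simp add: distrib_left distrib_right ucong_add)
    from ucong_trans[OF ucong_left[OF Emb_split] this] have "elt f * gen l \<approx> (scal c * hb + elt h) * elt f"
      by (simp add: Emb x)
    have "f \<in> frac_ideal (int N)" by (rule frac_ideal_mono[OF _ f]) (auto simp: M_def)
    from J_add[OF ucong_J[OF \<open>elt f * gen l \<approx> _\<close>] J_left[OF elt_J[OF this], of "scal c * hb + elt h"]]
    show ?thesis by simp
  qed
  then show ?thesis by blast
next
  case HInv
  have "elt f * gen l \<in> J N" if f: "f \<in> frac_ideal (int N)" for f
    using J_add[OF ucong_J[OF elt_hi[of f]] J_left[OF elt_J[OF f], of hi]] by (simp add: HInv)
  then show ?thesis by blast
qed

lemma J_right_gen: "\<exists>M\<ge>N. \<forall>x\<in>J M. x * gen l \<in> J N"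
proof -
  obtain M where M: "\<And>f. f \<in> frac_ideal (int M) \<Longrightarrow> elt f * gen l \<in> J N" using letter_J by blast
  have "x * gen l \<in> J N" if "x \<in> J (max M N)" for x
    using that
  proof (induction rule: J_induct)
    case (elt a f)
    then have "elt f * gen l \<in> J N" by (intro M) (auto intro: frac_ideal_mono[of _ "int (max M N)"])
    then show ?case by (simp add: mult.assoc J_left)
  qed (auto simp: distrib_right intro: U_J U_right J_add)
  then show ?thesis by (intro exI[of _ "max M N"]) simp
qed

lemma J_right_word: "\<exists>M\<ge>N. \<forall>x\<in>J M. x * Poly_Mapping.single (MWord w) c \<in> J N"
proof (induction w arbitrary: N rule: rev_induct)
  case Nil
  have "(Poly_Mapping.single (MWord []) c :: ('k, 'K) heis_free) = scal c" by (simp add: scal_def zero_mword_def)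
  moreover have "x * scal c \<in> J N" if "x \<in> J N" for x
    using J_left[OF that, of "scal c"] by (simp add: scal_commute)
  ultimately show ?case by (intro exI[of _ N]) simp
next
  case (snoc l w)
  obtain M1 where M1: "M1 \<ge> N" "\<And>x. x \<in> J M1 \<Longrightarrow> x * gen l \<in> J N" using J_right_gen by blast
  obtain M2 where M2: "M2 \<ge> M1" "\<And>x. x \<in> J M2 \<Longrightarrow> x * Poly_Mapping.single (MWord w) c \<in> J M1"
    using snoc.IH by blast
  have "Poly_Mapping.single (MWord (w @ [l])) c = Poly_Mapping.single (MWord w) c * gen l"
    by (simp add: gen_def mult_single plus_mword_def)
  then show ?case using M1 M2 by (intro exI[of _ M2]) (simp add: mult.assoc[symmetric])
qed

text \<open>Right multiplication by a fixed element is continuous for the filtration by the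
  \<open>J N\<close>, although these are only left ideals. This is what makes \<open>cprod\<close>
  well defined; it follows letter by letter, word by word, and for finitely many words.\<close>

lemma J_right: "\<exists>M\<ge>N. \<forall>x\<in>J M. x * y \<in> J N"
proof -
  have "\<exists>M\<ge>N. \<forall>x\<in>J M. x * (\<Sum>w\<in>A. Poly_Mapping.single w (Poly_Mapping.lookup y w)) \<in> J N" if "finite A" for A
    using that
  proof induction
    case empty
    show ?case by auto
  next
    case (insert w A)
    then obtain M1 where M1: "M1 \<ge> N" "\<And>x. x \<in> J M1 \<Longrightarrow> x * (\<Sum>w\<in>A. Poly_Mapping.single w (Poly_Mapping.lookup y w)) \<in> J N" by blast
    obtain M2 where M2: "M2 \<ge> N" "\<And>x. x \<in> J M2 \<Longrightarrow> x * Poly_Mapping.single w (Poly_Mapping.lookup y w) \<in> J N"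
      using J_right_word[of N "letters w" "Poly_Mapping.lookup y w"] by (auto simp: mword.collapse)
    show ?case
    proof (intro exI[of _ "max M1 M2"] conjI ballI)
      fix x assume "x \<in> J (max M1 M2)"
      then have "x \<in> J M1" "x \<in> J M2" by (auto intro: J_antimono[of _ "max M1 M2"])
      then show "x * (\<Sum>w\<in>insert w A. Poly_Mapping.single w (Poly_Mapping.lookup y w)) \<in> J N"
        using insert.hyps by (simp add: distrib_left J_add M1 M2)
    qed (use M1 in simp)
  qed
  from this[OF finite_keys, of y] show ?thesis by (simp flip: poly_mapping_sum)
qed

subsection \<open>A Fock module\<close>

text \<open>Functions on multisets of natural numbers form a right module over the localized enveloping
  algebra: \<open>t\<^sup>-\<^sup>n\<close> with \<open>n \<ge> 0\<close> is dual to a creation operator, \<open>t\<^sup>n\<close> to an annihilation operator,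
  and \<open>\<hbar>\<close> acts by \<open>1\<close>.  It shows that the left ideals \<open>J N\<close> are not too large.\<close>

definition create :: "'k fls \<Rightarrow> (nat multiset \<Rightarrow> 'k) \<Rightarrow> nat multiset \<Rightarrow> 'k" where
  "create f \<psi> M = (\<Sum>n\<le>nat (- fls_subdegree f). fls_nth f (- int n) * \<psi> (add_mset n M))"

text \<open>The weight n is the pairing of t^(-n) with t^n; the sum over the multiset counts n with
  its multiplicity.\<close>

definition annihilate :: "'k fls \<Rightarrow> (nat multiset \<Rightarrow> 'k) \<Rightarrow> nat multiset \<Rightarrow> 'k" where
  "annihilate f \<psi> M = (\<Sum>n\<in>#M. of_nat n * fls_nth f (int n) * \<psi> (M - {#n#}))"

fun act :: "'K \<Rightarrow> ('k \<times> 'K) letter \<Rightarrow> (nat multiset \<Rightarrow> 'k) \<Rightarrow> nat multiset \<Rightarrow> 'k" where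
  "act t (Emb (c, f)) \<psi> M = c * \<psi> M + create (expansion t f) \<psi> M - annihilate (expansion t f) \<psi> M"
| "act t HInv \<psi> M = \<psi> M"

lemma create_bound:
  assumes "\<And>n. n > B \<Longrightarrow> fls_nth f (- int n) = 0"
  shows "create f \<psi> M = (\<Sum>n\<le>B. fls_nth f (- int n) * \<psi> (add_mset n M))"
proof -
  have "create f \<psi> M = (\<Sum>n\<le>max B (nat (- fls_subdegree f)). fls_nth f (- int n) * \<psi> (add_mset n M))"
    unfolding create_def by (rule sum.mono_neutral_left) auto
  also have "\<dots> = (\<Sum>n\<le>B. fls_nth f (- int n) * \<psi> (add_mset n M))"
    by (rule sum.mono_neutral_right) (use assms in auto)
  finally show ?thesis .
qed

lemma neg_bound: "\<exists>B. \<forall>n>B. fls_nth f (- int n) = 0 \<and> fls_nth g (- int n) = 0"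
  by (intro exI[of _ "nat (max (- fls_subdegree f) (- fls_subdegree g))"]) auto

lemma create_add: "create (f + g) \<psi> M = create f \<psi> M + create g \<psi> M"
proof -
  obtain B where B: "\<forall>n>B. fls_nth f (- int n) = 0 \<and> fls_nth g (- int n) = 0" using neg_bound by blast
  show ?thesis
    by (subst (1 2 3) create_bound[of B]) (use B in \<open>auto simp: ring_distribs sum.distrib\<close>)
qed

lemma create_scale: "create (fls_const c * f) \<psi> M = c * create f \<psi> M"
  by (subst (1 2) create_bound[of "nat (- fls_subdegree f)"]) (auto simp: sum_distrib_left mult_ac)

lemma annihilate_add: "annihilate (f + g) \<psi> M = annihilate f \<psi> M + annihilate g \<psi> M"
  by (simp add: annihilate_def ring_distribs sum_mset.distrib)

lemma annihilate_scale: "annihilate (fls_const c * f) \<psi> M = c * annihilate f \<psi> M"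
  by (simp add: annihilate_def sum_mset_distrib_left mult_ac)

lemma sum_mset_diff: "(\<Sum>n\<in>#M. F n - G n) = (\<Sum>n\<in>#M. F n) - (\<Sum>n\<in>#M. G n :: 'k)"
  by (induction M) (simp_all add: algebra_simps)

lemma sum_mset_remove: "n \<in># M \<Longrightarrow> (\<Sum>m\<in>#M - {#n#}. G m) = (\<Sum>m\<in>#M. G m) - (G n :: 'k)"
  by (auto dest!: multi_member_split)

lemma create_commute: "create g (create f \<psi>) M = create f (create g \<psi>) M"
proof -
  have "create g (create f \<psi>) M = (\<Sum>n\<le>nat (- fls_subdegree g). \<Sum>m\<le>nat (- fls_subdegree f).
      fls_nth g (- int n) * (fls_nth f (- int m) * \<psi> (add_mset m (add_mset n M))))"
    by (simp add: create_def sum_distrib_left)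
  also have "\<dots> = create f (create g \<psi>) M"
    by (subst sum.swap) (simp add: create_def sum_distrib_left mult_ac add_mset_commute)
  finally show ?thesis .
qed

text \<open>Removing two elements in succession is a sum over ordered pairs minus its diagonal, and
  both are symmetric in the two removals.\<close>

lemma annihilate_commute: "annihilate g (annihilate f \<psi>) M = annihilate f (annihilate g \<psi>) M"
proof -
  define F where "F f g n m = (of_nat n * fls_nth g (int n)) * (of_nat m * fls_nth f (int m) * \<psi> (M - {#n#} - {#m#}))" for f g n m
  have *: "annihilate g (annihilate f \<psi>) M = (\<Sum>n\<in>#M. \<Sum>m\<in>#M. F f g n m) - (\<Sum>n\<in>#M. F f g n n)" for f g
  proof -
    have "annihilate g (annihilate f \<psi>) M = (\<Sum>n\<in>#M. \<Sum>m\<in>#M - {#n#}. F f g n m)"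
      by (simp add: annihilate_def F_def sum_mset_distrib_left)
    also have "\<dots> = (\<Sum>n\<in>#M. (\<Sum>m\<in>#M. F f g n m) - F f g n n)"
      by (intro arg_cong[of _ _ sum_mset] image_mset_cong) (simp add: sum_mset_remove)
    also have "\<dots> = (\<Sum>n\<in>#M. \<Sum>m\<in>#M. F f g n m) - (\<Sum>n\<in>#M. F f g n n)"
      by (rule sum_mset_diff)
    finally show ?thesis .
  qed
  have "F f g n m = F g f m n" for n m
    by (simp add: F_def mult_ac diff_right_commute add_mset_commute)
  note sym = this
  have "(\<Sum>n\<in>#M. \<Sum>m\<in>#M. F f g n m) = (\<Sum>m\<in>#M. \<Sum>n\<in>#M. F g f m n)"
    by (subst sum_mset.swap) (simp only: sym)
  then show ?thesis by (simp only: *) (simp only: sym)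
qed

text \<open>After n has been added, the removed element is either that n, which gives the scalar
  term, or an element of M, which gives the operators in the other order.\<close>

lemma create_annihilate:
  assumes "\<And>n. n > B \<Longrightarrow> fls_nth g (- int n) = 0"
  shows "create g (annihilate f \<psi>) M = annihilate f (create g \<psi>) M + (\<Sum>n\<le>B. of_nat n * fls_nth f (int n) * fls_nth g (- int n)) * \<psi> M"
proof -
  have "create g (annihilate f \<psi>) M = (\<Sum>n\<le>B. fls_nth g (- int n) *
      (of_nat n * fls_nth f (int n) * \<psi> M + (\<Sum>m\<in>#M. of_nat m * fls_nth f (int m) * \<psi> (add_mset n (M - {#m#})))))"
  proof -
    have "annihilate f \<psi> (add_mset n M) = of_nat n * fls_nth f (int n) * \<psi> M +
        (\<Sum>m\<in>#M. of_nat m * fls_nth f (int m) * \<psi> (add_mset n (M - {#m#})))" for n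
    proof -
      have "(\<Sum>m\<in>#M. of_nat m * fls_nth f (int m) * \<psi> (add_mset n M - {#m#})) =
          (\<Sum>m\<in>#M. of_nat m * fls_nth f (int m) * \<psi> (add_mset n (M - {#m#})))"
        by (intro arg_cong[of _ _ sum_mset] image_mset_cong) (auto simp: insert_DiffM2 dest!: multi_member_split)
      then show ?thesis by (simp add: annihilate_def)
    qed
    then show ?thesis by (subst create_bound[of B]) (use assms in auto)
  qed
  also have "\<dots> = (\<Sum>n\<le>B. of_nat n * fls_nth f (int n) * fls_nth g (- int n)) * \<psi> M +
      (\<Sum>n\<le>B. \<Sum>m\<in>#M. of_nat m * fls_nth f (int m) * (fls_nth g (- int n) * \<psi> (add_mset n (M - {#m#}))))"
    by (simp add: distrib_left sum.distrib sum_distrib_left sum_mset_distrib_left mult_ac)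
  also have "(\<Sum>n\<le>B. \<Sum>m\<in>#M. of_nat m * fls_nth f (int m) * (fls_nth g (- int n) * \<psi> (add_mset n (M - {#m#})))) =
      annihilate f (create g \<psi>) M"
  proof -
    have sw: "(\<Sum>n\<le>B. \<Sum>m\<in>#M. H n m) = (\<Sum>m\<in>#M. \<Sum>n\<le>B. H n m)" for H :: "nat \<Rightarrow> nat \<Rightarrow> 'k"
      by (induction M) (simp_all add: sum.distrib)
    have "create g \<psi> K = (\<Sum>n\<le>B. fls_nth g (- int n) * \<psi> (add_mset n K))" for K
      by (rule create_bound) (use assms in auto)
    then show ?thesis by (simp add: sw annihilate_def sum_distrib_left)
  qed
  finally show ?thesis by simp
qed

lemma act_linear: "act t l (\<lambda>M. \<psi> M + c * \<chi> M) M = act t l \<psi> M + c * act t l \<chi> M"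
proof (cases l)
  case (Emb x)
  have "(\<Sum>n\<in>#A. F n + c * G n) = (\<Sum>n\<in>#A. F n) + c * (\<Sum>n\<in>#A. G n :: 'k)" for A :: "nat multiset" and F G
    by (induction A) (simp_all add: algebra_simps)
  then have "annihilate f (\<lambda>M. \<psi> M + c * \<chi> M) M = annihilate f \<psi> M + c * annihilate f \<chi> M" for f
    by (simp add: annihilate_def distrib_left mult.left_commute[of _ c])
  moreover have "create f (\<lambda>M. \<psi> M + c * \<chi> M) M = create f \<psi> M + c * create f \<chi> M" for f
    by (simp add: create_def distrib_left sum.distrib sum_distrib_left mult_ac)
  ultimately show ?thesis by (cases x) (simp add: Emb algebra_simps)
qed simp

lemma fls_times_nth_bounds:
  fixes F G :: "'k fls"
  assumes "\<And>k. k < a \<Longrightarrow> fls_nth F k = 0" "\<And>k. k > b \<Longrightarrow> fls_nth G (n - k) = 0"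
  shows "fls_nth (F * G) n = (\<Sum>k\<in>{a..b}. fls_nth F k * fls_nth G (n - k))"
proof -
  have "fls_nth (F * G) n = (\<Sum>k\<in>{fls_subdegree F..n - fls_subdegree G}. fls_nth F k * fls_nth G (n - k))"
    by (rule fls_times_nth(2))
  also have "\<dots> = (\<Sum>k\<in>{min a (fls_subdegree F)..max b (n - fls_subdegree G)}. fls_nth F k * fls_nth G (n - k))"
    by (rule sum.mono_neutral_left) auto
  also have "\<dots> = (\<Sum>k\<in>{a..b}. fls_nth F k * fls_nth G (n - k))"
    by (rule sum.mono_neutral_right) (use assms in \<open>auto simp: not_le\<close>)
  finally show ?thesis .
qed

lemma res_pairing_coeffs:
  assumes t: "uniformizer \<O> t"
    and B: "\<And>n. n > B \<Longrightarrow> fls_nth (expansion t f) (- int n) = 0 \<and> fls_nth (expansion t g) (- int n) = 0"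
  shows "res_pairing f g = (\<Sum>n\<le>B. of_nat n * fls_nth (expansion t g) (int n) * fls_nth (expansion t f) (- int n))
     - (\<Sum>n\<le>B. of_nat n * fls_nth (expansion t f) (int n) * fls_nth (expansion t g) (- int n))"
proof -
  let ?f = "expansion t f" and ?g = "expansion t g"
  have "fls_nth (?f * fls_deriv ?g) (-1) = (\<Sum>k\<in>{- int B..int B}. fls_nth ?f k * fls_nth (fls_deriv ?g) (- 1 - k))"
  proof (rule fls_times_nth_bounds)
    show "fls_nth ?f k = 0" if "k < - int B" for k using B[of "nat (- k)"] that by simp
    show "fls_nth (fls_deriv ?g) (- 1 - k) = 0" if "k > int B" for k using B[of "nat k"] that by simp
  qed
  also have "\<dots> = (\<Sum>k\<in>{- int B..int B}. of_int (- k) * (fls_nth ?f k * fls_nth ?g (- k)))"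
    by (simp add: mult_ac)
  also have "\<dots> = (\<Sum>k\<in>{- int B..-1} \<union> {0..int B}. of_int (- k) * (fls_nth ?f k * fls_nth ?g (- k)))"
    by (rule sum.cong) auto
  also have "\<dots> = (\<Sum>k\<in>{- int B..-1}. of_int (- k) * (fls_nth ?f k * fls_nth ?g (- k))) +
      (\<Sum>k\<in>{0..int B}. of_int (- k) * (fls_nth ?f k * fls_nth ?g (- k)))"
    by (rule sum.union_disjoint) auto
  also have "(\<Sum>k\<in>{- int B..-1}. of_int (- k) * (fls_nth ?f k * fls_nth ?g (- k))) =
      (\<Sum>n\<in>{1..B}. of_nat n * (fls_nth ?f (- int n) * fls_nth ?g (int n)))"
    by (rule sum.reindex_bij_witness[of _ "\<lambda>n. - int n" "\<lambda>k. nat (- k)"]) auto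
  also have "\<dots> = (\<Sum>n\<le>B. of_nat n * fls_nth ?g (int n) * fls_nth ?f (- int n))"
    by (rule sum.mono_neutral_cong_left) (auto simp: mult_ac not_le Suc_le_eq)
  also have "(\<Sum>k\<in>{0..int B}. of_int (- k) * (fls_nth ?f k * fls_nth ?g (- k))) =
      - (\<Sum>n\<le>B. of_nat n * fls_nth ?f (int n) * fls_nth ?g (- int n))"
    unfolding sum_negf[symmetric]
    by (rule sum.reindex_bij_witness[of _ int nat]) auto
  finally show ?thesis using t by (simp add: res_pairing_eq[OF t] resid_def)
qed

text \<open>In a right module the product of x and y acts by x first, so the left side is the action
  of the bracket of x with y.\<close>

lemma act_commute:
  assumes t: "uniformizer \<O> t"
  shows "act t (Emb y) (act t (Emb x) \<psi>) M - act t (Emb x) (act t (Emb y) \<psi>) M = res_pairing (snd x) (snd y) * \<psi> M"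
proof -
  obtain c f where x: "x = (c, f)" by (cases x)
  obtain d g where y: "y = (d, g)" by (cases y)
  let ?f = "expansion t f" and ?g = "expansion t g"
  obtain B where B: "\<And>n. n > B \<Longrightarrow> fls_nth ?f (- int n) = 0 \<and> fls_nth ?g (- int n) = 0" using neg_bound by blast
  have lin: "create h (act t (Emb (c, f)) \<psi>) M = c * create h \<psi> M + create h (create (expansion t f) \<psi>) M - create h (annihilate (expansion t f) \<psi>) M"
    "annihilate h (act t (Emb (c, f)) \<psi>) M = c * annihilate h \<psi> M + annihilate h (create (expansion t f) \<psi>) M - annihilate h (annihilate (expansion t f) \<psi>) M"
    for h c f M
  proof -
    have "act t (Emb (c, f)) \<psi> = (\<lambda>M. (c * \<psi> M + create (expansion t f) \<psi> M) - annihilate (expansion t f) \<psi> M)"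
      by (rule ext) simp
    then show "create h (act t (Emb (c, f)) \<psi>) M = c * create h \<psi> M + create h (create (expansion t f) \<psi>) M - create h (annihilate (expansion t f) \<psi>) M"
      by (simp add: create_def sum_distrib_left sum.distrib algebra_simps sum_subtractf)
    show "annihilate h (act t (Emb (c, f)) \<psi>) M = c * annihilate h \<psi> M + annihilate h (create (expansion t f) \<psi>) M - annihilate h (annihilate (expansion t f) \<psi>) M"
      using \<open>act t (Emb (c, f)) \<psi> = _\<close>
      by (simp add: annihilate_def sum_mset_distrib_left sum_mset.distrib algebra_simps sum_mset_diff)
  qed
  have "create ?g (annihilate ?f \<psi>) M = annihilate ?f (create ?g \<psi>) M + (\<Sum>n\<le>B. of_nat n * fls_nth ?f (int n) * fls_nth ?g (- int n)) * \<psi> M"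
    "create ?f (annihilate ?g \<psi>) M = annihilate ?g (create ?f \<psi>) M + (\<Sum>n\<le>B. of_nat n * fls_nth ?g (int n) * fls_nth ?f (- int n)) * \<psi> M"
    by (intro create_annihilate; use B in auto)+
  then show ?thesis
    unfolding x y act.simps lin
    by (simp add: res_pairing_coeffs[OF t B] create_commute[of ?g] annihilate_commute[of ?g] algebra_simps)
qed

definition word_act :: "'K \<Rightarrow> ('k \<times> 'K) letter list \<Rightarrow> (nat multiset \<Rightarrow> 'k) \<Rightarrow> nat multiset \<Rightarrow> 'k" where
  "word_act t w \<psi> = foldl (\<lambda>\<chi> l. act t l \<chi>) \<psi> w"

definition rep :: "'K \<Rightarrow> ('k, 'K) heis_free \<Rightarrow> (nat multiset \<Rightarrow> 'k) \<Rightarrow> nat multiset \<Rightarrow> 'k" where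
  "rep t p \<psi> M = (\<Sum>w\<in>Poly_Mapping.keys p. Poly_Mapping.lookup p w * word_act t (letters w) \<psi> M)"

lemma rep_superset:
  "finite A \<Longrightarrow> Poly_Mapping.keys p \<subseteq> A \<Longrightarrow>
    rep t p \<psi> M = (\<Sum>w\<in>A. Poly_Mapping.lookup p w * word_act t (letters w) \<psi> M)"
  unfolding rep_def by (rule sum.mono_neutral_left) (auto simp: in_keys_iff)

lemma rep_add: "rep t (p + q) \<psi> M = rep t p \<psi> M + rep t q \<psi> M"
  using keys_add[of p q]
  by (subst (1 2 3) rep_superset[of "Poly_Mapping.keys p \<union> Poly_Mapping.keys q"])
    (auto simp: lookup_add distrib_right sum.distrib)

lemma rep_0 [simp]: "rep t 0 \<psi> M = 0"
  by (simp add: rep_def)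

lemma rep_single: "rep t (Poly_Mapping.single w c) \<psi> M = c * word_act t (letters w) \<psi> M"
  by (subst rep_superset[of "{w}"]) auto

lemma rep_sum: "rep t (sum f A) \<psi> M = (\<Sum>i\<in>A. rep t (f i) \<psi> M)"
  by (induction A rule: infinite_finite_induct) (auto simp: rep_add)

lemma rep_minus: "rep t (- p) \<psi> M = - rep t p \<psi> M"
  using rep_add[of t p "- p" \<psi> M] by (simp add: eq_neg_iff_add_eq_0 add.commute)

lemma rep_diff: "rep t (p - q) \<psi> M = rep t p \<psi> M - rep t q \<psi> M"
  using rep_add[of t p "- q" \<psi> M] by (simp add: rep_minus)

lemma word_act_snoc: "word_act t (w @ [l]) \<psi> = act t l (word_act t w \<psi>)"
  by (simp add: word_act_def)

lemma word_act_append: "word_act t (v @ w) \<psi> = word_act t w (word_act t v \<psi>)"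
  by (simp add: word_act_def)

lemma act_0: "act t l (\<lambda>M. 0) M = 0"
  by (cases "(t, l, \<lambda>M :: nat multiset. 0 :: 'k, M)" rule: act.cases) (auto simp: create_def annihilate_def)

lemma word_act_linear: "word_act t w (\<lambda>M. \<psi> M + c * \<chi> M) M = word_act t w \<psi> M + c * word_act t w \<chi> M"
proof (induction w arbitrary: M rule: rev_induct)
  case (snoc l w)
  then have "word_act t w (\<lambda>M. \<psi> M + c * \<chi> M) = (\<lambda>M. word_act t w \<psi> M + c * word_act t w \<chi> M)" by blast
  then show ?case by (simp add: word_act_snoc act_linear)
qed (simp add: word_act_def)

lemma word_act_0: "word_act t w (\<lambda>M. 0) M = 0"
  using word_act_linear[of t w "\<lambda>M. 0" "- 1" "\<lambda>M. 0" M] by simp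

lemma word_act_sum:
  "finite A \<Longrightarrow> word_act t w (\<lambda>M. \<Sum>i\<in>A. c i * \<psi> i M) M = (\<Sum>i\<in>A. c i * word_act t w (\<psi> i) M)"
proof (induction A rule: finite_induct)
  case empty
  show ?case by (simp add: word_act_0)
next
  case (insert x A)
  then show ?case using word_act_linear[of t w "\<lambda>M. \<Sum>i\<in>A. c i * \<psi> i M" "c x" "\<psi> x" M]
    by (simp add: add.commute)
qed

lemma rep_mult: "rep t (p * q) \<psi> M = rep t q (rep t p \<psi>) M"
proof -
  let ?c = "Poly_Mapping.lookup p" and ?d = "Poly_Mapping.lookup q"
  have "rep t (p * q) \<psi> M = rep t ((\<Sum>v\<in>Poly_Mapping.keys p. Poly_Mapping.single v (?c v)) *
      (\<Sum>w\<in>Poly_Mapping.keys q. Poly_Mapping.single w (?d w))) \<psi> M"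
    by (simp flip: poly_mapping_sum)
  also have "\<dots> = (\<Sum>v\<in>Poly_Mapping.keys p. \<Sum>w\<in>Poly_Mapping.keys q.
      ?c v * ?d w * word_act t (letters w) (word_act t (letters v) \<psi>) M)"
    unfolding sum_distrib_right sum_distrib_left
    by (simp add: rep_sum mult_single rep_single plus_mword_def word_act_append) (rule sum.swap)
  also have "\<dots> = (\<Sum>w\<in>Poly_Mapping.keys q. ?d w *
      (\<Sum>v\<in>Poly_Mapping.keys p. ?c v * word_act t (letters w) (word_act t (letters v) \<psi>) M))"
    by (subst sum.swap) (simp add: sum_distrib_left mult_ac)
  also have "\<dots> = (\<Sum>w\<in>Poly_Mapping.keys q. ?d w *
      word_act t (letters w) (\<lambda>M. \<Sum>v\<in>Poly_Mapping.keys p. ?c v * word_act t (letters v) \<psi> M) M)"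
    by (simp add: word_act_sum)
  also have "(\<lambda>M. \<Sum>v\<in>Poly_Mapping.keys p. ?c v * word_act t (letters v) \<psi> M) = rep t p \<psi>"
    by (rule ext) (simp add: rep_def)
  finally show ?thesis by (simp only: rep_def[of t q])
qed

lemma rep_gen: "rep t (gen l) \<psi> M = act t l \<psi> M"
  by (simp add: gen_def rep_single word_act_def)

lemma rep_scal: "rep t (scal c) \<psi> M = c * \<psi> M"
  by (simp add: scal_def rep_single word_act_def zero_mword_def)

lemma rep_zero_arg: "rep t p (\<lambda>M. 0) M = 0"
  by (simp add: rep_def word_act_0)

lemma rep_relations:
  assumes t: "uniformizer \<O> t" and s: "s \<in> envelope_relations \<union> localization_relations"
  shows "rep t s \<psi> M = 0"
proof -
  have e0: "create 0 \<psi> M = 0" "annihilate 0 \<psi> M = 0" for \<psi> M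
    by (simp_all add: create_def annihilate_def)
  consider (add) x y where "s = gen (Emb (x + y)) - gen (Emb x) - gen (Emb y)"
    | (scale) c x where "s = gen (Emb (heis_scale c x)) - scal c * gen (Emb x)"
    | (comm) x y where "s = gen (Emb x) * gen (Emb y) - gen (Emb y) * gen (Emb x) - gen (Emb (heis_bracket x y))"
    | (hb) "s = hb * hi - 1" | (hi) "s = hi * hb - 1"
    using s unfolding envelope_relations_def localization_relations_def by blast
  then show ?thesis
  proof cases
    case add
    show ?thesis unfolding add rep_diff rep_gen using t
      by (cases x; cases y) (simp add: create_add annihilate_add algebra_simps)
  next
    case scale
    have "rep t (scal c) \<psi> = (\<lambda>M. 0 + c * \<psi> M)" by (rule ext) (simp add: rep_scal)
    then have "rep t (scal c * gen (Emb x)) \<psi> M = c * act t (Emb x) \<psi> M"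
      using act_linear[of t "Emb x" "\<lambda>_. 0" c \<psi> M] by (simp add: rep_mult rep_gen act_0)
    then show ?thesis unfolding scale rep_diff rep_gen using t
      by (cases x) (simp add: heis_scale_def create_scale annihilate_scale algebra_simps)
  next
    case comm
    have "rep t (gen l) \<psi> = act t l \<psi>" for l by (rule ext) (rule rep_gen)
    then show ?thesis using t comm act_commute[OF t, of y x \<psi> M]
      by (simp add: rep_diff rep_mult rep_gen heis_bracket_def e0)
  next
    case hb
    have g: "rep t (gen l) \<psi> = act t l \<psi>" for l \<psi> by (rule ext) (rule rep_gen)
    have "act t (Emb hbar) \<psi> = \<psi>" by (rule ext) (simp add: hbar_def t e0)
    then show ?thesis using hb rep_scal[of t 1 \<psi> M] by (simp add: rep_diff rep_mult g scal_simps)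
  next
    case hi
    have g: "rep t (gen l) \<psi> = act t l \<psi>" for l \<psi> by (rule ext) (rule rep_gen)
    have "act t HInv \<psi> = \<psi>" by (rule ext) simp
    then show ?thesis using hi rep_scal[of t 1 \<psi> M] by (simp add: rep_diff rep_mult g scal_simps hbar_def t e0)
  qed
qed

lemma rep_U_ideal:
  assumes t: "uniformizer \<O> t" and x: "x \<in> U_ideal"
  shows "rep t x \<psi> M = 0"
  using x unfolding U_ideal_def
proof (induction arbitrary: \<psi> M rule: two_sided_ideal.induct)
  case (3 s a b)
  have "rep t s \<chi> = (\<lambda>M. 0)" for \<chi> by (rule ext) (rule rep_relations[OF t 3])
  then have "rep t (a * s) \<psi> = (\<lambda>M. 0)" by (intro ext) (simp add: rep_mult)
  then show ?case by (simp add: rep_mult[of t "a * s"] rep_zero_arg)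
qed (simp_all add: rep_add)

text \<open>The last factor \<open>elt f\<close> has only coefficients of exponent at least N. With
  N > 0 it adds no element, and it can remove only elements that are at least N, which M does not
  contain. The factors to its left merely change the function it acts on.\<close>

lemma rep_J:
  assumes t: "uniformizer \<O> t" and x: "x \<in> J N" and M: "\<And>n. n \<in># M \<Longrightarrow> n < N" and N: "N > 0"
  shows "rep t x \<psi> M = 0"
  using x
proof (induction rule: J_induct)
  case (elt a f)
  have f: "fls_nth (expansion t f) n = 0" if "n < int N" for n
    using elt that by (simp add: expansion_mem[OF t])
  have "create (expansion t f) \<chi> M = 0" for \<chi>
    unfolding create_def using f N by (intro sum.neutral) auto
  moreover have "annihilate (expansion t f) \<chi> M = 0" for \<chi>
  proof -
    have "image_mset (\<lambda>n. of_nat n * fls_nth (expansion t f) (int n) * \<chi> (M - {#n#})) M = image_mset (\<lambda>n. 0) M"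
      using f M by (intro image_mset_cong) auto
    then show ?thesis unfolding annihilate_def by (simp only: sum_mset.neutral_const)
  qed
  ultimately show ?case by (simp add: rep_mult elt_def rep_gen)
qed (simp_all add: rep_U_ideal[OF t] rep_add)

lemma scal_J:
  assumes "scal c \<in> J N" "N > 0" shows "c = 0"
proof -
  obtain t where t: "uniformizer \<O> t" using ex_uniformizer by blast
  show ?thesis using rep_J[OF t assms(1), of "{#}" "\<lambda>_. 1"] assms(2) by (simp add: rep_scal)
qed

text \<open>Indicator functions separate the coefficients: one located at a singleton and evaluated
  at the empty multiset reads off a coefficient of nonpositive exponent, and the reverse reads off n
  times a coefficient of positive exponent n.\<close>

lemma elt_J_zero:
  assumes "\<And>N. elt f \<in> J N"
  shows "f = 0"
proof -
  obtain t where t: "uniformizer \<O> t" using ex_uniformizer by blast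
  let ?s = "expansion t f"
  have r: "rep t (elt f) \<psi> M = create ?s \<psi> M - annihilate ?s \<psi> M" for \<psi> M
    by (simp add: elt_def rep_gen)
  have 0: "rep t (elt f) \<psi> M = 0" for \<psi> M
  proof (rule rep_J[OF t assms])
    show "n < Suc (Max (insert 0 (set_mset M)))" if "n \<in># M" for n
      using that by (simp add: less_Suc_eq_le Max_ge)
  qed simp
  have "fls_nth ?s n = 0" for n
  proof (cases "n \<le> 0")
    case True
    define k where "k = nat (- n)"
    have "create ?s (\<lambda>M. if M = {#k#} then 1 else 0) {#} = fls_nth ?s (- int k)"
      by (subst create_bound[of "max k (nat (- fls_subdegree ?s))"]) (auto simp: if_distrib[of "(*) _"] cong: if_cong)
    also have "- int k = n" using True by (simp add: k_def)
    finally show ?thesis using r[of "\<lambda>M. if M = {#k#} then 1 else 0" "{#}"] 0 by (simp add: annihilate_def)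
  next
    case False
    define k where "k = nat n"
    have "create ?s (\<lambda>M. if M = {#} then 1 else 0) {#k#} = 0" by (simp add: create_def)
    then show ?thesis
      using r[of "\<lambda>M. if M = {#} then 1 else 0" "{#k#}"] 0 False by (simp add: annihilate_def k_def)
  qed
  then have "?s = 0" by (intro fls_zero_eqI)
  then show ?thesis using t by simp
qed

text \<open>The matrix coefficient at the empty multiset. It vanishes on \<open>J N\<close> for N >
  0 and is the identity on scalars, so it identifies a scalar known only modulo such an ideal. It
  depends on t through the splitting of K into negative powers of t and \<O>.\<close>

definition vacuum :: "'K \<Rightarrow> ('k, 'K) heis_free \<Rightarrow> 'k" where
  "vacuum t x = rep t x (\<lambda>M. if M = {#} then 1 else 0) {#}"

lemma vacuum_J: "uniformizer \<O> t \<Longrightarrow> x \<in> J N \<Longrightarrow> N > 0 \<Longrightarrow> vacuum t x = 0"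
  unfolding vacuum_def by (rule rep_J) auto

lemma vacuum_add: "vacuum t (x + y) = vacuum t x + vacuum t y"
  and vacuum_diff: "vacuum t (x - y) = vacuum t x - vacuum t y"
  and vacuum_sum: "vacuum t (sum f A) = (\<Sum>i\<in>A. vacuum t (f i))"
  and vacuum_scal: "vacuum t (scal c) = c"
  by (simp_all add: vacuum_def rep_add rep_diff rep_sum rep_scal)

lemma vacuum_scal_mult: "vacuum t (scal c * x) = c * vacuum t x"
  unfolding scal_commute vacuum_def rep_mult rep_scal ..

text \<open>The value is the pairing of the regular part of f with the polar part of g, that is, the
  scalar subtracted by normal ordering for the standard splitting.\<close>

lemma vacuum_quadratic:
  assumes t: "uniformizer \<O> t" and B: "\<And>n. n > B \<Longrightarrow> fls_nth (expansion t g) (- int n) = 0"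
  shows "vacuum t (hi * elt f * elt g) = - (\<Sum>n\<le>B. of_nat n * fls_nth (expansion t f) (int n) * fls_nth (expansion t g) (- int n))"
proof -
  let ?\<psi> = "\<lambda>M :: nat multiset. if M = {#} then 1 else 0 :: 'k"
  have g: "rep t (gen l) \<psi> = act t l \<psi>" for l \<psi> by (rule ext) (rule rep_gen)
  have h: "act t HInv ?\<psi> = ?\<psi>" by (rule ext) simp
  have c: "create (expansion t f) ?\<psi> M = 0" for M by (simp add: create_def)
  have "act t (Emb (0, f)) ?\<psi> = (\<lambda>M. - annihilate (expansion t f) ?\<psi> M)"
    by (rule ext) (simp add: c)
  then have "vacuum t (hi * elt f * elt g) = create (expansion t g) (\<lambda>M. - annihilate (expansion t f) ?\<psi> M) {#}"
    unfolding vacuum_def rep_mult elt_def g h by (simp add: annihilate_def)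
  also have "\<dots> = (\<Sum>n\<le>B. fls_nth (expansion t g) (- int n) * - annihilate (expansion t f) ?\<psi> {#n#})"
    by (rule create_bound) (use B in auto)
  also have "\<dots> = - (\<Sum>n\<le>B. of_nat n * fls_nth (expansion t f) (int n) * fls_nth (expansion t g) (- int n))"
    by (simp add: annihilate_def sum_negf mult_ac)
  finally show ?thesis .
qed

subsection \<open>Quadratic elements\<close>

definition Q :: "'K \<Rightarrow> 'K \<Rightarrow> ('k, 'K) heis_free" where
  "Q f g = hi * elt f * elt g"

lemma Q_add_left: "Q (f + f') g \<approx> Q f g + Q f' g"
  using ucong_right[OF ucong_left[OF elt_add[of f f'], of hi], of "elt g"] by (simp add: Q_def algebra_simps)

lemma Q_scale_left: "Q (\<iota> c * f) g \<approx> scal c * Q f g"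
  using ucong_right[OF ucong_left[OF elt_scale[of c f], of hi], of "elt g"]
  by (simp add: Q_def scal_left_commute mult.assoc)

lemma Q_scale_right: "Q f (\<iota> c * g) \<approx> scal c * Q f g"
  using ucong_left[OF elt_scale[of c g], of "hi * elt f"]
  by (simp add: Q_def scal_left_commute mult.assoc)

lemma Q_diff_left: "Q (f - f') g \<approx> Q f g - Q f' g"
  using ucong_right[OF ucong_left[OF elt_diff[of f f'], of hi], of "elt g"] by (simp add: Q_def algebra_simps)

lemma Q_diff_right: "Q f (g - g') \<approx> Q f g - Q f g'"
  using ucong_left[OF elt_diff[of g g'], of "hi * elt f"] by (simp add: Q_def algebra_simps)

lemma Q_sum_left: "Q (sum f A) g \<approx> (\<Sum>i\<in>A. Q (f i) g)"
  using ucong_right[OF ucong_left[OF elt_sum[of f A], of hi], of "elt g"]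
  by (simp add: Q_def sum_distrib_left sum_distrib_right)

lemma Q_sum_right: "Q f (sum g A) \<approx> (\<Sum>i\<in>A. Q f (g i))"
  using ucong_left[OF elt_sum[of g A], of "hi * elt f"] by (simp add: Q_def sum_distrib_left)

lemma Q_swap: "Q f g \<approx> Q g f + scal (res_pairing f g)"
proof -
  have "Q f g \<approx> hi * (elt g * elt f + scal (res_pairing f g) * hb)"
    unfolding Q_def mult.assoc by (intro ucong_left elt_commutator)
  also have "\<dots> = Q g f + scal (res_pairing f g) * (hi * hb)"
    by (simp add: Q_def distrib_left mult.assoc scal_left_commute)
  also have "\<dots> \<approx> Q g f + scal (res_pairing f g) * 1"
    by (intro ucong_add ucong_left hi_hb ucong_refl)
  finally show ?thesis by simp
qed

lemma Q_elt_bracket: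
  "Q f g * elt h - elt h * Q f g \<approx> scal (res_pairing g h) * elt f + scal (res_pairing f h) * elt g"
proof -
  let ?s = "scal (res_pairing f h)" and ?r = "scal (res_pairing g h)"
  have "Q f g * elt h = hi * elt f * (elt g * elt h)" by (simp add: Q_def mult.assoc)
  also have "\<dots> \<approx> hi * elt f * (elt h * elt g + ?r * hb)" by (intro ucong_left elt_commutator)
  also have "\<dots> = hi * (elt f * elt h) * elt g + ?r * (hi * (elt f * hb))"
    by (simp add: distrib_left mult.assoc scal_left_commute)
  also have "\<dots> \<approx> hi * (elt h * elt f + ?s * hb) * elt g + ?r * (hi * (hb * elt f))"
    unfolding elt_def by (intro ucong_add ucong_left ucong_right hb_commute elt_commutator[unfolded elt_def])
  also have "\<dots> = (hi * elt h) * elt f * elt g + (?s * (hi * hb * elt g) + ?r * (hi * hb * elt f))"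
    by (simp add: distrib_left distrib_right mult.assoc scal_left_commute add.assoc)
  also have "\<dots> \<approx> (elt h * hi) * elt f * elt g + (?s * (1 * elt g) + ?r * (1 * elt f))"
    by (intro ucong_add ucong_left ucong_right hi_hb ucong_sym[OF elt_hi])
  finally have "Q f g * elt h \<approx> elt h * Q f g + (?s * elt g + ?r * elt f)" by (simp add: Q_def mult.assoc)
  from ucong_diff[OF this ucong_refl[of "elt h * Q f g"]] show ?thesis by (simp add: add.commute)
qed

text \<open>The commutator with X is a derivation; X commutes with the inverse of \<hbar>, so only
  the two linear factors contribute.\<close>

lemma derivation_Q:
  assumes "X * hi \<approx> hi * X" "X * elt f - elt f * X \<approx> elt a" "X * elt g - elt g * X \<approx> elt b"
  shows "X * Q f g - Q f g * X \<approx> Q a g + Q f b"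
proof -
  have f: "X * elt f \<approx> elt f * X + elt a" using ucong_add[OF ucong_refl[of "elt f * X"] assms(2)] by simp
  have g: "X * elt g \<approx> elt g * X + elt b" using ucong_add[OF ucong_refl[of "elt g * X"] assms(3)] by simp
  have "X * Q f g = X * hi * (elt f * elt g)" by (simp add: Q_def mult.assoc)
  also have "\<dots> \<approx> hi * X * (elt f * elt g)" by (intro ucong_right assms)
  also have "\<dots> = hi * (X * elt f) * elt g" by (simp add: mult.assoc)
  also have "\<dots> \<approx> hi * (elt f * X + elt a) * elt g" by (intro ucong_left ucong_right f)
  also have "\<dots> = hi * elt f * (X * elt g) + Q a g" by (simp add: Q_def distrib_left distrib_right mult.assoc)
  also have "\<dots> \<approx> hi * elt f * (elt g * X + elt b) + Q a g" by (intro ucong_add ucong_left g ucong_refl)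
  also have "\<dots> = Q f g * X + (Q a g + Q f b)" by (simp add: Q_def distrib_left mult.assoc algebra_simps)
  finally show ?thesis using ucong_diff[OF _ ucong_refl[of "Q f g * X"]] by (metis add_diff_cancel_left')
qed

lemma Q_hi: "Q f g * hi \<approx> hi * Q f g"
proof -
  have "Q f g * hi = hi * elt f * (elt g * hi)" by (simp add: Q_def mult.assoc)
  also have "\<dots> \<approx> hi * elt f * (hi * elt g)" by (intro ucong_left elt_hi)
  also have "\<dots> = hi * (elt f * hi) * elt g" by (simp add: mult.assoc)
  also have "\<dots> \<approx> hi * (hi * elt f) * elt g" by (intro ucong_left ucong_right elt_hi)
  finally show ?thesis by (simp add: Q_def mult.assoc)
qed

lemma Q_right_J: "g \<in> frac_ideal (int N) \<Longrightarrow> Q f g \<in> J N"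
  unfolding Q_def by (intro J_left elt_J)

text \<open>A small right factor puts the product into \<open>J N\<close>, a small left factor only
  up to the scalar produced by moving it to the right. These scalars are the reason why the series
  needs normal ordering to converge.\<close>

lemma Q_left_J: "f \<in> frac_ideal (int N) \<Longrightarrow> Q f g - scal (res_pairing f g) \<in> J N"
  using J_add[OF ucong_J[OF Q_swap[of f g]] Q_right_J[of f N g]] by simp

section \<open>Quadratic elements congruent to scalars\<close>

definition scalar_mod :: "nat \<Rightarrow> ('k, 'K) heis_free \<Rightarrow> bool" where
  "scalar_mod N x \<longleftrightarrow> (\<exists>c. x - scal c \<in> J N)"

lemma scalar_mod_J: "x \<in> J N \<Longrightarrow> scalar_mod N x"
  unfolding scalar_mod_def by (intro exI[of _ 0]) (simp add: scal_simps)

lemma scalar_mod_scal [simp]: "scalar_mod N (scal c)"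
  unfolding scalar_mod_def by (intro exI[of _ c]) simp

lemma scalar_mod_add: "scalar_mod N x \<Longrightarrow> scalar_mod N y \<Longrightarrow> scalar_mod N (x + y)"
proof -
  assume "scalar_mod N x" "scalar_mod N y"
  then obtain c d where "x - scal c \<in> J N" "y - scal d \<in> J N" by (auto simp: scalar_mod_def)
  from J_add[OF this] show ?thesis
    unfolding scalar_mod_def by (intro exI[of _ "c + d"]) (simp add: scal_simps algebra_simps)
qed

lemma scalar_mod_scale: "scalar_mod N x \<Longrightarrow> scalar_mod N (scal c * x)"
proof -
  assume "scalar_mod N x"
  then obtain d where "x - scal d \<in> J N" by (auto simp: scalar_mod_def)
  from J_left[OF this, of "scal c"] show ?thesis
    unfolding scalar_mod_def by (intro exI[of _ "c * d"]) (simp add: scal_simps algebra_simps)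
qed

lemma scalar_mod_minus: "scalar_mod N x \<Longrightarrow> scalar_mod N (- x)"
  using scalar_mod_scale[of N x "- 1"] by (simp add: scal_simps)

lemma scalar_mod_diff: "scalar_mod N x \<Longrightarrow> scalar_mod N y \<Longrightarrow> scalar_mod N (x - y)"
  using scalar_mod_add[OF _ scalar_mod_minus, of N x y] by simp

lemma scalar_mod_sum: "(\<And>i. i \<in> A \<Longrightarrow> scalar_mod N (f i)) \<Longrightarrow> scalar_mod N (sum f A)"
proof (induction A rule: infinite_finite_induct)
  case (insert x F)
  then show ?case by (simp add: scalar_mod_add)
qed (simp_all add: scalar_mod_J)

lemma scalar_mod_trans: "scalar_mod N (x - y) \<Longrightarrow> scalar_mod N y \<Longrightarrow> scalar_mod N x"
  using scalar_mod_add[of N "x - y" y] by simp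

lemma ucong_scalar_mod: "x \<approx> y \<Longrightarrow> scalar_mod N (x - y)"
  by (intro scalar_mod_J ucong_J)

text \<open>The hypothesis says that the symmetric part of the tensor vanishes; what is left is
  antisymmetric, hence a sum of commutators.\<close>

lemma quadratic_scalar:
  assumes t: "uniformizer \<O> t" and A: "finite A"
    and H: "\<And>l k. l < int N \<Longrightarrow> k < int N \<Longrightarrow>
      (\<Sum>a\<in>A. u a * (fls_nth (expansion t (f a)) l * fls_nth (expansion t (g a)) k +
                     fls_nth (expansion t (g a)) l * fls_nth (expansion t (f a)) k)) = 0"
  shows "scalar_mod N (\<Sum>a\<in>A. scal (u a) * Q (f a) (g a))"
proof -
  have "\<exists>lo. \<forall>a\<in>A. \<forall>n<lo. fls_nth (expansion t (f a)) n = 0 \<and> fls_nth (expansion t (g a)) n = 0"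
    using A
  proof induction
    case (insert a A)
    then obtain lo where lo: "\<forall>a\<in>A. \<forall>n<lo. fls_nth (expansion t (f a)) n = 0 \<and> fls_nth (expansion t (g a)) n = 0" by blast
    show ?case
      by (intro exI[of _ "min lo (min (fls_subdegree (expansion t (f a))) (fls_subdegree (expansion t (g a))))"])
        (use lo in auto)
  qed simp
  then obtain lo where lo: "\<And>a n. a \<in> A \<Longrightarrow> n < lo \<Longrightarrow> fls_nth (expansion t (f a)) n = 0 \<and> fls_nth (expansion t (g a)) n = 0"
    by blast
  let ?I = "{lo..<int N}"
  define P where "P h = (\<Sum>i\<in>?I. \<iota> (fls_nth (expansion t h) i) * t powi i)" for h
  have P: "h - P h \<in> frac_ideal (int N)" if "\<And>n. n < lo \<Longrightarrow> fls_nth (expansion t h) n = 0" for h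
    unfolding expansion_mem[OF t]
  proof (intro allI impI)
    fix n assume "n < int N"
    have "fls_nth (expansion t (P h)) n = (\<Sum>i\<in>?I. if i = n then fls_nth (expansion t h) n else 0)"
      unfolding P_def expansion_sum[OF t] fls_nth_sum by (rule sum.cong) (use t in auto)
    then show "fls_nth (expansion t (h - P h)) n = 0"
      using that[of n] \<open>n < int N\<close> t by (auto simp: not_le)
  qed
  define b where "b i j = (\<Sum>a\<in>A. u a * fls_nth (expansion t (f a)) i * fls_nth (expansion t (g a)) j)" for i j
  define y where "y = (\<Sum>i\<in>?I. \<Sum>j\<in>?I. scal (b i j) * Q (t powi i) (t powi j))"
  have Qab: "scalar_mod N (Q (f a) (g a) -
      (\<Sum>i\<in>?I. \<Sum>j\<in>?I. scal (fls_nth (expansion t (f a)) i * fls_nth (expansion t (g a)) j) * Q (t powi i) (t powi j)))"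
    if a: "a \<in> A" for a
  proof -
    let ?f = "f a" and ?g = "g a"
    have 1: "Q (P ?f) (P ?g) \<approx>
        (\<Sum>i\<in>?I. \<Sum>j\<in>?I. scal (fls_nth (expansion t ?f) i * fls_nth (expansion t ?g) j) * Q (t powi i) (t powi j))"
    proof -
      have "Q (P ?f) (P ?g) \<approx> (\<Sum>i\<in>?I. Q (\<iota> (fls_nth (expansion t ?f) i) * t powi i) (P ?g))"
        unfolding P_def[of ?f] by (rule Q_sum_left)
      also have "\<dots> \<approx> (\<Sum>i\<in>?I. \<Sum>j\<in>?I. Q (\<iota> (fls_nth (expansion t ?f) i) * t powi i) (\<iota> (fls_nth (expansion t ?g) j) * t powi j))"
        unfolding P_def by (intro ucong_sum Q_sum_right)
      also have "\<dots> \<approx> (\<Sum>i\<in>?I. \<Sum>j\<in>?I. scal (fls_nth (expansion t ?f) i * fls_nth (expansion t ?g) j) * Q (t powi i) (t powi j))"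
      proof (intro ucong_sum)
        fix i j
        have "Q (\<iota> (fls_nth (expansion t ?f) i) * t powi i) (\<iota> (fls_nth (expansion t ?g) j) * t powi j) \<approx>
            scal (fls_nth (expansion t ?f) i) * Q (t powi i) (\<iota> (fls_nth (expansion t ?g) j) * t powi j)"
          by (rule Q_scale_left)
        also have "\<dots> \<approx> scal (fls_nth (expansion t ?f) i) * (scal (fls_nth (expansion t ?g) j) * Q (t powi i) (t powi j))"
          by (intro ucong_left Q_scale_right)
        finally show "Q (\<iota> (fls_nth (expansion t ?f) i) * t powi i) (\<iota> (fls_nth (expansion t ?g) j) * t powi j) \<approx>
            scal (fls_nth (expansion t ?f) i * fls_nth (expansion t ?g) j) * Q (t powi i) (t powi j)"
          by (simp add: scal_simps mult.assoc)
      qed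
      finally show ?thesis .
    qed
    have "scalar_mod N (Q ?f ?g - Q ?f (P ?g))"
      using ucong_scalar_mod[OF ucong_sym[OF Q_diff_right[of ?f ?g "P ?g"]]]
      by (rule scalar_mod_trans) (intro scalar_mod_J Q_right_J P, use lo a in blast)
    moreover have "scalar_mod N (Q ?f (P ?g) - Q (P ?f) (P ?g))"
    proof (rule scalar_mod_trans[OF ucong_scalar_mod[OF ucong_sym[OF Q_diff_left]]])
      have "?f - P ?f \<in> frac_ideal (int N)" by (rule P) (use lo a in blast)
      from scalar_mod_J[OF Q_left_J[OF this]] show "scalar_mod N (Q (?f - P ?f) (P ?g))"
        by (rule scalar_mod_trans) simp
    qed
    ultimately show ?thesis
      using ucong_scalar_mod[OF 1, of N]
        scalar_mod_add[of N "Q ?f ?g - Q ?f (P ?g)" "Q ?f (P ?g) - Q (P ?f) (P ?g)"]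
        scalar_mod_add[of N "Q ?f ?g - Q (P ?f) (P ?g)" "Q (P ?f) (P ?g) - _"]
      by fastforce
  qed
  have "scalar_mod N ((\<Sum>a\<in>A. scal (u a) * Q (f a) (g a)) - y)"
  proof -
    have y: "y = (\<Sum>a\<in>A. scal (u a) * (\<Sum>i\<in>?I. \<Sum>j\<in>?I. scal (fls_nth (expansion t (f a)) i * fls_nth (expansion t (g a)) j) * Q (t powi i) (t powi j)))"
    proof -
      have "y = (\<Sum>i\<in>?I. \<Sum>j\<in>?I. \<Sum>a\<in>A. scal (u a) * (scal (fls_nth (expansion t (f a)) i * fls_nth (expansion t (g a)) j) * Q (t powi i) (t powi j)))"
        unfolding y_def b_def scal_sum sum_distrib_right by (simp add: scal_simps mult.assoc)
      also have "\<dots> = (\<Sum>i\<in>?I. \<Sum>a\<in>A. \<Sum>j\<in>?I. scal (u a) * (scal (fls_nth (expansion t (f a)) i * fls_nth (expansion t (g a)) j) * Q (t powi i) (t powi j)))"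
        by (intro sum.cong refl sum.swap)
      also have "\<dots> = (\<Sum>a\<in>A. \<Sum>i\<in>?I. \<Sum>j\<in>?I. scal (u a) * (scal (fls_nth (expansion t (f a)) i * fls_nth (expansion t (g a)) j) * Q (t powi i) (t powi j)))"
        by (rule sum.swap)
      finally show ?thesis by (simp add: sum_distrib_left)
    qed
    show ?thesis unfolding y sum_subtractf[symmetric] right_diff_distrib[symmetric]
      by (intro scalar_mod_sum scalar_mod_scale Qab)
  qed
  moreover have "scalar_mod N y"
  proof -
    have b: "b i j + b j i = 0" if "i \<in> ?I" "j \<in> ?I" for i j
      using H[of i j] that by (simp add: b_def sum.distrib[symmetric] algebra_simps)
    \<comment> \<open>Adding the sum to itself with the indices exchanged pairs opposite
      coefficients, so twice the sum consists of commutators; halving uses the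
      characteristic.\<close>
    have sw: "y = (\<Sum>i\<in>?I. \<Sum>j\<in>?I. scal (b j i) * Q (t powi j) (t powi i))"
      unfolding y_def by (rule sum.swap)
    have "scalar_mod N (scal (b i j) * Q (t powi i) (t powi j) + scal (b j i) * Q (t powi j) (t powi i))"
      if "i \<in> ?I" "j \<in> ?I" for i j
    proof -
      have "(scal (b j i) :: ('k, 'K) heis_free) = - scal (b i j)" using b[OF that] by (metis add_eq_0_iff scal_simps(5))
      then have "scal (b i j) * Q (t powi i) (t powi j) + scal (b j i) * Q (t powi j) (t powi i) =
          scal (b i j) * (Q (t powi i) (t powi j) - Q (t powi j) (t powi i))"
        by (simp add: right_diff_distrib)
      moreover have "scalar_mod N (Q (t powi i) (t powi j) - Q (t powi j) (t powi i))"
        using scalar_mod_add[OF ucong_scalar_mod[OF Q_swap] scalar_mod_scal]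
        by (metis (no_types) add_diff_eq diff_add_cancel diff_diff_add)
      ultimately show ?thesis by (simp add: scalar_mod_scale)
    qed
    then have "scalar_mod N (\<Sum>i\<in>?I. \<Sum>j\<in>?I. scal (b i j) * Q (t powi i) (t powi j) + scal (b j i) * Q (t powi j) (t powi i))"
      by (intro scalar_mod_sum)
    then have "scalar_mod N (y + y)"
      by (subst (2) sw) (simp add: y_def sum.distrib)
    from scalar_mod_scale[OF this, of "1 / 2"] show ?thesis
      by (simp add: distrib_left distrib_right flip: scal_simps(1)) (simp add: scal_simps flip: distrib_right scal_simps(1))
  qed
  ultimately show ?thesis by (rule scalar_mod_trans)
qed

subsection \<open>The completion\<close>

definition coset :: "nat \<Rightarrow> ('k, 'K) heis_free \<Rightarrow> ('k, 'K) heis_free set" where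
  "coset N x = {z. z - x \<in> J N}"

lemma mem_coset: "z \<in> coset N x \<longleftrightarrow> z - x \<in> J N"
  by (simp add: coset_def)

lemma coset_self [simp]: "x \<in> coset N x"
  by (simp add: mem_coset)

lemma coset_eq_iff: "coset N x = coset N y \<longleftrightarrow> x - y \<in> J N"
proof
  assume "x - y \<in> J N"
  then show "coset N x = coset N y"
    unfolding coset_def using J_add[of "_ - x" N "x - y"] J_diff[of "_ - y" N "x - y"] by fastforce
qed (metis coset_self mem_coset)

lemma incl_coset: "incl x = (\<lambda>N. coset N x)"
  by (simp add: incl_def coset_def)

lemma completion_iff: "X \<in> completion \<longleftrightarrow> (\<forall>N. (\<exists>u. X N = coset N u) \<and> X (Suc N) \<subseteq> X N)"
  by (simp add: completion_def coset_def)

lemma completion_coset: "X \<in> completion \<Longrightarrow> x \<in> X N \<Longrightarrow> X N = coset N x"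
  unfolding completion_iff by (metis coset_eq_iff mem_coset)

lemma completion_ex: "X \<in> completion \<Longrightarrow> \<exists>x. x \<in> X N"
  unfolding completion_iff by (metis coset_self)

lemma completion_antimono:
  assumes "X \<in> completion" "M \<le> N" shows "X N \<subseteq> X M"
  using assms(2)
proof (induction N rule: dec_induct)
  case (step N)
  then show ?case using assms(1) unfolding completion_iff by blast
qed simp

lemma J_Suc: "x \<in> J (Suc N) \<Longrightarrow> x \<in> J N"
  by (rule J_antimono[of N "Suc N"]) simp_all

lemma incl_completion [simp]: "incl x \<in> completion"
  unfolding completion_iff incl_coset by (auto simp: mem_coset intro: J_Suc)

lemma cadd_coset: "X N = coset N x \<Longrightarrow> Y N = coset N y \<Longrightarrow> cadd X Y N = coset N (x + y)"
proof -
  assume X: "X N = coset N x" and Y: "Y N = coset N y"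
  have "z \<in> cadd X Y N" if "z - (x + y) \<in> J N" for z
  proof -
    have "z = (z - y) + y" "z - y \<in> X N" "y \<in> Y N" using that X Y by (simp_all add: mem_coset algebra_simps)
    then show ?thesis unfolding cadd_def by blast
  qed
  moreover have "z - (x + y) \<in> J N" if z: "z \<in> cadd X Y N" for z
  proof -
    obtain x' y' where "z = x' + y'" "x' - x \<in> J N" "y' - y \<in> J N"
      using z X Y by (auto simp: cadd_def mem_coset)
    then show ?thesis using J_add[of "x' - x" N "y' - y"] by (simp add: algebra_simps)
  qed
  ultimately show ?thesis by (auto simp: mem_coset)
qed

lemma cdiff_coset: "X N = coset N x \<Longrightarrow> Y N = coset N y \<Longrightarrow> cdiff X Y N = coset N (x - y)"
proof -
  assume X: "X N = coset N x" and Y: "Y N = coset N y"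
  have "z \<in> cdiff X Y N" if "z - (x - y) \<in> J N" for z
  proof -
    have "z = (z + y) - y" "z + y \<in> X N" "y \<in> Y N" using that X Y by (simp_all add: mem_coset algebra_simps)
    then show ?thesis unfolding cdiff_def by blast
  qed
  moreover have "z - (x - y) \<in> J N" if z: "z \<in> cdiff X Y N" for z
  proof -
    obtain x' y' where "z = x' - y'" "x' - x \<in> J N" "y' - y \<in> J N"
      using z X Y by (auto simp: cdiff_def mem_coset)
    moreover from this have "z - (x - y) = (x' - x) - (y' - y)" by simp
    ultimately show ?thesis using J_diff[of "x' - x" N "y' - y"] by (simp only:)
  qed
  ultimately show ?thesis by (auto simp: mem_coset)
qed

lemma cscale_coset: "X N = coset N x \<Longrightarrow> cscale c X N = coset N (scal c * x)"
proof -
  assume X: "X N = coset N x"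
  have "z - scal c * x \<in> J N" if "x' - x \<in> J N" "z - scal c * x' \<in> J N" for z x'
    using J_add[OF that(2) J_left[OF that(1), of "scal c"]] by (simp add: algebra_simps)
  then show ?thesis by (auto simp: cscale_def X mem_coset intro!: bexI[of _ x])
qed

text \<open>An unconditional sum is computed modulo \<open>J N\<close> by any finite set outside
  which all terms lie in \<open>J N\<close>.\<close>

lemma csum_coset:
  assumes A: "\<And>i. A i N = coset N (a i)" and S: "finite S" "\<And>i. i \<notin> S \<Longrightarrow> a i \<in> J N"
  shows "csum A N = coset N (sum a S)"
proof -
  have w: "(\<Sum>i\<in>F. w i) - sum a S \<in> J N" if F: "finite F" "S \<subseteq> F" and w: "\<And>i. i \<in> F \<Longrightarrow> w i \<in> A i N" for F w
  proof -
    have "(\<Sum>i\<in>F. w i - a i) \<in> J N" by (rule J_sum) (use w A in \<open>simp add: mem_coset\<close>)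
    moreover have "(\<Sum>i\<in>F - S. a i) \<in> J N" by (rule J_sum) (use S in auto)
    moreover have "sum a F = sum a (F - S) + sum a S" by (rule sum.subset_diff[OF F(2,1)])
    ultimately show ?thesis using J_add by (fastforce simp: sum_subtractf)
  qed
  show ?thesis
  proof (intro set_eqI iffI)
    fix z assume "z \<in> csum A N"
    then obtain F0 where F0: "finite F0" "\<And>F w. finite F \<Longrightarrow> F0 \<subseteq> F \<Longrightarrow> (\<forall>i\<in>F. w i \<in> A i N) \<Longrightarrow> z - sum w F \<in> J N"
      by (auto simp: csum_def)
    have "z - sum a (F0 \<union> S) \<in> J N" by (rule F0(2)) (use F0 S A in auto)
    moreover have "sum a (F0 \<union> S) - sum a S \<in> J N" by (rule w) (use F0 S A in auto)
    ultimately show "z \<in> coset N (sum a S)" using J_add by (fastforce simp: mem_coset)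
  next
    fix z assume z: "z \<in> coset N (sum a S)"
    have "z - sum v F \<in> J N" if "finite F" "S \<subseteq> F" "\<forall>i\<in>F. v i \<in> A i N" for F v
      using J_diff[of "z - sum a S" N "sum v F - sum a S"] z w[of F v] that by (auto simp: mem_coset)
    then show "z \<in> csum A N" unfolding csum_def using S(1) by blast
  qed
qed

text \<open>The precision demanded of the left factor depends on the representative chosen for the
  right one, because right multiplication is continuous but not uniformly so.\<close>

lemma cprod_coset:
  assumes X: "X \<in> completion" and Y: "Y \<in> completion" and y: "y \<in> Y N"
  shows "\<exists>M0. \<forall>M\<ge>M0. \<forall>x\<in>X M. cprod X Y N = coset N (x * y)"
proof -
  obtain M0 where M0: "M0 \<ge> N" "\<And>x. x \<in> J M0 \<Longrightarrow> x * y \<in> J N" using J_right by blast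
  have "cprod X Y N = coset N (x * y)" if M: "M \<ge> M0" and x: "x \<in> X M" for M x
  proof -
    have x0: "x' - x \<in> J M0" if "x' \<in> X M0" for x'
      using completion_coset[OF X, of x M0] completion_antimono[OF X M] x that by (auto simp: mem_coset)
    show ?thesis
    proof (intro set_eqI iffI)
      fix z assume z: "z \<in> coset N (x * y)"
      have "z - x' * y \<in> J N" if "x' \<in> X M0" for x'
      proof -
        have "(z - x * y) - (x' - x) * y \<in> J N"
          using J_diff[OF _ M0(2)[OF x0[OF that]]] z by (simp add: mem_coset)
        then show ?thesis by (simp add: algebra_simps)
      qed
      then show "z \<in> cprod X Y N" unfolding cprod_def using y by blast
    next
      fix z assume "z \<in> cprod X Y N"
      then obtain y' M' where y': "y' \<in> Y N" and z: "\<And>x. x \<in> X M' \<Longrightarrow> z - x * y' \<in> J N"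
        by (auto simp: cprod_def)
      obtain x' where x': "x' \<in> X (max M' M0)" using completion_ex[OF X] by blast
      have x'1: "x' \<in> X M'" "x' \<in> X M0"
        using x' completion_antimono[OF X, of M' "max M' M0"] completion_antimono[OF X, of M0 "max M' M0"] by auto
      have "y' - y \<in> J N" using completion_coset[OF Y y] y' by (simp add: mem_coset)
      from J_add[OF J_add[OF z[OF x'1(1)] J_left[OF this, of x']] M0(2)[OF x0[OF x'1(2)]]]
      show "z \<in> coset N (x * y)" by (simp add: mem_coset algebra_simps)
    qed
  qed
  then show ?thesis by blast
qed

text \<open>The two products require precision in opposite orders. A rough representative of X is
  fixed first and determines the precision of y; then y determines that of x. Replacing the rough
  representative by x changes the second product only by an element of the left ideal.\<close>

lemma commutator_coset:
  assumes X: "X \<in> completion" and Y: "Y \<in> completion"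
  shows "\<exists>c0. \<forall>c\<ge>c0. \<forall>y\<in>Y c. \<exists>a0. \<forall>a\<ge>a0. \<forall>x\<in>X a. commutator X Y N = coset N (x * y - y * x)"
proof -
  obtain x0 where x0: "x0 \<in> X N" using completion_ex[OF X] by blast
  obtain c0 where c0: "\<And>c y. c \<ge> c0 \<Longrightarrow> y \<in> Y c \<Longrightarrow> cprod Y X N = coset N (y * x0)"
    using cprod_coset[OF Y X x0] by blast
  have "\<exists>a0. \<forall>a\<ge>a0. \<forall>x\<in>X a. commutator X Y N = coset N (x * y - y * x)"
    if c: "c \<ge> max c0 N" and y: "y \<in> Y c" for c y
  proof -
    have yN: "y \<in> Y N" using completion_antimono[OF Y, of N c] c y by auto
    obtain a0 where a0: "\<And>a x. a \<ge> a0 \<Longrightarrow> x \<in> X a \<Longrightarrow> cprod X Y N = coset N (x * y)"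
      using cprod_coset[OF X Y yN] by blast
    have "commutator X Y N = coset N (x * y - y * x)" if a: "a \<ge> max a0 N" and x: "x \<in> X a" for a x
    proof -
      have "x \<in> X N" using completion_antimono[OF X, of N a] a x by auto
      from completion_coset[OF X this] x0 have "x0 - x \<in> J N" by (simp add: mem_coset)
      from J_left[OF this, of y] have "coset N (y * x0) = coset N (y * x)"
        by (simp add: coset_eq_iff right_diff_distrib)
      then have "cprod Y X N = coset N (y * x)" using c0[of c y] c y by simp
      moreover have "cprod X Y N = coset N (x * y)" using a0[of a x] a x by simp
      ultimately show ?thesis unfolding commutator_def by (rule cdiff_coset[rotated])
    qed
    then show ?thesis by blast
  qed
  then show ?thesis by blast
qed

lemma commutator_completion:
  assumes X: "X \<in> completion" and Y: "Y \<in> completion"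
  shows "commutator X Y \<in> completion"
  unfolding completion_iff
proof (intro allI conjI)
  fix N
  obtain c1 where c1: "\<And>c y. c \<ge> c1 \<Longrightarrow> y \<in> Y c \<Longrightarrow> \<exists>a0. \<forall>a\<ge>a0. \<forall>x\<in>X a. commutator X Y N = coset N (x * y - y * x)"
    using commutator_coset[OF X Y] by blast
  obtain c2 where c2: "\<And>c y. c \<ge> c2 \<Longrightarrow> y \<in> Y c \<Longrightarrow> \<exists>a0. \<forall>a\<ge>a0. \<forall>x\<in>X a. commutator X Y (Suc N) = coset (Suc N) (x * y - y * x)"
    using commutator_coset[OF X Y] by blast
  obtain y where y: "y \<in> Y (max c1 c2)" using completion_ex[OF Y] by blast
  obtain a1 where a1: "\<And>a x. a \<ge> a1 \<Longrightarrow> x \<in> X a \<Longrightarrow> commutator X Y N = coset N (x * y - y * x)"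
    using c1[OF _ y] by auto
  obtain a2 where a2: "\<And>a x. a \<ge> a2 \<Longrightarrow> x \<in> X a \<Longrightarrow> commutator X Y (Suc N) = coset (Suc N) (x * y - y * x)"
    using c2[OF _ y] by auto
  obtain x where x: "x \<in> X (max a1 a2)" using completion_ex[OF X] by blast
  have 1: "commutator X Y N = coset N (x * y - y * x)" by (rule a1[OF _ x]) simp
  have 2: "commutator X Y (Suc N) = coset (Suc N) (x * y - y * x)" by (rule a2[OF _ x]) simp
  show "\<exists>u. commutator X Y N = coset N u" using 1 by blast
  show "commutator X Y (Suc N) \<subseteq> commutator X Y N"
    unfolding 1 2 by (auto simp: mem_coset intro: J_Suc)
qed

lemma cadd_completion: "X \<in> completion \<Longrightarrow> Y \<in> completion \<Longrightarrow> cadd X Y \<in> completion"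
  unfolding completion_iff[of "cadd X Y"]
proof (intro allI conjI)
  fix N assume X: "X \<in> completion" and Y: "Y \<in> completion"
  obtain x y where xy: "x \<in> X (Suc N)" "y \<in> Y (Suc N)" using completion_ex X Y by metis
  have 2: "cadd X Y (Suc N) = coset (Suc N) (x + y)"
    by (rule cadd_coset) (use xy completion_coset X Y in blast)+
  have "x \<in> X N" "y \<in> Y N" using xy completion_antimono[OF X, of N "Suc N"] completion_antimono[OF Y, of N "Suc N"] by auto
  then have 1: "cadd X Y N = coset N (x + y)"
    by (intro cadd_coset) (use completion_coset X Y in blast)+
  show "\<exists>u. cadd X Y N = coset N u" using 1 by blast
  show "cadd X Y (Suc N) \<subseteq> cadd X Y N"
    unfolding 1 2 by (auto simp: mem_coset intro: J_Suc)
qed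

text \<open>The scalars modulo the various \<open>J N\<close> agree because a scalar in \<open>J N\<close>, \<open>N > 0\<close>, vanishes; their
  common value is read off as a vacuum expectation value.\<close>

lemma differ_by_scalar:
  assumes X: "X \<in> completion" and Y: "Y \<in> completion"
    and d: "\<And>N. \<exists>x\<in>X N. \<exists>y\<in>Y N. scalar_mod N (x - y)"
    and t: "uniformizer \<O> t" and x1: "x1 \<in> X 1" and y1: "y1 \<in> Y 1"
  shows "X = cadd (incl (scal (vacuum t x1 - vacuum t y1))) Y"
proof
  let ?c = "vacuum t x1 - vacuum t y1"
  fix N
  \<comment> \<open>The level is raised to at least 1 because \<open>vacuum\<close> kills
    \<open>J N\<close> only for N > 0.\<close>
  obtain x y where x: "x \<in> X (max N 1)" and y: "y \<in> Y (max N 1)" and "scalar_mod (max N 1) (x - y)" using d by blast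
  then obtain c where c: "x - y - scal c \<in> J (max N 1)" by (auto simp: scalar_mod_def)
  have x': "x \<in> X 1" "x \<in> X N" and y': "y \<in> Y 1" "y \<in> Y N"
    using x y completion_antimono[OF X, of 1 "max N 1"] completion_antimono[OF Y, of 1 "max N 1"]
      completion_antimono[OF X, of N "max N 1"] completion_antimono[OF Y, of N "max N 1"] by auto
  have "x - x1 \<in> J 1" "y - y1 \<in> J 1"
    using completion_coset[OF X x1] completion_coset[OF Y y1] x' y' by (auto simp: mem_coset)
  then have "vacuum t x = vacuum t x1" "vacuum t y = vacuum t y1"
    using vacuum_J[OF t, of _ 1] by (metis eq_iff_diff_eq_0 vacuum_diff zero_less_one)+
  moreover have "x - y - scal c \<in> J 1" using c by (rule J_antimono[rotated]) simp
  from vacuum_J[OF t this] have "vacuum t x - vacuum t y - c = 0" by (simp add: vacuum_diff vacuum_scal)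
  ultimately have "c = ?c" by simp
  then have "x - y - scal ?c \<in> J N" using c by (auto intro: J_antimono[of N "max N 1"])
  then have "coset N x = coset N (scal ?c + y)" by (simp add: coset_eq_iff algebra_simps)
  moreover have "X N = coset N x" by (rule completion_coset[OF X x'(2)])
  moreover have "cadd (incl (scal ?c)) Y N = coset N (scal ?c + y)"
    by (rule cadd_coset) (simp_all add: incl_coset completion_coset[OF Y y'(2)])
  ultimately show "X N = cadd (incl (scal ?c)) Y N" by simp
qed

subsection \<open>Normally ordered series\<close>

text \<open>The scalars to be subtracted from the products of powers of t. The conditions put every
  term with an index at least N into \<open>J N\<close>; the values at two negative indices remain
  free and are where orderings differ.\<close>

definition normal_order :: "'K \<Rightarrow> (int \<Rightarrow> int \<Rightarrow> 'k) \<Rightarrow> bool" where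
  "normal_order t \<kappa> \<longleftrightarrow> (\<forall>i j. j \<ge> 0 \<longrightarrow> \<kappa> i j = 0) \<and>
     (\<forall>i j. i \<ge> 0 \<longrightarrow> \<kappa> i j = res_pairing (t powi i) (t powi j))"

definition pterm :: "'K \<Rightarrow> 'k fls \<Rightarrow> (int \<Rightarrow> int \<Rightarrow> 'k) \<Rightarrow> int \<times> int \<Rightarrow> ('k, 'K) heis_free" where
  "pterm t g \<kappa> = (\<lambda>(i, j). scal (fls_nth g (i + j + 1) / 2) * (Q (t powi i) (t powi j) - scal (\<kappa> i j)))"

text \<open>The indices of the terms that need not lie in \<open>J N\<close>. The last inequality
  excludes zero coefficients of g and makes the set finite.\<close>

definition core :: "'k fls \<Rightarrow> nat \<Rightarrow> (int \<times> int) set" where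
  "core g N = {(i, j). i < int N \<and> j < int N \<and> fls_subdegree g \<le> i + j + 1}"

definition vir_series :: "'K \<Rightarrow> 'k fls \<Rightarrow> (int \<Rightarrow> int \<Rightarrow> 'k) \<Rightarrow> ('k, 'K) completed" where
  "vir_series t g \<kappa> = (\<lambda>N. coset N (sum (pterm t g \<kappa>) (core g N)))"

text \<open>Squares are symmetric in the two indices, which permits symmetrization of sums, and they
  eventually contain any given \<open>core\<close>.\<close>

definition box :: "nat \<Rightarrow> (int \<times> int) set" where
  "box R = {- int R..int R} \<times> {- int R..int R}"

lemma finite_box [simp]: "finite (box R)"
  by (simp add: box_def)

lemma core_box: "\<bar>fls_subdegree g\<bar> + int N + 1 \<le> int R \<Longrightarrow> core g N \<subseteq> box R"
  by (auto simp: core_def box_def)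

lemma finite_core [simp]: "finite (core g N)"
  by (rule finite_subset[OF core_box[of g N "nat (\<bar>fls_subdegree g\<bar> + int N + 1)"]]) auto

lemma pterm_J:
  assumes t: "uniformizer \<O> t" and k: "normal_order t \<kappa>" and p: "p \<notin> core g N"
  shows "pterm t g \<kappa> p \<in> J N"
proof -
  obtain i j where p': "p = (i, j)" by (cases p)
  consider "i + j + 1 < fls_subdegree g" | "j \<ge> int N" | "i \<ge> int N"
    using p by (auto simp: p' core_def)
  then show ?thesis
  proof cases
    case 1
    then show ?thesis by (simp add: p' pterm_def scal_simps)
  next
    case 2
    then have "Q (t powi i) (t powi j) \<in> J N" by (intro Q_right_J frac_ideal_powi[OF t])
    moreover have "\<kappa> i j = 0" using k 2 by (simp add: normal_order_def)
    ultimately show ?thesis by (simp add: p' pterm_def scal_simps J_left)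
  next
    case 3
    then have "Q (t powi i) (t powi j) - scal (res_pairing (t powi i) (t powi j)) \<in> J N"
      by (intro Q_left_J frac_ideal_powi[OF t])
    moreover have "\<kappa> i j = res_pairing (t powi i) (t powi j)" using k 3 by (simp add: normal_order_def)
    ultimately show ?thesis by (simp add: p' pterm_def J_left)
  qed
qed

lemma vir_series_eq:
  assumes t: "uniformizer \<O> t" and k: "normal_order t \<kappa>" and P: "finite P" "core g N \<subseteq> P"
  shows "vir_series t g \<kappa> N = coset N (sum (pterm t g \<kappa>) P)"
proof -
  have "sum (pterm t g \<kappa>) P = sum (pterm t g \<kappa>) (P - core g N) + sum (pterm t g \<kappa>) (core g N)"
    by (rule sum.subset_diff[OF P(2,1)])
  moreover have "sum (pterm t g \<kappa>) (P - core g N) \<in> J N" by (intro J_sum pterm_J[OF t k]) auto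
  ultimately show ?thesis unfolding vir_series_def coset_eq_iff by (simp add: J_minus)
qed

lemma vir_series_completion:
  assumes t: "uniformizer \<O> t" and k: "normal_order t \<kappa>"
  shows "vir_series t g \<kappa> \<in> completion"
  unfolding completion_iff
proof (intro allI conjI)
  fix N
  show "\<exists>u. vir_series t g \<kappa> N = coset N u" unfolding vir_series_def by blast
  have "core g N \<subseteq> core g (Suc N)" by (auto simp: core_def)
  then have 1: "vir_series t g \<kappa> N = coset N (sum (pterm t g \<kappa>) (core g (Suc N)))" by (intro vir_series_eq[OF t k]) simp_all
  have 2: "vir_series t g \<kappa> (Suc N) = coset (Suc N) (sum (pterm t g \<kappa>) (core g (Suc N)))" by (simp add: vir_series_def)
  show "vir_series t g \<kappa> (Suc N) \<subseteq> vir_series t g \<kappa> N" unfolding 1 2 by (auto simp: mem_coset intro: J_Suc)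
qed

lemma vir_series_box:
  assumes t: "uniformizer \<O> t" and k: "normal_order t \<kappa>"
  shows "\<exists>R0. \<forall>R\<ge>R0. sum (pterm t g \<kappa>) (box R) \<in> vir_series t g \<kappa> N"
proof (intro exI allI impI)
  fix R assume "R \<ge> nat (\<bar>fls_subdegree g\<bar> + int N + 1)"
  then have "core g N \<subseteq> box R" by (intro core_box) simp
  from vir_series_eq[OF t k finite_box this] show "sum (pterm t g \<kappa>) (box R) \<in> vir_series t g \<kappa> N" by simp
qed

section \<open>Contraction of the quadratic tensor of a vector field with a residue
  functional\<close>

definition contraction :: "'K \<Rightarrow> 'k fls \<Rightarrow> 'k fls \<Rightarrow> nat \<Rightarrow> 'K" where
  "contraction t g p R = (\<Sum>(i, j)\<in>box R. \<iota> (fls_nth g (i + j + 1) * fls_nth p (- 1 - i)) * t powi j)"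

text \<open>Applying Res(p f) to the first factor of the tensor with entries
  \<open>fls_nth g (i + j + 1)\<close> yields the product p g. In low degrees the finite square
  already gives its exact coefficients.\<close>

lemma contraction_nth:
  assumes t: "uniformizer \<O> t" and p: "\<And>n. n < - P \<Longrightarrow> fls_nth p n = 0"
    and R: "P \<le> int R" "N - fls_subdegree g \<le> int R" "P - fls_subdegree g \<le> int R" "N \<le> int R" and k: "k < N"
  shows "fls_nth (expansion t (contraction t g p R)) k = fls_nth (p * g) k"
proof -
  let ?I = "{- int R..int R}"
  have "fls_nth (expansion t (contraction t g p R)) k =
      (\<Sum>i\<in>?I. \<Sum>j\<in>?I. if j = k then fls_nth g (i + k + 1) * fls_nth p (- 1 - i) else 0)"
    unfolding contraction_def box_def expansion_sum[OF t] fls_nth_sum sum.cartesian_product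
    by (rule sum.cong) (use t in auto)
  also have "\<dots> = (if k \<in> ?I then \<Sum>i\<in>?I. fls_nth g (i + k + 1) * fls_nth p (- 1 - i) else 0)"
    by (cases "k \<in> ?I") (auto simp: sum.delta intro!: sum.neutral)
  also have "\<dots> = fls_nth (p * g) k"
  proof (cases "k \<in> ?I")
    case True
    have "fls_nth (p * g) k = (\<Sum>m\<in>{- int R - 1..int R - 1}. fls_nth p m * fls_nth g (k - m))"
    proof (rule fls_times_nth_bounds)
      show "fls_nth p m = 0" if "m < - int R - 1" for m using p R that by simp
      show "fls_nth g (k - m) = 0" if "m > int R - 1" for m
        using R k that by (intro fls_eq0_below_subdegree) linarith
    qed
    also have "\<dots> = (\<Sum>i\<in>?I. fls_nth g (i + k + 1) * fls_nth p (- 1 - i))"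
      by (rule sum.reindex_bij_witness[of _ "\<lambda>i. - 1 - i" "\<lambda>m. - 1 - m"]) (auto simp: algebra_simps)
    finally show ?thesis using True by simp
  next
    case False
    then have "k < - int R" using R k by auto
    then have "fls_nth (p * g) k = 0"
      by (intro fls_mult_vanish[of "- P" p "fls_subdegree g" g]) (use p R in auto)
    then show ?thesis unfolding if_not_P[OF False] by simp
  qed
  finally show ?thesis .
qed

lemma res_pairing_powi_left: "uniformizer \<O> t \<Longrightarrow> res_pairing (t powi i) h = fls_nth (fls_deriv (expansion t h)) (- 1 - i)"
  by (simp add: res_pairing_eq resid_def fls_shifted_times_simps)

lemma sum_box_swap: "(\<Sum>(i, j)\<in>box R. F i j) = (\<Sum>(i, j)\<in>box R. F j i)"
  unfolding box_def sum.cartesian_product[symmetric] by (rule sum.swap)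

lemma bracket_scal:
  "scal c * (q - scal d) * e - e * (scal c * (q - scal d)) = scal c * (q * e - e * q :: ('k, 'K) heis_free)"
  unfolding scal_left_commute mult.assoc right_diff_distrib left_diff_distrib scal_commute[of d e] by simp

text \<open>Each factor of a quadratic term contributes one half of the bracket; exchanging the
  indices of the square shows that the halves are equal. The subtracted scalars commute and
  disappear.\<close>

lemma box_bracket:
  assumes t: "uniformizer \<O> t"
  shows "sum (pterm t g \<kappa>) (box R) * elt h - elt h * sum (pterm t g \<kappa>) (box R) \<approx>
    elt (contraction t g (fls_deriv (expansion t h)) R)"
proof -
  let ?c = "\<lambda>i j. fls_nth g (i + j + 1)"
  let ?r = "\<lambda>i. res_pairing (t powi i) h"
  have "sum (pterm t g \<kappa>) (box R) * elt h - elt h * sum (pterm t g \<kappa>) (box R) =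
      (\<Sum>(i, j)\<in>box R. scal (?c i j / 2) * (Q (t powi i) (t powi j) * elt h - elt h * Q (t powi i) (t powi j)))"
    unfolding sum_distrib_left sum_distrib_right sum_subtractf[symmetric] pterm_def case_prod_unfold bracket_scal ..
  also have "\<dots> \<approx> (\<Sum>(i, j)\<in>box R. scal (?c i j / 2) * (scal (?r j) * elt (t powi i) + scal (?r i) * elt (t powi j)))"
    by (intro ucong_sum) (auto intro!: ucong_left Q_elt_bracket)
  also have "\<dots> = (\<Sum>(i, j)\<in>box R. scal (?c i j / 2 * ?r j) * elt (t powi i)) +
      (\<Sum>(i, j)\<in>box R. scal (?c i j / 2 * ?r i) * elt (t powi j))"
    unfolding sum.distrib[symmetric]
    by (rule sum.cong[OF refl]) (simp only: case_prod_unfold distrib_left scal_simps(2) mult.assoc)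
  also have "(\<Sum>(i, j)\<in>box R. scal (?c i j / 2 * ?r j) * elt (t powi i)) = (\<Sum>(i, j)\<in>box R. scal (?c i j / 2 * ?r i) * elt (t powi j))"
    by (subst sum_box_swap) (simp add: add.commute[of "_ :: int"])
  also have "(\<Sum>(i, j)\<in>box R. scal (?c i j / 2 * ?r i) * elt (t powi j)) + (\<Sum>(i, j)\<in>box R. scal (?c i j / 2 * ?r i) * elt (t powi j)) =
      (\<Sum>(i, j)\<in>box R. scal (?c i j * ?r i) * elt (t powi j))"
    unfolding sum.distrib[symmetric]
    by (rule sum.cong[OF refl]) (auto simp: mult.commute simp flip: distrib_right scal_simps(1))
  also have "\<dots> \<approx> (\<Sum>(i, j)\<in>box R. elt (\<iota> (?c i j * ?r i) * t powi j))"
    by (intro ucong_sum) (auto intro: ucong_sym[OF elt_scale])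
  also have "\<dots> \<approx> elt (\<Sum>(i, j)\<in>box R. \<iota> (?c i j * ?r i) * t powi j)"
    unfolding case_prod_unfold by (rule ucong_sym[OF elt_sum])
  also have "(\<Sum>(i, j)\<in>box R. \<iota> (?c i j * ?r i) * t powi j) = contraction t g (fls_deriv (expansion t h)) R"
    unfolding contraction_def by (simp add: res_pairing_powi_left[OF t])
  finally show ?thesis .
qed

lemma contraction_vec:
  assumes t: "uniformizer \<O> t"
  shows "\<exists>R0. \<forall>R\<ge>R0. contraction t g (fls_deriv (expansion t h)) R - vec t g h \<in> frac_ideal N"
proof -
  define P where "P = - fls_subdegree (fls_deriv (expansion t h))"
  define R0 where "R0 = nat (max (max P (N - fls_subdegree g)) (max (P - fls_subdegree g) N))"
  have "contraction t g (fls_deriv (expansion t h)) R - vec t g h \<in> frac_ideal N" if "R \<ge> R0" for R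
    unfolding expansion_mem[OF t]
  proof (intro allI impI)
    fix k assume k: "k < N"
    have "fls_nth (expansion t (contraction t g (fls_deriv (expansion t h)) R)) k = fls_nth (fls_deriv (expansion t h) * g) k"
    proof (rule contraction_nth[OF t, of P])
      show "fls_nth (fls_deriv (expansion t h)) n = 0" if "n < - P" for n
        by (rule fls_eq0_below_subdegree) (use that in \<open>simp add: P_def\<close>)
    qed (use that k in \<open>auto simp: R0_def\<close>)
    then show "fls_nth (expansion t (contraction t g (fls_deriv (expansion t h)) R - vec t g h)) k = 0"
      using t by (simp add: mult.commute)
  qed
  then show ?thesis by blast
qed

lemma vir_series_bracket:
  assumes t: "uniformizer \<O> t" and k: "normal_order t \<kappa>"
  shows "commutator (vir_series t g \<kappa>) (incl (elt h)) = incl (elt (vec t g h))"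
proof
  fix N
  have Y: "elt h \<in> incl (elt h) c" for c by (simp add: incl_coset)
  obtain a0 where a0: "\<And>a x. a \<ge> a0 \<Longrightarrow> x \<in> vir_series t g \<kappa> a \<Longrightarrow>
      commutator (vir_series t g \<kappa>) (incl (elt h)) N = coset N (x * elt h - elt h * x)"
    using commutator_coset[OF vir_series_completion[OF t k] incl_completion[of "elt h"], where N = N] Y by metis
  obtain R1 where R1: "\<And>R. R \<ge> R1 \<Longrightarrow> sum (pterm t g \<kappa>) (box R) \<in> vir_series t g \<kappa> a0" using vir_series_box[OF t k] by blast
  obtain R2 where R2: "\<And>R. R \<ge> R2 \<Longrightarrow> contraction t g (fls_deriv (expansion t h)) R - vec t g h \<in> frac_ideal (int N)"
    using contraction_vec[OF t] by blast
  define R where "R = max R1 R2"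
  define x where "x = sum (pterm t g \<kappa>) (box R)"
  have "commutator (vir_series t g \<kappa>) (incl (elt h)) N = coset N (x * elt h - elt h * x)"
    by (rule a0[of a0]) (simp_all add: x_def R1 R_def)
  also have "\<dots> = coset N (elt (vec t g h))"
    unfolding coset_eq_iff
  proof -
    let ?c = "contraction t g (fls_deriv (expansion t h)) R"
    have "x * elt h - elt h * x - elt ?c \<in> J N" unfolding x_def by (rule ucong_J[OF box_bracket[OF t]])
    moreover have "elt ?c - elt (vec t g h) - elt (?c - vec t g h) \<in> J N" by (rule ucong_J[OF ucong_sym[OF elt_diff]])
    moreover have "elt (?c - vec t g h) \<in> J N" by (rule elt_J) (simp add: R2 R_def)
    ultimately have "(x * elt h - elt h * x - elt ?c) + ((elt ?c - elt (vec t g h) - elt (?c - vec t g h)) + elt (?c - vec t g h)) \<in> J N"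
      by (intro J_add)
    then show "x * elt h - elt h * x - elt (vec t g h) \<in> J N" by simp
  qed
  finally show "commutator (vir_series t g \<kappa>) (incl (elt h)) N = incl (elt (vec t g h)) N" by (simp add: incl_coset)
qed

lemma scalar_mod_pterm: "scalar_mod N (sum (pterm t g \<kappa>) B - (\<Sum>(i, j)\<in>B. scal (fls_nth g (i + j + 1) / 2) * Q (t powi i) (t powi j)))"
proof -
  have "scalar_mod N (\<Sum>p\<in>B. case p of (i, j) \<Rightarrow> - scal (fls_nth g (i + j + 1) / 2 * \<kappa> i j))"
    by (intro scalar_mod_sum) (auto intro!: scalar_mod_minus)
  also have "(\<Sum>p\<in>B. case p of (i, j) \<Rightarrow> - scal (fls_nth g (i + j + 1) / 2 * \<kappa> i j)) =
      sum (pterm t g \<kappa>) B - (\<Sum>(i, j)\<in>B. scal (fls_nth g (i + j + 1) / 2) * Q (t powi i) (t powi j))"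
    unfolding sum_subtractf[symmetric]
    by (rule sum.cong) (auto simp: pterm_def right_diff_distrib simp flip: scal_simps(2))
  finally show ?thesis .
qed

lemma box_symbol:
  assumes t: "uniformizer \<O> t"
  shows "(\<Sum>(i, j)\<in>box R. fls_nth g (i + j + 1) / 2 *
      (L (t powi i) * fls_nth (expansion s (t powi j)) k + L (t powi j) * fls_nth (expansion s (t powi i)) k)) =
    (\<Sum>(i, j)\<in>box R. fls_nth g (i + j + 1) * (L (t powi i) * fls_nth (expansion s (t powi j)) k))"
proof -
  let ?c = "\<lambda>i j. fls_nth g (i + j + 1) / 2"
  let ?F = "\<lambda>i j. L (t powi i) * fls_nth (expansion s (t powi j)) k"
  have "(\<Sum>(i, j)\<in>box R. ?c i j * (?F i j + ?F j i)) = (\<Sum>(i, j)\<in>box R. ?c i j * ?F i j) + (\<Sum>(i, j)\<in>box R. ?c i j * ?F j i)"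
    unfolding sum.distrib[symmetric] by (rule sum.cong) (auto simp: distrib_left)
  also have "(\<Sum>(i, j)\<in>box R. ?c i j * ?F j i) = (\<Sum>(i, j)\<in>box R. ?c i j * ?F i j)"
    by (subst sum_box_swap) (simp add: add.commute[of "_ :: int"])
  also have "(\<Sum>(i, j)\<in>box R. ?c i j * ?F i j) + (\<Sum>(i, j)\<in>box R. ?c i j * ?F i j) = (\<Sum>(i, j)\<in>box R. fls_nth g (i + j + 1) * ?F i j)"
    unfolding sum.distrib[symmetric] by (rule sum.cong) auto
  finally show ?thesis .
qed

text \<open>The coefficient of s^l in f is Res(s^(-1-l) f ds), which in the coordinate t is the
  residue of f against s^(-1-l) ds/dt. The derivative ds/dt is regular, whence the bound on
  h.\<close>

lemma functional_change:
  assumes s: "uniformizer \<O> s" and t: "uniformizer \<O> t"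
  shows "\<exists>h. (\<forall>f. fls_nth (expansion s f) l = fls_residue (expansion t h * expansion t f)) \<and>
    h * ddt s t = s powi (- 1 - l) \<and> h \<in> frac_ideal (- 1 - l)"
proof -
  have 1: "ddt s t * ddt t s = 1"
    using ddt_change[OF t s, of t] t by (simp flip: expansion_eq_iff[OF t])
  define h where "h = s powi (- 1 - l) * ddt t s"
  have "fls_nth (expansion s f) l = fls_residue (expansion t h * expansion t f)" for f
  proof -
    have "fls_nth (expansion s f) l = resid s (s powi (- 1 - l) * f)"
      using s by (simp add: resid_def fls_shifted_times_simps)
    also have "\<dots> = resid t (s powi (- 1 - l) * f * ddt t s)" by (rule resid_change[OF t s, symmetric])
    finally show ?thesis using t by (simp add: resid_def h_def mult_ac)
  qed
  moreover have "h * ddt s t = s powi (- 1 - l)" using 1 by (simp add: h_def mult_ac)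
  moreover have "h \<in> frac_ideal (- 1 - l)"
  proof -
    have "s \<in> frac_ideal 1" using s by (simp add: uniformizer_val frac_ideal_def)
    from frac_ideal_mult[OF frac_ideal_powi[OF s order_refl, of "- 1 - l"] ddt_frac_ideal[OF t this]]
    show ?thesis by (simp add: h_def)
  qed
  ultimately show ?thesis by blast
qed

text \<open>Contracting the tensor of a vector field D with the functional reading off s^l gives
  s^(-1-l) D(s), an expression without t. So the symbol depends on D alone and not on the coordinate
  in which the series is written.\<close>

lemma box_symbol_approx:
  assumes s: "uniformizer \<O> s" and t: "uniformizer \<O> t" and lN: "l < N" "k < N"
    and R: "N \<le> int R" "N - fls_subdegree g \<le> int R"
  shows "(\<Sum>(i, j)\<in>box R. fls_nth g (i + j + 1) * (fls_nth (expansion s (t powi i)) l * fls_nth (expansion s (t powi j)) k)) =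
    fls_nth (expansion s (s powi (- 1 - l) * vec t g s)) k"
proof -
  obtain h where h: "\<And>f. fls_nth (expansion s f) l = fls_residue (expansion t h * expansion t f)"
    and hs: "h * ddt s t = s powi (- 1 - l)" and hf: "h \<in> frac_ideal (- 1 - l)"
    using functional_change[OF s t, of l] by blast
  have hi: "fls_nth (expansion s (t powi i)) l = fls_nth (expansion t h) (- 1 - i)" for i
    unfolding h using t by (simp add: fls_shifted_times_simps mult.commute[of "expansion t h"])
  have "(\<Sum>(i, j)\<in>box R. fls_nth g (i + j + 1) * (fls_nth (expansion s (t powi i)) l * fls_nth (expansion s (t powi j)) k)) =
      fls_nth (expansion s (contraction t g (expansion t h) R)) k"
    unfolding contraction_def expansion_sum[OF s] fls_nth_sum hi
    by (rule sum.cong) (use s in \<open>auto simp: mult.assoc\<close>)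
  also have "\<dots> = fls_nth (expansion s (h * vec t g t)) k"
  proof -
    have "contraction t g (expansion t h) R - h * vec t g t \<in> frac_ideal N"
      unfolding expansion_mem[OF t]
    proof (intro allI impI)
      fix m assume m: "m < N"
      have "fls_nth (expansion t (contraction t g (expansion t h) R)) m = fls_nth (expansion t h * g) m"
      proof (rule contraction_nth[OF t, of N])
        show "fls_nth (expansion t h) n = 0" if "n < - N" for n
        proof -
          have "h \<in> frac_ideal (- N)" by (rule frac_ideal_mono[OF _ hf]) (use lN in simp)
          then show ?thesis using that by (simp add: expansion_mem[OF t])
        qed
      qed (use R m in auto)
      then show "fls_nth (expansion t (contraction t g (expansion t h) R - h * vec t g t)) m = 0"
        using t by simp
    qed
    then have "fls_nth (expansion s (contraction t g (expansion t h) R - h * vec t g t)) k = 0"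
      using lN by (simp only: expansion_mem[OF s])
    then show ?thesis using s by simp
  qed
  also have "h * vec t g t = s powi (- 1 - l) * vec t g s"
  proof -
    have "vec t g f = ddt t f * vec t g t" for f
      using t by (simp flip: expansion_eq_iff[OF t])
    from this[of s] have v: "vec t g s = ddt t s * vec t g t" .
    have 1: "ddt s t * ddt t s = 1"
      using ddt_change[OF t s, of t] t by (simp flip: expansion_eq_iff[OF t])
    have "h * vec t g t = h * (ddt s t * ddt t s) * vec t g t" by (simp add: 1)
    also have "\<dots> = h * ddt s t * vec t g s" by (simp only: v mult.assoc)
    finally show ?thesis by (simp only: hs)
  qed
  finally show ?thesis .
qed

lemma vir_series_differ:
  assumes t: "uniformizer \<O> t" and k: "normal_order t \<kappa>" and s: "uniformizer \<O> s" and k': "normal_order s \<kappa>'"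
    and eq: "vec t g = vec s g'"
  shows "\<exists>x\<in>vir_series t g \<kappa> N. \<exists>y\<in>vir_series s g' \<kappa>' N. scalar_mod N (x - y)"
proof -
  obtain R1 where R1: "\<And>R. R \<ge> R1 \<Longrightarrow> sum (pterm t g \<kappa>) (box R) \<in> vir_series t g \<kappa> N" using vir_series_box[OF t k] by blast
  obtain R2 where R2: "\<And>R. R \<ge> R2 \<Longrightarrow> sum (pterm s g' \<kappa>') (box R) \<in> vir_series s g' \<kappa>' N" using vir_series_box[OF s k'] by blast
  define R where "R = max (max R1 R2) (max N (nat (max (int N - fls_subdegree g) (int N - fls_subdegree g'))))"
  have R: "R \<ge> R1" "R \<ge> R2" "int N \<le> int R" "int N - fls_subdegree g \<le> int R" "int N - fls_subdegree g' \<le> int R"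
    by (auto simp: R_def)
  \<comment> \<open>The disjoint sum of two squares presents the difference of both series as a
    single family for \<open>quadratic_scalar\<close>.\<close>
  let ?u = "case_sum (\<lambda>(i, j). fls_nth g (i + j + 1) / 2) (\<lambda>(i, j). - (fls_nth g' (i + j + 1) / 2))"
  let ?f = "case_sum (\<lambda>(i, j). t powi i) (\<lambda>(i, j). s powi i)"
  let ?g = "case_sum (\<lambda>(i, j). t powi j) (\<lambda>(i, j). s powi j)"
  have "scalar_mod N (\<Sum>a\<in>box R <+> box R. scal (?u a) * Q (?f a) (?g a))"
  proof (rule quadratic_scalar[OF s])
    fix l k assume l: "l < int N" and k: "k < int N"
    let ?e = "\<lambda>f n. fls_nth (expansion s f) n"
    have "(\<Sum>a\<in>box R <+> box R. ?u a * (?e (?f a) l * ?e (?g a) k + ?e (?g a) l * ?e (?f a) k)) =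
        (\<Sum>(i, j)\<in>box R. fls_nth g (i + j + 1) / 2 * (?e (t powi i) l * ?e (t powi j) k + ?e (t powi j) l * ?e (t powi i) k)) -
        (\<Sum>(i, j)\<in>box R. fls_nth g' (i + j + 1) / 2 * (?e (s powi i) l * ?e (s powi j) k + ?e (s powi j) l * ?e (s powi i) k))"
      by (simp add: sum.Plus case_prod_unfold sum_negf)
    also have "\<dots> = 0"
      unfolding box_symbol[OF t, where L = "\<lambda>f. ?e f l"] box_symbol[OF s, where L = "\<lambda>f. ?e f l"]
        box_symbol_approx[OF s t l k R(3,4)] box_symbol_approx[OF s s l k R(3,5)] eq by simp
    finally show "(\<Sum>a\<in>box R <+> box R. ?u a * (?e (?f a) l * ?e (?g a) k + ?e (?g a) l * ?e (?f a) k)) = 0" .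
  qed simp
  then have "scalar_mod N ((\<Sum>(i, j)\<in>box R. scal (fls_nth g (i + j + 1) / 2) * Q (t powi i) (t powi j)) -
      (\<Sum>(i, j)\<in>box R. scal (fls_nth g' (i + j + 1) / 2) * Q (s powi i) (s powi j)))"
    by (simp add: sum.Plus case_prod_unfold sum_negf scal_simps(5))
  from scalar_mod_diff[OF scalar_mod_add[OF scalar_mod_pterm[of N t g \<kappa> "box R"] this] scalar_mod_pterm[of N s g' \<kappa>' "box R"]]
  have "scalar_mod N (sum (pterm t g \<kappa>) (box R) - sum (pterm s g' \<kappa>') (box R))"
    by (simp add: algebra_simps)
  then show ?thesis using R1 R2 R(1,2) by blast
qed

text \<open>The borderline case that \<open>res_pairing_vanish\<close> leaves out: the derivative of
  a regular function is regular, although \<open>ddt_frac_ideal\<close> loses one degree.\<close>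

lemma res_pairing_regular:
  assumes "f \<in> frac_ideal 0" "g \<in> frac_ideal 0"
  shows "res_pairing f g = 0"
proof -
  obtain t where t: "uniformizer \<O> t" using ex_uniformizer by blast
  have "fls_nth (fls_deriv (expansion t g)) n = 0" if "n < 0" for n
    using assms(2) that by (cases "n = -1") (auto simp: expansion_mem[OF t])
  then have "ddt t g \<in> frac_ideal 0" using t by (simp add: expansion_mem[OF t] del: fls_deriv_nth)
  from frac_ideal_mult[OF assms(1) this] show ?thesis
    by (simp add: res_pairing_eq[OF t] resid_frac_ideal[OF t, of _ 0])
qed

lemma res_pairing_powi:
  "uniformizer \<O> t \<Longrightarrow> res_pairing (t powi i) (t powi j) = (if i + j = 0 then of_int j else 0)"
  by (cases "i = - j") (auto simp: res_pairing_powi_left)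

section \<open>The standard ordering and the ordering given by eta\<close>

definition standard_order :: "int \<Rightarrow> int \<Rightarrow> 'k" where
  "standard_order i j = (if i > 0 \<and> j = - i then of_int j else 0)"

lemma normal_order_standard: "uniformizer \<O> t \<Longrightarrow> normal_order t standard_order"
  by (auto simp: normal_order_def standard_order_def res_pairing_powi)

text \<open>This is the uniqueness of the splitting. An element of the span that is regular remains
  regular after adding back the regular \<open>fs n\<close>, and what is left is a combination of
  negative powers of t, whose coefficients must vanish.\<close>

lemma minus_part_eq:
  assumes t: "uniformizer \<O> t" and fs: "\<And>n. n \<ge> 1 \<Longrightarrow> fs n \<in> frac_ideal 0"
    and u: "u \<in> L_eta t fs" "f - u \<in> frac_ideal 0"
  shows "minus_part t fs f = u"
  unfolding minus_part_def ring_mem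
proof (rule the_equality)
  fix u' assume "u' \<in> L_eta t fs \<and> f - u' \<in> frac_ideal 0"
  then have u': "u' \<in> L_eta t fs" "f - u' \<in> frac_ideal 0" by auto
  obtain c S where c: "u = (\<Sum>n\<in>S. \<iota> (c n) * (t powi (- int n) - fs n))" "finite S" "S \<subseteq> {1..}"
    using u(1) by (auto simp: L_eta_def)
  obtain c' S' where c': "u' = (\<Sum>n\<in>S'. \<iota> (c' n) * (t powi (- int n) - fs n))" "finite S'" "S' \<subseteq> {1..}"
    using u'(1) by (auto simp: L_eta_def)
  define d where "d n = (if n \<in> S then c n else 0) - (if n \<in> S' then c' n else 0)" for n
  have "u = (\<Sum>n\<in>S \<union> S'. \<iota> (if n \<in> S then c n else 0) * (t powi (- int n) - fs n))"
    unfolding c(1) by (rule sum.mono_neutral_cong_left) (use c c' in auto)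
  moreover have "u' = (\<Sum>n\<in>S \<union> S'. \<iota> (if n \<in> S' then c' n else 0) * (t powi (- int n) - fs n))"
    unfolding c'(1) by (rule sum.mono_neutral_cong_left) (use c c' in auto)
  ultimately have uu: "u - u' = (\<Sum>n\<in>S \<union> S'. \<iota> (d n) * (t powi (- int n) - fs n))"
    by (simp only: sum_subtractf[symmetric] left_diff_distrib[symmetric] d_def iota_diff)
  have "u - u' \<in> frac_ideal 0" using frac_ideal_diff[OF u'(2) u(2)] by simp
  moreover have "(\<Sum>n\<in>S \<union> S'. \<iota> (d n) * fs n) \<in> frac_ideal 0"
    using c c' by (intro frac_ideal_sum frac_ideal_iota_mult fs) auto
  ultimately have "(u - u') + (\<Sum>n\<in>S \<union> S'. \<iota> (d n) * fs n) \<in> frac_ideal 0" by (rule frac_ideal_add)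
  also have "(u - u') + (\<Sum>n\<in>S \<union> S'. \<iota> (d n) * fs n) = (\<Sum>n\<in>S \<union> S'. \<iota> (d n) * t powi (- int n))"
    unfolding uu sum.distrib[symmetric] by (rule sum.cong) (auto simp: right_diff_distrib)
  finally have mem: "(\<Sum>n\<in>S \<union> S'. \<iota> (d n) * t powi (- int n)) \<in> frac_ideal 0" .
  have "d m = 0" if m: "m \<in> S \<union> S'" for m
  proof -
    have "m \<ge> 1" using m c c' by auto
    then have "fls_nth (expansion t (\<Sum>n\<in>S \<union> S'. \<iota> (d n) * t powi (- int n))) (- int m) = 0"
      using mem by (simp add: expansion_mem[OF t])
    moreover have "fls_nth (expansion t (\<Sum>n\<in>S \<union> S'. \<iota> (d n) * t powi (- int n))) (- int m) = (\<Sum>n\<in>S \<union> S'. if n = m then d m else 0)"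
      unfolding expansion_sum[OF t] fls_nth_sum by (rule sum.cong) (use t in auto)
    ultimately show ?thesis using m c c' by (simp add: sum.delta)
  qed
  then have "u - u' = 0" unfolding uu by (intro sum.neutral) simp
  then show "u' = u" by simp
qed (use u in simp)

lemma minus_part_powi:
  assumes t: "uniformizer \<O> t" and fs: "\<And>n. n \<ge> 1 \<Longrightarrow> fs n \<in> frac_ideal 0"
  shows "j \<ge> 0 \<Longrightarrow> minus_part t fs (t powi j) = 0"
    and "m \<ge> 1 \<Longrightarrow> minus_part t fs (t powi (- int m)) = t powi (- int m) - fs m"
proof -
  show "minus_part t fs (t powi j) = 0" if "j \<ge> 0"
  proof (rule minus_part_eq[OF t fs])
    show "0 \<in> L_eta t fs" unfolding L_eta_def by (intro CollectI exI[of _ "\<lambda>_. 0"] exI[of _ "{}"]) simp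
  qed (use that frac_ideal_powi[OF t] in simp_all)
  show "minus_part t fs (t powi (- int m)) = t powi (- int m) - fs m" if "m \<ge> 1"
  proof (rule minus_part_eq[OF t fs])
    show "t powi (- int m) - fs m \<in> L_eta t fs"
      unfolding L_eta_def by (intro CollectI exI[of _ "\<lambda>_. 1"] exI[of _ "{m}"]) (use that in \<open>simp add: iota_one\<close>)
  qed (use that fs in simp_all)
qed

definition eta_order :: "'K \<Rightarrow> (nat \<Rightarrow> 'K) \<Rightarrow> int \<Rightarrow> int \<Rightarrow> 'k" where
  "eta_order t fs i j = res_pairing (plus_part t fs (t powi i)) (minus_part t fs (t powi j))"

text \<open>For i \<ge> 0 the first factor is its own regular part, and replacing the polar part of
  the second factor by the factor itself changes the pairing by that of two regular functions, which
  is 0.\<close>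

lemma normal_order_eta:
  assumes t: "uniformizer \<O> t" and fs: "\<And>n. n \<ge> 1 \<Longrightarrow> fs n \<in> frac_ideal 0"
  shows "normal_order t (eta_order t fs)"
  unfolding normal_order_def
proof (intro conjI allI impI)
  show "eta_order t fs i j = 0" if "j \<ge> 0" for i j
    using minus_part_powi(1)[OF t fs that] by (simp add: eta_order_def)
  show "eta_order t fs i j = res_pairing (t powi i) (t powi j)" if i: "i \<ge> 0" for i j
  proof -
    have p: "plus_part t fs (t powi i) = t powi i" using minus_part_powi(1)[OF t fs i] by (simp add: plus_part_def)
    have "t powi j - minus_part t fs (t powi j) \<in> frac_ideal 0"
    proof (cases "j \<ge> 0")
      case True
      then show ?thesis using minus_part_powi(1)[OF t fs True] frac_ideal_powi[OF t] by simp
    next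
      case False
      then show ?thesis using minus_part_powi(2)[OF t fs, where m = "nat (- j)"] fs by simp
    qed
    from res_pairing_regular[OF frac_ideal_powi[OF t i] this] show ?thesis
      by (simp add: eta_order_def p res_pairing_diff_right)
  qed
qed

text \<open>Of the four products of parts only the regular part of f times the polar part of g
  appears in the opposite order.\<close>

lemma normal_prod_ucong:
  "normal_prod t fs f g \<approx> elt f * elt g - scal (res_pairing (plus_part t fs f) (minus_part t fs g)) * hb"
proof -
  define fm gm fp gp where "fm = minus_part t fs f" and "gm = minus_part t fs g"
    and "fp = plus_part t fs f" and "gp = plus_part t fs g"
  have f: "f = fm + fp" and g: "g = gm + gp" by (simp_all add: fm_def gm_def fp_def gp_def plus_part_def)
  have "elt f * elt g \<approx> (elt fm + elt fp) * (elt gm + elt gp)"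
    by (subst f, subst g) (rule ucong_mult[OF elt_add elt_add])
  also have "\<dots> = elt fm * elt gm + elt fm * elt gp + elt fp * elt gp + elt fp * elt gm"
    by (simp only: distrib_left distrib_right add_ac)
  also have "\<dots> \<approx> elt fm * elt gm + elt fm * elt gp + elt fp * elt gp + (elt gm * elt fp + scal (res_pairing fp gm) * hb)"
    by (intro ucong_add ucong_refl elt_commutator)
  also have "\<dots> = normal_prod t fs f g + scal (res_pairing fp gm) * hb"
    by (simp add: normal_prod_def fm_def gm_def fp_def gp_def)
  finally have "elt f * elt g - scal (res_pairing fp gm) * hb \<approx> normal_prod t fs f g"
    using ucong_diff[OF _ ucong_refl[of "scal (res_pairing fp gm) * hb"]] by fastforce
  then show ?thesis unfolding fp_def gm_def by (rule ucong_sym)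
qed

lemma half_normal_prod:
  "scal (1 / 2) * hi * normal_prod t fs f g \<approx>
    scal (1 / 2) * (Q f g - scal (res_pairing (plus_part t fs f) (minus_part t fs g)))"
proof -
  let ?s = "scal (res_pairing (plus_part t fs f) (minus_part t fs g))"
  have "scal (1 / 2) * hi * normal_prod t fs f g \<approx> scal (1 / 2) * hi * (elt f * elt g - ?s * hb)"
    by (intro ucong_left normal_prod_ucong)
  also have "\<dots> = scal (1 / 2) * (Q f g - ?s * (hi * hb))"
    by (simp only: Q_def right_diff_distrib mult.assoc
        scal_left_commute[where c = "res_pairing (plus_part t fs f) (minus_part t fs g)"])
  also have "\<dots> \<approx> scal (1 / 2) * (Q f g - ?s * 1)"
    by (intro ucong_left ucong_diff hi_hb ucong_refl)
  finally show ?thesis by simp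
qed

lemma T_basis_eq:
  assumes t: "uniformizer \<O> t" and fs: "\<And>n. n \<ge> 1 \<Longrightarrow> fs n \<in> frac_ideal 0"
  shows "T_basis t fs n N = coset N (\<Sum>i\<in>{n - int N<..<int N}. pterm t (fls_X_intpow (n + 1)) (eta_order t fs) (i, n - i))"
  unfolding T_basis_def
proof (rule csum_coset)
  let ?a = "\<lambda>i. pterm t (fls_X_intpow (n + 1)) (eta_order t fs) (i, n - i)"
  show "incl (scal (1 / 2) * hi * normal_prod t fs (t powi i) (t powi (n - i))) N = coset N (?a i)" for i
    unfolding incl_coset coset_eq_iff
    using ucong_J[OF half_normal_prod] by (simp add: pterm_def eta_order_def)
  show "?a i \<in> J N" if "i \<notin> {n - int N<..<int N}" for i
    by (rule pterm_J[OF t normal_order_eta[OF t fs]]) (use that in \<open>auto simp: core_def\<close>)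
qed simp

lemma T_eta_eq:
  assumes t: "uniformizer \<O> t" and fs: "\<And>n. n \<ge> 1 \<Longrightarrow> fs n \<in> frac_ideal 0"
  shows "T_eta t fs D = vir_series t (expansion t (D t)) (eta_order t fs)"
proof
  fix N
  let ?g = "expansion t (D t)"
  let ?S = "\<lambda>n. {n - int N<..<int N}"
  let ?a = "\<lambda>n i. pterm t (fls_X_intpow (n + 1)) (eta_order t fs) (i, n - i)"
  \<comment> \<open>Both indices i and n - i are below N, so the inner range is empty once n exceeds
    2 N; below the lower bound the coefficient of D_n is zero.\<close>
  have "T_eta t fs D N = coset N (\<Sum>n\<in>{fls_subdegree ?g - 1..2 * int N}. scal (fls_nth ?g (n + 1)) * (\<Sum>i\<in>?S n. ?a n i))"
    unfolding T_eta_def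
  proof (rule csum_coset)
    show "cscale (fls_nth ?g (n + 1)) (T_basis t fs n) N = coset N (scal (fls_nth ?g (n + 1)) * (\<Sum>i\<in>?S n. ?a n i))" for n
      by (rule cscale_coset[OF T_basis_eq[OF t fs]])
    show "scal (fls_nth ?g (n + 1)) * (\<Sum>i\<in>?S n. ?a n i) \<in> J N" if "n \<notin> {fls_subdegree ?g - 1..2 * int N}" for n
    proof (cases "n < fls_subdegree ?g - 1")
      case True
      then show ?thesis by (simp add: scal_simps)
    next
      case False
      then have "?S n = {}" using that by auto
      then show ?thesis by simp
    qed
  qed simp
  also have "(\<Sum>n\<in>{fls_subdegree ?g - 1..2 * int N}. scal (fls_nth ?g (n + 1)) * (\<Sum>i\<in>?S n. ?a n i)) =
      (\<Sum>(n, i)\<in>(SIGMA n:{fls_subdegree ?g - 1..2 * int N}. ?S n). scal (fls_nth ?g (n + 1)) * ?a n i)"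
    by (simp add: sum_distrib_left sum.Sigma)
  also have "\<dots> = sum (pterm t ?g (eta_order t fs)) (core ?g N)"
    by (rule sum.reindex_bij_witness[of _ "\<lambda>(i, j). (i + j, i)" "\<lambda>(n, i). (i, n - i)"])
      (auto simp: core_def pterm_def mult.assoc[symmetric] simp flip: scal_simps(2))
  finally show "T_eta t fs D N = vir_series t ?g (eta_order t fs) N" by (simp add: vir_series_def)
qed

subsection \<open>Comparison of normal orderings\<close>

lemma vacuum_pterm: "vacuum s (pterm t g \<kappa> (i, j)) = fls_nth g (i + j + 1) / 2 * (vacuum s (Q (t powi i) (t powi j)) - \<kappa> i j)"
  by (simp only: pterm_def case_prod_conv vacuum_scal_mult vacuum_diff vacuum_scal)

lemma vacuum_ucong: "uniformizer \<O> s \<Longrightarrow> x \<approx> y \<Longrightarrow> vacuum s x = vacuum s y"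
  using vacuum_J[of s "x - y" 1] ucong_J[of x y 1] by (simp add: vacuum_diff)

lemma vacuum_Q_right_regular:
  assumes s: "uniformizer \<O> s" and "g \<in> frac_ideal 0"
  shows "vacuum s (Q f g) = 0"
proof -
  have "vacuum s (Q f g) = - (\<Sum>n\<le>0. of_nat n * fls_nth (expansion s f) (int n) * fls_nth (expansion s g) (- int n))"
    unfolding Q_def by (rule vacuum_quadratic[OF s]) (use assms in \<open>simp add: expansion_mem[OF s]\<close>)
  then show ?thesis by simp
qed

lemma vacuum_Q_left_regular:
  assumes s: "uniformizer \<O> s" and "f \<in> frac_ideal 0"
  shows "vacuum s (Q f g) = res_pairing f g"
  using vacuum_ucong[OF s Q_swap[of f g]] vacuum_Q_right_regular[OF assms]
  by (simp add: vacuum_add vacuum_scal)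

lemma vacuum_Q_add_left: "uniformizer \<O> s \<Longrightarrow> vacuum s (Q (f + f') g) = vacuum s (Q f g) + vacuum s (Q f' g)"
  using vacuum_ucong[OF _ Q_add_left[of f f' g], of s] by (simp add: vacuum_add)

text \<open>The vacuum of s yields a normal ordering for powers of t: it kills products with a
  regular right factor, and a regular left factor leaves only the pairing. The vacuum value of a
  series is thereby a comparison of two orderings.\<close>

lemma normal_order_vacuum:
  assumes s: "uniformizer \<O> s" and t: "uniformizer \<O> t"
  shows "normal_order t (\<lambda>i j. vacuum s (Q (t powi i) (t powi j)))"
  unfolding normal_order_def
  using vacuum_Q_right_regular[OF s frac_ideal_powi[OF t]] vacuum_Q_left_regular[OF s frac_ideal_powi[OF t]]
  by blast

lemma vacuum_Q_powi_left:
  assumes t: "uniformizer \<O> t"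
  shows "vacuum t (Q (t powi i) f) = (if i \<ge> 0 then - of_int i * fls_nth (expansion t f) (- i) else 0)"
proof -
  define B where "B = max (nat i) (nat (- fls_subdegree (expansion t f)))"
  have "vacuum t (Q (t powi i) f) = - (\<Sum>n\<le>B. of_nat n * fls_nth (expansion t (t powi i)) (int n) * fls_nth (expansion t f) (- int n))"
    unfolding Q_def by (rule vacuum_quadratic[OF t]) (auto simp: B_def)
  also have "(\<Sum>n\<le>B. of_nat n * fls_nth (expansion t (t powi i)) (int n) * fls_nth (expansion t f) (- int n)) =
      (\<Sum>n\<le>B. if n = nat i \<and> i \<ge> 0 then of_int i * fls_nth (expansion t f) (- i) else 0)"
    by (rule sum.cong) (use t in auto)
  also have "\<dots> = (if i \<ge> 0 then of_int i * fls_nth (expansion t f) (- i) else 0)"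
    by (auto simp: B_def)
  finally show ?thesis by auto
qed

lemma vacuum_Q_powi_right:
  assumes t: "uniformizer \<O> t"
  shows "vacuum t (Q f (t powi j)) = (if j \<le> 0 then of_int j * fls_nth (expansion t f) (- j) else 0)"
proof -
  define B where "B = nat (- j)"
  have "vacuum t (Q f (t powi j)) = - (\<Sum>n\<le>B. of_nat n * fls_nth (expansion t f) (int n) * fls_nth (expansion t (t powi j)) (- int n))"
    unfolding Q_def by (rule vacuum_quadratic[OF t]) (use t in \<open>auto simp: B_def\<close>)
  also have "(\<Sum>n\<le>B. of_nat n * fls_nth (expansion t f) (int n) * fls_nth (expansion t (t powi j)) (- int n)) =
      (\<Sum>n\<le>B. if n = nat (- j) \<and> j \<le> 0 then - of_int j * fls_nth (expansion t f) (- j) else 0)"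
    by (rule sum.cong) (use t in auto)
  also have "\<dots> = (if j \<le> 0 then - of_int j * fls_nth (expansion t f) (- j) else 0)"
    by (auto simp: B_def)
  finally show ?thesis by auto
qed

text \<open>The standard ordering in t subtracts precisely the vacuum values in t, so each term has
  value 0.\<close>

lemma vacuum_standard:
  assumes t: "uniformizer \<O> t"
  shows "vacuum t (sum (pterm t g standard_order) B) = 0"
proof -
  have "vacuum t (pterm t g standard_order p) = 0" for p
    by (cases p) (auto simp: vacuum_pterm vacuum_Q_powi_left[OF t] standard_order_def t)
  then show ?thesis by (simp add: vacuum_sum)
qed

lemma residue_diag:
  fixes g :: "'k fls"
  assumes "\<And>n. n < - int R \<Longrightarrow> fls_nth g n = 0"
  shows "(\<Sum>i<R. \<Sum>l<R. fls_nth g (- 1 - int i - int l) * (S $ i $ l)) = fls_residue (g * fps_to_fls (diag S))"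
proof -
  have "fls_residue (g * fps_to_fls (diag S)) = fls_nth (fps_to_fls (diag S) * g) (- 1)"
    by (simp add: mult.commute)
  also have "\<dots> = (\<Sum>n\<in>{0..int R - 1}. fls_nth (fps_to_fls (diag S)) n * fls_nth g (- 1 - n))"
    by (rule fls_times_nth_bounds) (use assms in auto)
  also have "\<dots> = (\<Sum>n<R. diag S $ n * fls_nth g (- 1 - int n))"
    by (rule sum.reindex_bij_witness[of _ int nat]) auto
  also have "\<dots> = (\<Sum>n<R. \<Sum>i\<le>n. fls_nth g (- 1 - int n) * (S $ i $ (n - i)))"
    by (simp add: diag_def sum_distrib_left mult.commute)
  also have "\<dots> = (\<Sum>(n, i)\<in>(SIGMA n:{..<R}. {..n}). fls_nth g (- 1 - int n) * (S $ i $ (n - i)))"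
    by (simp add: sum.Sigma)
  also have "\<dots> = (\<Sum>(i, l)\<in>{(i, l). i + l < R}. fls_nth g (- 1 - int i - int l) * (S $ i $ l))"
    by (rule sum.reindex_bij_witness[of _ "\<lambda>(i, l). (i + l, i)" "\<lambda>(n, i). (i, n - i)"])
      (auto simp: algebra_simps)
  also have "\<dots> = (\<Sum>(i, l)\<in>{..<R} \<times> {..<R}. fls_nth g (- 1 - int i - int l) * (S $ i $ l))"
  proof (rule sum.mono_neutral_left)
    have "i + l < R" if "fls_nth g (- 1 - int i - int l) \<noteq> 0" for i l
      using assms[of "- 1 - int i - int l"] that by (cases "i + l < R") auto
    then show "\<forall>p\<in>{..<R} \<times> {..<R} - {(i, l). i + l < R}. (case p of (i, l) \<Rightarrow> fls_nth g (- 1 - int i - int l) * (S $ i $ l)) = 0"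
      by auto
  qed auto
  finally show ?thesis by (simp add: sum.cartesian_product)
qed

text \<open>Two orderings agree unless both indices are negative, so their difference is a matrix
  indexed by pole orders, encoded as a power series S in two variables. For i = -m and j = -l the
  index i + j + 1 is -1 - (m-1) - (l-1), and summing along total degree gives a residue on the
  diagonal.\<close>

lemma order_difference:
  assumes k: "normal_order t \<kappa>" and k': "normal_order t \<kappa>'"
    and S: "\<And>m l. m \<ge> 1 \<Longrightarrow> l \<ge> 1 \<Longrightarrow> \<kappa>' (- int m) (- int l) - \<kappa> (- int m) (- int l) = - (S $ (m - 1) $ (l - 1))"
    and R: "- fls_subdegree g \<le> int R"
  shows "(\<Sum>(i, j)\<in>box R. fls_nth g (i + j + 1) / 2 * (\<kappa>' i j - \<kappa> i j)) = - (fls_residue (g * fps_to_fls (diag S)) / 2)"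
proof -
  have z: "\<kappa>' i j - \<kappa> i j = 0" if "i \<ge> 0 \<or> j \<ge> 0" for i j
    using k k' that unfolding normal_order_def by force
  have z': "i \<le> -1 \<and> j \<le> -1" if "\<kappa>' i j \<noteq> \<kappa> i j" for i j
    using z[of i j] that by force
  have "(\<Sum>(i, j)\<in>box R. fls_nth g (i + j + 1) / 2 * (\<kappa>' i j - \<kappa> i j)) =
      (\<Sum>(i, j)\<in>{- int R..-1} \<times> {- int R..-1}. fls_nth g (i + j + 1) / 2 * (\<kappa>' i j - \<kappa> i j))"
    by (rule sum.mono_neutral_right) (auto simp: box_def dest: z')
  also have "\<dots> = (\<Sum>(i, l)\<in>{..<R} \<times> {..<R}. - (fls_nth g (- 1 - int i - int l) * (S $ i $ l) / 2))"
  proof (rule sum.reindex_bij_witness[of _ "\<lambda>(i, l). (- 1 - int i, - 1 - int l)" "\<lambda>(i, j). (nat (- 1 - i), nat (- 1 - j))"], goal_cases)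
    case (5 p)
    obtain i j where p: "p = (i, j)" by (cases p)
    with 5 have ij: "i \<le> -1" "j \<le> -1" by auto
    define a b where "a = nat (- 1 - i)" and "b = nat (- 1 - j)"
    have e: "i = - int (Suc a)" "j = - int (Suc b)" using ij by (simp_all add: a_def b_def)
    then have "nat (- 1 - i) = a" "nat (- 1 - j) = b" by simp_all
    moreover have "\<kappa>' i j - \<kappa> i j = - (S $ a $ b)" using S[of "Suc a" "Suc b"] by (simp add: e del: of_nat_Suc)
    moreover have "fls_nth g (- 1 - int a - int b) = fls_nth g (i + j + 1)"
      by (rule arg_cong[of _ _ "fls_nth g"]) (simp add: e)
    ultimately show ?case by (simp add: p)
  qed auto
  also have "\<dots> = - (\<Sum>i<R. \<Sum>l<R. fls_nth g (- 1 - int i - int l) * (S $ i $ l)) / 2"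
    by (simp add: sum.cartesian_product[symmetric] sum_negf sum_divide_distrib)
  also have "(\<Sum>i<R. \<Sum>l<R. fls_nth g (- 1 - int i - int l) * (S $ i $ l)) = fls_residue (g * fps_to_fls (diag S))"
    by (rule residue_diag) (use R in auto)
  finally show ?thesis by simp
qed

text \<open>Both series are evaluated in the vacuum of s: the standard one gives 0, the other minus
  one half of the residue. Their difference is known to be a scalar and so equals one half of the
  residue.\<close>

lemma vir_series_shift:
  assumes t: "uniformizer \<O> t" and k: "normal_order t \<kappa>" and s: "uniformizer \<O> s"
    and eq: "vec s g' = vec t g"
    and S: "\<And>m l. m \<ge> 1 \<Longrightarrow> l \<ge> 1 \<Longrightarrow>
      vacuum s (Q (t powi (- int m)) (t powi (- int l))) - \<kappa> (- int m) (- int l) = - (S $ (m - 1) $ (l - 1))"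
  shows "vir_series s g' standard_order = cadd (incl (scal (fls_residue (g * fps_to_fls (diag S)) / 2))) (vir_series t g \<kappa>)"
proof -
  note ks = normal_order_standard[OF s]
  obtain R1 where R1: "\<And>R. R \<ge> R1 \<Longrightarrow> sum (pterm s g' standard_order) (box R) \<in> vir_series s g' standard_order 1"
    using vir_series_box[OF s ks] by blast
  obtain R2 where R2: "\<And>R. R \<ge> R2 \<Longrightarrow> sum (pterm t g \<kappa>) (box R) \<in> vir_series t g \<kappa> 1"
    using vir_series_box[OF t k] by blast
  define R where "R = max (max R1 R2) (nat (- fls_subdegree g))"
  have "vacuum s (sum (pterm t g \<kappa>) (box R)) =
      (\<Sum>(i, j)\<in>box R. fls_nth g (i + j + 1) / 2 * (vacuum s (Q (t powi i) (t powi j)) - \<kappa> i j))"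
    unfolding vacuum_sum by (rule sum.cong) (auto simp: vacuum_pterm)
  also have "\<dots> = - (fls_residue (g * fps_to_fls (diag S)) / 2)"
    by (rule order_difference[OF k normal_order_vacuum[OF s t] S]) (simp_all add: R_def)
  finally have v: "vacuum s (sum (pterm t g \<kappa>) (box R)) = - (fls_residue (g * fps_to_fls (diag S)) / 2)" .
  show ?thesis
    using differ_by_scalar[OF vir_series_completion[OF s ks] vir_series_completion[OF t k] vir_series_differ[OF s ks t k eq] s R1[of R] R2[of R]]
    by (simp add: R_def[symmetric] v vacuum_standard[OF s] del: fls_residue_def) (simp add: R_def)
qed

text \<open>The ordering scalar at (-m, -l) is the pairing of \<open>fs m\<close> with t^(-l), since
  two regular functions pair to 0. It is minus l times the coefficient l of \<open>fs m\<close>,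
  which up to sign is the entry (m-1, l-1) of the regular part of \<open>eta\<close>.\<close>

lemma vir_series_eta:
  assumes t: "uniformizer \<O> t" and fs: "\<And>n. n \<ge> 1 \<Longrightarrow> fs n \<in> frac_ideal 1"
  shows "vir_series t g standard_order = cadd (incl (scal (- (fls_residue (g * fps_to_fls (diag
      (Abs_fps (\<lambda>i. fps_deriv (fls_regpart (expansion t (fs (Suc i)))))))) / 2)))) (vir_series t g (eta_order t fs))"
proof -
  have fs0: "fs n \<in> frac_ideal 0" if "n \<ge> 1" for n using frac_ideal_mono[OF _ fs[OF that], of 0] by simp
  define S where "S = Abs_fps (\<lambda>i. fps_deriv (fls_regpart (expansion t (fs (Suc i)))))"
  have "vacuum t (Q (t powi (- int m)) (t powi (- int l))) - eta_order t fs (- int m) (- int l) = - ((- S) $ (m - 1) $ (l - 1))"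
    if m: "m \<ge> 1" and l: "l \<ge> 1" for m l
  proof -
    have "vacuum t (Q (t powi (- int m)) (t powi (- int l))) = 0"
      using m by (simp add: vacuum_Q_powi_left[OF t])
    moreover have "eta_order t fs (- int m) (- int l) = - (S $ (m - 1) $ (l - 1))"
    proof -
      have "eta_order t fs (- int m) (- int l) = res_pairing (fs m) (t powi (- int l) - fs l)"
        using minus_part_powi(2)[OF t fs0] m l by (simp add: eta_order_def plus_part_def)
      also have "\<dots> = res_pairing (fs m) (t powi (- int l))"
        by (simp add: res_pairing_diff_right res_pairing_regular[OF fs0[OF m] fs0[OF l]])
      also have "\<dots> = - res_pairing (t powi (- int l)) (fs m)" by (rule res_pairing_antisym)
      also have "\<dots> = - (of_nat l * fls_nth (expansion t (fs m)) (int l))"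
        by (simp add: res_pairing_powi_left[OF t])
      finally show ?thesis using m l by (simp add: S_def of_nat_diff)
    qed
    ultimately show ?thesis by simp
  qed
  from vir_series_shift[OF t normal_order_eta[OF t fs0] t refl this, of g]
  have "vir_series t g standard_order = cadd (incl (scal (fls_residue (g * fps_to_fls (diag (- S))) / 2))) (vir_series t g (eta_order t fs))"
    by simp
  moreover have "diag (- S) = - diag S" by (simp add: diag_def fps_eq_iff sum_negf)
  ultimately show ?thesis by (simp add: S_def)
qed

lemma vir_series_coordinates:
  assumes t: "uniformizer \<O> t" and s: "uniformizer \<O> s" and eq: "vec s g' = vec t g"
  shows "vir_series s g' standard_order =
    cadd (incl (scal (fls_residue (g * fps_to_fls (diag (schwarzian (transition t s)))) / 2))) (vir_series t g standard_order)"
proof (rule vir_series_shift[OF t normal_order_standard[OF t] s eq])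
  fix m l :: nat assume m: "m \<ge> 1" and l: "l \<ge> 1"
  let ?phi = "transition t s"
  note phi = subdegree_transition[OF t s]
  \<comment> \<open>P is the part of t^(-m) with negative powers of s, so the vacuum of s kills its
    products with anything on the right. The rest u is regular and contributes only its pairing,
    which involves \<open>polar_diff\<close>.\<close>
  define P where "P = (\<Sum>j<m. \<iota> ((fps_deriv ?phi * ?phi ^ j) $ (m - 1)) * s powi (- int j - 1))"
  define u where "u = t powi (- int m) - P"
  have EP: "expansion t P = polar ?phi m"
    unfolding P_def polar_def[OF phi] expansion_sum[OF t]
    by (rule sum.cong) (simp_all add: t fps_to_fls_transition[OF t s])
  have Eu: "expansion t u = - fps_to_fls (polar_diff ?phi $ (m - 1))"
    using polar_diff_nth[OF phi, of "m - 1"] m t by (simp add: u_def EP)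
  then have u: "u \<in> frac_ideal 0" by (simp add: expansion_mem[OF t])
  have "vacuum s (Q P (t powi (- int l))) = 0"
  proof -
    have "Q P (t powi (- int l)) \<approx> (\<Sum>j<m. Q (\<iota> ((fps_deriv ?phi * ?phi ^ j) $ (m - 1)) * s powi (- int j - 1)) (t powi (- int l)))"
      unfolding P_def by (rule Q_sum_left)
    also have "\<dots> \<approx> (\<Sum>j<m. scal ((fps_deriv ?phi * ?phi ^ j) $ (m - 1)) * Q (s powi (- int j - 1)) (t powi (- int l)))"
      by (intro ucong_sum Q_scale_left)
    finally show ?thesis
      by (simp add: vacuum_ucong[OF s] vacuum_sum vacuum_scal_mult vacuum_Q_powi_left[OF s])
  qed
  moreover have "t powi (- int m) = u + P" by (simp add: u_def)
  ultimately have "vacuum s (Q (t powi (- int m)) (t powi (- int l))) = vacuum s (Q u (t powi (- int l)))"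
    by (simp add: vacuum_Q_add_left[OF s])
  also have "\<dots> = res_pairing u (t powi (- int l))" by (rule vacuum_Q_left_regular[OF s u])
  also have "\<dots> = - res_pairing (t powi (- int l)) u" by (rule res_pairing_antisym)
  also have "\<dots> = of_nat l * polar_diff ?phi $ (m - 1) $ l"
    by (simp add: res_pairing_powi_left[OF t] Eu)
  also have "\<dots> = - (schwarzian ?phi $ (m - 1) $ (l - 1))"
    using l by (simp add: schwarzian_def[OF phi] of_nat_diff)
  finally show "vacuum s (Q (t powi (- int m)) (t powi (- int l))) - standard_order (- int m) (- int l) =
      - (schwarzian ?phi $ (m - 1) $ (l - 1))" by (simp add: standard_order_def)
qed

subsection \<open>Commutators of quadratic series\<close>

definition field_bracket :: "'k fls \<Rightarrow> 'k fls \<Rightarrow> 'k fls" where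
  "field_bracket g g' = g * fls_deriv g' - g' * fls_deriv g"

lemma vec_bracket:
  assumes t: "uniformizer \<O> t"
  shows "vec t (field_bracket g g') x = vec t g (vec t g' x) - vec t g' (vec t g x)"
  using t by (simp add: field_bracket_def algebra_simps flip: expansion_eq_iff[OF t])

lemma vec_frac_ideal:
  assumes t: "uniformizer \<O> t" and f: "f \<in> frac_ideal N"
  shows "vec t g f \<in> frac_ideal (fls_subdegree g + (N - 1))"
  unfolding expansion_mem[OF t] expansion_vec[OF t]
proof (intro allI impI)
  fix n assume "n < fls_subdegree g + (N - 1)"
  then show "fls_nth (g * fls_deriv (expansion t f)) n = 0"
    by (intro fls_mult_vanish[of "fls_subdegree g" _ "N - 1"]) (use f in \<open>auto simp: expansion_mem[OF t]\<close>)
qed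

lemma vec_add: "uniformizer \<O> t \<Longrightarrow> vec t g (x + y) = vec t g x + vec t g y"
  and vec_iota_mult: "uniformizer \<O> t \<Longrightarrow> vec t g (\<iota> c * x) = \<iota> c * vec t g x"
  using thetaD(1,2)[OF vec_theta[of t g]] by auto

lemma vec_0: "uniformizer \<O> t \<Longrightarrow> vec t g 0 = 0"
  using theta_0[OF vec_theta[of t g]] .

lemma vec_diff: "uniformizer \<O> t \<Longrightarrow> vec t g (x - y) = vec t g x - vec t g y"
  using vec_add[of t g "x - y" y] by simp

lemma vec_sum: "uniformizer \<O> t \<Longrightarrow> vec t g (sum f A) = (\<Sum>i\<in>A. vec t g (f i))"
  by (induction A rule: infinite_finite_induct) (simp_all add: vec_0 vec_add)

text \<open>The derivation given by g applied to both factors of the truncated series of g'. The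
  ordering scalars of either series do not occur because they are central.\<close>

definition bracket_sum :: "'K \<Rightarrow> 'k fls \<Rightarrow> 'k fls \<Rightarrow> nat \<Rightarrow> ('k, 'K) heis_free" where
  "bracket_sum t g g' R = (\<Sum>(i, j)\<in>box R. scal (fls_nth g' (i + j + 1) / 2) *
     (Q (vec t g (t powi i)) (t powi j) + Q (t powi i) (vec t g (t powi j))))"

lemma pterm_hi: "pterm t g \<kappa> p * hi \<approx> hi * pterm t g \<kappa> p"
proof -
  obtain i j where p: "p = (i, j)" by (cases p)
  let ?c = "scal (fls_nth g (i + j + 1) / 2)"
  have "(Q (t powi i) (t powi j) - scal (\<kappa> i j)) * hi = Q (t powi i) (t powi j) * hi - hi * scal (\<kappa> i j)"
    by (simp add: left_diff_distrib scal_commute[of _ hi])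
  also have "\<dots> \<approx> hi * Q (t powi i) (t powi j) - hi * scal (\<kappa> i j)"
    by (intro ucong_diff Q_hi ucong_refl)
  finally have "?c * ((Q (t powi i) (t powi j) - scal (\<kappa> i j)) * hi) \<approx> ?c * (hi * (Q (t powi i) (t powi j) - scal (\<kappa> i j)))"
    by (intro ucong_left) (simp add: right_diff_distrib)
  then show ?thesis by (simp add: p pterm_def mult.assoc scal_left_commute)
qed

text \<open>Changing the left factor by a small element costs the scalar by which it pairs with g;
  the last two hypotheses make that pairing vanish.\<close>

lemma Q_near:
  assumes "f - f' \<in> frac_ideal (int N)" "f - f' \<in> frac_ideal P" "g \<in> frac_ideal (1 - P)"
  shows "Q f g - Q f' g \<in> J N"
proof -
  have "res_pairing (f - f') g = 0" by (rule res_pairing_vanish[OF assms(2,3)]) simp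
  then have "Q (f - f') g \<in> J N" using Q_left_J[OF assms(1), of g] by (simp add: scal_simps)
  from J_diff[OF this ucong_J[OF Q_diff_left[of f f' g]]] show ?thesis by simp
qed

lemma commutator_vir_series:
  assumes t: "uniformizer \<O> t" and k: "normal_order t \<kappa>" and k': "normal_order t \<kappa>'"
  shows "\<exists>R0. \<forall>R\<ge>R0. commutator (vir_series t g \<kappa>) (vir_series t g' \<kappa>') N = coset N (bracket_sum t g g' R)"
proof -
  let ?X = "vir_series t g \<kappa>" and ?Y = "vir_series t g' \<kappa>'"
  obtain c0 where c0: "\<And>y. y \<in> ?Y c0 \<Longrightarrow> \<exists>a0. \<forall>a\<ge>a0. \<forall>x\<in>?X a. commutator ?X ?Y N = coset N (x * y - y * x)"
    using commutator_coset[OF vir_series_completion[OF t k] vir_series_completion[OF t k'], where N = N] by blast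
  obtain R0 where R0: "\<And>R. R \<ge> R0 \<Longrightarrow> sum (pterm t g' \<kappa>') (box R) \<in> ?Y c0" using vir_series_box[OF t k'] by blast
  have "commutator ?X ?Y N = coset N (bracket_sum t g g' R')" if R': "R' \<ge> R0" for R'
  proof -
    define y where "y = sum (pterm t g' \<kappa>') (box R')"
    obtain a0 where a0: "\<And>a x. a \<ge> a0 \<Longrightarrow> x \<in> ?X a \<Longrightarrow> commutator ?X ?Y N = coset N (x * y - y * x)"
      using c0[OF R0[OF R']] y_def by blast
    \<comment> \<open>The truncation R' of the second series is now fixed, so its powers of t have
      exponents at least -R'. The bound R' + 1 makes the error of the contraction pair trivially
      with all of them.\<close>
    define P where "P = max (int N) (int R' + 1)"
    have "eventually (\<lambda>R. sum (pterm t g \<kappa>) (box R) \<in> ?X a0) sequentially"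
      using vir_series_box[OF t k] by (simp add: eventually_sequentially)
    moreover have "eventually (\<lambda>R. \<forall>i\<in>{- int R'..int R'}. contraction t g (fls_deriv (expansion t (t powi i))) R - vec t g (t powi i) \<in> frac_ideal P) sequentially"
      using contraction_vec[OF t, where N = P] by (intro eventually_ball_finite) (auto simp: eventually_sequentially)
    ultimately have "eventually (\<lambda>R. sum (pterm t g \<kappa>) (box R) \<in> ?X a0 \<and> (\<forall>i\<in>{- int R'..int R'}. contraction t g (fls_deriv (expansion t (t powi i))) R - vec t g (t powi i) \<in> frac_ideal P)) sequentially"
      by (rule eventually_conj)
    then obtain R where R: "sum (pterm t g \<kappa>) (box R) \<in> ?X a0"
      "\<And>i. i \<in> {- int R'..int R'} \<Longrightarrow> contraction t g (fls_deriv (expansion t (t powi i))) R - vec t g (t powi i) \<in> frac_ideal P"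
      unfolding eventually_sequentially by blast
    define x where "x = sum (pterm t g \<kappa>) (box R)"
    define con where "con i = contraction t g (fls_deriv (expansion t (t powi i))) R" for i
    have con: "con i - vec t g (t powi i) \<in> frac_ideal P" if "i \<in> {- int R'..int R'}" for i
      using R(2)[OF that] by (simp add: con_def)
    have xhi: "x * hi \<approx> hi * x"
      unfolding x_def sum_distrib_left sum_distrib_right by (intro ucong_sum pterm_hi)
    have xt: "x * elt (t powi i) - elt (t powi i) * x \<approx> elt (con i)" for i
      unfolding x_def con_def by (rule box_bracket[OF t])
    have "x * y - y * x = (\<Sum>(i, j)\<in>box R'. scal (fls_nth g' (i + j + 1) / 2) * (x * Q (t powi i) (t powi j) - Q (t powi i) (t powi j) * x))"
    proof -
      have "x * (scal c * (q - scal d)) - scal c * (q - scal d) * x = scal c * (x * q - q * x)" for c d and q :: "('k, 'K) heis_free"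
      proof -
        have "x * (scal c * (q - scal d)) - scal c * (q - scal d) * x = - (scal c * (q * x - x * q))"
          unfolding bracket_scal[of c q d x, symmetric] by (rule minus_diff_eq[symmetric])
        then show ?thesis by (simp only: mult_minus_right[symmetric] minus_diff_eq)
      qed
      then show ?thesis
        unfolding y_def sum_distrib_left sum_distrib_right sum_subtractf[symmetric]
        by (intro sum.cong) (auto simp: pterm_def)
    qed
    also have "\<dots> \<approx> (\<Sum>(i, j)\<in>box R'. scal (fls_nth g' (i + j + 1) / 2) * (Q (con i) (t powi j) + Q (t powi i) (con j)))"
      by (intro ucong_sum) (auto intro!: ucong_left derivation_Q[OF xhi xt xt])
    finally have 1: "x * y - y * x \<approx> (\<Sum>(i, j)\<in>box R'. scal (fls_nth g' (i + j + 1) / 2) * (Q (con i) (t powi j) + Q (t powi i) (con j)))" .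
    have 2: "(\<Sum>(i, j)\<in>box R'. scal (fls_nth g' (i + j + 1) / 2) * (Q (con i) (t powi j) + Q (t powi i) (con j))) - bracket_sum t g g' R' \<in> J N"
      unfolding bracket_sum_def sum_subtractf[symmetric]
    proof (rule J_sum)
      fix p assume p: "p \<in> box R'"
      obtain i j where ij: "p = (i, j)" by (cases p)
      have i: "i \<in> {- int R'..int R'}" and j: "j \<in> {- int R'..int R'}" using p by (auto simp: ij box_def)
      have "Q (con i) (t powi j) - Q (vec t g (t powi i)) (t powi j) \<in> J N"
      proof (rule Q_near[of _ _ N P])
        show "con i - vec t g (t powi i) \<in> frac_ideal (int N)" by (rule frac_ideal_mono[OF _ con[OF i]]) (simp add: P_def)
        show "t powi j \<in> frac_ideal (1 - P)" by (rule frac_ideal_powi[OF t]) (use j in \<open>auto simp: P_def\<close>)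
      qed (rule con[OF i])
      moreover have "Q (t powi i) (con j) - Q (t powi i) (vec t g (t powi j)) \<in> J N"
      proof -
        have "con j - vec t g (t powi j) \<in> frac_ideal (int N)" by (rule frac_ideal_mono[OF _ con[OF j]]) (simp add: P_def)
        from J_diff[OF Q_right_J[OF this, of "t powi i"] ucong_J[OF Q_diff_right[of "t powi i" "con j" "vec t g (t powi j)"]]] show ?thesis by simp
      qed
      ultimately have "scal (fls_nth g' (i + j + 1) / 2) * ((Q (con i) (t powi j) - Q (vec t g (t powi i)) (t powi j)) +
          (Q (t powi i) (con j) - Q (t powi i) (vec t g (t powi j)))) \<in> J N"
        by (intro J_left J_add)
      then show "(case p of (i, j) \<Rightarrow> scal (fls_nth g' (i + j + 1) / 2) * (Q (con i) (t powi j) + Q (t powi i) (con j))) -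
          (case p of (i, j) \<Rightarrow> scal (fls_nth g' (i + j + 1) / 2) * (Q (vec t g (t powi i)) (t powi j) + Q (t powi i) (vec t g (t powi j)))) \<in> J N"
        by (simp add: ij right_diff_distrib distrib_left algebra_simps)
    qed
    have "commutator ?X ?Y N = coset N (x * y - y * x)" using a0[OF order_refl] R(1) by (simp add: x_def)
    then show ?thesis using J_add[OF ucong_J[OF 1] 2] by (simp add: coset_eq_iff)
  qed
  then show ?thesis by blast
qed

lemma residue_by_parts:
  fixes f g :: "'k fls"
  shows "fls_nth (f * fls_deriv g) (-1) = - fls_nth (fls_deriv f * g) (-1)"
  using fls_residue_times_deriv[of f g] by simp

text \<open>Integration by parts moves the derivative from the first factor to the functional
  X^(-1-l), giving p = -(X^(-1-l) g)'. The terms in which X^(-1-l) is differentiated cancel between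
  the two summands and leave X^(-1-l) times the bracket.\<close>

lemma bracket_symbol:
  assumes t: "uniformizer \<O> t"
  shows "\<exists>R0. \<forall>R\<ge>R0. \<forall>l<N. \<forall>k<N.
    (\<Sum>(i, j)\<in>box R. fls_nth g' (i + j + 1) *
      (fls_nth (expansion t (vec t g (t powi i))) l * fls_nth (expansion t (t powi j)) k +
       fls_nth (expansion t (t powi i)) l * fls_nth (expansion t (vec t g (t powi j))) k)) =
    fls_nth (fls_X_intpow (- 1 - l) * field_bracket g g') k"
proof -
  let ?s = "fls_subdegree g" and ?s' = "fls_subdegree g'"
  \<comment> \<open>A vector field lowers valuations by at most 1 minus its subdegree; the margin
    compensates for that when \<open>vec\<close> is applied to an approximate contraction.\<close>
  define N' where "N' = max N (N - ?s + 1)"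
  define R0 where "R0 = nat (max (max N N') (max (max (N' - ?s') (N - ?s')) (N - ?s + 1 - ?s')))"
  have "(\<Sum>(i, j)\<in>box R. fls_nth g' (i + j + 1) *
      (fls_nth (expansion t (vec t g (t powi i))) l * fls_nth (expansion t (t powi j)) k +
       fls_nth (expansion t (t powi i)) l * fls_nth (expansion t (vec t g (t powi j))) k)) =
    fls_nth (fls_X_intpow (- 1 - l) * field_bracket g g') k" if R: "R \<ge> R0" and l: "l < N" and k: "k < N" for R l k
  proof -
    let ?X = "fls_X_intpow (- 1 - l) :: 'k fls"
    define p where "p = - fls_deriv (?X * g)"
    have R': "N \<le> int R" "N' \<le> int R" "N' - ?s' \<le> int R" "N - ?s' \<le> int R" "N - ?s + 1 - ?s' \<le> int R"
      using R by (auto simp: R0_def)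
    have RN: "N - ?s + 1 \<le> int R" using R'(2) by (simp add: N'_def)
    have pv: "fls_nth p n = 0" if "n < - (N - ?s + 1)" for n
    proof -
      have "fls_nth (?X * g) (n + 1) = 0"
        by (rule fls_mult_vanish[of "- 1 - l" _ ?s]) (use that l in auto)
      then show ?thesis by (simp add: p_def del: fls_deriv_mult)
    qed
    have e1: "fls_nth (expansion t (vec t g (t powi i))) l = fls_nth p (- 1 - i)" for i
    proof -
      have "fls_nth (g * fls_deriv (fls_X_intpow i)) l = fls_nth (?X * (g * fls_deriv (fls_X_intpow i))) (- 1)"
        by (simp add: fls_shifted_times_simps)
      also have "\<dots> = - fls_nth (fls_deriv (?X * g) * fls_X_intpow i) (- 1)"
        unfolding mult.assoc[symmetric] by (rule residue_by_parts)
      also have "\<dots> = fls_nth p (- 1 - i)"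
        by (simp add: p_def fls_shifted_times_simps del: fls_deriv_mult)
      finally show ?thesis using t by simp
    qed
    have e2: "fls_nth (expansion t (t powi i)) l = fls_nth ?X (- 1 - i)" for i using t by auto
    have "(\<Sum>(i, j)\<in>box R. fls_nth g' (i + j + 1) * (fls_nth p (- 1 - i) * fls_nth (expansion t (t powi j)) k)) =
        fls_nth (expansion t (contraction t g' p R)) k"
      unfolding contraction_def expansion_sum[OF t] fls_nth_sum
      by (rule sum.cong) (use t in \<open>auto simp: mult.assoc\<close>)
    also have "\<dots> = fls_nth (p * g') k"
      by (rule contraction_nth[OF t, of "N - ?s + 1"]) (use pv R' RN k in auto)
    finally have 1: "(\<Sum>(i, j)\<in>box R. fls_nth g' (i + j + 1) * (fls_nth p (- 1 - i) * fls_nth (expansion t (t powi j)) k)) = fls_nth (p * g') k" .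
    have "(\<Sum>(i, j)\<in>box R. fls_nth g' (i + j + 1) * (fls_nth ?X (- 1 - i) * fls_nth (expansion t (vec t g (t powi j))) k)) =
        fls_nth (expansion t (vec t g (contraction t g' ?X R))) k"
      unfolding contraction_def vec_sum[OF t] expansion_sum[OF t] fls_nth_sum
      by (rule sum.cong) (use t in \<open>auto simp: mult.assoc vec_iota_mult[OF t] mult.left_commute[of g "fls_const _"]\<close>)
    also have "\<dots> = fls_nth (g * fls_deriv (?X * g')) k"
    proof -
      obtain v where v: "expansion t v = ?X * g'" using expansion_surj[OF t] by blast
      have "contraction t g' ?X R - v \<in> frac_ideal N'"
        unfolding expansion_mem[OF t]
      proof (intro allI impI)
        fix m assume m: "m < N'"
        have "fls_nth (expansion t (contraction t g' ?X R)) m = fls_nth (?X * g') m"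
          by (rule contraction_nth[OF t, of N _ _ N']) (use l R' m in auto)
        then show "fls_nth (expansion t (contraction t g' ?X R - v)) m = 0" using t v by simp
      qed
      from frac_ideal_mono[OF _ vec_frac_ideal[OF t this, of g], of N]
      have "vec t g (contraction t g' ?X R) - vec t g v \<in> frac_ideal N"
        by (simp add: N'_def vec_diff[OF t])
      then have "fls_nth (expansion t (vec t g (contraction t g' ?X R) - vec t g v)) k = 0"
        using k by (simp only: expansion_mem[OF t])
      then show ?thesis using t v by simp
    qed
    finally have 2: "(\<Sum>(i, j)\<in>box R. fls_nth g' (i + j + 1) * (fls_nth ?X (- 1 - i) * fls_nth (expansion t (vec t g (t powi j))) k)) =
      fls_nth (g * fls_deriv (?X * g')) k" .
    have "p * g' + g * fls_deriv (?X * g') = ?X * field_bracket g g'"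
      by (simp add: p_def field_bracket_def algebra_simps)
    then have "fls_nth (p * g') k + fls_nth (g * fls_deriv (?X * g')) k = fls_nth (?X * field_bracket g g') k"
      by (metis fls_plus_nth)
    then show ?thesis
      unfolding e1 e2 distrib_left case_prod_unfold sum.distrib 1[unfolded case_prod_unfold] 2[unfolded case_prod_unfold] .
  qed
  then show ?thesis by blast
qed

lemma bracket_scalar_mod:
  assumes t: "uniformizer \<O> t"
  shows "\<exists>R0. \<forall>R\<ge>R0. scalar_mod N (bracket_sum t g g' R - sum (pterm t (field_bracket g g') \<kappa>) (box R))"
proof -
  let ?b = "field_bracket g g'"
  obtain R1 where R1: "\<And>R l k. R \<ge> R1 \<Longrightarrow> l < int N \<Longrightarrow> k < int N \<Longrightarrow>
    (\<Sum>(i, j)\<in>box R. fls_nth g' (i + j + 1) *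
      (fls_nth (expansion t (vec t g (t powi i))) l * fls_nth (expansion t (t powi j)) k +
       fls_nth (expansion t (t powi i)) l * fls_nth (expansion t (vec t g (t powi j))) k)) =
    fls_nth (fls_X_intpow (- 1 - l) * ?b) k"
    using bracket_symbol[OF t, where N = "int N" and g = g and g' = g'] by blast
  define R0 where "R0 = max R1 (max N (nat (int N - fls_subdegree ?b)))"
  have "scalar_mod N (bracket_sum t g g' R - sum (pterm t ?b \<kappa>) (box R))" if R: "R \<ge> R0" for R
  proof -
    have R': "R \<ge> R1" "int N \<le> int R" "int N - fls_subdegree ?b \<le> int R" using R by (auto simp: R0_def)
    let ?u = "case_sum (\<lambda>(i, j). fls_nth g' (i + j + 1) / 2) (case_sum (\<lambda>(i, j). fls_nth g' (i + j + 1) / 2) (\<lambda>(i, j). - (fls_nth ?b (i + j + 1) / 2)))"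
    let ?f = "case_sum (\<lambda>(i, j). vec t g (t powi i)) (case_sum (\<lambda>(i, j). t powi i) (\<lambda>(i, j). t powi i))"
    let ?g = "case_sum (\<lambda>(i, j). t powi j) (case_sum (\<lambda>(i, j). vec t g (t powi j)) (\<lambda>(i, j). t powi j))"
    have "scalar_mod N (\<Sum>a\<in>box R <+> (box R <+> box R). scal (?u a) * Q (?f a) (?g a))"
    proof (rule quadratic_scalar[OF t])
      fix l k assume l: "l < int N" and k: "k < int N"
      let ?e = "\<lambda>f n. fls_nth (expansion t f) n"
      let ?F = "\<lambda>i j. ?e (vec t g (t powi i)) l * ?e (t powi j) k + ?e (t powi i) l * ?e (vec t g (t powi j)) k"
      have "(\<Sum>a\<in>box R <+> (box R <+> box R). ?u a * (?e (?f a) l * ?e (?g a) k + ?e (?g a) l * ?e (?f a) k)) =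
          (\<Sum>(i, j)\<in>box R. fls_nth g' (i + j + 1) / 2 * (?F i j + ?F j i)) -
          (\<Sum>(i, j)\<in>box R. fls_nth ?b (i + j + 1) / 2 * (?e (t powi i) l * ?e (t powi j) k + ?e (t powi j) l * ?e (t powi i) k))"
        by (simp add: sum.Plus case_prod_unfold sum_negf, subst sum.distrib[symmetric], rule sum.cong) (simp_all add: algebra_simps add_divide_distrib)
      also have "(\<Sum>(i, j)\<in>box R. fls_nth g' (i + j + 1) / 2 * (?F i j + ?F j i)) = (\<Sum>(i, j)\<in>box R. fls_nth g' (i + j + 1) * ?F i j)"
      proof -
        have "(\<Sum>(i, j)\<in>box R. fls_nth g' (i + j + 1) / 2 * (?F i j + ?F j i)) =
            (\<Sum>(i, j)\<in>box R. fls_nth g' (i + j + 1) / 2 * ?F i j) + (\<Sum>(i, j)\<in>box R. fls_nth g' (i + j + 1) / 2 * ?F j i)"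
          unfolding sum.distrib[symmetric] by (rule sum.cong) (auto simp: distrib_left)
        also have "(\<Sum>(i, j)\<in>box R. fls_nth g' (i + j + 1) / 2 * ?F j i) = (\<Sum>(i, j)\<in>box R. fls_nth g' (i + j + 1) / 2 * ?F i j)"
          by (subst sum_box_swap) (simp add: add.commute[of "_ :: int"])
        finally show ?thesis unfolding sum.distrib[symmetric] by (simp add: case_prod_unfold)
      qed
      also have "\<dots> = fls_nth (fls_X_intpow (- 1 - l) * ?b) k" by (rule R1[OF R'(1) l k])
      also have "(\<Sum>(i, j)\<in>box R. fls_nth ?b (i + j + 1) / 2 * (?e (t powi i) l * ?e (t powi j) k + ?e (t powi j) l * ?e (t powi i) k)) =
          fls_nth (fls_X_intpow (- 1 - l) * ?b) k"
        unfolding box_symbol[OF t, where L = "\<lambda>f. ?e f l"] box_symbol_approx[OF t t l k R'(2,3)]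
        using t by simp
      finally show "(\<Sum>a\<in>box R <+> (box R <+> box R). ?u a * (?e (?f a) l * ?e (?g a) k + ?e (?g a) l * ?e (?f a) k)) = 0" by simp
    qed simp
    then have "scalar_mod N (bracket_sum t g g' R - (\<Sum>(i, j)\<in>box R. scal (fls_nth ?b (i + j + 1) / 2) * Q (t powi i) (t powi j)))"
      by (simp add: sum.Plus case_prod_unfold sum_negf scal_simps(5) bracket_sum_def distrib_left sum.distrib add_diff_eq)
    from scalar_mod_diff[OF this scalar_mod_pterm[of N t ?b \<kappa> "box R"]] show ?thesis by simp
  qed
  then show ?thesis by blast
qed

text \<open>The Virasoro cocycle of central charge 1: its value on D_m and D_(-m) is (m^3 -
  m)/12.\<close>

definition cocycle :: "'k fls \<Rightarrow> 'k fls \<Rightarrow> 'k" where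
  "cocycle g g' = fls_residue (fls_deriv (fls_deriv (fls_deriv g)) * g') / 12"

lemma sum_products: "(\<Sum>a\<in>{1..<n}. of_nat a * of_nat (n - a)) = (of_nat n ^ 3 - of_nat n) / (6 :: 'k)"
proof (induction n)
  case (Suc n)
  have "(\<Sum>a\<in>{1..<Suc n}. of_nat a * of_nat (Suc n - a)) = (\<Sum>a\<in>{1..<Suc n}. of_nat a * of_nat (n - a) + of_nat a :: 'k)"
    by (rule sum.cong) (auto simp: Suc_diff_le algebra_simps)
  also have "\<dots> = (\<Sum>a\<in>{1..<n}. of_nat a * of_nat (n - a)) + (\<Sum>a\<in>{1..<Suc n}. of_nat a)"
    by (cases n) (simp_all add: sum.distrib)
  also have "(\<Sum>a\<in>{1..<Suc n}. of_nat a :: 'k) = of_nat n * (of_nat n + 1) / 2"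
    by (induction n) (auto simp: field_simps)
  finally have e: "(\<Sum>a\<in>{1..<Suc n}. of_nat a * of_nat (Suc n - a)) =
      (of_nat n ^ 3 - of_nat n) / 6 + of_nat n * (of_nat n + 1) / (2 :: 'k)" by (simp only: Suc)
  show ?case unfolding e by (simp add: field_simps power3_eq_cube)
qed simp

text \<open>Terms whose indices have opposite signs drop out: either both vacuum contributions
  cancel or neither occurs. What remains is the sum over two negative indices minus that over two
  positive ones. Grouped by the sum n of their absolute values, the weight is the sum of a(n - a),
  which \<open>sum_products\<close> evaluates as (n^3 - n)/6.\<close>

lemma vacuum_bracket_sum:
  assumes t: "uniformizer \<O> t"
  shows "\<exists>R0. \<forall>R\<ge>R0. vacuum t (bracket_sum t g g' R) = cocycle g g'"
proof -
  define R0 where "R0 = nat (max (2 - fls_subdegree g) (2 - fls_subdegree g'))"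
  have "vacuum t (bracket_sum t g g' R) = cocycle g g'" if R: "R \<ge> R0" for R
  proof -
    have R': "1 - fls_subdegree g < int R" "1 - fls_subdegree g' < int R" using R by (auto simp: R0_def)
    define G where "G n = fls_nth g' (n + 1) * fls_nth g (1 - n) / 2" for n
    have G0: "G n = 0" if "n \<ge> int R \<or> n \<le> - int R" for n using that R' by (auto simp: G_def)
    define F where "F i j = of_int i * of_int j * G (i + j)" for i j
    have Fs: "F i j = F j i" for i j by (simp add: F_def mult_ac add.commute)
    have v1: "vacuum t (Q (vec t g (t powi i)) (t powi j)) = (if j \<le> 0 then of_int i * of_int j * fls_nth g (1 - (i + j)) else 0)" for i j
    proof -
      have "fls_nth (expansion t (vec t g (t powi i))) (- j) = of_int i * fls_nth g (1 - (i + j))"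
        using t by (simp add: fls_deriv_X_intpow fls_of_int fls_shifted_times_simps mult.left_commute[of g] algebra_simps)
      then show ?thesis by (simp add: vacuum_Q_powi_right[OF t] mult_ac)
    qed
    have v2: "vacuum t (Q (t powi i) (vec t g (t powi j))) = (if i \<ge> 0 then - of_int i * of_int j * fls_nth g (1 - (i + j)) else 0)" for i j
    proof -
      have "fls_nth (expansion t (vec t g (t powi j))) (- i) = of_int j * fls_nth g (1 - (i + j))"
        using t by (simp add: fls_deriv_X_intpow fls_of_int fls_shifted_times_simps mult.left_commute[of g] algebra_simps)
      then show ?thesis by (simp add: vacuum_Q_powi_left[OF t] mult_ac)
    qed
    have "vacuum t (bracket_sum t g g' R) = (\<Sum>(i, j)\<in>box R. (if j \<le> 0 then F i j else 0) - (if i \<ge> 0 then F i j else 0))"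
      unfolding bracket_sum_def vacuum_sum
    proof (rule sum.cong[OF refl], clarify)
      fix i j
      show "vacuum t (scal (fls_nth g' (i + j + 1) / 2) * (Q (vec t g (t powi i)) (t powi j) + Q (t powi i) (vec t g (t powi j)))) =
        (if j \<le> 0 then F i j else 0) - (if i \<ge> 0 then F i j else 0)"
        unfolding vacuum_scal_mult vacuum_add v1 v2 by (auto simp: F_def G_def)
    qed
    also have "\<dots> = (\<Sum>(i, j)\<in>box R. (if i < 0 \<and> j < 0 then F i j else 0)) - (\<Sum>(i, j)\<in>box R. (if i > 0 \<and> j > 0 then F i j else 0))"
      unfolding sum_subtractf[symmetric] by (rule sum.cong) (auto simp: F_def)
    also have "(\<Sum>(i, j)\<in>box R. (if i < 0 \<and> j < 0 then F i j else 0)) = (\<Sum>(a, b)\<in>{1..R} \<times> {1..R}. of_nat a * of_nat b * G (- int (a + b)))"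
    proof -
      have "(\<Sum>(i, j)\<in>box R. (if i < 0 \<and> j < 0 then F i j else 0)) = (\<Sum>(i, j)\<in>{- int R..-1} \<times> {- int R..-1}. F i j)"
        by (rule sum.mono_neutral_cong_right) (auto simp: box_def split: if_splits)
      also have "\<dots> = (\<Sum>(a, b)\<in>{1..R} \<times> {1..R}. of_nat a * of_nat b * G (- int (a + b)))"
        by (rule sum.reindex_bij_witness[of _ "\<lambda>(a, b). (- int a, - int b)" "\<lambda>(i, j). (nat (- i), nat (- j))"]) (auto simp: F_def)
      finally show ?thesis .
    qed
    also have "(\<Sum>(i, j)\<in>box R. (if i > 0 \<and> j > 0 then F i j else 0)) = (\<Sum>(a, b)\<in>{1..R} \<times> {1..R}. of_nat a * of_nat b * G (int (a + b)))"
    proof -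
      have "(\<Sum>(i, j)\<in>box R. (if i > 0 \<and> j > 0 then F i j else 0)) = (\<Sum>(i, j)\<in>{1..int R} \<times> {1..int R}. F i j)"
        by (rule sum.mono_neutral_cong_right) (auto simp: box_def split: if_splits)
      also have "\<dots> = (\<Sum>(a, b)\<in>{1..R} \<times> {1..R}. of_nat a * of_nat b * G (int (a + b)))"
        by (rule sum.reindex_bij_witness[of _ "\<lambda>(a, b). (int a, int b)" "\<lambda>(i, j). (nat i, nat j)"]) (auto simp: F_def)
      finally show ?thesis .
    qed
    also have "(\<Sum>(a, b)\<in>{1..R} \<times> {1..R}. of_nat a * of_nat b * G (- int (a + b))) - (\<Sum>(a, b)\<in>{1..R} \<times> {1..R}. of_nat a * of_nat b * G (int (a + b))) =
        (\<Sum>(a, b)\<in>{1..R} \<times> {1..R}. of_nat a * of_nat b * (G (- int (a + b)) - G (int (a + b))))"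
      unfolding sum_subtractf[symmetric] by (rule sum.cong) (auto simp: right_diff_distrib)
    also have "\<dots> = (\<Sum>(n, a)\<in>(SIGMA n:{..<R}. {1..<n}). of_nat a * of_nat (n - a) * (G (- int n) - G (int n)))"
    proof -
      have "(\<Sum>(a, b)\<in>{1..R} \<times> {1..R}. of_nat a * of_nat b * (G (- int (a + b)) - G (int (a + b)))) =
          (\<Sum>(a, b)\<in>{(a, b). 1 \<le> a \<and> 1 \<le> b \<and> a + b < R}. of_nat a * of_nat b * (G (- int (a + b)) - G (int (a + b))))"
      proof (rule sum.mono_neutral_right)
        have "a + b < R" if "G (- int (a + b)) \<noteq> G (int (a + b))" for a b
          using that G0[of "int (a + b)"] G0[of "- int (a + b)"] by (cases "a + b < R") auto
        then show "\<forall>p\<in>{1..R} \<times> {1..R} - {(a, b). 1 \<le> a \<and> 1 \<le> b \<and> a + b < R}.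
          (case p of (a, b) \<Rightarrow> of_nat a * of_nat b * (G (- int (a + b)) - G (int (a + b)))) = 0" by auto
      qed auto
      also have "\<dots> = (\<Sum>(n, a)\<in>(SIGMA n:{..<R}. {1..<n}). of_nat a * of_nat (n - a) * (G (- int n) - G (int n)))"
        by (rule sum.reindex_bij_witness[of _ "\<lambda>(n, a). (a, n - a)" "\<lambda>(a, b). (a + b, a)"]) auto
      finally show ?thesis .
    qed
    also have "\<dots> = (\<Sum>n<R. (\<Sum>a\<in>{1..<n}. of_nat a * of_nat (n - a)) * (G (- int n) - G (int n)))"
      by (simp add: sum.Sigma[symmetric] sum_distrib_right)
    also have "\<dots> = (\<Sum>n<R. (of_nat n ^ 3 - of_nat n) / 6 * (G (- int n) - G (int n)))"
      by (simp only: sum_products)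
    finally have 1: "vacuum t (bracket_sum t g g' R) = (\<Sum>n<R. (of_nat n ^ 3 - of_nat n) / 6 * (G (- int n) - G (int n)))" .
    have "fls_residue (fls_deriv (fls_deriv (fls_deriv g)) * g') = fls_nth (g' * fls_deriv (fls_deriv (fls_deriv g))) (-1)"
      by (simp add: mult.commute)
    also have "\<dots> = (\<Sum>k\<in>{2 - int R..int R}. fls_nth g' k * fls_nth (fls_deriv (fls_deriv (fls_deriv g))) (-1 - k))"
      by (rule fls_times_nth_bounds) (use R' in auto)
    \<comment> \<open>With k = n + 1 the threefold derivative contributes (1-n)(-n)(-n-1) = n -
      n^3.\<close>
    also have "\<dots> = (\<Sum>n\<in>{1 - int R..int R - 1}. (of_int n - of_int n ^ 3) * (2 * G n))"
      by (rule sum.reindex_bij_witness[of _ "\<lambda>n. n + 1" "\<lambda>k. k - 1"])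
        (auto simp: G_def algebra_simps power3_eq_cube)
    also have "\<dots> = (\<Sum>n\<in>{1 - int R..-1} \<union> {0..int R - 1}. (of_int n - of_int n ^ 3) * (2 * G n))"
      by (rule sum.cong) (use R' in auto)
    also have "\<dots> = (\<Sum>n\<in>{1 - int R..-1}. (of_int n - of_int n ^ 3) * (2 * G n)) + (\<Sum>n\<in>{0..int R - 1}. (of_int n - of_int n ^ 3) * (2 * G n))"
      by (rule sum.union_disjoint) auto
    also have "(\<Sum>n\<in>{1 - int R..-1}. (of_int n - of_int n ^ 3) * (2 * G n)) = (\<Sum>n\<in>{1..<R}. (of_nat n ^ 3 - of_nat n) * (2 * G (- int n)))"
      by (rule sum.reindex_bij_witness[of _ "\<lambda>n. - int n" "\<lambda>k. nat (- k)"]) (auto simp: of_nat_nat algebra_simps)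
    also have "\<dots> = (\<Sum>n<R. (of_nat n ^ 3 - of_nat n) * (2 * G (- int n)))"
      by (rule sum.mono_neutral_left) (auto simp: not_le)
    also have "(\<Sum>n\<in>{0..int R - 1}. (of_int n - of_int n ^ 3) * (2 * G n)) = (\<Sum>n<R. (of_nat n - of_nat n ^ 3) * (2 * G (int n)))"
      by (rule sum.reindex_bij_witness[of _ int nat]) auto
    finally have 2: "fls_residue (fls_deriv (fls_deriv (fls_deriv g)) * g') = (\<Sum>n<R. (of_nat n ^ 3 - of_nat n) * (2 * G (- int n)) + (of_nat n - of_nat n ^ 3) * (2 * G (int n)))"
      by (simp add: sum.distrib)
    show ?thesis unfolding 1 cocycle_def 2 sum_divide_distrib
      by (rule sum.cong) (auto simp: field_simps)
  qed
  then show ?thesis by blast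
qed

lemma commutator_vir_series_standard:
  assumes t: "uniformizer \<O> t"
  shows "commutator (vir_series t g standard_order) (vir_series t g' standard_order) =
    cadd (incl (scal (cocycle g g'))) (vir_series t (field_bracket g g') standard_order)"
proof -
  let ?k = "standard_order" and ?b = "field_bracket g g'"
  note k = normal_order_standard[OF t]
  let ?C = "commutator (vir_series t g ?k) (vir_series t g' ?k)"
  have C: "?C \<in> completion" by (intro commutator_completion vir_series_completion t k)
  have ev: "eventually (\<lambda>R. bracket_sum t g g' R \<in> ?C N) sequentially" for N
    using commutator_vir_series[OF t k k, of g g' N] by (metis (mono_tags, lifting) coset_self eventually_sequentiallyI)
  have ev': "eventually (\<lambda>R. sum (pterm t ?b ?k) (box R) \<in> vir_series t ?b ?k N) sequentially" for N
    using vir_series_box[OF t k] by (simp add: eventually_sequentially)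
  have "\<exists>x\<in>?C N. \<exists>y\<in>vir_series t ?b ?k N. scalar_mod N (x - y)" for N
  proof -
    have "eventually (\<lambda>R. scalar_mod N (bracket_sum t g g' R - sum (pterm t ?b ?k) (box R))) sequentially"
      using bracket_scalar_mod[OF t] by (simp add: eventually_sequentially)
    from eventually_conj[OF ev[of N] eventually_conj[OF ev'[of N] this]]
    show ?thesis unfolding eventually_sequentially by blast
  qed
  note d = this
  have "eventually (\<lambda>R. vacuum t (bracket_sum t g g' R) = cocycle g g') sequentially"
    using vacuum_bracket_sum[OF t] by (simp add: eventually_sequentially)
  from eventually_conj[OF this eventually_conj[OF ev[of 1] ev'[of 1]]]
  obtain R where R: "vacuum t (bracket_sum t g g' R) = cocycle g g'" "bracket_sum t g g' R \<in> ?C 1"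
    "sum (pterm t ?b ?k) (box R) \<in> vir_series t ?b ?k 1"
    unfolding eventually_sequentially by blast
  from differ_by_scalar[OF C vir_series_completion[OF t k] d t R(2,3)] show ?thesis
    by (simp add: R(1) vacuum_standard[OF t])
qed

end

section \<open>Functoriality of the free algebra\<close>

lemma free_map_superset:
  assumes "finite A" "Poly_Mapping.keys p \<subseteq> A"
  shows "free_map h p = (\<Sum>w\<in>A. Poly_Mapping.single (map_mword h w) (Poly_Mapping.lookup p w))"
  unfolding free_map_def by (rule sum.mono_neutral_left) (use assms in \<open>auto simp: in_keys_iff\<close>)

lemma free_map_add: "free_map h (p + q) = free_map h p + free_map h q"
  using keys_add[of p q]
  by (subst (1 2 3) free_map_superset[of "Poly_Mapping.keys p \<union> Poly_Mapping.keys q"])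
    (auto simp: lookup_add single_add sum.distrib)

lemma free_map_single: "free_map h (Poly_Mapping.single w c) = Poly_Mapping.single (map_mword h w) c"
  by (simp add: free_map_def)

lemma free_map_0 [simp]: "free_map h 0 = 0"
  by (simp add: free_map_def)

lemma free_map_sum: "free_map h (sum f A) = (\<Sum>i\<in>A. free_map h (f i))"
  by (induction A rule: infinite_finite_induct) (simp_all add: free_map_add)

lemma free_map_diff: "free_map h (p - q) = free_map h p - free_map h q"
  using free_map_add[of h "p - q" q] by simp

lemma map_mword_add: "map_mword h (u + v) = map_mword h u + map_mword h v"
  by (cases u; cases v) (simp add: plus_mword_def)

lemma map_mword_0 [simp]: "map_mword h 0 = 0"
  by (simp add: zero_mword_def)

lemma free_map_mult: "free_map h (p * q) = free_map h p * free_map h q"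
proof -
  let ?s = "\<lambda>p w. Poly_Mapping.single w (Poly_Mapping.lookup p w)"
  have "free_map h (p * q) = free_map h ((\<Sum>v\<in>Poly_Mapping.keys p. ?s p v) * (\<Sum>w\<in>Poly_Mapping.keys q. ?s q w))"
    by (simp flip: poly_mapping_sum)
  also have "\<dots> = (\<Sum>v\<in>Poly_Mapping.keys p. \<Sum>w\<in>Poly_Mapping.keys q. free_map h (?s p v) * free_map h (?s q w))"
    by (simp add: sum_product free_map_sum mult_single free_map_single map_mword_add)
  also have "\<dots> = free_map h (\<Sum>v\<in>Poly_Mapping.keys p. ?s p v) * free_map h (\<Sum>w\<in>Poly_Mapping.keys q. ?s q w)"
    by (simp add: sum_product free_map_sum)
  finally show ?thesis by (simp flip: poly_mapping_sum)
qed

lemma free_map_gen: "free_map h (gen g) = gen (h g)"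
  by (simp add: gen_def free_map_single)

lemma free_map_scal: "free_map h (scal c) = scal c"
  by (simp add: scal_def free_map_single)

lemma free_map_1: "free_map h 1 = 1"
  using free_map_scal[of h 1] by (simp add: scal_simps)

lemma free_map_comp: "free_map h (free_map h' p) = free_map (h \<circ> h') p"
  unfolding free_map_def[of h' p] free_map_sum free_map_single
  by (simp add: mword.map_comp free_map_def)

lemma free_map_id: "free_map id p = p"
  by (simp add: free_map_def mword.map_id flip: poly_mapping_sum)

context cdv_algebra
begin

subsection \<open>The extension of the vector fields as an algebra of quadratic elements\<close>

lemma cadd_incl_coset: "Y N = coset N y \<Longrightarrow> cadd (incl x) Y N = coset N (x + y)"
  by (rule cadd_coset) (simp_all add: incl_coset)

lemma cadd_scal:
  assumes "Y \<in> completion"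
  shows "cadd (incl (scal a)) (cadd (incl (scal b)) Y) = cadd (incl (scal (a + b))) Y"
proof
  fix N
  obtain y where "y \<in> Y N" using completion_ex[OF assms] by blast
  then have Y: "Y N = coset N y" by (rule completion_coset[OF assms])
  show "cadd (incl (scal a)) (cadd (incl (scal b)) Y) N = cadd (incl (scal (a + b))) Y N"
    by (simp add: cadd_incl_coset[of "cadd (incl (scal b)) Y", OF cadd_incl_coset[of Y, OF Y]]
        cadd_incl_coset[of Y, OF Y] scal_simps add.assoc)
qed

lemma cadd_scal_0:
  assumes "Y \<in> completion"
  shows "cadd (incl (scal 0)) Y = Y"
proof
  fix N
  obtain y where "y \<in> Y N" using completion_ex[OF assms] by blast
  then have Y: "Y N = coset N y" by (rule completion_coset[OF assms])
  show "cadd (incl (scal 0)) Y N = Y N" by (simp add: cadd_incl_coset[of Y, OF Y] Y scal_simps)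
qed

lemma commutator_scal:
  assumes X: "X \<in> completion" and Y: "Y \<in> completion"
  shows "commutator (cadd (incl (scal a)) X) (cadd (incl (scal b)) Y) = commutator X Y"
proof
  fix N
  let ?X = "cadd (incl (scal a)) X" and ?Y = "cadd (incl (scal b)) Y"
  obtain c0 where c0: "\<And>c y. c \<ge> c0 \<Longrightarrow> y \<in> Y c \<Longrightarrow> \<exists>a0. \<forall>a\<ge>a0. \<forall>x\<in>X a. commutator X Y N = coset N (x * y - y * x)"
    using commutator_coset[OF X Y] by blast
  have X': "?X \<in> completion" and Y': "?Y \<in> completion" by (intro cadd_completion incl_completion X Y)+
  obtain c1 where c1: "\<And>c y. c \<ge> c1 \<Longrightarrow> y \<in> ?Y c \<Longrightarrow> \<exists>a0. \<forall>a\<ge>a0. \<forall>x\<in>?X a. commutator ?X ?Y N = coset N (x * y - y * x)"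
    using commutator_coset[OF X' Y'] by blast
  have mem: "scal e + z \<in> cadd (incl (scal e)) Z N" if "z \<in> Z N" for e z Z N
  proof -
    have "scal e \<in> incl (scal e) N" by (simp add: incl_coset)
    with that show ?thesis unfolding cadd_def by blast
  qed
  obtain y where y: "y \<in> Y (max c0 c1)" using completion_ex[OF Y] by blast
  obtain a0 where a0: "\<And>a x. a \<ge> a0 \<Longrightarrow> x \<in> X a \<Longrightarrow> commutator X Y N = coset N (x * y - y * x)"
    using c0[OF _ y] by auto
  obtain a1 where a1: "\<And>a x. a \<ge> a1 \<Longrightarrow> x \<in> ?X a \<Longrightarrow> commutator ?X ?Y N = coset N (x * (scal b + y) - (scal b + y) * x)"
    using c1[OF _ mem[of y Y, OF y]] by auto
  obtain x where x: "x \<in> X (max a0 a1)" using completion_ex[OF X] by blast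
  have "(scal a + x) * (scal b + y) - (scal b + y) * (scal a + x) = x * y - y * x"
    using scal_commute[of a "scal b :: ('k, 'K) heis_free"] scal_commute[of a y] scal_commute[of b x]
    by (simp add: distrib_left distrib_right)
  then show "commutator ?X ?Y N = commutator X Y N"
    using a0[OF _ x] a1[OF _ mem[of x X, OF x]] by simp
qed

lemma incl_elt_inj:
  assumes "incl (elt f) = incl (elt g)"
  shows "f = g"
proof -
  have "elt (f - g) \<in> J N" for N
    using fun_cong[OF assms, of N] J_add[OF ucong_J[OF elt_diff[of f g], of N], of "elt f - elt g"]
    by (simp add: incl_coset coset_eq_iff)
  from elt_J_zero[OF this] show ?thesis by simp
qed

definition lift :: "'K \<Rightarrow> 'k \<Rightarrow> 'k fls \<Rightarrow> ('k, 'K) completed" where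
  "lift t z g = cadd (incl (scal (- z / 2))) (vir_series t g standard_order)"

lemma vir_series_standard_completion: "uniformizer \<O> t \<Longrightarrow> vir_series t g standard_order \<in> completion"
  by (rule vir_series_completion[OF _ normal_order_standard])

lemma lift_completion: "uniformizer \<O> t \<Longrightarrow> lift t z g \<in> completion"
  unfolding lift_def by (intro cadd_completion incl_completion vir_series_standard_completion)

lemma pterm_linear:
  "pterm t (fls_const a * g + fls_const b * g') \<kappa> p = scal a * pterm t g \<kappa> p + scal b * pterm t g' \<kappa> p"
proof (cases p)
  case (Pair i j)
  have "scal ((a * x + b * y) / 2) * q = scal a * (scal (x / 2) * q) + scal b * (scal (y / 2) * q)"
    for x y and q :: "('k, 'K) heis_free"
    by (simp add: scal_simps add_divide_distrib distrib_right mult.assoc[symmetric] flip: scal_simps(2))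
  then show ?thesis by (simp add: pterm_def Pair)
qed

lemma lift_linear:
  assumes t: "uniformizer \<O> t"
  shows "lift t (a * z + b * z') (fls_const a * g + fls_const b * g') =
    cadd (cscale a (lift t z g)) (cscale b (lift t z' g'))"
proof
  fix N
  let ?h = "fls_const a * g + fls_const b * g'" and ?k = "standard_order :: int \<Rightarrow> int \<Rightarrow> 'k"
  \<comment> \<open>The third set is listed separately because the subdegree of a combination is not
    governed by its summands: a vanishing combination has subdegree 0.\<close>
  define P where "P = core g N \<union> core g' N \<union> core ?h N"
  have *: "lift t z f N = coset N (scal (- z / 2) + sum (pterm t f ?k) P)" if "core f N \<subseteq> P" for z f
    unfolding lift_def
    by (intro cadd_coset vir_series_eq[OF t normal_order_standard[OF t]] that) (auto simp: incl_coset P_def)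
  have "scal (- (a * z + b * z') / 2) + sum (pterm t ?h ?k) P =
      scal a * (scal (- z / 2) + sum (pterm t g ?k) P) + scal b * (scal (- z' / 2) + sum (pterm t g' ?k) P)"
  proof -
    have "scal (- (a * z + b * z') / 2) = (scal (a * (- z / 2) + b * (- z' / 2)) :: ('k, 'K) heis_free)"
      by (rule arg_cong[of _ _ scal]) (simp add: field_simps)
    moreover have "sum (pterm t ?h ?k) P = scal a * sum (pterm t g ?k) P + scal b * sum (pterm t g' ?k) P"
      unfolding sum_distrib_left sum.distrib[symmetric] by (rule sum.cong) (simp_all add: pterm_linear)
    ultimately show ?thesis by (simp only: scal_simps(1,2) distrib_left add_ac)
  qed
  moreover have "cadd (cscale a (lift t z g)) (cscale b (lift t z' g')) N =
      coset N (scal a * (scal (- z / 2) + sum (pterm t g ?k) P) + scal b * (scal (- z' / 2) + sum (pterm t g' ?k) P))"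
    by (intro cadd_coset cscale_coset *) (auto simp: P_def)
  moreover have "lift t (a * z + b * z') ?h N = coset N (scal (- (a * z + b * z') / 2) + sum (pterm t ?h ?k) P)"
    by (rule *) (simp add: P_def)
  ultimately show "lift t (a * z + b * z') ?h N = cadd (cscale a (lift t z g)) (cscale b (lift t z' g')) N"
    by (simp only:)
qed

lemma lift_bracket:
  assumes t: "uniformizer \<O> t"
  shows "commutator (lift t z g) (incl (elt h)) = incl (elt (vec t g h))"
proof -
  have "commutator (lift t z g) (incl (elt h)) = commutator (lift t z g) (cadd (incl (scal 0)) (incl (elt h)))"
    by (simp add: cadd_scal_0)
  also have "\<dots> = commutator (vir_series t g standard_order) (incl (elt h))"
    unfolding lift_def by (rule commutator_scal) (simp_all add: vir_series_standard_completion[OF t])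
  also have "\<dots> = incl (elt (vec t g h))" by (rule vir_series_bracket[OF t normal_order_standard[OF t]])
  finally show ?thesis .
qed

text \<open>Commutators with K determine the vector field; then only scalars are left to compare,
  and these are separated modulo \<open>J 1\<close>.\<close>

lemma lift_inj:
  assumes t: "uniformizer \<O> t" and eq: "lift t z g = lift t z' g'"
  shows "z = z' \<and> g = g'"
proof -
  have "vec t g h = vec t g' h" for h
    using lift_bracket[OF t, of z g h] lift_bracket[OF t, of z' g' h] eq by (intro incl_elt_inj) simp
  then have g: "g = g'" by (intro vec_inj[OF t] ext)
  obtain y where y: "y \<in> vir_series t g' standard_order 1" using completion_ex[OF vir_series_standard_completion[OF t]] by blast
  have i: "incl (scal c) 1 = coset 1 (scal c)" for c by (simp add: incl_coset)
  have "lift t c g' 1 = coset 1 (scal (- c / 2) + y)" for c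
    unfolding lift_def by (intro cadd_coset i completion_coset[OF vir_series_standard_completion[OF t] y])
  then have "scal (- z / 2 - (- z' / 2)) \<in> J 1"
    using fun_cong[OF eq, of 1] unfolding g scal_simps(6) by (simp add: coset_eq_iff)
  from scal_J[OF this] show ?thesis using g by simp
qed

lemma Vir_proj_lift:
  assumes t: "uniformizer \<O> t"
  shows "Vir_proj (lift t z g) = vec t g"
  unfolding Vir_proj_def lift_bracket[OF t]
proof (rule the_equality)
  fix D assume D: "D \<in> theta \<and> (\<forall>f. incl (elt (vec t g f)) = incl (elt (D f)))"
  then have "vec t g f = D f" for f by (intro incl_elt_inj) blast
  then show "D = vec t g" by (simp add: fun_eq_iff)
qed (simp add: vec_theta[OF t])

lemma lift_coordinates:
  assumes t: "uniformizer \<O> t" and s: "uniformizer \<O> s" and eq: "vec s g' = vec t g"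
  shows "lift s (z + fls_residue (g * fps_to_fls (diag (schwarzian (transition t s))))) g' = lift t z g"
  unfolding lift_def vir_series_coordinates[OF assms]
  by (subst cadd_scal[OF vir_series_standard_completion[OF t]]) (simp add: add_divide_distrib diff_divide_distrib)

lemma lift_range:
  assumes t: "uniformizer \<O> t" and s: "uniformizer \<O> s"
  shows "{lift t z g | z g. True} \<subseteq> {lift s z g | z g. True}"
proof clarify
  fix z g
  have "vec s (expansion s (vec t g s)) = vec t g"
    using theta_vec[OF s vec_theta[OF t]] by simp
  from lift_coordinates[OF t s this] show "\<exists>z' g'. lift t z g = lift s z' g' \<and> True" by metis
qed

lemma lift_eta:
  assumes t: "uniformizer \<O> t" and fs: "\<And>n. n \<ge> 1 \<Longrightarrow> fs n \<in> maximal_ideal \<O>"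
  shows "lift t z g = cadd (incl (scal (- (z + fls_residue (g * fps_to_fls (diag
      (Abs_fps (\<lambda>i. fps_deriv (fls_regpart (expansion t (fs (Suc i))))))))) / 2))) (T_eta t fs (vec t g))"
proof -
  have fs1: "fs n \<in> frac_ideal 1" if "n \<ge> 1" for n using fs[OF that] by (simp add: maximal_ideal_frac_ideal)
  have fs0: "fs n \<in> frac_ideal 0" if "n \<ge> 1" for n using frac_ideal_mono[OF _ fs1[OF that], of 0] by simp
  have e: "T_eta t fs (vec t g) = vir_series t g (eta_order t fs)"
    using T_eta_eq[of t fs "vec t g", OF t fs0] by (simp add: vec_uniformizer[OF t] del: expansion_vec)
  have c: "vir_series t g (eta_order t fs) \<in> completion"
    by (rule vir_series_completion[OF t normal_order_eta[OF t fs0]])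
  show ?thesis
    unfolding lift_def e vir_series_eta[of t fs g, OF t fs1, simplified] cadd_scal[OF c]
    by (simp add: add_divide_distrib diff_divide_distrib)
qed

lemma T_eta_completion:
  assumes t: "uniformizer \<O> t" and fs: "\<And>n. n \<ge> 1 \<Longrightarrow> fs n \<in> maximal_ideal \<O>"
  shows "T_eta t fs D \<in> completion"
proof -
  have fs0: "fs n \<in> frac_ideal 0" if "n \<ge> 1" for n
    using fs[OF that] frac_ideal_mono[of 0 1 "fs n"] by (simp add: maximal_ideal_frac_ideal)
  have "T_eta t fs D = vir_series t (expansion t (D t)) (eta_order t fs)" by (rule T_eta_eq[OF t fs0])
  moreover have "vir_series t (expansion t (D t)) (eta_order t fs) \<in> completion"
    by (rule vir_series_completion[OF t normal_order_eta[OF t fs0]])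
  ultimately show ?thesis by simp
qed

lemma Vir_eq:
  assumes t: "uniformizer \<O> t" and fs: "\<And>n. n \<ge> 1 \<Longrightarrow> fs n \<in> maximal_ideal \<O>"
  shows "Vir t fs = {lift t z g | z g. True}"
proof (intro subset_antisym subsetI)
  let ?r = "\<lambda>g. fls_residue (g * fps_to_fls (diag (Abs_fps (\<lambda>i. fps_deriv (fls_regpart (expansion t (fs (Suc i))))))))"
  fix X assume "X \<in> Vir t fs"
  then obtain c D where X: "X = cadd (incl (scal c)) (T_eta t fs D)" and D: "D \<in> theta" by (auto simp: Vir_def)
  obtain g where g: "D = vec t g" using theta_vec[OF t D] by blast
  have "lift t (- 2 * c - ?r g) g = cadd (incl (scal (- (- 2 * c - ?r g + ?r g) / 2))) (T_eta t fs (vec t g))"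
    by (rule lift_eta[OF t fs])
  then have "X = lift t (- 2 * c - ?r g) g" by (simp add: X g)
  then show "X \<in> {lift t z g | z g. True}" by blast
next
  fix X assume "X \<in> {lift t z g | z g. True}"
  then obtain z g where X: "X = lift t z g" by blast
  show "X \<in> Vir t fs" unfolding X Vir_def using lift_eta[of t fs z g, OF t fs] vec_theta[OF t] by blast
qed

subsection \<open>The Lie algebra structure\<close>

definition symbol :: "('k frac2 set \<Rightarrow> 'k) \<Rightarrow> 'k fls" where
  "symbol \<zeta> = (THE g. \<exists>z. \<zeta> = hat_form z g)"

lemma symbol_hat_form [simp]: "symbol (hat_form z g) = g"
  unfolding symbol_def by (rule the_equality) (auto dest: hat_form_inj)

text \<open>A scalar c in the algebra is the image of the form with double-pole value -2c, hence the
  factor in front of the cocycle.\<close>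

definition hat_bracket :: "('k frac2 set \<Rightarrow> 'k) \<Rightarrow> ('k frac2 set \<Rightarrow> 'k) \<Rightarrow> 'k frac2 set \<Rightarrow> 'k" where
  "hat_bracket \<zeta> \<zeta>' = hat_form (- 2 * cocycle (symbol \<zeta>) (symbol \<zeta>')) (field_bracket (symbol \<zeta>) (symbol \<zeta>'))"

lemma cocycle_linear:
  "cocycle (fls_const a * g + fls_const b * h) l = a * cocycle g l + b * cocycle h l"
  "cocycle l (fls_const a * g + fls_const b * h) = a * cocycle l g + b * cocycle l h"
  by (simp_all add: cocycle_def ring_distribs mult.assoc mult.left_commute[of _ "fls_const _"] add_divide_distrib)

lemma field_bracket_linear:
  "field_bracket (fls_const a * g + fls_const b * h) l = fls_const a * field_bracket g l + fls_const b * field_bracket h l"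
  "field_bracket l (fls_const a * g + fls_const b * h) = fls_const a * field_bracket l g + fls_const b * field_bracket l h"
  by (simp_all add: field_bracket_def algebra_simps)

text \<open>Up to the factor -2 the integrand is the derivative of g'^2 - 2 g'' g.\<close>

lemma cocycle_self: "cocycle g g = 0"
proof -
  let ?d = fls_deriv
  have "fls_residue (?d (?d g * ?d g - ?d (?d g) * g - ?d (?d g) * g)) = 0"
    by (rule fls_residue_deriv)
  moreover have "?d (?d g * ?d g - ?d (?d g) * g - ?d (?d g) * g) = - (?d (?d (?d g)) * g) - ?d (?d (?d g)) * g"
    by (simp add: algebra_simps)
  ultimately have "fls_nth (?d (?d (?d g)) * g) (- 1) = 0" by (simp add: mult.commute del: fls_deriv_nth)
  then show ?thesis by (simp add: cocycle_def)
qed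

lemma field_bracket_jacobi:
  "field_bracket g (field_bracket h l) + field_bracket h (field_bracket l g) + field_bracket l (field_bracket g h) = 0"
  by (simp add: field_bracket_def algebra_simps)

text \<open>The cyclic sum is the residue of the derivative of the Wronskian of \<open>g\<close>, \<open>h\<close>, \<open>l\<close>.\<close>

lemma cocycle_jacobi:
  "cocycle g (field_bracket h l) + cocycle h (field_bracket l g) + cocycle l (field_bracket g h) = 0"
proof -
  let ?d = fls_deriv
  let ?dd = "\<lambda>x. ?d (?d x)"
  let ?W = "?dd g * field_bracket h l + ?dd h * field_bracket l g + ?dd l * field_bracket g h"
  have "?d ?W = ?d (?dd g) * field_bracket h l + ?d (?dd h) * field_bracket l g + ?d (?dd l) * field_bracket g h"
    by (simp add: field_bracket_def algebra_simps)
  then have "fls_residue (?d (?dd g) * field_bracket h l) + fls_residue (?d (?dd h) * field_bracket l g) +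
      fls_residue (?d (?dd l) * field_bracket g h) = fls_residue (?d ?W)"
    by (metis fls_plus_nth fls_residue_def)
  also have "\<dots> = 0" by (rule fls_residue_deriv)
  finally show ?thesis by (simp only: cocycle_def add_divide_distrib[symmetric]) simp
qed

lemma hat_form_add: "hat_form (z :: 'k) g \<omega> + hat_form z' g' \<omega> = hat_form (z + z') (g + g') \<omega>"
  using fun_cong[OF hat_form_linear[of 1 z g 1 z' g'], of \<omega>] by simp

lemma hat_form_0: "hat_form (0 :: 'k) 0 = (\<lambda>_. 0)"
  using hat_form_linear[of "0 :: 'k" 0 0 0 0 0, symmetric] by simp

lemma lie_bracket_hat_bracket: "lie_bracket_on hat_theta hat_bracket"
  unfolding lie_bracket_on_def
proof (intro conjI ballI allI)
  fix x y z :: "'k frac2 set \<Rightarrow> 'k" and a b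
  show "hat_bracket x y \<in> hat_theta" by (simp add: hat_bracket_def hat_form_hat_theta)
  assume "x \<in> hat_theta"
  then obtain zx g where x: "x = hat_form zx g" using hat_theta_ex by blast
  show "hat_bracket x x = (\<lambda>_. 0)"
    by (simp add: x hat_bracket_def cocycle_self field_bracket_def hat_form_0)
  assume "y \<in> hat_theta"
  then obtain zy h where y: "y = hat_form zy h" using hat_theta_ex by blast
  assume "z \<in> hat_theta"
  then obtain zz l where z: "z = hat_form zz l" using hat_theta_ex by blast
  show "hat_bracket (\<lambda>i. a * x i + b * y i) z = (\<lambda>i. a * hat_bracket x z i + b * hat_bracket y z i)"
    "hat_bracket z (\<lambda>i. a * x i + b * y i) = (\<lambda>i. a * hat_bracket z x i + b * hat_bracket z y i)"
    by (simp_all add: x y z hat_bracket_def hat_form_linear cocycle_linear field_bracket_linear) (simp_all add: algebra_simps)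
  have "- 2 * cocycle g (field_bracket h l) + - 2 * cocycle h (field_bracket l g) + - 2 * cocycle l (field_bracket g h) = 0"
    using cocycle_jacobi[of g h l] by (simp only: distrib_left[symmetric]) simp
  then show "(\<lambda>i. hat_bracket x (hat_bracket y z) i + hat_bracket y (hat_bracket z x) i + hat_bracket z (hat_bracket x y) i) = (\<lambda>_. 0)"
    by (simp add: x y z hat_bracket_def hat_form_add field_bracket_jacobi hat_form_0)
qed

lemma hat_bracket_biresidue:
  assumes "\<zeta> \<in> hat_theta"
  shows "hat_bracket hat_biresidue \<zeta> = (\<lambda>_. 0)"
proof -
  have "hat_biresidue = hat_form (1 :: 'k) 0" using hat_biresidue_hat_form[of 1] by simp
  then show ?thesis unfolding hat_bracket_def \<open>hat_biresidue = hat_form 1 0\<close> symbol_hat_form by (simp add: cocycle_def field_bracket_def hat_form_0)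
qed

lemma lift_commutator:
  assumes t: "uniformizer \<O> t"
  shows "commutator (lift t z g) (lift t z' g') = lift t (- 2 * cocycle g g') (field_bracket g g')"
  unfolding lift_def commutator_scal[OF vir_series_standard_completion[OF t] vir_series_standard_completion[OF t]]
    commutator_vir_series_standard[OF t] by simp

subsection \<open>Naturality\<close>

text \<open>A quadratic differential acquires two factors ds/dt. One turns the component of the
  vector field in t into that in s, the other is absorbed by the change of variable in the
  residue.\<close>

lemma pullback_transition:
  assumes t: "uniformizer \<O> t" and s: "uniformizer \<O> s"
  shows "pullback (transition t s) (hat_form z g) =
    hat_form (z + fls_residue (g * fps_to_fls (diag (schwarzian (transition t s))))) (expansion s (vec t g s))"
proof (rule pullback_eq_hat_form[OF subdegree_transition[OF t s]])
  fix f :: "'k fls"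
  obtain x where x: "expansion s x = f" using expansion_surj[OF s] by blast
  obtain v where v: "expansion t v = g" using expansion_surj[OF t] by blast
  have vs: "vec t g s = v * ddt t s" using t by (simp add: v flip: expansion_eq_iff[OF t])
  have "fps_to_fls (fps_deriv (transition t s)) = expansion t (ddt t s)"
    using t by (simp add: fls_deriv_fps_to_fls flip: fps_to_fls_transition[OF t s])
  then have "fls_residue (g * (fls_compose_fps f (transition t s) * fps_to_fls (fps_deriv (transition t s)) ^ 2)) =
      resid t ((v * ddt t s * x) * ddt t s)"
    using t expansion_compose[OF t s, of x]
    by (simp add: resid_def x v power2_eq_square mult_ac del: fls_residue_def)
  also have "\<dots> = resid s (v * ddt t s * x)" by (rule resid_change[OF t s])
  also have "\<dots> = fls_residue (expansion s (vec t g s) * f)" using s by (simp add: resid_def vs x)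
  finally show "fls_residue (g * (fls_compose_fps f (transition t s) * fps_to_fls (fps_deriv (transition t s)) ^ 2)) =
      fls_residue (expansion s (vec t g s) * f)" .
qed

text \<open>A form of \<open>automorphism\<close> that passes directly to the inverse map, which is
  needed to show that the action is onto on cosets.\<close>

definition alg_aut :: "('K \<Rightarrow> 'K) \<Rightarrow> bool" where
  "alg_aut \<alpha> \<longleftrightarrow> bij \<alpha> \<and> (\<forall>x y. \<alpha> (x + y) = \<alpha> x + \<alpha> y) \<and> (\<forall>x y. \<alpha> (x * y) = \<alpha> x * \<alpha> y) \<and>
     (\<forall>c. \<alpha> (\<iota> c) = \<iota> c) \<and> (\<forall>x. \<alpha> x \<in> \<O> \<longleftrightarrow> x \<in> \<O>)"

lemma automorphism_alg_aut: "automorphism \<alpha> \<Longrightarrow> alg_aut \<alpha>"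
proof -
  assume a: "automorphism \<alpha>"
  have "x \<in> \<O>" if "\<alpha> x \<in> \<O>" for x
  proof -
    have "\<alpha> x \<in> \<alpha> ` \<O>" using a that by (simp add: automorphism_def)
    then obtain y where "y \<in> \<O>" "\<alpha> x = \<alpha> y" by blast
    then show ?thesis using a by (simp add: automorphism_def bij_is_inj inj_eq)
  qed
  then show ?thesis using a unfolding automorphism_def alg_aut_def by blast
qed

lemma alg_aut_inv:
  assumes a: "alg_aut \<alpha>"
  shows "alg_aut (inv \<alpha>)"
proof -
  have b: "bij \<alpha>" using a by (simp add: alg_aut_def)
  then have i: "\<alpha> (inv \<alpha> x) = x" "inv \<alpha> (\<alpha> x) = x" for x
    by (simp_all add: bij_is_surj bij_is_inj surj_f_inv_f)
  show ?thesis
    using a unfolding alg_aut_def by (metis b bij_imp_bij_inv i)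
qed

context
  fixes \<alpha> assumes aut: "alg_aut \<alpha>"
begin

lemma aut_simps:
  "\<alpha> (x + y) = \<alpha> x + \<alpha> y" "\<alpha> (x * y) = \<alpha> x * \<alpha> y" "\<alpha> (\<iota> c) = \<iota> c" "\<alpha> x \<in> \<O> \<longleftrightarrow> x \<in> \<O>" "\<alpha> x = \<alpha> y \<longleftrightarrow> x = y"
  using aut by (auto simp: alg_aut_def bij_is_inj inj_eq)

lemma aut_more: "\<alpha> 0 = 0" "\<alpha> 1 = 1" "\<alpha> (x - y) = \<alpha> x - \<alpha> y" "\<alpha> x = 0 \<longleftrightarrow> x = 0"
proof -
  show 0: "\<alpha> 0 = 0" using aut_simps(1)[of 0 0] by (metis add.right_neutral add_left_cancel)
  show "\<alpha> 1 = 1" using aut_simps(3)[of 1] by (simp add: iota_one)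
  show "\<alpha> (x - y) = \<alpha> x - \<alpha> y" using aut_simps(1)[of "x - y" y] by simp
  show "\<alpha> x = 0 \<longleftrightarrow> x = 0" using aut_simps(5)[of x 0] 0 by simp
qed

lemma aut_inverse: "\<alpha> (inverse x) = inverse (\<alpha> x)"
proof (cases "x = 0")
  case False
  then have "\<alpha> x * \<alpha> (inverse x) = 1" by (simp add: aut_more flip: aut_simps(2))
  then show ?thesis using inverse_unique by metis
qed (simp add: aut_more)

lemma aut_power: "\<alpha> (x ^ n) = \<alpha> x ^ n"
  by (induction n) (simp_all add: aut_simps aut_more)

lemma aut_powi: "\<alpha> (x powi n) = \<alpha> x powi n"
  by (simp add: power_int_def aut_power aut_inverse)

lemma aut_sum: "\<alpha> (sum f A) = (\<Sum>i\<in>A. \<alpha> (f i))"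
  by (induction A rule: infinite_finite_induct) (simp_all add: aut_simps aut_more)

lemma aut_maximal_ideal: "\<alpha> x \<in> frac_ideal 1 \<longleftrightarrow> x \<in> frac_ideal 1"
  unfolding maximal_ideal_frac_ideal[symmetric] maximal_ideal_def
  by (simp add: aut_simps aut_more flip: aut_inverse)

text \<open>If \<alpha> t had valuation at least 2, so would every uniformizer u: its preimage lies
  in the maximal ideal, hence is t times a regular element, and applying \<alpha> puts u into the
  square of that ideal.\<close>

lemma aut_uniformizer:
  assumes t: "uniformizer \<O> t"
  shows "uniformizer \<O> (\<alpha> t)"
proof -
  have t0: "t \<noteq> 0" using t by (simp add: uniformizer_val)
  then have n: "\<alpha> t \<noteq> 0" by (simp add: aut_more)
  have "\<alpha> t \<in> frac_ideal 1" using frac_ideal_powi[OF t, of 1 1] by (simp add: aut_maximal_ideal)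
  moreover have "\<alpha> t \<notin> frac_ideal 2"
  proof
    assume 2: "\<alpha> t \<in> frac_ideal 2"
    obtain u where u: "uniformizer \<O> u" using ex_uniformizer by blast
    obtain u' where u': "u = \<alpha> u'" using aut by (metis alg_aut_def bij_is_surj surj_def)
    have "u' \<in> frac_ideal 1" using frac_ideal_powi[OF u, of 1 1] by (simp add: u' aut_maximal_ideal)
    then have "t powi (-1) * u' \<in> frac_ideal 0" unfolding frac_ideal_powi_mult_iff[OF t] by simp
    then have "\<alpha> (inverse t * u') \<in> frac_ideal 0" unfolding ring_mem[symmetric] aut_simps(4) by simp
    then have "inverse (\<alpha> t) * u \<in> frac_ideal 0" by (simp add: aut_simps aut_inverse u')
    from frac_ideal_mult[OF 2 this] have "u \<in> frac_ideal 2" using n by (simp add: mult.assoc[symmetric])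
    then show False using u by (simp add: frac_ideal_def uniformizer_val)
  qed
  ultimately show ?thesis using n by (auto simp: uniformizer_val frac_ideal_def)
qed

lemma aut_frac_ideal: "\<alpha> x \<in> frac_ideal N \<longleftrightarrow> x \<in> frac_ideal N"
proof -
  obtain t where t: "uniformizer \<O> t" using ex_uniformizer by blast
  have "x \<in> frac_ideal N \<longleftrightarrow> t powi (- N) * x \<in> \<O>"
    unfolding ring_mem frac_ideal_powi_mult_iff[OF t] by simp
  also have "\<dots> \<longleftrightarrow> \<alpha> t powi (- N) * \<alpha> x \<in> \<O>"
    by (subst aut_simps(4)[symmetric]) (simp only: aut_simps(2) aut_powi)
  also have "\<dots> \<longleftrightarrow> \<alpha> x \<in> frac_ideal N"
    unfolding ring_mem frac_ideal_powi_mult_iff[OF aut_uniformizer[OF t]] by simp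
  finally show ?thesis by simp
qed

lemma aut_expansion:
  assumes t: "uniformizer \<O> t"
  shows "expansion (\<alpha> t) (\<alpha> f) = expansion t f"
  unfolding expansion_iff[OF aut_uniformizer[OF t]]
proof
  fix N
  have "\<alpha> (partial_sum t (expansion t f) (int N)) = partial_sum (\<alpha> t) (expansion t f) (int N)"
    by (simp add: partial_sum_def aut_sum aut_simps aut_powi)
  moreover have "f - partial_sum t (expansion t f) (int N) \<in> frac_ideal (int N)"
    using expansion_iff[OF t, of f "expansion t f"] by simp
  ultimately show "\<alpha> f - partial_sum (\<alpha> t) (expansion t f) (int N) \<in> frac_ideal (int N)"
    by (metis aut_frac_ideal aut_more(3))
qed

lemma aut_res_pairing: "res_pairing (\<alpha> f) (\<alpha> g) = res_pairing f g"
proof -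
  obtain t where t: "uniformizer \<O> t" using ex_uniformizer by blast
  show ?thesis
    using t aut_uniformizer[OF t] res_pairing_eq[OF t, of f g] res_pairing_eq[OF aut_uniformizer[OF t], of "\<alpha> f" "\<alpha> g"]
    by (simp add: resid_def aut_expansion[OF t])
qed

abbreviation "env \<equiv> free_map (map_letter (\<lambda>(c, f). (c, \<alpha> f))) :: ('k, 'K) heis_free \<Rightarrow> _"

lemmas env_simps = free_map_add free_map_diff free_map_mult free_map_gen free_map_scal free_map_1

lemma env_elt: "env (elt f) = elt (\<alpha> f)"
  by (simp add: elt_def env_simps)

lemma env_U_ideal: "x \<in> U_ideal \<Longrightarrow> env x \<in> U_ideal"
  unfolding U_ideal_def
proof (induction rule: two_sided_ideal.induct)
  case (3 s a b)
  have "env s \<in> envelope_relations \<union> localization_relations"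
  proof -
    consider (add) x y where "s = gen (Emb (x + y)) - gen (Emb x) - gen (Emb y)"
      | (scale) c x where "s = gen (Emb (heis_scale c x)) - scal c * gen (Emb x)"
      | (bracket) x y where "s = gen (Emb x) * gen (Emb y) - gen (Emb y) * gen (Emb x) - gen (Emb (heis_bracket x y))"
      | (loc) "s = hb * hi - 1 \<or> s = hi * hb - 1"
      using 3 unfolding envelope_relations_def localization_relations_def by blast
    then show ?thesis
    proof cases
      case add
      let ?a = "\<lambda>(c, f). (c, \<alpha> f)"
      have "?a (x + y) = ?a x + ?a y" by (cases x; cases y) (simp add: aut_simps)
      then have "env s = gen (Emb (?a x + ?a y)) - gen (Emb (?a x)) - gen (Emb (?a y))" by (simp add: add env_simps)
      then show ?thesis unfolding envelope_relations_def by blast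
    next
      case scale
      let ?a = "\<lambda>(c, f). (c, \<alpha> f)"
      have "?a (heis_scale c x) = heis_scale c (?a x)" by (cases x) (simp add: aut_simps heis_scale_def)
      then have "env s = gen (Emb (heis_scale c (?a x))) - scal c * gen (Emb (?a x))" by (simp add: scale env_simps)
      then show ?thesis unfolding envelope_relations_def by blast
    next
      case bracket
      let ?a = "\<lambda>(c, f). (c, \<alpha> f)"
      have "?a (heis_bracket x y) = heis_bracket (?a x) (?a y)"
        by (cases x; cases y) (simp add: aut_more heis_bracket_def aut_res_pairing)
      then have "env s = gen (Emb (?a x)) * gen (Emb (?a y)) - gen (Emb (?a y)) * gen (Emb (?a x)) - gen (Emb (heis_bracket (?a x) (?a y)))"
        by (simp add: bracket env_simps)
      then show ?thesis unfolding envelope_relations_def by blast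
    next
      case loc
      then have "env s = s" by (auto simp: env_simps hbar_def aut_more)
      then show ?thesis using 3 by simp
    qed
  qed
  then show ?case by (simp add: env_simps two_sided_ideal.intros(3))
qed (simp_all add: env_simps two_sided_ideal.intros)

lemma env_J: "x \<in> J N \<Longrightarrow> env x \<in> J N"
proof (induction rule: J_induct)
  case (U x)
  then show ?case by (intro U_J env_U_ideal)
next
  case (elt a f)
  then show ?case by (simp add: env_simps env_elt J_left elt_J aut_frac_ideal)
next
  case (add x y)
  then show ?case by (simp add: env_simps J_add)
qed

lemma env_pterm: "env (pterm t g \<kappa> p) = pterm (\<alpha> t) g \<kappa> p"
  by (cases p) (simp add: pterm_def Q_def env_simps env_elt aut_powi)

end

lemma aut_act_coset:
  assumes a: "alg_aut \<alpha>"
  shows "free_map (map_letter (\<lambda>(c, f). (c, \<alpha> f))) ` coset N x = coset N (free_map (map_letter (\<lambda>(c, f). (c, \<alpha> f))) x)"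
    (is "?A ` _ = _")
proof (intro subset_antisym subsetI)
  fix z assume "z \<in> ?A ` coset N x"
  then show "z \<in> coset N (?A x)" using env_J[OF a] by (auto simp: mem_coset simp flip: free_map_diff)
next
  fix z assume z: "z \<in> coset N (?A x)"
  let ?B = "free_map (map_letter (\<lambda>(c, f). (c, inv \<alpha> f))) :: ('k, 'K) heis_free \<Rightarrow> _"
  have b: "bij \<alpha>" using a by (simp add: alg_aut_def)
  have i: "\<alpha> \<circ> inv \<alpha> = id" "inv \<alpha> \<circ> \<alpha> = id"
    using b by (simp_all add: fun_eq_iff bij_is_surj bij_is_inj surj_f_inv_f)
  have inverse: "free_map (map_letter (\<lambda>(c, f). (c, \<beta> f))) (free_map (map_letter (\<lambda>(c, f). (c, \<gamma> f))) w) = w"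
    if "\<beta> \<circ> \<gamma> = id" for \<beta> \<gamma> :: "'K \<Rightarrow> 'K" and w :: "('k, 'K) heis_free"
  proof -
    have "(\<lambda>(c, f). (c, \<beta> f)) \<circ> (\<lambda>(c, f). (c, \<gamma> f)) = (id :: 'k \<times> 'K \<Rightarrow> _)"
      using that by (auto simp: fun_eq_iff)
    moreover have "map_letter (\<lambda>(c :: 'k, f). (c, \<beta> f)) \<circ> map_letter (\<lambda>(c :: 'k, f). (c, \<gamma> f)) =
        map_letter ((\<lambda>(c, f). (c, \<beta> f)) \<circ> (\<lambda>(c, f). (c, \<gamma> f)))"
      by (simp add: fun_eq_iff letter.map_comp)
    ultimately have "map_letter (\<lambda>(c :: 'k, f). (c, \<beta> f)) \<circ> map_letter (\<lambda>(c, f). (c, \<gamma> f)) = id"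
      by (simp only: letter.map_id0)
    then show ?thesis by (simp add: free_map_comp free_map_id)
  qed
  have "?B (z - ?A x) \<in> J N" using z by (intro env_J alg_aut_inv[OF a]) (simp add: mem_coset)
  then have "?B z \<in> coset N x" by (simp add: free_map_diff inverse[OF i(2)] mem_coset)
  moreover have "z = ?A (?B z)" by (simp add: inverse[OF i(1)])
  ultimately show "z \<in> ?A ` coset N x" by blast
qed

text \<open>Transport of structure: the series is built from powers of t with coefficients in k, and
  the automorphism fixes k and sends powers of t to powers of \<alpha> t.\<close>

lemma aut_act_lift:
  assumes a: "alg_aut \<alpha>" and t: "uniformizer \<O> t"
  shows "aut_act \<alpha> (lift t z g) = lift (\<alpha> t) z g"
proof
  fix N
  have *: "lift s z g N = coset N (scal (- z / 2) + sum (pterm s g standard_order) (core g N))" for s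
    unfolding lift_def by (rule cadd_coset) (simp_all add: incl_coset vir_series_def)
  show "aut_act \<alpha> (lift t z g) N = lift (\<alpha> t) z g N"
    unfolding aut_act_def * aut_act_coset[OF a]
    by (simp add: free_map_add free_map_scal free_map_sum env_pterm[OF a])
qed

lemma aut_transition:
  assumes a: "alg_aut \<alpha>" and t: "uniformizer \<O> t"
  shows "transition t (inv \<alpha> t) = transition (\<alpha> t) t"
proof -
  have "\<alpha> (inv \<alpha> t) = t" using a by (simp add: alg_aut_def bij_is_surj surj_f_inv_f)
  then show ?thesis using aut_expansion[OF a t, of "inv \<alpha> t"] by (simp add: transition_def)
qed

subsection \<open>The canonical isomorphism\<close>

definition vir_iso :: "'K \<Rightarrow> ('k frac2 set \<Rightarrow> 'k) \<Rightarrow> ('k, 'K) completed" where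
  "vir_iso t \<zeta> = lift t (\<zeta> (qclass (hrep 1 0))) (symbol \<zeta>)"

lemma vir_iso_hat_form [simp]: "vir_iso t (hat_form z g) = lift t z g"
  by (simp add: vir_iso_def)

lemma vir_iso_bij:
  assumes t: "uniformizer \<O> t" and s: "uniformizer \<O> s" and fs: "admissible s fs"
  shows "bij_betw (vir_iso t) hat_theta (Vir s fs)"
proof -
  have "inj_on (vir_iso t) hat_theta"
    by (intro inj_onI) (auto dest!: hat_theta_ex dest: lift_inj[OF t])
  moreover have "vir_iso t ` hat_theta = {lift t z g | z g. True}"
    using hat_form_hat_theta by (force dest!: hat_theta_ex simp: image_iff)
  moreover have "\<dots> = Vir s fs"
    using Vir_eq[OF s, of fs] fs lift_range[OF t s] lift_range[OF s t] by (simp add: admissible_def)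
  ultimately show ?thesis by (simp add: bij_betw_def)
qed

text \<open>The class of \<open>eta\<close> has normal form with c = 1 and with f the restriction of
  its regular part to the diagonal. Vanishing of the form on it is the vanishing of the scalar in
  \<open>lift_eta\<close>.\<close>

lemma vir_iso_eta:
  assumes t: "uniformizer \<O> t" and fs: "admissible t fs" and vanish: "hat_form z g (qclass (eta t fs)) = 0"
  shows "lift t z g = T_eta t fs (vec t g)"
proof -
  define S where "S = Abs_fps (\<lambda>i. fps_deriv (fls_regpart (expansion t (fs (Suc i)))))"
  have fs': "fs n \<in> maximal_ideal \<O>" if "n \<ge> 1" for n using fs that by (simp add: admissible_def)
  have "eta t fs - hrep 1 (fps_to_fls (diag S)) = emb2 S - laurent_t2 (diag_fls (emb2 S))"
    by (simp add: eta_def hrep_def S_def scalar2_simps diag_fls_emb2)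
  also have "\<dots> \<in> diag_power 1" by (rule diag_fls_mem) simp
  finally have "qclass (eta t fs) = qclass (hrep 1 (fps_to_fls (diag S)))" by (rule qclass_cong)
  then have "z + fls_residue (g * fps_to_fls (diag S)) = 0" using vanish by (simp del: fls_residue_def)
  then show ?thesis
    using lift_eta[of t fs z g, OF t fs'] by (simp add: S_def T_eta_completion[OF t fs'] cadd_scal_0 del: fls_residue_def)
qed

lemma vir_iso_linear:
  assumes t: "uniformizer \<O> t" and "\<zeta> \<in> hat_theta" "\<zeta>' \<in> hat_theta"
  shows "vir_iso t (\<lambda>\<omega>. a * \<zeta> \<omega> + b * \<zeta>' \<omega>) = cadd (cscale a (vir_iso t \<zeta>)) (cscale b (vir_iso t \<zeta>'))"
  using assms(2,3) by (auto dest!: hat_theta_ex simp: hat_form_linear lift_linear[OF t])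

lemma vir_iso_proj:
  assumes t: "uniformizer \<O> t" and "\<zeta> \<in> hat_theta"
  shows "Vir_proj (vir_iso t \<zeta>) = hat_theta_proj t \<zeta>"
  using assms(2) by (auto dest!: hat_theta_ex simp: Vir_proj_lift[OF t] hat_theta_proj_hat_form[OF t])

lemma vir_iso_T_eta:
  assumes t: "uniformizer \<O> t" and fs: "admissible t fs" and "\<zeta> \<in> hat_theta" "\<zeta> (qclass (eta t fs)) = 0"
  shows "vir_iso t \<zeta> = T_eta t fs (hat_theta_proj t \<zeta>)"
proof -
  obtain z g where "\<zeta> = hat_form z g" using hat_theta_ex[OF assms(3)] by blast
  then show ?thesis using vir_iso_eta[OF t fs, of z g] assms(4) by (simp add: hat_theta_proj_hat_form[OF t])
qed

lemma vir_iso_hat_bracket: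
  assumes t: "uniformizer \<O> t" and "\<zeta> \<in> hat_theta" "\<zeta>' \<in> hat_theta"
  shows "vir_iso t (hat_bracket \<zeta> \<zeta>') = commutator (vir_iso t \<zeta>) (vir_iso t \<zeta>')"
    and "hat_theta_proj t (hat_bracket \<zeta> \<zeta>') =
      (\<lambda>x. hat_theta_proj t \<zeta> (hat_theta_proj t \<zeta>' x) - hat_theta_proj t \<zeta>' (hat_theta_proj t \<zeta> x))"
  using assms(2,3)
  by (auto dest!: hat_theta_ex simp: hat_bracket_def lift_commutator[OF t] hat_theta_proj_hat_form[OF t] vec_bracket[OF t])

lemma vir_iso_pullback:
  assumes t: "uniformizer \<O> t" and s: "uniformizer \<O> s" and "\<zeta> \<in> hat_theta"
  shows "vir_iso s (pullback (transition t s) \<zeta>) = vir_iso t \<zeta>"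
proof -
  obtain z g where "\<zeta> = hat_form z g" using hat_theta_ex[OF assms(3)] by blast
  moreover have "vec s (expansion s (vec t g s)) = vec t g"
    using theta_vec[OF s vec_theta[OF t]] by metis
  from lift_coordinates[OF t s this] have "lift s (z + fls_residue (g * fps_to_fls (diag (schwarzian (transition t s)))))
      (expansion s (vec t g s)) = lift t z g" .
  ultimately show ?thesis by (simp only: pullback_transition[OF t s] vir_iso_hat_form)
qed

text \<open>Equivariance is an instance of independence of the coordinate: by
  \<open>aut_transition\<close> the pullback is the change from the uniformizer \<alpha> t to t, and
  by transport of structure the isomorphism for \<alpha> t is that for t followed by the action of
  \<alpha>.\<close>

lemma vir_iso_automorphism:
  assumes a: "automorphism \<alpha>" and t: "uniformizer \<O> t" and "\<zeta> \<in> hat_theta"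
  shows "vir_iso t (pullback (transition t (inv \<alpha> t)) \<zeta>) = aut_act \<alpha> (vir_iso t \<zeta>)"
proof -
  note a = automorphism_alg_aut[OF a]
  obtain z g where \<zeta>: "\<zeta> = hat_form z g" using hat_theta_ex[OF assms(3)] by blast
  show ?thesis
    unfolding aut_transition[OF a t] vir_iso_pullback[OF aut_uniformizer[OF a t] t assms(3)]
    by (simp add: \<zeta> aut_act_lift[OF a t])
qed

end

theorem theorem5p2:
  fixes \<iota> :: "'k::field_char_0 \<Rightarrow> 'K::field" and \<O> :: "'K set"
  assumes "cdv_algebra \<iota> \<O>"
  shows
    "(inj (quad_diff :: 'k fls \<Rightarrow> _) \<and>
      range (quad_diff :: 'k fls \<Rightarrow> _) = {\<omega> \<in> hat_omega. hat_biresidue \<omega> = 0} \<and>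
      hat_biresidue ` (hat_omega :: 'k frac2 set set) = UNIV) \<and>
     (\<forall>t. uniformizer \<O> t \<longrightarrow>
        (\<forall>\<zeta>\<in>hat_theta. \<forall>\<zeta>'\<in>hat_theta. \<forall>a b.
           (\<lambda>\<omega>. a * \<zeta> \<omega> + b * \<zeta>' \<omega>) \<in> hat_theta \<and>
           cdv_algebra.hat_theta_proj \<iota> \<O> t (\<lambda>\<omega>. a * \<zeta> \<omega> + b * \<zeta>' \<omega>) =
             (\<lambda>x. \<iota> a * cdv_algebra.hat_theta_proj \<iota> \<O> t \<zeta> x +
                  \<iota> b * cdv_algebra.hat_theta_proj \<iota> \<O> t \<zeta>' x)) \<and>
        inj (\<lambda>c \<omega>. c * hat_biresidue \<omega> :: 'k) \<and>
        range (\<lambda>c \<omega>. c * hat_biresidue \<omega>) =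
          {\<zeta> \<in> hat_theta. cdv_algebra.hat_theta_proj \<iota> \<O> t \<zeta> = (\<lambda>_. 0)} \<and>
        cdv_algebra.hat_theta_proj \<iota> \<O> t ` hat_theta = cdv_algebra.theta \<iota> \<O>) \<and>
     (\<exists>\<Phi> :: 'K \<Rightarrow> ('k frac2 set \<Rightarrow> 'k) \<Rightarrow> ('k, 'K) completed.
        (\<forall>t. uniformizer \<O> t \<longrightarrow>
           (\<forall>\<zeta>\<in>hat_theta. \<forall>\<zeta>'\<in>hat_theta. \<forall>a b.
              \<Phi> t (\<lambda>\<omega>. a * \<zeta> \<omega> + b * \<zeta>' \<omega>) =
                cdv_algebra.cadd (cdv_algebra.cscale \<iota> \<O> a (\<Phi> t \<zeta>))
                                 (cdv_algebra.cscale \<iota> \<O> b (\<Phi> t \<zeta>'))) \<and>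
           (\<forall>s fs. uniformizer \<O> s \<and> cdv_algebra.admissible \<iota> \<O> s fs \<longrightarrow>
              cdv_algebra.Vir \<iota> \<O> s fs \<subseteq> cdv_algebra.completion \<iota> \<O> \<and>
              bij_betw (\<Phi> t) hat_theta (cdv_algebra.Vir \<iota> \<O> s fs)) \<and>
           (\<forall>\<zeta>\<in>hat_theta.
              cdv_algebra.Vir_proj \<iota> \<O> (\<Phi> t \<zeta>) = cdv_algebra.hat_theta_proj \<iota> \<O> t \<zeta>) \<and>
           (\<forall>fs. cdv_algebra.admissible \<iota> \<O> t fs \<longrightarrow>
              (\<forall>\<zeta>\<in>hat_theta. \<zeta> (qclass (cdv_algebra.eta \<iota> \<O> t fs)) = 0 \<longrightarrow>
                 \<Phi> t \<zeta> = cdv_algebra.T_eta \<iota> \<O> t fs (cdv_algebra.hat_theta_proj \<iota> \<O> t \<zeta>))) \<and>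
           (\<exists>B. lie_bracket_on hat_theta B \<and>
              (\<forall>\<zeta>\<in>hat_theta. \<forall>\<zeta>'\<in>hat_theta.
                 \<Phi> t (B \<zeta> \<zeta>') = cdv_algebra.commutator \<iota> \<O> (\<Phi> t \<zeta>) (\<Phi> t \<zeta>') \<and>
                 cdv_algebra.hat_theta_proj \<iota> \<O> t (B \<zeta> \<zeta>') =
                   (\<lambda>x. cdv_algebra.hat_theta_proj \<iota> \<O> t \<zeta> (cdv_algebra.hat_theta_proj \<iota> \<O> t \<zeta>' x) -
                        cdv_algebra.hat_theta_proj \<iota> \<O> t \<zeta>' (cdv_algebra.hat_theta_proj \<iota> \<O> t \<zeta> x))) \<and>
              (\<forall>\<zeta>\<in>hat_theta. B hat_biresidue \<zeta> = (\<lambda>_. 0)))) \<and>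
        (\<forall>s t. uniformizer \<O> s \<longrightarrow> uniformizer \<O> t \<longrightarrow>
           (\<forall>\<zeta>\<in>hat_theta.
              \<Phi> s (pullback (cdv_algebra.transition \<iota> \<O> t s) \<zeta>) = \<Phi> t \<zeta>)) \<and>
        (\<forall>\<alpha> t. cdv_algebra.automorphism \<iota> \<O> \<alpha> \<longrightarrow> uniformizer \<O> t \<longrightarrow>
           (\<forall>\<zeta>\<in>hat_theta.
              \<Phi> t (pullback (cdv_algebra.transition \<iota> \<O> t (inv \<alpha> t)) \<zeta>) =
                cdv_algebra.aut_act \<alpha> (\<Phi> t \<zeta>))))"
proof -
  interpret cdv_algebra \<iota> \<O> by fact
  have "\<exists>B. lie_bracket_on hat_theta B \<and>
      (\<forall>\<zeta>\<in>hat_theta. \<forall>\<zeta>'\<in>hat_theta.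
         vir_iso t (B \<zeta> \<zeta>') = commutator (vir_iso t \<zeta>) (vir_iso t \<zeta>') \<and>
         hat_theta_proj t (B \<zeta> \<zeta>') =
           (\<lambda>x. hat_theta_proj t \<zeta> (hat_theta_proj t \<zeta>' x) - hat_theta_proj t \<zeta>' (hat_theta_proj t \<zeta> x))) \<and>
      (\<forall>\<zeta>\<in>hat_theta. B hat_biresidue \<zeta> = (\<lambda>_. 0))" if t: "uniformizer \<O> t" for t
    by (intro exI[of _ hat_bracket] conjI ballI lie_bracket_hat_bracket hat_bracket_biresidue
        vir_iso_hat_bracket[OF t])
  moreover have "Vir s fs \<subseteq> completion" if "uniformizer \<O> s" "admissible s fs" for s fs
    using that Vir_eq[of s fs] lift_completion[of s] by (auto simp: admissible_def)
  ultimately show ?thesis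
    by (intro conjI allI impI ballI exI[of _ vir_iso] quad_diff_exact hat_theta_exact vir_iso_linear vir_iso_proj
        vir_iso_bij vir_iso_T_eta vir_iso_pullback vir_iso_automorphism)
      auto
qed

end
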